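(* For every $d$ there exists a constant $K(d)$, depending only on $d$, such that the following holds. Let $I$ be a countable set, let $(X_i)_{i\in I}$ be independent random variables with values in a separable Banach space $(F,\|\cdot\|)$ such that $|\{i\in I\colon X_i\ne0\}|<\infty$ a.s., and let $\mathcal{C}$ be a countable Vapnik–Chervonenkis class of subsets of $I$ of order (at most) $d$. Then $$\mathbb{P}\Big(\sup_{C\in\mathcal{C}}\Big\|\sum_{i\in C}X_i\Big\|\ge u\Big)\le K(d)\sup_{C\in\mathcal{C}\cup\{I\}}\mathbb{P}\Big(\Big\|\sum_{i\in C}X_i\Big\|\ge\frac{u}{K(d)}\Big)\quad\text{for } u>0.$$ Moreover, if the variables $X_i$ are symmetric then $$\mathbb{P}\Big(\sup_{C\in\mathcal{C}}\Big\|\sum_{i\in C}X_i\Big\|\ge u\Big)\le K(d)\,\mathbb{P}\Big(\Big\|\sum_{i\in I}X_i\Big\|\ge\frac{u}{K(d)}\Big)\quad\text{for } u>0.$$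
   Context: A class $\mathcal{C}$ of subsets of $I$ is called a Vapnik–Chervonenkis class (VC-class) of order at most $d$ (with $d$ a nonnegative integer) if for any set $A\subset I$ of cardinality $d+1$ we have $|\{C\cap A\colon C\in\mathcal{C}\}|<2^{d+1}$. A random variable $X$ is symmetric if $X$ and $-X$ have the same distribution. *)

theory Defs
  imports "HOL-Probability.Probability"
begin

definition VC_class :: "'i set \<Rightarrow> 'i set set \<Rightarrow> nat \<Rightarrow> bool" where
  "VC_class I \<C> d \<longleftrightarrow> \<C> \<subseteq> Pow I \<and>
     (\<forall>A. A \<subseteq> I \<and> card A = d + 1 \<longrightarrow> card {C \<inter> A | C. C \<in> \<C>} < 2 ^ (d + 1))"

definition symmetric_rv :: "'a measure \<Rightarrow> ('a \<Rightarrow> 'b::real_normed_vector) \<Rightarrow> bool" where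
  "symmetric_rv M X \<longleftrightarrow> X \<in> borel_measurable M \<and> distr M borel X = distr M borel (\<lambda>\<omega>. - X \<omega>)"

(* C may be infinite, so the sum runs over the indices with a nonzero summand. It has the
   conventional value 0 if there are infinitely many of these, which has probability 0 below. *)
definition partial_sum :: "('i \<Rightarrow> 'a \<Rightarrow> 'b::real_normed_vector) \<Rightarrow> 'i set \<Rightarrow> 'a \<Rightarrow> 'b" where
  "partial_sum X C \<omega> = (\<Sum>i\<in>{i \<in> C. X i \<omega> \<noteq> 0}. X i \<omega>)"

(* The supremum is taken in [0,\<infinity>]: on a null set it can be infinite. *)
definition sup_tail ::
  "'a measure \<Rightarrow> ('i \<Rightarrow> 'a \<Rightarrow> 'b::real_normed_vector) \<Rightarrow> 'i set set \<Rightarrow> real \<Rightarrow> real" where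
  "sup_tail M X \<C> u =
     measure M {\<omega> \<in> space M. (SUP C\<in>\<C>. ennreal (norm (partial_sum X C \<omega>))) \<ge> ennreal u}"

definition sum_tail ::
  "'a measure \<Rightarrow> ('i \<Rightarrow> 'a \<Rightarrow> 'b::real_normed_vector) \<Rightarrow> 'i set \<Rightarrow> real \<Rightarrow> real" where
  "sum_tail M X C u = measure M {\<omega> \<in> space M. norm (partial_sum X C \<omega>) \<ge> u}"

(* K(d) must not depend on the index set, the probability space or the Banach space. An
   existential quantifier over K inside a theorem that is polymorphic in their types would allow
   K to depend on these types. So K(d) is named by a constant of the monomorphic type
   nat => real: some K > 0 for which the two inequalities hold in a universal case, namely for
   index sets of natural numbers and for closed separable subspaces F of the space of bounded
   real sequences with the supremum norm. Every separable Banach space is isometrically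
   isomorphic to such an F, and every family as in the theorem has the joint law of a family on
   the sequence space nat => F. *)
definition VC_const :: "nat \<Rightarrow> real" where
  "VC_const d = (SOME K. K > 0 \<and>
     (\<forall>(F :: (nat \<Rightarrow>\<^sub>C real) set) (I :: nat set) (M :: (nat \<Rightarrow> (nat \<Rightarrow>\<^sub>C real)) measure) X \<C>.
        subspace F \<and> closed F \<and> (\<exists>D. countable D \<and> F \<subseteq> closure D) \<and>
        prob_space M \<and> prob_space.indep_vars M (\<lambda>_. borel) X I \<and>
        (\<forall>i\<in>I. \<forall>\<omega>\<in>space M. X i \<omega> \<in> F) \<and>
        (AE \<omega> in M. finite {i \<in> I. X i \<omega> \<noteq> 0}) \<and>
        countable \<C> \<and> VC_class I \<C> d \<longrightarrow>
        (\<forall>u>0. sup_tail M X \<C> u \<le> K * (SUP C\<in>\<C> \<union> {I}. sum_tail M X C (u / K))) \<and>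
        ((\<forall>i\<in>I. symmetric_rv M (X i)) \<longrightarrow>
           (\<forall>u>0. sup_tail M X \<C> u \<le> K * sum_tail M X I (u / K)))))"

end

theory Submission
  imports Defs
begin

text \<open>
  By symmetrization and by conditioning on the vectors, everything reduces to finite Rademacher
  sums: one compares \<open>sup\<^sub>C |\<Sum>\<^sub>i\<^sub>\<in>\<^sub>C \<epsilon>\<^sub>i y\<^sub>i|\<close> over a finite set of vectors \<open>y\<close> with the same supremum
  without the class. The comparison of expectations is a chaining argument in the style of the
  Bernoulli theorem. A set of vectors in a box of side \<open>b\<close> and an \<open>\<ell>\<^sub>2\<close>-ball of radius \<open>Q b\<close> is cut into
  few pieces of smaller radius; on a piece the vectors are clipped coordinatewise to a smaller box, the
  clipped-off part being small in \<open>\<ell>\<^sub>1\<close>. Either the radius shrinks or the expected supremum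
  drops, because many separated pieces of large expected supremum increase the supremum of their
  union; this is shown by tilting the signs towards a random centre and an entropy estimate. For a
  single vector the class costs a multiple of its \<open>\<ell>\<^sub>2\<close>-norm (Sauer--Shelah, packing numbers and
  chaining). Tensorization over independent copies of the cube turns the comparison of
  expectations into one of tails.
\<close>

section \<open>Averages over signs\<close>

text \<open>A sign can be tilted only by a drift of size at most 1, so a drift proportional to a
  vector needs small coordinates; this forces a box beside the l2-ball. Shrinking the box by
  clipping creates the main obstacle: a piece that is small after clipping may have been wide
  before, and then smallness of the balls of the original set says nothing about it. The part cut
  off is then wide. Giving clipped part and excess independent signs does not increase the expected
  supremum. If the excess of the maximiser of the clipped part is spread out, tilting the second
  signs towards it raises the supremum; otherwise the excesses concentrate in few balls. The
  maximiser depends on the first signs, and undoing this dependence costs a conditional entropy. In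
  the recursion a covering step divides the unit \<open>Q\<^sup>2 * b\<close> by 4, while clipping
  at constant radius multiplies it by 2^66; only the gain from sparse sets pays for the latter. The
  class enters through the bound \<open>V\<close> for a single vector alone, and \<open>V\<close>
  depends only on \<open>d\<close>.\<close>

definition cube :: "'i set \<Rightarrow> ('i \<Rightarrow> real) set" where
  "cube I = (I \<rightarrow>\<^sub>E {-1, 1})"

text \<open>A finite average instead of an integral: the whole argument on the cube then consists of
  finite sums, and it can be run by induction on the coordinates through
  \<open>EE_insert\<close>.\<close>

definition EE :: "'i set \<Rightarrow> (('i \<Rightarrow> real) \<Rightarrow> real) \<Rightarrow> real" where
  "EE I f = (\<Sum>\<epsilon>\<in>cube I. f \<epsilon>) / 2 ^ card I"

definition lf :: "'i set \<Rightarrow> ('i \<Rightarrow> real) \<Rightarrow> ('i \<Rightarrow> real) \<Rightarrow> real" where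
  "lf I v \<epsilon> = (\<Sum>i\<in>I. \<epsilon> i * v i)"

definition nsq :: "'i set \<Rightarrow> ('i \<Rightarrow> real) \<Rightarrow> real" where
  "nsq I v = (\<Sum>i\<in>I. (v i)\<^sup>2)"

lemma finite_cube [simp]: "finite I \<Longrightarrow> finite (cube I)"
  by (simp add: cube_def finite_PiE)

lemma card_cube: "finite I \<Longrightarrow> card (cube I) = 2 ^ card I"
  by (simp add: cube_def card_PiE numeral_2_eq_2)

lemma cube_ne [simp]: "cube I \<noteq> {}"
  by (simp add: cube_def PiE_eq_empty_iff)

lemma EE_empty [simp]: "EE {} f = f (\<lambda>_. undefined)"
  by (simp add: EE_def cube_def)

lemma EE_insert:
  assumes "finite I" "i \<notin> I"
  shows "EE (insert i I) f = (EE I (\<lambda>\<epsilon>. f (\<epsilon>(i := 1))) + EE I (\<lambda>\<epsilon>. f (\<epsilon>(i := -1)))) / 2"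
proof -
  have "(\<Sum>\<epsilon>\<in>cube (insert i I). f \<epsilon>) = (\<Sum>(y, g)\<in>{-1, 1} \<times> cube I. f (g(i := y)))"
    unfolding cube_def PiE_insert_eq using inj_combinator[OF assms(2), of "\<lambda>_. {-1, 1::real}"]
    by (subst sum.reindex) (simp_all add: case_prod_unfold)
  also have "\<dots> = (\<Sum>y\<in>{-1, 1}. \<Sum>g\<in>cube I. f (g(i := y)))"
    by (simp add: sum.cartesian_product)
  also have "\<dots> = (\<Sum>g\<in>cube I. f (g(i := -1))) + (\<Sum>g\<in>cube I. f (g(i := 1)))"
    by simp
  finally show ?thesis
    using assms by (simp add: EE_def field_simps)
qed

lemma EE_cong: "(\<And>\<epsilon>. \<epsilon> \<in> cube I \<Longrightarrow> f \<epsilon> = g \<epsilon>) \<Longrightarrow> EE I f = EE I g"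
  by (simp add: EE_def cong: sum.cong)

lemma EE_mono: "(\<And>\<epsilon>. \<epsilon> \<in> cube I \<Longrightarrow> f \<epsilon> \<le> g \<epsilon>) \<Longrightarrow> EE I f \<le> EE I g"
  by (simp add: EE_def sum_mono divide_right_mono)

lemma EE_add: "EE I (\<lambda>\<epsilon>. f \<epsilon> + g \<epsilon>) = EE I f + EE I g"
  by (simp add: EE_def sum.distrib add_divide_distrib)

lemma EE_diff: "EE I (\<lambda>\<epsilon>. f \<epsilon> - g \<epsilon>) = EE I f - EE I g"
  by (simp add: EE_def sum_subtractf diff_divide_distrib)

lemma EE_cmult: "EE I (\<lambda>\<epsilon>. c * f \<epsilon>) = c * EE I f"
  by (simp add: EE_def sum_distrib_left)

lemma EE_multc: "EE I (\<lambda>\<epsilon>. f \<epsilon> * c) = EE I f * c"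
  by (simp add: EE_def sum_distrib_right)

lemma EE_divc: "EE I (\<lambda>\<epsilon>. f \<epsilon> / c) = EE I f / c"
  using EE_multc[of I f "1 / c"] by simp

lemma EE_sum: "EE I (\<lambda>\<epsilon>. \<Sum>k\<in>S. f k \<epsilon>) = (\<Sum>k\<in>S. EE I (f k))"
  by (simp add: EE_def sum_divide_distrib sum.swap [of _ S "cube I"])

lemma EE_const [simp]: "finite I \<Longrightarrow> EE I (\<lambda>_. c) = c"
  by (simp add: EE_def card_cube)

lemma EE_nonneg: "(\<And>\<epsilon>. \<epsilon> \<in> cube I \<Longrightarrow> 0 \<le> f \<epsilon>) \<Longrightarrow> 0 \<le> EE I f"
  by (simp add: EE_def sum_nonneg)

lemma EE_pos: "finite I \<Longrightarrow> (\<And>\<epsilon>. \<epsilon> \<in> cube I \<Longrightarrow> 0 < f \<epsilon>) \<Longrightarrow> 0 < EE I f"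
  by (simp add: EE_def sum_pos)

lemma EE_weights: "EE I f = (\<Sum>\<epsilon>\<in>cube I. (1 / 2 ^ card I) * f \<epsilon>)"
  by (simp add: EE_def sum_divide_distrib)

lemma EE_swap: "EE I (\<lambda>\<epsilon>. EE J (f \<epsilon>)) = EE J (\<lambda>\<delta>. EE I (\<lambda>\<epsilon>. f \<epsilon> \<delta>))"
  unfolding EE_def sum_divide_distrib [symmetric]
  by (subst sum.swap) (simp add: mult.commute)

lemma EE_square_le: "finite I \<Longrightarrow> (EE I f)\<^sup>2 \<le> EE I (\<lambda>\<epsilon>. (f \<epsilon>)\<^sup>2)"
proof -
  assume I: "finite I"
  have "0 \<le> EE I (\<lambda>\<epsilon>. (f \<epsilon> - EE I f)\<^sup>2)"
    by (rule EE_nonneg) simp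
  also have "\<dots> = EE I (\<lambda>\<epsilon>. (f \<epsilon>)\<^sup>2 - (2 * EE I f) * f \<epsilon> + (EE I f)\<^sup>2)"
    by (rule EE_cong) (simp add: power2_eq_square algebra_simps)
  also have "\<dots> = EE I (\<lambda>\<epsilon>. (f \<epsilon>)\<^sup>2) - (EE I f)\<^sup>2"
    unfolding EE_add EE_diff EE_cmult EE_const[OF I] by (simp add: power2_eq_square)
  finally show ?thesis by simp
qed

lemma lf_insert_upd:
  "finite I \<Longrightarrow> i \<notin> I \<Longrightarrow> lf (insert i I) v (\<epsilon>(i := c)) = c * v i + lf I v \<epsilon>"
  by (simp add: lf_def) (rule sum.cong, auto)

lemma nsq_insert: "finite I \<Longrightarrow> i \<notin> I \<Longrightarrow> nsq (insert i I) v = (v i)\<^sup>2 + nsq I v"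
  by (simp add: nsq_def)

lemma nsq_nonneg [simp]: "0 \<le> nsq I v"
  by (simp add: nsq_def sum_nonneg)

section \<open>Maxima of linear forms: exponential moments and contraction\<close>

lemma Max_ex:
  fixes f :: "'a \<Rightarrow> real"
  assumes "finite A" "A \<noteq> {}"
  shows "\<exists>a\<in>A. (MAX b\<in>A. f b) = f a"
proof -
  have "Max (f ` A) \<in> f ` A"
    by (rule Max_in) (use assms in auto)
  then show ?thesis by (simp only: image_iff)
qed

lemma Max_ge_at: "finite A \<Longrightarrow> a \<in> A \<Longrightarrow> (f a :: real) \<le> (MAX b\<in>A. f b)"
  by simp

lemma Max_le_all:
  "finite A \<Longrightarrow> A \<noteq> {} \<Longrightarrow> (\<And>a. a \<in> A \<Longrightarrow> (f a :: real) \<le> x) \<Longrightarrow> (MAX b\<in>A. f b) \<le> x"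
  by (simp add: Max_le_iff)

text \<open>Hoeffding's lemma for a fair two-point law, that is, cosh x \<le> exp (x^2 / 2).\<close>

lemma exp_mean_le: "(exp a + exp b) / 2 \<le> exp ((a + b) / 2 + (a - b)\<^sup>2 / (8::real))"
proof -
  have *: "(exp a + exp b) / 2 \<le> exp ((a + b) / 2 + (a - b)\<^sup>2 / 8)" if "a \<le> b" for a b :: real
  proof -
    have "- (b - a) * (1/2) + ln (1 + (1/2) * (exp (b - a) - 1)) \<le> (b - a)\<^sup>2 / 8"
      using Hoeffdings_lemma_aux[of "b - a" "1/2"] that by simp
    then have "ln ((1 + exp (b - a)) / 2) \<le> (b - a)/2 + (b - a)\<^sup>2 / 8"
      by (simp add: field_simps)
    then have "(1 + exp (b - a)) / 2 \<le> exp ((b - a)/2 + (b - a)\<^sup>2 / 8)"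
      by (metis add_pos_pos exp_gt_zero exp_le_cancel_iff exp_ln half_gt_zero zero_less_one)
    then have "exp a * ((1 + exp (b - a)) / 2) \<le> exp a * exp ((b - a)/2 + (b - a)\<^sup>2 / 8)"
      by (rule mult_left_mono) simp
    moreover have "exp a * ((1 + exp (b - a)) / 2) = (exp a + exp b) / 2"
      by (simp add: exp_diff field_simps)
    moreover have "exp a * exp ((b - a)/2 + (b - a)\<^sup>2 / 8) = exp ((a + b) / 2 + (a - b)\<^sup>2 / 8)"
      by (simp add: exp_add [symmetric] power2_commute field_simps)
    ultimately show ?thesis by simp
  qed
  show ?thesis
    using *[of a b] *[of b a] by (cases "a \<le> b") (auto simp: power2_commute add.commute)
qed

text \<open>At the maximiser \<open>p\<close> of the larger penalised maximum, the other one is at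
  least \<open>x p - u p - (u p)\<^sup>2\<close>, so the two differ by at most
  \<open>2 * u p\<close>. The penalty at \<open>p\<close> is therefore at least a quarter of the
  squared difference, and this is, after halving, the amount that \<open>exp_mean_le\<close> loses
  in one coordinate.\<close>

lemma upper_step:
  fixes x u :: "'a \<Rightarrow> real"
  assumes "finite A" "A \<noteq> {}"
  defines "Gp \<equiv> MAX a\<in>A. x a + u a - (u a)\<^sup>2" and "Gm \<equiv> MAX a\<in>A. x a - u a - (u a)\<^sup>2"
    and "Mp \<equiv> MAX a\<in>A. x a + u a" and "Mm \<equiv> MAX a\<in>A. x a - u a"
  shows "Gp + Gm + (Gp - Gm)\<^sup>2 / 4 \<le> Mp + Mm"
proof -
  obtain p where p: "p \<in> A" "Gp = x p + u p - (u p)\<^sup>2"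
    using Max_ex[OF assms(1,2)] unfolding Gp_def by blast
  obtain q where q: "q \<in> A" "Gm = x q - u q - (u q)\<^sup>2"
    using Max_ex[OF assms(1,2)] unfolding Gm_def by blast
  have M: "x p + u p \<le> Mp" "x q + u q \<le> Mp" "x p - u p \<le> Mm" "x q - u q \<le> Mm"
    unfolding Mp_def Mm_def using p(1) q(1) assms(1) by (simp_all add: Max_ge_at)
  have G: "x q + u q - (u q)\<^sup>2 \<le> Gp" "x p - u p - (u p)\<^sup>2 \<le> Gm"
    unfolding Gp_def Gm_def using p(1) q(1) assms(1) by (simp_all add: Max_ge_at)
  show ?thesis
  proof (cases "Gm \<le> Gp")
    case True
    then have "(Gp - Gm)\<^sup>2 \<le> (2 * u p)\<^sup>2"
      using G p by (intro power_mono) auto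
    then have "(Gp - Gm)\<^sup>2 / 4 \<le> (u p)\<^sup>2" by (simp add: power_mult_distrib)
    then show ?thesis using M p(2) q(2) zero_le_power2[of "u q"] by linarith
  next
    case False
    then have "(Gm - Gp)\<^sup>2 \<le> (- 2 * u q)\<^sup>2"
      using G q by (intro power_mono) auto
    then have "(Gp - Gm)\<^sup>2 / 4 \<le> (u q)\<^sup>2" by (simp add: power_mult_distrib power2_commute)
    then show ?thesis using M p(2) q(2) zero_le_power2[of "u p"] by linarith
  qed
qed

text \<open>The penalty of the exposed coordinate pays, through \<open>upper_step\<close>, for the
  variance term of \<open>exp_mean_le\<close>. The offsets \<open>c\<close> are arbitrary because
  exposing a sign turns its contribution into a new offset. The result is concentration of a maximum
  on the scale of the largest \<open>nsq\<close>, whatever the number of vectors.\<close>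

lemma EE_max_exp_upper:
  assumes "finite I" "finite A" "A \<noteq> {}"
  shows "EE I (\<lambda>\<epsilon>. exp (MAX a\<in>A. c a + lf I (v a) \<epsilon> - nsq I (v a)))
    \<le> exp (EE I (\<lambda>\<epsilon>. MAX a\<in>A. c a + lf I (v a) \<epsilon>))"
  using assms(1)
proof (induction I arbitrary: c rule: finite_induct)
  case empty
  then show ?case by (simp add: lf_def nsq_def)
next
  case (insert i I)
  define G where "G s \<epsilon> = (MAX a\<in>A. (c a + s * v a i - (v a i)\<^sup>2) + lf I (v a) \<epsilon>)" for s \<epsilon>
  define N where "N s \<epsilon> = (MAX a\<in>A. (c a + s * v a i) + lf I (v a) \<epsilon>)" for s \<epsilon>
  have IH: "EE I (\<lambda>\<epsilon>. exp (MAX a\<in>A. c a + s * v a i - (v a i)\<^sup>2 + lf I (v a) \<epsilon> - nsq I (v a)))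
      \<le> exp (EE I (G s))" for s
    unfolding G_def by (rule insert.IH)
  have pt: "G 1 \<epsilon> + G (-1) \<epsilon> + (G 1 \<epsilon> - G (-1) \<epsilon>)\<^sup>2 / 4 \<le> N 1 \<epsilon> + N (-1) \<epsilon>" for \<epsilon>
    using upper_step[OF assms(2,3), of "\<lambda>a. c a + lf I (v a) \<epsilon>" "\<lambda>a. v a i"]
    unfolding G_def N_def by (simp add: algebra_simps)
  have "EE (insert i I) (\<lambda>\<epsilon>. exp (MAX a\<in>A. c a + lf (insert i I) (v a) \<epsilon> - nsq (insert i I) (v a)))
    = (EE I (\<lambda>\<epsilon>. exp (MAX a\<in>A. c a + 1 * v a i - (v a i)\<^sup>2 + lf I (v a) \<epsilon> - nsq I (v a)))
      + EE I (\<lambda>\<epsilon>. exp (MAX a\<in>A. c a + (-1) * v a i - (v a i)\<^sup>2 + lf I (v a) \<epsilon> - nsq I (v a)))) / 2"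
    using insert.hyps by (simp add: EE_insert lf_insert_upd nsq_insert algebra_simps)
  also have "\<dots> \<le> (exp (EE I (G 1)) + exp (EE I (G (-1)))) / 2"
    using IH[of 1] IH[of "-1"] by (intro divide_right_mono add_mono) auto
  also have "\<dots> \<le> exp ((EE I (G 1) + EE I (G (-1))) / 2 + (EE I (G 1) - EE I (G (-1)))\<^sup>2 / 8)"
    by (rule exp_mean_le)
  also have "\<dots> \<le> exp ((EE I (N 1) + EE I (N (-1))) / 2)"
  proof -
    have "(EE I (\<lambda>\<epsilon>. G 1 \<epsilon> - G (-1) \<epsilon>))\<^sup>2 \<le> EE I (\<lambda>\<epsilon>. (G 1 \<epsilon> - G (-1) \<epsilon>)\<^sup>2)"
      by (rule EE_square_le[OF insert.hyps(1)])
    moreover have "EE I (\<lambda>\<epsilon>. G 1 \<epsilon> + G (-1) \<epsilon> + (G 1 \<epsilon> - G (-1) \<epsilon>)\<^sup>2 * (1/4))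
        \<le> EE I (\<lambda>\<epsilon>. N 1 \<epsilon> + N (-1) \<epsilon>)"
      using pt by (intro EE_mono) simp
    ultimately have "(EE I (G 1) - EE I (G (-1)))\<^sup>2 \<le> EE I (\<lambda>\<epsilon>. (G 1 \<epsilon> - G (-1) \<epsilon>)\<^sup>2)"
      "EE I (G 1) + EE I (G (-1)) + EE I (\<lambda>\<epsilon>. (G 1 \<epsilon> - G (-1) \<epsilon>)\<^sup>2) * (1/4) \<le> EE I (N 1) + EE I (N (-1))"
      by (simp_all only: EE_add EE_diff EE_multc)
    then show ?thesis unfolding exp_le_cancel_iff by (simp add: field_simps)
  qed
  also have "(EE I (N 1) + EE I (N (-1))) / 2
      = EE (insert i I) (\<lambda>\<epsilon>. MAX a\<in>A. c a + lf (insert i I) (v a) \<epsilon>)"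
    using insert.hyps by (simp add: EE_insert lf_insert_upd N_def[abs_def] algebra_simps)
  finally show ?case .
qed

text \<open>Mirror image of \<open>upper_step\<close> with a bonus in place of a penalty. The
  difference of the two maxima is at most \<open>e + 2 * u p\<close>, where \<open>e\<close> is the
  slack of the bonus maximum at the maximiser of the plain one. The slack enters squared, and it can
  be charged to itself only because \<open>e\<close> is at most 2; this is where the bound on
  \<open>u\<close> enters.\<close>

lemma lower_step:
  fixes x u :: "'a \<Rightarrow> real"
  assumes "finite A" "A \<noteq> {}" and u1: "\<And>a. a \<in> A \<Longrightarrow> \<bar>u a\<bar> \<le> 1"
  defines "Gp \<equiv> MAX a\<in>A. x a + u a + 2 * (u a)\<^sup>2" and "Gm \<equiv> MAX a\<in>A. x a - u a + 2 * (u a)\<^sup>2"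
    and "Mp \<equiv> MAX a\<in>A. x a + u a" and "Mm \<equiv> MAX a\<in>A. x a - u a"
  shows "Mp + Mm + (Gp - Gm)\<^sup>2 / 4 \<le> Gp + Gm"
proof -
  obtain p where p: "p \<in> A" "Mp = x p + u p"
    using Max_ex[OF assms(1,2)] unfolding Mp_def by blast
  obtain q where q: "q \<in> A" "Mm = x q - u q"
    using Max_ex[OF assms(1,2)] unfolding Mm_def by blast
  obtain g where g: "g \<in> A" "Gp = x g + u g + 2 * (u g)\<^sup>2"
    using Max_ex[OF assms(1,2)] unfolding Gp_def by blast
  obtain h where h: "h \<in> A" "Gm = x h - u h + 2 * (u h)\<^sup>2"
    using Max_ex[OF assms(1,2)] unfolding Gm_def by blast
  have M: "x g + u g \<le> Mp" "x h - u h \<le> Mm"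
    unfolding Mp_def Mm_def using g(1) h(1) assms(1) by (simp_all add: Max_ge_at)
  have G: "x p + u p + 2 * (u p)\<^sup>2 \<le> Gp" "x q + u q + 2 * (u q)\<^sup>2 \<le> Gp"
     "x p - u p + 2 * (u p)\<^sup>2 \<le> Gm" "x q - u q + 2 * (u q)\<^sup>2 \<le> Gm"
    unfolding Gp_def Gm_def using p(1) q(1) assms(1) by (simp_all add: Max_ge_at)
  have sq: "(u g)\<^sup>2 \<le> 1" "(u h)\<^sup>2 \<le> 1" "0 \<le> (u p)\<^sup>2" "0 \<le> (u q)\<^sup>2"
    using u1[OF g(1)] u1[OF h(1)] by (simp_all add: abs_square_le_1)
  have key: "D\<^sup>2 / 4 \<le> e + 2 * w\<^sup>2" if "0 \<le> e" "e \<le> 2" "0 \<le> D" "D \<le> e + 2 * w" for D e w :: real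
  proof -
    have "D\<^sup>2 \<le> (e + 2 * w)\<^sup>2" using that by (intro power_mono) auto
    also have "\<dots> \<le> 2 * e\<^sup>2 + 8 * w\<^sup>2"
      using zero_le_power2[of "e - 2 * w"] by (simp add: power2_eq_square algebra_simps)
    also have "e\<^sup>2 \<le> 2 * e" using that by (simp add: power2_eq_square mult_right_mono)
    finally show ?thesis by simp
  qed
  show ?thesis
  proof (cases "Gm \<le> Gp")
    case True
    have "(Gp - Gm)\<^sup>2 / 4 \<le> (Gp - (Mp + 2 * (u p)\<^sup>2)) + 2 * (u p)\<^sup>2"
      by (rule key; use True G M sq p g in linarith)
    then show ?thesis using G q sq by linarith
  next
    case False
    have "(Gm - Gp)\<^sup>2 / 4 \<le> (Gm - (Mm + 2 * (u q)\<^sup>2)) + 2 * (- u q)\<^sup>2"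
      by (rule key; use False G M sq q h in linarith)
    then show ?thesis
      using G p(2) zero_le_power2[of "u p"] power2_commute[of Gp Gm] by (simp only: power2_minus)
  qed
qed

text \<open>The induction of \<open>EE_max_exp_upper\<close> with \<open>lower_step\<close> as its
  one-coordinate inequality; it controls the lower tail of the maximum.\<close>

lemma EE_max_exp_lower:
  assumes "finite I" "finite A" "A \<noteq> {}" and "\<And>a i. a \<in> A \<Longrightarrow> i \<in> I \<Longrightarrow> \<bar>v a i\<bar> \<le> 1"
  shows "EE I (\<lambda>\<epsilon>. exp (- (MAX a\<in>A. c a + lf I (v a) \<epsilon> + 2 * nsq I (v a))))
    \<le> exp (- EE I (\<lambda>\<epsilon>. MAX a\<in>A. c a + lf I (v a) \<epsilon>))"
  using assms(1,4)
proof (induction I arbitrary: c rule: finite_induct)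
  case empty
  then show ?case by (simp add: lf_def nsq_def)
next
  case (insert i I)
  define G where "G s \<epsilon> = (MAX a\<in>A. (c a + s * v a i + 2 * (v a i)\<^sup>2) + lf I (v a) \<epsilon>)" for s \<epsilon>
  define N where "N s \<epsilon> = (MAX a\<in>A. (c a + s * v a i) + lf I (v a) \<epsilon>)" for s \<epsilon>
  have IH: "EE I (\<lambda>\<epsilon>. exp (- (MAX a\<in>A. c a + s * v a i + 2 * (v a i)\<^sup>2 + lf I (v a) \<epsilon> + 2 * nsq I (v a))))
      \<le> exp (- EE I (G s))" for s
    unfolding G_def by (rule insert.IH) (use insert.prems in auto)
  have pt: "N 1 \<epsilon> + N (-1) \<epsilon> + (G 1 \<epsilon> - G (-1) \<epsilon>)\<^sup>2 / 4 \<le> G 1 \<epsilon> + G (-1) \<epsilon>" for \<epsilon>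
    using lower_step[OF assms(2,3), of "\<lambda>a. v a i" "\<lambda>a. c a + lf I (v a) \<epsilon>"] insert.prems
    unfolding G_def N_def by (simp add: algebra_simps)
  have "EE (insert i I) (\<lambda>\<epsilon>. exp (- (MAX a\<in>A. c a + lf (insert i I) (v a) \<epsilon> + 2 * nsq (insert i I) (v a))))
    = (EE I (\<lambda>\<epsilon>. exp (- (MAX a\<in>A. c a + 1 * v a i + 2 * (v a i)\<^sup>2 + lf I (v a) \<epsilon> + 2 * nsq I (v a))))
      + EE I (\<lambda>\<epsilon>. exp (- (MAX a\<in>A. c a + (-1) * v a i + 2 * (v a i)\<^sup>2 + lf I (v a) \<epsilon> + 2 * nsq I (v a))))) / 2"
    using insert.hyps by (simp add: EE_insert lf_insert_upd nsq_insert algebra_simps)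
  also have "\<dots> \<le> (exp (- EE I (G 1)) + exp (- EE I (G (-1)))) / 2"
    using IH[of 1] IH[of "-1"] by (intro divide_right_mono add_mono) auto
  also have "\<dots> \<le> exp ((- EE I (G 1) + - EE I (G (-1))) / 2 + (- EE I (G 1) - - EE I (G (-1)))\<^sup>2 / 8)"
    by (rule exp_mean_le)
  also have "\<dots> \<le> exp (- ((EE I (N 1) + EE I (N (-1))) / 2))"
  proof -
    have "(EE I (\<lambda>\<epsilon>. G 1 \<epsilon> - G (-1) \<epsilon>))\<^sup>2 \<le> EE I (\<lambda>\<epsilon>. (G 1 \<epsilon> - G (-1) \<epsilon>)\<^sup>2)"
      by (rule EE_square_le[OF insert.hyps(1)])
    moreover have "EE I (\<lambda>\<epsilon>. N 1 \<epsilon> + N (-1) \<epsilon> + (G 1 \<epsilon> - G (-1) \<epsilon>)\<^sup>2 * (1/4))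
        \<le> EE I (\<lambda>\<epsilon>. G 1 \<epsilon> + G (-1) \<epsilon>)"
      using pt by (intro EE_mono) simp
    ultimately have "EE I (N 1) + EE I (N (-1)) + (EE I (G 1) - EE I (G (-1)))\<^sup>2 / 4
        \<le> EE I (G 1) + EE I (G (-1))"
      by (simp add: EE_add EE_diff EE_divc)
    moreover have "(- EE I (G 1) - - EE I (G (-1)))\<^sup>2 = (EE I (G 1) - EE I (G (-1)))\<^sup>2"
      by (simp add: power2_eq_square algebra_simps)
    ultimately show ?thesis unfolding exp_le_cancel_iff by (simp add: field_simps)
  qed
  also have "(EE I (N 1) + EE I (N (-1))) / 2
      = EE (insert i I) (\<lambda>\<epsilon>. MAX a\<in>A. c a + lf (insert i I) (v a) \<epsilon>)"
    using insert.hyps by (simp add: EE_insert lf_insert_upd N_def[abs_def] algebra_simps)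
  finally show ?case .
qed

text \<open>Let \<open>a\<close> and \<open>b\<close> be the maximisers on the left. Of the two ways
  to insert \<open>a\<close> and \<open>b\<close> on the right, one produces
  \<open>x a + x b + \<bar>v a - v b\<bar>\<close>.\<close>

lemma contraction_step:
  fixes x w v :: "'a \<Rightarrow> real"
  assumes "finite A" "A \<noteq> {}" "\<And>a b. a \<in> A \<Longrightarrow> b \<in> A \<Longrightarrow> \<bar>w a - w b\<bar> \<le> \<bar>v a - v b\<bar>"
  shows "(MAX a\<in>A. x a + w a) + (MAX a\<in>A. x a - w a) \<le> (MAX a\<in>A. x a + v a) + (MAX a\<in>A. x a - v a)"
proof -
  obtain a where a: "a \<in> A" "(MAX a\<in>A. x a + w a) = x a + w a"
    using Max_ex[OF assms(1,2)] by blast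
  obtain b where b: "b \<in> A" "(MAX a\<in>A. x a - w a) = x b - w b"
    using Max_ex[OF assms(1,2)] by blast
  have "x a + v a \<le> (MAX a\<in>A. x a + v a)" "x b + v b \<le> (MAX a\<in>A. x a + v a)"
    "x a - v a \<le> (MAX a\<in>A. x a - v a)" "x b - v b \<le> (MAX a\<in>A. x a - v a)"
    using a(1) b(1) assms(1) by (simp_all add: Max_ge_at)
  then show ?thesis using a b assms(3)[of a b] by linarith
qed

text \<open>In one coordinate the two signs agree or disagree with equal probability, so they act as
  a single sign in front of \<open>p + q\<close> or of \<open>p - q\<close>. The hypothesis makes
  both of these contractions of \<open>v\<close>, and \<open>contraction_step\<close> applies to
  each.\<close>

lemma EE_max_chop:
  assumes "finite I" "finite A" "A \<noteq> {}"
    and "\<And>a b i. a \<in> A \<Longrightarrow> b \<in> A \<Longrightarrow> i \<in> I \<Longrightarrow>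
      \<bar>p a i - p b i\<bar> + \<bar>q a i - q b i\<bar> \<le> \<bar>v a i - v b i\<bar>"
  shows "EE I (\<lambda>\<epsilon>. EE I (\<lambda>\<delta>. MAX a\<in>A. c a + lf I (p a) \<epsilon> + lf I (q a) \<delta>))
    \<le> EE I (\<lambda>\<epsilon>. MAX a\<in>A. c a + lf I (v a) \<epsilon>)"
  using assms(1,4)
proof (induction I arbitrary: c rule: finite_induct)
  case empty
  then show ?case by (simp add: lf_def)
next
  case (insert i I)
  define N where "N f \<epsilon> \<delta> = (MAX a\<in>A. (c a + f a) + lf I (p a) \<epsilon> + lf I (q a) \<delta>)" for f \<epsilon> \<delta>
  have IH: "EE I (\<lambda>\<epsilon>. EE I (N f \<epsilon>)) \<le> EE I (\<lambda>\<epsilon>. MAX a\<in>A. (c a + f a) + lf I (v a) \<epsilon>)" for f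
    unfolding N_def by (rule insert.IH) (use insert.prems in auto)
  have s: "N (\<lambda>a. w a) \<epsilon> \<delta> + N (\<lambda>a. - w a) \<epsilon> \<delta> \<le> N (\<lambda>a. v a i) \<epsilon> \<delta> + N (\<lambda>a. - v a i) \<epsilon> \<delta>"
    if "\<And>a b. a \<in> A \<Longrightarrow> b \<in> A \<Longrightarrow> \<bar>w a - w b\<bar> \<le> \<bar>v a i - v b i\<bar>" for w \<epsilon> \<delta>
    using contraction_step[OF assms(2,3) that, where x = "\<lambda>a. c a + lf I (p a) \<epsilon> + lf I (q a) \<delta>"]
    unfolding N_def by (simp add: algebra_simps)
  have le: "\<bar>(p a i + q a i) - (p b i + q b i)\<bar> \<le> \<bar>v a i - v b i\<bar>"
    "\<bar>(p a i - q a i) - (p b i - q b i)\<bar> \<le> \<bar>v a i - v b i\<bar>" if "a \<in> A" "b \<in> A" for a b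
    using insert.prems[OF that, of i] by auto
  have "EE (insert i I) (\<lambda>\<epsilon>. EE (insert i I) (\<lambda>\<delta>. MAX a\<in>A. c a + lf (insert i I) (p a) \<epsilon> + lf (insert i I) (q a) \<delta>))
    = EE I (\<lambda>\<epsilon>. EE I (\<lambda>\<delta>. ((N (\<lambda>a. p a i + q a i) \<epsilon> \<delta> + N (\<lambda>a. - (p a i + q a i)) \<epsilon> \<delta>)
       + (N (\<lambda>a. p a i - q a i) \<epsilon> \<delta> + N (\<lambda>a. - (p a i - q a i)) \<epsilon> \<delta>)) * (1/4)))"
    using insert.hyps
    by (simp add: EE_insert lf_insert_upd EE_add EE_divc N_def[abs_def] algebra_simps add_divide_distrib)
  also have "\<dots> \<le> EE I (\<lambda>\<epsilon>. EE I (\<lambda>\<delta>. ((N (\<lambda>a. v a i) \<epsilon> \<delta> + N (\<lambda>a. - v a i) \<epsilon> \<delta>)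
       + (N (\<lambda>a. v a i) \<epsilon> \<delta> + N (\<lambda>a. - v a i) \<epsilon> \<delta>)) * (1/4)))"
    by (intro EE_mono mult_right_mono add_mono s le) auto
  also have "\<dots> = (EE I (\<lambda>\<epsilon>. EE I (N (\<lambda>a. v a i) \<epsilon>)) + EE I (\<lambda>\<epsilon>. EE I (N (\<lambda>a. - v a i) \<epsilon>))) / 2"
    unfolding EE_add EE_multc by simp
  also have "\<dots> \<le> (EE I (\<lambda>\<epsilon>. MAX a\<in>A. (c a + v a i) + lf I (v a) \<epsilon>)
      + EE I (\<lambda>\<epsilon>. MAX a\<in>A. (c a + - v a i) + lf I (v a) \<epsilon>)) / 2"
    by (intro divide_right_mono add_mono IH) simp
  also have "\<dots> = EE (insert i I) (\<lambda>\<epsilon>. MAX a\<in>A. c a + lf (insert i I) (v a) \<epsilon>)"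
    using insert.hyps by (simp add: EE_insert lf_insert_upd algebra_simps)
  finally show ?case .
qed

lemma lf_zero [simp]: "lf I (\<lambda>_. 0) \<epsilon> = 0"
  by (simp add: lf_def)

lemma EE_max_contraction:
  assumes "finite I" "finite A" "A \<noteq> {}"
    and "\<And>a b i. a \<in> A \<Longrightarrow> b \<in> A \<Longrightarrow> i \<in> I \<Longrightarrow> \<bar>p a i - p b i\<bar> \<le> \<bar>v a i - v b i\<bar>"
  shows "EE I (\<lambda>\<epsilon>. MAX a\<in>A. lf I (p a) \<epsilon>) \<le> EE I (\<lambda>\<epsilon>. MAX a\<in>A. lf I (v a) \<epsilon>)"
  using EE_max_chop[OF assms(1-3), of p "\<lambda>_ _. 0" v "\<lambda>_. 0"] assms by simp

text \<open>The variational formula for entropy, obtained pointwise from ln t \<le> t - 1. The mass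
  \<open>R\<close> of \<open>J\<close> is left free because the formula is later applied to a joint
  density read at a fixed value of the second variable.\<close>

lemma gibbs:
  fixes p J F :: "'w \<Rightarrow> real"
  assumes "finite S" "\<And>w. w \<in> S \<Longrightarrow> 0 \<le> p w" "\<And>w. w \<in> S \<Longrightarrow> 0 \<le> J w" "s > 0"
  defines "R \<equiv> \<Sum>w\<in>S. p w * J w" and "Z \<equiv> \<Sum>w\<in>S. p w * exp (s * F w)"
  shows "s * (\<Sum>w\<in>S. p w * J w * F w) \<le> R * ln Z + (\<Sum>w\<in>S. p w * J w * ln (J w)) - R * ln R"
proof (cases "R = 0")
  case True
  then have z: "\<forall>w\<in>S. p w * J w = 0"
    unfolding R_def using assms by (subst (asm) sum_nonneg_eq_0_iff) auto
  then have "(\<Sum>w\<in>S. p w * J w * F w) = 0" "(\<Sum>w\<in>S. p w * J w * ln (J w)) = 0"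
    by (auto intro!: sum.neutral)
  then show ?thesis using True by simp
next
  case False
  have R: "R > 0" using False unfolding R_def
    by (metis (no_types, lifting) assms(2,3) less_le mult_nonneg_nonneg sum_nonneg)
  obtain w0 where w0: "w0 \<in> S" "p w0 * J w0 \<noteq> 0"
    using False unfolding R_def by (meson sum.neutral)
  then have "p w0 > 0" using assms(2)[of w0] by (cases "p w0 = 0") auto
  then have Z: "Z > 0" unfolding Z_def
    using assms w0 by (intro sum_pos2[of S w0]) auto
  have pt: "J w * (s * F w) \<le> J w * ln (J w) + J w * ln Z - J w * ln R + R * exp (s * F w) / Z - J w"
    if "w \<in> S" for w
  proof (cases "J w = 0")
    case True
    then show ?thesis using R Z by simp
  next
    case False
    then have J: "J w > 0" using assms(3)[OF that] by simp
    \<comment> \<open>The point at which ln t \<le> t - 1 is used: \<open>t\<close> equals 1 exactly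
      for the extremal density, the one proportional to \<open>exp (s * F w)\<close> with mass
      \<open>R\<close>.\<close>
    define t where "t = R * exp (s * F w) / (Z * J w)"
    have t: "t > 0" using R Z J by (simp add: t_def)
    have "ln t = ln R + s * F w - ln Z - ln (J w)"
      using R Z J by (simp add: t_def ln_div ln_mult)
    moreover have "ln t \<le> t - 1" using t by (rule ln_le_minus_one)
    ultimately have "J w * (ln R + s * F w - ln Z - ln (J w)) \<le> J w * (t - 1)"
      using J by (simp add: mult_left_mono)
    moreover have "J w * t = R * exp (s * F w) / Z" using J Z by (simp add: t_def)
    ultimately show ?thesis by (simp add: algebra_simps)
  qed
  have "s * (\<Sum>w\<in>S. p w * J w * F w) = (\<Sum>w\<in>S. p w * (J w * (s * F w)))"
    by (simp add: sum_distrib_left mult_ac)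
  also have "\<dots> \<le> (\<Sum>w\<in>S. p w * (J w * ln (J w) + J w * ln Z - J w * ln R + R * exp (s * F w) / Z - J w))"
    using assms pt by (intro sum_mono mult_left_mono) auto
  also have "\<dots> = (\<Sum>w\<in>S. p w * J w * ln (J w)) + (\<Sum>w\<in>S. p w * J w) * ln Z - (\<Sum>w\<in>S. p w * J w) * ln R
      + (R / Z) * (\<Sum>w\<in>S. p w * exp (s * F w)) - (\<Sum>w\<in>S. p w * J w)"
    by (simp add: sum.distrib sum_subtractf sum_distrib_left sum_distrib_right algebra_simps)
  also have "\<dots> = (\<Sum>w\<in>S. p w * J w * ln (J w)) + R * ln Z - R * ln R"
    using Z by (simp add: R_def[symmetric] Z_def[symmetric])
  finally show ?thesis by simp
qed

lemma gibbs_EE: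
  assumes "finite I" "\<And>\<epsilon>. \<epsilon> \<in> cube I \<Longrightarrow> 0 \<le> J \<epsilon>" "EE I J = 1" "s > 0"
  shows "s * EE I (\<lambda>\<epsilon>. J \<epsilon> * F \<epsilon>) \<le> ln (EE I (\<lambda>\<epsilon>. exp (s * F \<epsilon>))) + EE I (\<lambda>\<epsilon>. J \<epsilon> * ln (J \<epsilon>))"
proof -
  have "(\<Sum>w\<in>cube I. (1 / 2 ^ card I) * J w) = 1"
    using assms(3) unfolding EE_weights .
  then show ?thesis
    using gibbs[of "cube I" "\<lambda>_. 1 / 2 ^ card I" J s F] assms
    unfolding EE_weights by (simp add: mult_ac)
qed

section \<open>Product densities on the cube\<close>

lemma EE_prod:
  "finite I \<Longrightarrow> EE I (\<lambda>\<epsilon>. \<Prod>i\<in>I. g i (\<epsilon> i)) = (\<Prod>i\<in>I. (g i 1 + g i (-1)) / 2)"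
proof (induction I rule: finite_induct)
  case empty
  then show ?case by simp
next
  case (insert i I)
  have "(\<Prod>j\<in>I. g j ((\<epsilon>(i := c)) j)) = (\<Prod>j\<in>I. g j (\<epsilon> j))" for \<epsilon> c
    using insert.hyps by (intro prod.cong) auto
  then have *: "(\<Prod>j\<in>insert i I. g j ((\<epsilon>(i := c)) j)) = g i c * (\<Prod>j\<in>I. g j (\<epsilon> j))" for \<epsilon> c
    using insert.hyps by simp
  show ?case
    using insert.hyps unfolding EE_insert[OF insert.hyps(1,2)] * EE_cmult insert.IH by (simp add: field_simps)
qed

text \<open>The density, with respect to uniform signs, of independent signs with means
  \<open>h i\<close>, provided that these lie in [-1, 1].\<close>

definition tilt :: "'i set \<Rightarrow> ('i \<Rightarrow> real) \<Rightarrow> ('i \<Rightarrow> real) \<Rightarrow> real" where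
  "tilt I h \<epsilon> = (\<Prod>i\<in>I. 1 + h i * \<epsilon> i)"

lemma cube_coord: "\<epsilon> \<in> cube I \<Longrightarrow> i \<in> I \<Longrightarrow> \<epsilon> i = 1 \<or> \<epsilon> i = -1"
  unfolding cube_def by (auto dest: PiE_mem)

lemma tilt_nonneg:
  assumes "\<epsilon> \<in> cube I" "\<And>i. i \<in> I \<Longrightarrow> \<bar>h i\<bar> \<le> 1"
  shows "0 \<le> tilt I h \<epsilon>"
  unfolding tilt_def
proof (rule prod_nonneg)
  fix i assume "i \<in> I"
  then show "0 \<le> 1 + h i * \<epsilon> i"
    using cube_coord[OF assms(1), of i] assms(2)[of i] by auto
qed

lemma EE_tilt: "finite I \<Longrightarrow> EE I (tilt I h) = 1"
  unfolding tilt_def by (subst EE_prod[where g = "\<lambda>i e. 1 + h i * e"]) auto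

lemma EE_tilt_coord:
  assumes "finite I" "i \<in> I"
  shows "EE I (\<lambda>\<epsilon>. tilt I h \<epsilon> * \<epsilon> i) = h i"
proof -
  have "EE I (\<lambda>\<epsilon>. tilt I h \<epsilon> * \<epsilon> i)
      = EE I (\<lambda>\<epsilon>. \<Prod>j\<in>I. (if j = i then (1 + h j * \<epsilon> j) * \<epsilon> j else 1 + h j * \<epsilon> j))"
  proof (rule EE_cong)
    fix \<epsilon> :: "'a \<Rightarrow> real"
    have "(\<Prod>j\<in>I - {i}. 1 + h j * \<epsilon> j)
        = (\<Prod>j\<in>I - {i}. if j = i then (1 + h j * \<epsilon> j) * \<epsilon> j else 1 + h j * \<epsilon> j)"
      by (rule prod.cong) auto
    then show "tilt I h \<epsilon> * \<epsilon> i
        = (\<Prod>j\<in>I. if j = i then (1 + h j * \<epsilon> j) * \<epsilon> j else 1 + h j * \<epsilon> j)"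
      unfolding tilt_def using assms by (simp add: prod.remove[of I i])
  qed
  also have "\<dots> = (\<Prod>j\<in>I. if j = i then h i else 1)"
    by (subst EE_prod[OF assms(1), of "\<lambda>j e. if j = i then (1 + h j * e) * e else 1 + h j * e"])
       (auto intro!: prod.cong)
  finally show ?thesis using assms by simp
qed

lemma EE_tilt_lf: "finite I \<Longrightarrow> EE I (\<lambda>\<epsilon>. tilt I h \<epsilon> * lf I v \<epsilon>) = (\<Sum>i\<in>I. h i * v i)"
proof -
  assume I: "finite I"
  have "EE I (\<lambda>\<epsilon>. tilt I h \<epsilon> * lf I v \<epsilon>) = EE I (\<lambda>\<epsilon>. \<Sum>i\<in>I. (tilt I h \<epsilon> * \<epsilon> i) * v i)"
    by (simp add: lf_def sum_distrib_left mult_ac)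
  also have "\<dots> = (\<Sum>i\<in>I. h i * v i)"
    using I by (simp add: EE_sum EE_multc EE_tilt_coord)
  finally show ?thesis .
qed

lemma EE_lf [simp]: "finite I \<Longrightarrow> EE I (lf I v) = 0"
  using EE_tilt_lf[of I "\<lambda>_. 0" v] by (simp add: tilt_def)

text \<open>By independence the correlation factorises into terms \<open>1 + h i * k i\<close>.
  Consequently a mixture of tilts with nearly orthogonal drifts has a small second moment.\<close>

lemma EE_tilt_tilt_le:
  assumes "finite I" "\<And>i. i \<in> I \<Longrightarrow> \<bar>h i\<bar> \<le> 1" "\<And>i. i \<in> I \<Longrightarrow> \<bar>k i\<bar> \<le> 1"
  shows "EE I (\<lambda>\<epsilon>. tilt I h \<epsilon> * tilt I k \<epsilon>) \<le> exp (\<Sum>i\<in>I. h i * k i)"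
proof -
  have "EE I (\<lambda>\<epsilon>. tilt I h \<epsilon> * tilt I k \<epsilon>) = (\<Prod>i\<in>I. 1 + h i * k i)"
    unfolding tilt_def prod.distrib[symmetric]
    by (subst EE_prod[OF assms(1), of "\<lambda>j e. (1 + h j * e) * (1 + k j * e)"])
       (auto intro!: prod.cong simp: field_simps)
  also have "\<dots> \<le> (\<Prod>i\<in>I. exp (h i * k i))"
  proof (rule prod_mono, intro conjI)
    fix i assume i: "i \<in> I"
    have "\<bar>h i * k i\<bar> \<le> 1" using assms(2)[OF i] assms(3)[OF i] by (simp add: abs_mult mult_le_one)
    then show "0 \<le> 1 + h i * k i" by linarith
    show "1 + h i * k i \<le> exp (h i * k i)" by (rule exp_ge_add_one_self)
  qed
  finally show ?thesis using assms(1) by (simp add: exp_sum)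
qed

text \<open>Since ln (1 + x) \<le> x, the logarithm of the density is at most the linear form of
  \<open>h\<close>, whose mean under the tilt is \<open>nsq I h\<close>.\<close>

lemma EE_tilt_ln_le:
  assumes "finite I" "\<And>i. i \<in> I \<Longrightarrow> \<bar>h i\<bar> < 1"
  shows "EE I (\<lambda>\<epsilon>. tilt I h \<epsilon> * ln (tilt I h \<epsilon>)) \<le> nsq I h"
proof -
  have "EE I (\<lambda>\<epsilon>. tilt I h \<epsilon> * ln (tilt I h \<epsilon>)) \<le> EE I (\<lambda>\<epsilon>. tilt I h \<epsilon> * lf I h \<epsilon>)"
  proof (intro EE_mono mult_left_mono tilt_nonneg)
    fix \<epsilon> :: "'a \<Rightarrow> real" assume e: "\<epsilon> \<in> cube I"
    have pos: "0 < 1 + h i * \<epsilon> i" if "i \<in> I" for i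
      using cube_coord[OF e that] assms(2)[OF that] by auto
    then have "ln (tilt I h \<epsilon>) = (\<Sum>i\<in>I. ln (1 + h i * \<epsilon> i))"
      unfolding tilt_def using assms(1) by (intro ln_prod) (auto dest: pos)
    also have "\<dots> \<le> (\<Sum>i\<in>I. \<epsilon> i * h i)"
      using pos by (intro sum_mono) (metis add.commute add_diff_cancel_right' ln_le_minus_one mult.commute)
    finally show "ln (tilt I h \<epsilon>) \<le> lf I h \<epsilon>" by (simp add: lf_def)
  qed (use assms in \<open>auto intro: less_imp_le\<close>)
  also have "\<dots> = nsq I h"
    using assms by (simp add: EE_tilt_lf nsq_def power2_eq_square)
  finally show ?thesis .
qed

section \<open>Tilted signs and entropy\<close>

lemma lf_scale: "lf I (\<lambda>i. s * v i) \<epsilon> = s * lf I v \<epsilon>"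
  by (simp add: lf_def sum_distrib_left mult_ac)

lemma lf_add: "lf I (\<lambda>i. v i + w i) \<epsilon> = lf I v \<epsilon> + lf I w \<epsilon>"
  by (simp add: lf_def sum.distrib algebra_simps)

lemma lf_diff: "lf I (\<lambda>i. v i - w i) \<epsilon> = lf I v \<epsilon> - lf I w \<epsilon>"
  by (simp add: lf_def sum_subtractf algebra_simps)

lemma nsq_scale: "nsq I (\<lambda>i. s * v i) = s\<^sup>2 * nsq I v"
  by (simp add: nsq_def sum_distrib_left power_mult_distrib)

lemma ln_le_of_le_exp: "0 < x \<Longrightarrow> x \<le> exp y \<Longrightarrow> ln x \<le> (y::real)"
  using ln_le_cancel_iff[of x "exp y"] by simp

text \<open>\<open>EE_max_exp_upper\<close> for the vectors scaled by \<open>s\<close>: their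
  penalties are at most \<open>s\<^sup>2 * L\<close> and can be pulled out of the maximum.\<close>

lemma EE_exp_max_upper:
  assumes "finite I" "finite A" "A \<noteq> {}" "s > 0" and L: "\<And>a. a \<in> A \<Longrightarrow> nsq I (v a) \<le> L"
  shows "EE I (\<lambda>\<epsilon>. exp (s * (MAX a\<in>A. c a + lf I (v a) \<epsilon>)))
    \<le> exp (s * EE I (\<lambda>\<epsilon>. MAX a\<in>A. c a + lf I (v a) \<epsilon>) + s\<^sup>2 * L)"
proof -
  define w where "w a = (\<lambda>i. s * v a i)" for a
  have sm: "s * (MAX a\<in>A. f a) = (MAX a\<in>A. s * f a)" for f :: "'b \<Rightarrow> real"
    using mono_Max_commute[of "\<lambda>t. s * t" "f ` A"] assms
    by (simp add: mono_def image_image mult_left_mono)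
  have pt: "exp (s * (MAX a\<in>A. c a + lf I (v a) \<epsilon>))
      \<le> exp (MAX a\<in>A. s * c a + lf I (w a) \<epsilon> - nsq I (w a)) * exp (s\<^sup>2 * L)" for \<epsilon>
  proof -
    have "(MAX a\<in>A. s * (c a + lf I (v a) \<epsilon>)) \<le> (MAX a\<in>A. s * c a + lf I (w a) \<epsilon> - nsq I (w a)) + s\<^sup>2 * L"
    proof (rule Max_le_all[OF assms(2,3)])
      fix a assume a: "a \<in> A"
      have "s * c a + lf I (w a) \<epsilon> - nsq I (w a) \<le> (MAX a\<in>A. s * c a + lf I (w a) \<epsilon> - nsq I (w a))"
        using Max_ge_at[OF assms(2) a, of "\<lambda>a. s * c a + lf I (w a) \<epsilon> - nsq I (w a)"] .
      moreover have "nsq I (w a) \<le> s\<^sup>2 * L"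
        using L[OF a] by (simp add: w_def nsq_scale mult_left_mono)
      ultimately show "s * (c a + lf I (v a) \<epsilon>) \<le> (MAX a\<in>A. s * c a + lf I (w a) \<epsilon> - nsq I (w a)) + s\<^sup>2 * L"
        by (simp add: w_def lf_scale algebra_simps)
    qed
    then show ?thesis by (simp add: sm exp_add[symmetric])
  qed
  have "EE I (\<lambda>\<epsilon>. exp (s * (MAX a\<in>A. c a + lf I (v a) \<epsilon>)))
      \<le> EE I (\<lambda>\<epsilon>. exp (MAX a\<in>A. s * c a + lf I (w a) \<epsilon> - nsq I (w a))) * exp (s\<^sup>2 * L)"
    unfolding EE_multc[symmetric] by (rule EE_mono) (rule pt)
  also have "\<dots> \<le> exp (EE I (\<lambda>\<epsilon>. MAX a\<in>A. s * c a + lf I (w a) \<epsilon>)) * exp (s\<^sup>2 * L)"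
    by (rule mult_right_mono[OF EE_max_exp_upper[OF assms(1-3)]]) simp
  also have "EE I (\<lambda>\<epsilon>. MAX a\<in>A. s * c a + lf I (w a) \<epsilon>) = s * EE I (\<lambda>\<epsilon>. MAX a\<in>A. c a + lf I (v a) \<epsilon>)"
    unfolding EE_cmult[symmetric] sm by (simp add: w_def lf_scale algebra_simps)
  finally show ?thesis by (simp add: exp_add)
qed

lemma EE_exp_max_lower:
  assumes "finite I" "finite A" "A \<noteq> {}" "s > 0" and L: "\<And>a. a \<in> A \<Longrightarrow> nsq I (v a) \<le> L"
    and one: "\<And>a i. a \<in> A \<Longrightarrow> i \<in> I \<Longrightarrow> s * \<bar>v a i\<bar> \<le> 1"
  shows "EE I (\<lambda>\<epsilon>. exp (- s * (MAX a\<in>A. c a + lf I (v a) \<epsilon>)))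
    \<le> exp (- s * EE I (\<lambda>\<epsilon>. MAX a\<in>A. c a + lf I (v a) \<epsilon>) + 2 * s\<^sup>2 * L)"
proof -
  define w where "w a = (\<lambda>i. s * v a i)" for a
  have sm: "s * (MAX a\<in>A. f a) = (MAX a\<in>A. s * f a)" for f :: "'b \<Rightarrow> real"
    using mono_Max_commute[of "\<lambda>t. s * t" "f ` A"] assms
    by (simp add: mono_def image_image mult_left_mono)
  have pt: "exp (- s * (MAX a\<in>A. c a + lf I (v a) \<epsilon>))
      \<le> exp (- (MAX a\<in>A. s * c a + lf I (w a) \<epsilon> + 2 * nsq I (w a))) * exp (2 * s\<^sup>2 * L)" for \<epsilon>
  proof -
    have "(MAX a\<in>A. s * c a + lf I (w a) \<epsilon> + 2 * nsq I (w a)) \<le> (MAX a\<in>A. s * (c a + lf I (v a) \<epsilon>)) + 2 * s\<^sup>2 * L"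
    proof (rule Max_le_all[OF assms(2,3)])
      fix a assume a: "a \<in> A"
      have "s * (c a + lf I (v a) \<epsilon>) \<le> (MAX a\<in>A. s * (c a + lf I (v a) \<epsilon>))"
        using Max_ge_at[OF assms(2) a, of "\<lambda>a. s * (c a + lf I (v a) \<epsilon>)"] .
      moreover have "nsq I (w a) \<le> s\<^sup>2 * L"
        using L[OF a] by (simp add: w_def nsq_scale mult_left_mono)
      ultimately show "s * c a + lf I (w a) \<epsilon> + 2 * nsq I (w a) \<le> (MAX a\<in>A. s * (c a + lf I (v a) \<epsilon>)) + 2 * s\<^sup>2 * L"
        by (simp add: w_def lf_scale algebra_simps)
    qed
    then show ?thesis by (simp add: sm exp_add[symmetric])
  qed
  have "EE I (\<lambda>\<epsilon>. exp (- s * (MAX a\<in>A. c a + lf I (v a) \<epsilon>)))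
      \<le> EE I (\<lambda>\<epsilon>. exp (- (MAX a\<in>A. s * c a + lf I (w a) \<epsilon> + 2 * nsq I (w a)))) * exp (2 * s\<^sup>2 * L)"
    unfolding EE_multc[symmetric] by (rule EE_mono) (rule pt)
  also have "\<dots> \<le> exp (- EE I (\<lambda>\<epsilon>. MAX a\<in>A. s * c a + lf I (w a) \<epsilon>)) * exp (2 * s\<^sup>2 * L)"
    by (rule mult_right_mono[OF EE_max_exp_lower[OF assms(1-3)]])
       (use one assms(4) in \<open>auto simp: w_def abs_mult\<close>)
  also have "EE I (\<lambda>\<epsilon>. MAX a\<in>A. s * c a + lf I (w a) \<epsilon>) = s * EE I (\<lambda>\<epsilon>. MAX a\<in>A. c a + lf I (v a) \<epsilon>)"
    unfolding EE_cmult[symmetric] sm by (simp add: w_def lf_scale algebra_simps)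
  finally show ?thesis by (simp add: exp_add[symmetric])
qed

text \<open>\<open>gibbs\<close> against the exponential moment of the maximum. The best
  \<open>s\<close> would give twice the square root of \<open>L\<close> times the entropy, so a
  change of density of small entropy hardly raises the mean.\<close>

lemma EE_tilted_max_le:
  assumes "finite I" "finite A" "A \<noteq> {}" "s > 0" and L: "\<And>a. a \<in> A \<Longrightarrow> nsq I (v a) \<le> L"
    and J: "\<And>\<epsilon>. \<epsilon> \<in> cube I \<Longrightarrow> 0 \<le> J \<epsilon>" "EE I J = 1"
  shows "EE I (\<lambda>\<epsilon>. J \<epsilon> * (MAX a\<in>A. c a + lf I (v a) \<epsilon>))
    \<le> EE I (\<lambda>\<epsilon>. MAX a\<in>A. c a + lf I (v a) \<epsilon>) + s * L + EE I (\<lambda>\<epsilon>. J \<epsilon> * ln (J \<epsilon>)) / s"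
proof -
  have "ln (EE I (\<lambda>\<epsilon>. exp (s * (MAX a\<in>A. c a + lf I (v a) \<epsilon>))))
      \<le> s * EE I (\<lambda>\<epsilon>. MAX a\<in>A. c a + lf I (v a) \<epsilon>) + s\<^sup>2 * L"
    by (intro ln_le_of_le_exp EE_exp_max_upper assms EE_pos) auto
  then have "s * EE I (\<lambda>\<epsilon>. J \<epsilon> * (MAX a\<in>A. c a + lf I (v a) \<epsilon>))
      \<le> s * (EE I (\<lambda>\<epsilon>. MAX a\<in>A. c a + lf I (v a) \<epsilon>) + s * L + EE I (\<lambda>\<epsilon>. J \<epsilon> * ln (J \<epsilon>)) / s)"
    using gibbs_EE[OF assms(1) J assms(4), of "\<lambda>\<epsilon>. MAX a\<in>A. c a + lf I (v a) \<epsilon>"] assms(4)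
    by (simp add: power2_eq_square algebra_simps)
  then show ?thesis using assms(4) by (simp only: mult_le_cancel_left_pos)
qed

text \<open>The same for the negated maximum; the restriction on \<open>s\<close> is inherited from
  \<open>EE_exp_max_lower\<close>.\<close>

lemma EE_tilted_max_ge:
  assumes "finite I" "finite A" "A \<noteq> {}" "s > 0" and L: "\<And>a. a \<in> A \<Longrightarrow> nsq I (v a) \<le> L"
    and one: "\<And>a i. a \<in> A \<Longrightarrow> i \<in> I \<Longrightarrow> s * \<bar>v a i\<bar> \<le> 1"
    and J: "\<And>\<epsilon>. \<epsilon> \<in> cube I \<Longrightarrow> 0 \<le> J \<epsilon>" "EE I J = 1"
  shows "EE I (\<lambda>\<epsilon>. MAX a\<in>A. c a + lf I (v a) \<epsilon>) - 2 * s * L - EE I (\<lambda>\<epsilon>. J \<epsilon> * ln (J \<epsilon>)) / s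
    \<le> EE I (\<lambda>\<epsilon>. J \<epsilon> * (MAX a\<in>A. c a + lf I (v a) \<epsilon>))"
proof -
  have "ln (EE I (\<lambda>\<epsilon>. exp (- s * (MAX a\<in>A. c a + lf I (v a) \<epsilon>))))
      \<le> - s * EE I (\<lambda>\<epsilon>. MAX a\<in>A. c a + lf I (v a) \<epsilon>) + 2 * s\<^sup>2 * L"
    by (intro ln_le_of_le_exp EE_exp_max_lower assms EE_pos) auto
  then have "s * (EE I (\<lambda>\<epsilon>. MAX a\<in>A. c a + lf I (v a) \<epsilon>) - 2 * s * L - EE I (\<lambda>\<epsilon>. J \<epsilon> * ln (J \<epsilon>)) / s)
      \<le> s * EE I (\<lambda>\<epsilon>. J \<epsilon> * (MAX a\<in>A. c a + lf I (v a) \<epsilon>))"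
    using gibbs_EE[OF assms(1) J assms(4), of "\<lambda>\<epsilon>. - (MAX a\<in>A. c a + lf I (v a) \<epsilon>)"] assms(4)
      EE_cmult[of I "-1" "\<lambda>\<epsilon>. J \<epsilon> * (MAX a\<in>A. c a + lf I (v a) \<epsilon>)"]
    by (simp add: power2_eq_square algebra_simps)
  then show ?thesis using assms(4) by (simp only: mult_le_cancel_left_pos)
qed

text \<open>Jensen's inequality for the logarithm under the density \<open>J\<close>, in the form ln
  (J / m) \<le> J / m - 1 with \<open>m\<close> the second moment.\<close>

lemma EE_entropy_le:
  assumes "finite I" "\<And>\<epsilon>. \<epsilon> \<in> cube I \<Longrightarrow> 0 \<le> J \<epsilon>" "EE I J = 1"
  shows "EE I (\<lambda>\<epsilon>. J \<epsilon> * ln (J \<epsilon>)) \<le> ln (EE I (\<lambda>\<epsilon>. (J \<epsilon>)\<^sup>2))"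
proof -
  define m where "m = EE I (\<lambda>\<epsilon>. (J \<epsilon>)\<^sup>2)"
  have "1 \<le> m" using EE_square_le[OF assms(1), of J] assms(3) by (simp add: m_def)
  have "EE I (\<lambda>\<epsilon>. J \<epsilon> * ln (J \<epsilon>)) \<le> EE I (\<lambda>\<epsilon>. J \<epsilon> * ln m + (J \<epsilon>)\<^sup>2 * (1 / m) - J \<epsilon>)"
  proof (rule EE_mono)
    fix \<epsilon> :: "'a \<Rightarrow> real" assume "\<epsilon> \<in> cube I"
    then have J: "0 \<le> J \<epsilon>" by (rule assms(2))
    show "J \<epsilon> * ln (J \<epsilon>) \<le> J \<epsilon> * ln m + (J \<epsilon>)\<^sup>2 * (1 / m) - J \<epsilon>"
    proof (cases "J \<epsilon> = 0")
      case False
      then have "ln (J \<epsilon> / m) \<le> J \<epsilon> / m - 1" using J \<open>1 \<le> m\<close> by (intro ln_le_minus_one) auto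
      then have "ln (J \<epsilon>) \<le> ln m + J \<epsilon> / m - 1" using J False \<open>1 \<le> m\<close> by (simp add: ln_div)
      then have "J \<epsilon> * ln (J \<epsilon>) \<le> J \<epsilon> * (ln m + J \<epsilon> / m - 1)" using J by (rule mult_left_mono)
      then show ?thesis by (simp add: power2_eq_square algebra_simps)
    qed simp
  qed
  also have "\<dots> = ln m"
    unfolding EE_add EE_diff EE_multc using \<open>1 \<le> m\<close> assms(3) by (simp add: m_def[symmetric])
  finally show ?thesis by (simp add: m_def)
qed

section \<open>Euclidean distance and the search for a well spread ball\<close>

definition dI :: "'i set \<Rightarrow> ('i \<Rightarrow> real) \<Rightarrow> ('i \<Rightarrow> real) \<Rightarrow> real" where
  "dI I x y = L2_set (\<lambda>i. x i - y i) I"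

lemma dI_nonneg [simp]: "0 \<le> dI I x y"
  by (simp add: dI_def)

lemma dI_self [simp]: "dI I x x = 0"
  by (simp add: dI_def L2_set_def)

lemma dI_sq: "(dI I x y)\<^sup>2 = nsq I (\<lambda>i. x i - y i)"
  by (simp add: dI_def L2_set_def nsq_def sum_nonneg)

lemma dI_commute: "dI I x y = dI I y x"
  by (simp add: dI_def L2_set_def power2_commute)

lemma dI_triangle: "dI I x z \<le> dI I x y + dI I y z"
  using L2_set_triangle_ineq[of "\<lambda>i. x i - y i" "\<lambda>i. y i - z i" I] by (simp add: dI_def)

lemma dI_le_iff: "0 \<le> R \<Longrightarrow> dI I x y \<le> R \<longleftrightarrow> nsq I (\<lambda>i. x i - y i) \<le> R\<^sup>2"
  using abs_le_square_iff[of "dI I x y" R] by (simp add: dI_sq)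

lemma inner_le_L2: "(\<Sum>i\<in>I. f i * g i) \<le> sqrt (nsq I f) * sqrt (nsq I g)"
proof -
  have "(\<Sum>i\<in>I. f i * g i) \<le> (\<Sum>i\<in>I. \<bar>f i\<bar> * \<bar>g i\<bar>)"
    by (rule sum_mono) (metis abs_ge_self abs_mult)
  also have "\<dots> \<le> L2_set f I * L2_set g I" by (rule L2_set_mult_ineq)
  finally show ?thesis by (simp add: L2_set_def nsq_def)
qed

text \<open>Expanding the square shows that the squared distance to the shifted centre is at most (1
  - d^2) R^2, and 1 - d^2 \<le> (1 - d^2/2)^2. Points strongly correlated with \<open>x\<close> thus
  share a ball of smaller radius.\<close>

lemma shifted_ball:
  assumes "0 \<le> d" "d \<le> 1" "dI I x u \<le> R" "dI I y u \<le> R"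
    and "d * R\<^sup>2 \<le> (\<Sum>i\<in>I. (y i - u i) * (x i - u i))"
  shows "dI I y (\<lambda>i. u i + d * (x i - u i)) \<le> (1 - d\<^sup>2 / 2) * R"
proof -
  have R: "0 \<le> R" using assms(3) dI_nonneg order_trans by blast
  have n: "nsq I (\<lambda>i. x i - u i) \<le> R\<^sup>2" "nsq I (\<lambda>i. y i - u i) \<le> R\<^sup>2"
    using assms(3,4) R by (simp_all add: dI_le_iff)
  have d2: "d\<^sup>2 \<le> 1" using assms by (simp add: power_le_one)
  have "nsq I (\<lambda>i. y i - (u i + d * (x i - u i)))
      = nsq I (\<lambda>i. y i - u i) - 2 * d * (\<Sum>i\<in>I. (y i - u i) * (x i - u i)) + d\<^sup>2 * nsq I (\<lambda>i. x i - u i)"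
    unfolding nsq_def sum_distrib_left sum_subtractf[symmetric] sum.distrib[symmetric]
    by (rule sum.cong) (auto simp: power2_eq_square algebra_simps)
  also have "\<dots> \<le> R\<^sup>2 - 2 * d * (d * R\<^sup>2) + d\<^sup>2 * R\<^sup>2"
    using assms n by (intro add_mono diff_mono mult_left_mono) auto
  also have "\<dots> = (1 - d\<^sup>2) * R\<^sup>2" by (simp add: power2_eq_square algebra_simps)
  also have "\<dots> \<le> (1 - d\<^sup>2 / 2)\<^sup>2 * R\<^sup>2"
    using zero_le_power2[of "d\<^sup>2"] by (intro mult_right_mono) (simp_all add: power2_diff)
  finally show ?thesis
    using R d2 by (subst dI_le_iff) (auto simp: power_mult_distrib)
qed

text \<open>Let the radius decrease geometrically from \<open>R0\<close>, and call it good if some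
  admissible ball has mass at least \<open>exp (- a / r\<^sup>2)\<close>. The first radius is good
  and the first one not above \<open>Rm\<close> is not. At the radius just before the first failure
  there is a good ball, while all balls of the next radius are lighter by a definite factor.\<close>

lemma spread_ball:
  fixes p :: "'w \<Rightarrow> real" and x :: "'w \<Rightarrow> 'i \<Rightarrow> real"
  defines "mass \<equiv> \<lambda>S p (x :: 'w \<Rightarrow> 'i \<Rightarrow> real) I u R. \<Sum>w\<in>{w\<in>S. dI I (x w) u \<le> R}. p w"
  assumes "finite S" and p: "\<And>w. w \<in> S \<Longrightarrow> 0 \<le> p w" "(\<Sum>w\<in>S. p w) = 1"
    and b: "0 \<le> b"
    and R0: "\<And>w. w \<in> S \<Longrightarrow> dI I (x w) c \<le> R0"
    and del: "0 < del" "del < 1" and Rm: "0 < Rm" "Rm \<le> R0" and g: "0 < g"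
    and small: "\<And>u. (\<And>i. i \<in> I \<Longrightarrow> \<bar>u i - c i\<bar> \<le> b) \<Longrightarrow>
        mass S p x I u Rm < exp (- (g\<^sup>2 / del) / ((1 - del) * Rm)\<^sup>2)"
  obtains u R where "\<And>i. i \<in> I \<Longrightarrow> \<bar>u i - c i\<bar> \<le> b" "(1 - del) * Rm \<le> R" "R \<le> R0"
    "exp (- (g\<^sup>2 / del) / R\<^sup>2) \<le> mass S p x I u R"
    "\<And>u'. (\<And>i. i \<in> I \<Longrightarrow> \<bar>u' i - c i\<bar> \<le> b) \<Longrightarrow>
       mass S p x I u' ((1 - del) * R) \<le> mass S p x I u R * exp (- 2 * g\<^sup>2 / R\<^sup>2)"
proof -
  define r where "r i = (1 - del) ^ i * R0" for i :: nat
  define a where "a = g\<^sup>2 / del"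
  have a: "a > 0" using g del by (simp add: a_def)
  have r_pos: "0 < r i" for i using del Rm by (simp add: r_def)
  have r_Suc: "r (Suc i) = (1 - del) * r i" for i by (simp add: r_def)
  have r_anti: "r j \<le> r i" if "i \<le> j" for i j
    unfolding r_def using that del Rm by (intro mult_right_mono power_decreasing) auto
  define B where "B u \<longleftrightarrow> (\<forall>i\<in>I. \<bar>u i - c i\<bar> \<le> b)" for u
  define Q where "Q i \<longleftrightarrow> (\<exists>u. B u \<and> exp (- a / (r i)\<^sup>2) \<le> mass S p x I u (r i))" for i
  have Q0: "Q 0"
  proof -
    have "mass S p x I c (r 0) = 1"
    proof -
      have "{w\<in>S. dI I (x w) c \<le> r 0} = S" using R0 by (auto simp: r_def)
      then show ?thesis by (simp add: mass_def p)
    qed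
    moreover have "exp (- a / (r 0)\<^sup>2) \<le> 1" using a by simp
    ultimately show ?thesis unfolding Q_def B_def using b by (intro exI[of _ c]) auto
  qed
  have "(\<lambda>i. (1 - del) ^ i * R0) \<longlonglongrightarrow> 0 * R0"
    using del by (intro tendsto_mult LIMSEQ_realpow_zero tendsto_const) auto
  then have "eventually (\<lambda>i. r i < Rm) sequentially"
    unfolding r_def using Rm by (intro order_tendstoD(2)[of _ 0]) auto
  then obtain j where "r j < Rm" by (auto simp: eventually_sequentially)
  then have ex: "\<exists>j. r j \<le> Rm" by (auto intro: less_imp_le)
  define j0 where "j0 = (LEAST j. r j \<le> Rm)"
  have j0: "r j0 \<le> Rm" unfolding j0_def using ex by (rule LeastI_ex)
  have j0_ge: "(1 - del) * Rm \<le> r j0"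
  proof (cases j0)
    case 0
    then have "r j0 = R0" by (simp add: r_def)
    moreover have "(1 - del) * Rm \<le> 1 * Rm" using del Rm by (intro mult_right_mono) auto
    ultimately show ?thesis using Rm by linarith
  next
    case (Suc k)
    then have "\<not> r k \<le> Rm" using not_less_Least[of k "\<lambda>j. r j \<le> Rm"] by (simp add: j0_def)
    then show ?thesis using Suc del by (simp add: r_Suc mult_left_mono)
  qed
  have mass_mono: "mass S p x I u R \<le> mass S p x I u R'" if "R \<le> R'" for u R R'
    unfolding mass_def using that p assms(2) by (intro sum_mono2) auto
  have "\<not> Q j0"
  proof
    assume "Q j0"
    then obtain u where u: "B u" "exp (- a / (r j0)\<^sup>2) \<le> mass S p x I u (r j0)"
      by (auto simp: Q_def)
    have "mass S p x I u (r j0) \<le> mass S p x I u Rm" by (rule mass_mono[OF j0])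
    also have "\<dots> < exp (- a / ((1 - del) * Rm)\<^sup>2)"
      using small[of u] u(1) by (simp add: B_def a_def)
    also have "\<dots> \<le> exp (- a / (r j0)\<^sup>2)"
    proof -
      have "((1 - del) * Rm)\<^sup>2 \<le> (r j0)\<^sup>2" using j0_ge del Rm by (intro power_mono) auto
      moreover have "0 < ((1 - del) * Rm)\<^sup>2" using del Rm by simp
      ultimately show ?thesis using a r_pos[of j0] by (simp add: frac_le)
    qed
    finally show False using u by simp
  qed
  \<comment> \<open>Being good need not be monotone in the radius, so the first failure is taken; it
    occurs no later than at \<open>j0\<close>.\<close>
  define k where "k = (LEAST k. \<not> Q k)"
  have nQ: "\<not> Q k" unfolding k_def using \<open>\<not> Q j0\<close> by (rule LeastI)
  have k_le: "k \<le> j0" unfolding k_def using \<open>\<not> Q j0\<close> by (rule Least_le)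
  obtain i where i: "k = Suc i" using nQ Q0 by (cases k) auto
  have "Q i" using not_less_Least[of i "\<lambda>k. \<not> Q k"] i by (simp add: k_def)
  then obtain u where u: "B u" "exp (- a / (r i)\<^sup>2) \<le> mass S p x I u (r i)"
    by (auto simp: Q_def)
  show ?thesis
  proof (rule that[of u "r i"])
    show "(1 - del) * Rm \<le> r i"
      using j0_ge r_anti[OF k_le] r_anti[of i k] i by simp
    show "r i \<le> R0" using r_anti[of 0 i] by (simp add: r_def)
    show "exp (- (g\<^sup>2 / del) / (r i)\<^sup>2) \<le> mass S p x I u (r i)" using u by (simp add: a_def)
    fix u' :: "'i \<Rightarrow> real" assume "\<And>i. i \<in> I \<Longrightarrow> \<bar>u' i - c i\<bar> \<le> b"
    then have "B u'" by (simp add: B_def)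
    then have "mass S p x I u' ((1 - del) * r i) < exp (- a / ((1 - del) * r i)\<^sup>2)"
      using nQ i by (auto simp: Q_def r_Suc not_le)
    also have "\<dots> \<le> exp (- a / (r i)\<^sup>2) * exp (- 2 * g\<^sup>2 / (r i)\<^sup>2)"
    proof -
      \<comment> \<open>Hence shrinking the radius by the factor \<open>1 - del\<close> raises
        \<open>a / r\<^sup>2\<close> by at least \<open>2 * del * a / r\<^sup>2\<close>, and this
        equals \<open>2 * g\<^sup>2 / r\<^sup>2\<close> because
        \<open>a = g\<^sup>2 / del\<close>.\<close>
      have "(1 + 2 * del) * (1 - del)\<^sup>2 \<le> 1"
      proof -
        have "(1 + 2 * del) * (1 - del)\<^sup>2 \<le> (1 + del)\<^sup>2 * (1 - del)\<^sup>2"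
          by (intro mult_right_mono zero_le_power2) (simp add: power2_eq_square algebra_simps)
        also have "\<dots> = (1 - del\<^sup>2)\<^sup>2" by (simp add: power2_eq_square algebra_simps)
        also have "\<dots> \<le> 1"
          using del power_le_one[of del 2] by (intro power_le_one) (auto simp: less_imp_le)
        finally show ?thesis .
      qed
      then have "a * (1 + 2 * del) * (1 - del)\<^sup>2 \<le> a * 1"
        using a by (simp add: mult.assoc)
      then have "a * (1 + 2 * del) \<le> a / (1 - del)\<^sup>2"
        using del by (simp add: field_simps)
      moreover have "a * (2 * del) = 2 * g\<^sup>2" using del by (simp add: a_def)
      ultimately have "a + 2 * g\<^sup>2 \<le> a / (1 - del)\<^sup>2" by (simp add: algebra_simps)
      then have "(a + 2 * g\<^sup>2) / (r i)\<^sup>2 \<le> a / (1 - del)\<^sup>2 / (r i)\<^sup>2"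
        by (rule divide_right_mono) simp
      then show ?thesis
        by (simp add: exp_add[symmetric] power_mult_distrib add_divide_distrib)
    qed
    also have "\<dots> \<le> mass S p x I u (r i) * exp (- 2 * g\<^sup>2 / (r i)\<^sup>2)"
      using u by (intro mult_right_mono) auto
    finally show "mass S p x I u' ((1 - del) * r i) \<le> mass S p x I u (r i) * exp (- 2 * g\<^sup>2 / (r i)\<^sup>2)"
      by simp
  qed (use u in \<open>auto simp: B_def\<close>)
qed


lemma inner_le_ball:
  assumes "dI I x u \<le> R" "dI I y u \<le> R"
  shows "(\<Sum>i\<in>I. (y i - u i) * (x i - u i)) \<le> R\<^sup>2"
proof -
  have "(\<Sum>i\<in>I. (y i - u i) * (x i - u i)) \<le> dI I y u * dI I x u"
    using inner_le_L2[of "\<lambda>i. y i - u i" "\<lambda>i. x i - u i" I] by (simp add: dI_def L2_set_def nsq_def)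
  also have "\<dots> \<le> R * R"
    using assms order_trans[OF dI_nonneg assms(1)] by (intro mult_mono) auto
  finally show ?thesis by (simp add: power2_eq_square)
qed

text \<open>A prior that charges no small ball restricts to a ball on which it is nearly orthogonal
  about the centre, so that the product measures with drifts proportional to its points have an
  average close to the uniform measure on the cube.\<close>

lemma orthogonal_prior:
  fixes p :: "'w \<Rightarrow> real" and x :: "'w \<Rightarrow> 'i \<Rightarrow> real"
  assumes S: "finite S" and p: "\<And>w. w \<in> S \<Longrightarrow> 0 \<le> p w" "(\<Sum>w\<in>S. p w) = 1"
    and b: "0 \<le> b" and box: "\<And>w i. w \<in> S \<Longrightarrow> i \<in> I \<Longrightarrow> \<bar>x w i - c i\<bar> \<le> b"
    and R0: "\<And>w. w \<in> S \<Longrightarrow> dI I (x w) c \<le> R0"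
    and d: "0 < d" "d \<le> 1" and Rm: "0 < Rm" "Rm \<le> R0" and g: "0 < g"
    and small: "\<And>u. (\<And>i. i \<in> I \<Longrightarrow> \<bar>u i - c i\<bar> \<le> b) \<Longrightarrow>
        (\<Sum>w\<in>{w\<in>S. dI I (x w) u \<le> Rm}. p w) < exp (- (g\<^sup>2 / (d\<^sup>2 / 2)) / ((1 - d\<^sup>2 / 2) * Rm)\<^sup>2)"
  obtains u R T q where "\<And>i. i \<in> I \<Longrightarrow> \<bar>u i - c i\<bar> \<le> b" "(1 - d\<^sup>2 / 2) * Rm \<le> R" "R \<le> R0"
    "T \<subseteq> S" "\<And>w. w \<in> T \<Longrightarrow> dI I (x w) u \<le> R" "\<And>w. w \<in> T \<Longrightarrow> 0 \<le> q w" "(\<Sum>w\<in>T. q w) = 1"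
    "\<And>w. w \<in> T \<Longrightarrow> q w \<le> p w * exp ((g\<^sup>2 / (d\<^sup>2 / 2)) / R\<^sup>2)"
    "(\<Sum>w\<in>T. q w * nsq I (\<lambda>i. x w i - u i)) \<ge> (1 - d\<^sup>2 / 2)\<^sup>2 * R\<^sup>2 * (1 - exp (- 2 * g\<^sup>2 / R\<^sup>2))"
    "(\<Sum>w\<in>T. \<Sum>v\<in>T. q w * q v * exp ((g / R\<^sup>2)\<^sup>2 * (\<Sum>i\<in>I. (x v i - u i) * (x w i - u i))))
       \<le> exp (d * (g\<^sup>2 / R\<^sup>2)) + exp (- (g\<^sup>2 / R\<^sup>2))"
proof -
  have del: "0 < d\<^sup>2 / 2" "d\<^sup>2 / 2 < 1" using d power_le_one[of d 2] by auto
  define mass where "mass u R = (\<Sum>w\<in>{w\<in>S. dI I (x w) u \<le> R}. p w)" for u R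
  obtain u R where uR: "\<And>i. i \<in> I \<Longrightarrow> \<bar>u i - c i\<bar> \<le> b" "(1 - d\<^sup>2 / 2) * Rm \<le> R" "R \<le> R0"
    and m: "exp (- (g\<^sup>2 / (d\<^sup>2 / 2)) / R\<^sup>2) \<le> mass u R"
    and sm: "\<And>u'. (\<And>i. i \<in> I \<Longrightarrow> \<bar>u' i - c i\<bar> \<le> b) \<Longrightarrow>
       mass u' ((1 - d\<^sup>2 / 2) * R) \<le> mass u R * exp (- 2 * g\<^sup>2 / R\<^sup>2)"
    using spread_ball[OF S p b R0 del Rm g small] unfolding mass_def by blast
  have mpos: "0 < mass u R" using m by (rule less_le_trans[OF exp_gt_zero])
  have "0 < (1 - d\<^sup>2 / 2) * Rm" using del Rm by simp
  then have Rpos: "0 < R" using uR(2) by linarith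
  define T where "T = {w\<in>S. dI I (x w) u \<le> R}"
  define q where "q w = p w / mass u R" for w
  define k where "k = g\<^sup>2 / R\<^sup>2"
  have fT: "finite T" using S by (simp add: T_def)
  have q0: "0 \<le> q w" if "w \<in> T" for w using that p mpos by (simp add: q_def T_def)
  have q1: "(\<Sum>w\<in>T. q w) = 1"
    using mpos by (simp add: q_def sum_divide_distrib[symmetric] T_def mass_def)
  \<comment> \<open>Used twice: for the points too close to \<open>u\<close>, which bounds the mean
    squared radius below, and for the points too correlated with a fixed \<open>x w\<close>, which
    bounds the correlations above.\<close>
  have qsub: "(\<Sum>w\<in>{w\<in>T. P w}. q w) \<le> exp (- 2 * k)"
    if "\<And>w. w \<in> T \<Longrightarrow> P w \<Longrightarrow> dI I (x w) u' \<le> (1 - d\<^sup>2 / 2) * R"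
      and "\<And>i. i \<in> I \<Longrightarrow> \<bar>u' i - c i\<bar> \<le> b" for P u'
  proof -
    have "(\<Sum>w\<in>{w\<in>T. P w}. p w) \<le> mass u' ((1 - d\<^sup>2 / 2) * R)"
      unfolding mass_def using S p that(1) by (intro sum_mono2) (auto simp: T_def)
    also have "\<dots> \<le> mass u R * exp (- 2 * g\<^sup>2 / R\<^sup>2)" by (rule sm[OF that(2)])
    finally show ?thesis
      using mpos by (simp add: q_def sum_divide_distrib[symmetric] k_def divide_le_eq mult.commute)
  qed
  show ?thesis
  proof (rule that[of u R T q])
    show "T \<subseteq> S" by (auto simp: T_def)
    show "dI I (x w) u \<le> R" if "w \<in> T" for w using that by (simp add: T_def)
    show "q w \<le> p w * exp ((g\<^sup>2 / (d\<^sup>2 / 2)) / R\<^sup>2)" if "w \<in> T" for w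
    proof -
      have "1 \<le> mass u R * exp ((g\<^sup>2 / (d\<^sup>2 / 2)) / R\<^sup>2)"
        using mult_right_mono[OF m, of "exp ((g\<^sup>2 / (d\<^sup>2 / 2)) / R\<^sup>2)"] by (simp add: exp_minus field_simps)
      then have "p w * 1 \<le> p w * (mass u R * exp ((g\<^sup>2 / (d\<^sup>2 / 2)) / R\<^sup>2))"
        using that p by (intro mult_left_mono) (auto simp: T_def)
      then show ?thesis using mpos by (simp add: q_def divide_le_eq mult_ac)
    qed
    have "(1 - d\<^sup>2 / 2)\<^sup>2 * R\<^sup>2 * (1 - exp (- 2 * k)) \<le> (\<Sum>w\<in>T. q w * nsq I (\<lambda>i. x w i - u i))"
    proof -
      let ?N = "{w\<in>T. dI I (x w) u \<le> (1 - d\<^sup>2 / 2) * R}"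
      have N: "(\<Sum>w\<in>?N. q w) \<le> exp (- 2 * k)" by (rule qsub) (use uR in auto)
      have "(\<Sum>w\<in>T - ?N. q w) = 1 - (\<Sum>w\<in>?N. q w)"
        using q1 fT by (subst sum_diff) auto
      then have "1 - exp (- 2 * k) \<le> (\<Sum>w\<in>T - ?N. q w)" using N by simp
      then have "(1 - d\<^sup>2 / 2)\<^sup>2 * R\<^sup>2 * (1 - exp (- 2 * k)) \<le> (1 - d\<^sup>2 / 2)\<^sup>2 * R\<^sup>2 * (\<Sum>w\<in>T - ?N. q w)"
        by (rule mult_left_mono) simp
      also have "\<dots> = (\<Sum>w\<in>T - ?N. q w * ((1 - d\<^sup>2 / 2) * R)\<^sup>2)"
        by (simp add: sum_distrib_left power_mult_distrib mult_ac)
      also have "\<dots> \<le> (\<Sum>w\<in>T - ?N. q w * nsq I (\<lambda>i. x w i - u i))"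
      proof (intro sum_mono mult_left_mono)
        fix w assume "w \<in> T - ?N"
        then have "\<not> dI I (x w) u \<le> (1 - d\<^sup>2 / 2) * R" by auto
        then show "((1 - d\<^sup>2 / 2) * R)\<^sup>2 \<le> nsq I (\<lambda>i. x w i - u i)"
          unfolding dI_sq[symmetric] using del Rpos by (intro power_mono) auto
      qed (use q0 in auto)
      also have "\<dots> \<le> (\<Sum>w\<in>T. q w * nsq I (\<lambda>i. x w i - u i))"
        using fT q0 by (intro sum_mono2) auto
      finally show ?thesis .
    qed
    then show "(1 - d\<^sup>2 / 2)\<^sup>2 * R\<^sup>2 * (1 - exp (- 2 * g\<^sup>2 / R\<^sup>2)) \<le> (\<Sum>w\<in>T. q w * nsq I (\<lambda>i. x w i - u i))"
      by (simp add: k_def)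
    have lam: "(g / R\<^sup>2)\<^sup>2 * R\<^sup>2 = k" using Rpos by (simp add: k_def power2_eq_square)
    have inner: "(\<Sum>v\<in>T. q v * exp ((g / R\<^sup>2)\<^sup>2 * (\<Sum>i\<in>I. (x v i - u i) * (x w i - u i)))) \<le> exp (d * k) + exp (- k)"
      if w: "w \<in> T" for w
    proof -
      define ip where "ip v = (\<Sum>i\<in>I. (x v i - u i) * (x w i - u i))" for v
      let ?N = "{v\<in>T. d * R\<^sup>2 \<le> ip v}"
      \<comment> \<open>The centre given by \<open>shifted_ball\<close> is a convex combination of
        \<open>u\<close> and \<open>x w\<close>; it therefore stays in the box, where the bound for
        small balls is available.\<close>
      have "(\<Sum>v\<in>?N. q v) \<le> exp (- 2 * k)"
      proof (rule qsub[where u' = "\<lambda>i. u i + d * (x w i - u i)"])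
        fix v assume v: "v \<in> T" "d * R\<^sup>2 \<le> ip v"
        then show "dI I (x v) (\<lambda>i. u i + d * (x w i - u i)) \<le> (1 - d\<^sup>2 / 2) * R"
          using d w by (intro shifted_ball) (auto simp: ip_def T_def)
      next
        fix i assume i: "i \<in> I"
        have "u i + d * (x w i - u i) - c i = (1 - d) * (u i - c i) + d * (x w i - c i)"
          by (simp add: algebra_simps)
        also have "\<bar>\<dots>\<bar> \<le> (1 - d) * \<bar>u i - c i\<bar> + d * \<bar>x w i - c i\<bar>"
          using d by (intro order_trans[OF abs_triangle_ineq]) (simp add: abs_mult)
        also have "\<dots> \<le> (1 - d) * b + d * b"
          using d uR(1)[OF i] box[of w i] w i by (intro add_mono mult_left_mono) (auto simp: T_def)
        finally show "\<bar>u i + d * (x w i - u i) - c i\<bar> \<le> b" by (simp add: algebra_simps)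
      qed
      \<comment> \<open>On the exceptional points the exponent may reach \<open>k\<close>, but their
        mass is at most \<open>exp (- 2 * k)\<close>, so that they contribute at most
        \<open>exp (- k)\<close>.\<close>
      then have *: "(\<Sum>v\<in>?N. q v) * exp k \<le> exp (- 2 * k) * exp k" by (rule mult_right_mono) simp
      have "(\<Sum>v\<in>T. q v * exp ((g / R\<^sup>2)\<^sup>2 * ip v))
          \<le> (\<Sum>v\<in>T. q v * exp (d * k) + (if v \<in> ?N then q v * exp k else 0))"
      proof (rule sum_mono)
        fix v assume v: "v \<in> T"
        show "q v * exp ((g / R\<^sup>2)\<^sup>2 * ip v) \<le> q v * exp (d * k) + (if v \<in> ?N then q v * exp k else 0)"
        proof (cases "v \<in> ?N")
          case True
          have "ip v \<le> R\<^sup>2" unfolding ip_def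
            by (rule inner_le_ball) (use v w in \<open>auto simp: T_def\<close>)
          then have "(g / R\<^sup>2)\<^sup>2 * ip v \<le> k" unfolding lam[symmetric] by (rule mult_left_mono) simp
          then have "q v * exp ((g / R\<^sup>2)\<^sup>2 * ip v) \<le> q v * exp k" using q0[OF v] by (intro mult_left_mono) auto
          then show ?thesis using True q0[OF v] by (simp add: add_increasing)
        next
          case False
          then have "ip v \<le> d * R\<^sup>2" using v by auto
          then have "(g / R\<^sup>2)\<^sup>2 * ip v \<le> (g / R\<^sup>2)\<^sup>2 * (d * R\<^sup>2)" by (rule mult_left_mono) simp
          also have "\<dots> = d * k" unfolding lam[symmetric] by simp
          finally show ?thesis using False q0[OF v] by (auto intro: mult_left_mono)
        qed
      qed
      also have "\<dots> = exp (d * k) + (\<Sum>v\<in>?N. q v) * exp k"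
        using fT q1 by (simp add: sum.distrib sum_distrib_right[symmetric] sum.inter_filter[symmetric] cong: conj_cong)
      also have "\<dots> \<le> exp (d * k) + exp (- k)"
        using * by (simp add: exp_add[symmetric])
      finally show ?thesis by (simp add: ip_def)
    qed
    have "(\<Sum>w\<in>T. \<Sum>v\<in>T. q w * q v * exp ((g / R\<^sup>2)\<^sup>2 * (\<Sum>i\<in>I. (x v i - u i) * (x w i - u i))))
        \<le> (\<Sum>w\<in>T. q w * (exp (d * k) + exp (- k)))"
    proof (rule sum_mono)
      fix w assume w: "w \<in> T"
      have "(\<Sum>v\<in>T. q w * q v * exp ((g / R\<^sup>2)\<^sup>2 * (\<Sum>i\<in>I. (x v i - u i) * (x w i - u i))))
        = q w * (\<Sum>v\<in>T. q v * exp ((g / R\<^sup>2)\<^sup>2 * (\<Sum>i\<in>I. (x v i - u i) * (x w i - u i))))"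
        by (simp add: sum_distrib_left mult.assoc)
      also have "\<dots> \<le> q w * (exp (d * k) + exp (- k))"
        using inner[OF w] q0[OF w] by (rule mult_left_mono)
      finally show "(\<Sum>v\<in>T. q w * q v * exp ((g / R\<^sup>2)\<^sup>2 * (\<Sum>i\<in>I. (x v i - u i) * (x w i - u i))))
        \<le> q w * (exp (d * k) + exp (- k))" .
    qed
    also have "\<dots> = exp (d * k) + exp (- k)" using q1 by (simp add: sum_distrib_right[symmetric])
    finally show "(\<Sum>w\<in>T. \<Sum>v\<in>T. q w * q v * exp ((g / R\<^sup>2)\<^sup>2 * (\<Sum>i\<in>I. (x v i - u i) * (x w i - u i))))
       \<le> exp (d * (g\<^sup>2 / R\<^sup>2)) + exp (- (g\<^sup>2 / R\<^sup>2))" by (simp add: k_def)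
  qed (use uR q0 q1 in auto)
qed

section \<open>Growth of the expected supremum\<close>

lemma ln_two_exp_le: "0 \<le> k \<Longrightarrow> 0 \<le> d \<Longrightarrow> ln (exp (d * k) + exp (- k)) \<le> d * k + (1::real)"
proof (rule ln_le_of_le_exp)
  assume k: "0 \<le> k" "0 \<le> d"
  have "exp (- k) \<le> exp (d * k)" using k by (simp add: order_trans[of _ 0])
  then have "exp (d * k) + exp (- k) \<le> 2 * exp (d * k)" by simp
  also have "\<dots> \<le> exp 1 * exp (d * k)" using exp_ge_add_one_self[of 1] by (intro mult_right_mono) auto
  finally show "exp (d * k) + exp (- k) \<le> exp (d * k + 1)" by (simp add: exp_add mult.commute)
qed (simp add: add_pos_pos)

text \<open>The entropy is bounded through the second moment, which is an average of exponentials of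
  inner products of drifts. A single tilt may have entropy of order \<open>k\<close>; mixing over
  nearly orthogonal drifts brings it down to \<open>d * k + 1\<close>.\<close>

lemma EE_avg_tilt:
  assumes I: "finite I" and T: "finite T" and q: "\<And>w. w \<in> T \<Longrightarrow> 0 \<le> q w" "(\<Sum>w\<in>T. q w) = 1"
    and h: "\<And>w i. w \<in> T \<Longrightarrow> i \<in> I \<Longrightarrow> \<bar>h w i\<bar> \<le> 1"
  defines "J \<equiv> \<lambda>\<epsilon>. \<Sum>w\<in>T. q w * tilt I (h w) \<epsilon>"
  shows "\<And>\<epsilon>. \<epsilon> \<in> cube I \<Longrightarrow> 0 \<le> J \<epsilon>" "EE I J = 1"
    "\<And>k d. 0 \<le> k \<Longrightarrow> 0 \<le> d \<Longrightarrow>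
       (\<Sum>w\<in>T. \<Sum>v\<in>T. q w * q v * exp (\<Sum>i\<in>I. h v i * h w i)) \<le> exp (d * k) + exp (- k) \<Longrightarrow>
       EE I (\<lambda>\<epsilon>. J \<epsilon> * ln (J \<epsilon>)) \<le> d * k + 1"
proof -
  show J0: "0 \<le> J \<epsilon>" if "\<epsilon> \<in> cube I" for \<epsilon>
    unfolding J_def using that q h by (intro sum_nonneg mult_nonneg_nonneg tilt_nonneg) auto
  show J1: "EE I J = 1"
    unfolding J_def by (simp add: EE_sum EE_cmult EE_tilt I q)
  have "EE I (\<lambda>\<epsilon>. (J \<epsilon>)\<^sup>2) = EE I (\<lambda>\<epsilon>. \<Sum>w\<in>T. \<Sum>v\<in>T. q w * q v * (tilt I (h v) \<epsilon> * tilt I (h w) \<epsilon>))"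
    unfolding J_def power2_eq_square sum_product by (simp add: mult_ac)
  also have "\<dots> = (\<Sum>w\<in>T. \<Sum>v\<in>T. q w * q v * EE I (\<lambda>\<epsilon>. tilt I (h v) \<epsilon> * tilt I (h w) \<epsilon>))"
    unfolding EE_sum EE_cmult ..
  also have "\<dots> \<le> (\<Sum>w\<in>T. \<Sum>v\<in>T. q w * q v * exp (\<Sum>i\<in>I. h v i * h w i))"
    using q h by (intro sum_mono mult_left_mono EE_tilt_tilt_le I) auto
  finally have le: "EE I (\<lambda>\<epsilon>. (J \<epsilon>)\<^sup>2) \<le> (\<Sum>w\<in>T. \<Sum>v\<in>T. q w * q v * exp (\<Sum>i\<in>I. h v i * h w i))" .
  have "1 \<le> EE I (\<lambda>\<epsilon>. (J \<epsilon>)\<^sup>2)" using EE_square_le[OF I, of J] J1 by simp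
  then have "0 < EE I (\<lambda>\<epsilon>. (J \<epsilon>)\<^sup>2)" by linarith
  fix k d :: real
  assume k: "0 \<le> k" "0 \<le> d"
    and S: "(\<Sum>w\<in>T. \<Sum>v\<in>T. q w * q v * exp (\<Sum>i\<in>I. h v i * h w i)) \<le> exp (d * k) + exp (- k)"
  have "ln (EE I (\<lambda>\<epsilon>. (J \<epsilon>)\<^sup>2)) \<le> ln (exp (d * k) + exp (- k))"
    using \<open>0 < EE I (\<lambda>\<epsilon>. (J \<epsilon>)\<^sup>2)\<close> le S by (subst ln_le_cancel_iff) (auto intro: add_pos_pos)
  then show "EE I (\<lambda>\<epsilon>. J \<epsilon> * ln (J \<epsilon>)) \<le> d * k + 1"
    using EE_entropy_le[OF I J0 J1] ln_two_exp_le[OF k] by linarith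
qed

abbreviation bb :: "'i set \<Rightarrow> ('i \<Rightarrow> real) set \<Rightarrow> real" where
  "bb I Y \<equiv> EE I (\<lambda>\<epsilon>. MAX y\<in>Y. lf I y \<epsilon>)"

lemma Max_add_const:
  fixes f :: "'a \<Rightarrow> real"
  assumes "finite A" "A \<noteq> {}"
  shows "(MAX a\<in>A. f a + k) = (MAX a\<in>A. f a) + k"
  using Max_add_commute[OF assms, of f k] .

lemma EE_max_translate:
  assumes "finite I" "finite A" "A \<noteq> {}"
  shows "EE I (\<lambda>\<epsilon>. MAX a\<in>A. c a + lf I (\<lambda>i. v a i - u i) \<epsilon>) = EE I (\<lambda>\<epsilon>. MAX a\<in>A. c a + lf I (v a) \<epsilon>)"
proof -
  have "(MAX a\<in>A. c a + lf I (\<lambda>i. v a i - u i) \<epsilon>) = (MAX a\<in>A. c a + lf I (v a) \<epsilon>) + - lf I u \<epsilon>" for \<epsilon>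
    unfolding Max_add_const[OF assms(2,3), symmetric] by (simp add: lf_diff algebra_simps)
  then show ?thesis
    using EE_cmult[of I "-1" "lf I u"] assms by (simp add: EE_diff)
qed

lemma bb_translate:
  assumes "finite I" "finite A" "A \<noteq> {}"
  shows "EE I (\<lambda>\<epsilon>. MAX a\<in>A. lf I (\<lambda>i. v a i - u i) \<epsilon>) = EE I (\<lambda>\<epsilon>. MAX a\<in>A. lf I (v a) \<epsilon>)"
  using EE_max_translate[OF assms, of "\<lambda>_. 0"] by simp

lemma bb_mono:
  assumes "finite Y" "X \<subseteq> Y" "X \<noteq> {}"
  shows "bb I X \<le> bb I Y"
  using assms by (intro EE_mono Max_mono) auto

text \<open>The correlation threshold 2^-12 and the shrinking factor that
  \<open>shifted_ball\<close> attaches to it. The inverse of \<open>del\<close> is 2^25, the factor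
  in the entropy bounds of \<open>excess_gain\<close>.\<close>

abbreviation dd :: real where "dd \<equiv> 1 / 4096"
abbreviation del :: real where "del \<equiv> dd\<^sup>2 / 2"

text \<open>The drift \<open>g / R\<^sup>2\<close> times a vector raises the mean of its linear form
  by \<open>g / R\<^sup>2\<close> times its squared length. Most of the prior lies at distance at
  least \<open>(1 - del) * R\<close> from the centre, and \<open>64 * R \<le> g\<close> makes the
  exceptional mass at most 1/4.\<close>

lemma tilt_gain:
  assumes g: "0 < g" and R: "0 < R" "64 * R \<le> g"
  shows "g / 2 \<le> g / R\<^sup>2 * ((1 - del)\<^sup>2 * R\<^sup>2 * (1 - exp (- 2 * g\<^sup>2 / R\<^sup>2)))"
proof -
  have "(64 * R)\<^sup>2 \<le> g\<^sup>2" using assms by (intro power_mono) auto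
  then have "4096 * R\<^sup>2 \<le> g\<^sup>2" by (simp add: power_mult_distrib)
  then have "3 * R\<^sup>2 \<le> 2 * g\<^sup>2" using zero_le_power2[of R] zero_le_power2[of g] by linarith
  then have k: "3 \<le> 2 * g\<^sup>2 / R\<^sup>2" using R by (simp add: pos_le_divide_eq)
  have "1 + 3 \<le> exp (2 * g\<^sup>2 / R\<^sup>2)"
    using exp_ge_add_one_self[of "2 * g\<^sup>2 / R\<^sup>2"] k by linarith
  then have "exp (- 2 * g\<^sup>2 / R\<^sup>2) \<le> 1 / 4" by (simp add: exp_minus field_simps)
  then have "(3/4) * (3/4) \<le> (1 - del)\<^sup>2 * (1 - exp (- 2 * g\<^sup>2 / R\<^sup>2))"
    by (intro mult_mono) (auto simp: power2_eq_square)
  then have "g * ((3/4) * (3/4)) \<le> g * ((1 - del)\<^sup>2 * (1 - exp (- 2 * g\<^sup>2 / R\<^sup>2)))"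
    using g by (intro mult_left_mono) auto
  moreover have "g / R\<^sup>2 * ((1 - del)\<^sup>2 * R\<^sup>2 * (1 - exp (- 2 * g\<^sup>2 / R\<^sup>2)))
      = g * ((1 - del)\<^sup>2 * (1 - exp (- 2 * g\<^sup>2 / R\<^sup>2)))" using R by simp
  ultimately show ?thesis using g by linarith
qed

text \<open>A centre is drawn from the prior of \<open>orthogonal_prior\<close> and the signs are
  tilted towards it. Each tilt raises the maximum to about \<open>v\<close> plus the gain of its
  drift, whereas the mixture of all tilts has so little entropy that its mean can exceed the
  untilted one only by a small part of \<open>g\<close>. \<open>C1\<close> keeps the drifts within
  1/32, \<open>C1\<close> and \<open>C2\<close> keep the loss inside a piece below
  \<open>g / 16\<close>, \<open>C3\<close> keeps all pieces within \<open>2 * R\<close> of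
  \<open>u\<close>, and \<open>C4\<close> makes the additive 1 in the entropy negligible.\<close>

lemma growth:
  fixes s :: "'l \<Rightarrow> 'i \<Rightarrow> real"
  assumes I: "finite I" and L: "finite L" "L \<noteq> {}" and b: "0 < b"
    and box: "\<And>l i. l \<in> L \<Longrightarrow> i \<in> I \<Longrightarrow> \<bar>s l i - c i\<bar> \<le> b"
    and R0: "\<And>l. l \<in> L \<Longrightarrow> dI I (s l) c \<le> R0" and Rm: "0 < Rm" "Rm \<le> R0" and g: "0 < g"
    and small: "\<And>u. (\<And>i. i \<in> I \<Longrightarrow> \<bar>u i - c i\<bar> \<le> b) \<Longrightarrow>
        real (card {l\<in>L. dI I (s l) u \<le> Rm}) / real (card L) < exp (- (g\<^sup>2 / del) / ((1 - del) * Rm)\<^sup>2)"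
    and H: "\<And>l. l \<in> L \<Longrightarrow> finite (H l)" "\<And>l. l \<in> L \<Longrightarrow> H l \<noteq> {}"
    and Hs: "\<And>l y. l \<in> L \<Longrightarrow> y \<in> H l \<Longrightarrow> dI I y (s l) \<le> \<tau>"
    and Hb: "\<And>l y i. l \<in> L \<Longrightarrow> y \<in> H l \<Longrightarrow> i \<in> I \<Longrightarrow> \<bar>y i - s l i\<bar> \<le> 2 * b"
    and v: "\<And>l. l \<in> L \<Longrightarrow> v \<le> bb I (H l)"
    and Y: "finite Y" "\<And>l. l \<in> L \<Longrightarrow> H l \<subseteq> Y"
    and C1: "64 * b * g \<le> ((1 - del) * Rm)\<^sup>2" and C2: "32 * \<tau>\<^sup>2 \<le> b * g"
    and C3: "0 \<le> \<tau>" "\<tau> \<le> (1 - del) * Rm" and C4: "64 * R0 \<le> g"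
  shows "v + g / 4 \<le> bb I Y"
proof -
  have cL: "0 < real (card L)" using L by (simp add: card_gt_0_iff)
  have sm: "(\<Sum>l\<in>{l\<in>L. dI I (s l) u \<le> Rm}. 1 / real (card L)) < exp (- (g\<^sup>2 / del) / ((1 - del) * Rm)\<^sup>2)"
    if "\<And>i. i \<in> I \<Longrightarrow> \<bar>u i - c i\<bar> \<le> b" for u
    using small[OF that] by simp
  have pr: "\<And>l. l \<in> L \<Longrightarrow> 0 \<le> 1 / real (card L)" "(\<Sum>l\<in>L. 1 / real (card L)) = 1" "0 \<le> b" "0 < dd" "dd \<le> 1"
    using cL b by auto
  obtain u R T q where u: "\<And>i. i \<in> I \<Longrightarrow> \<bar>u i - c i\<bar> \<le> b" and R: "(1 - del) * Rm \<le> R" "R \<le> R0"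
    and T: "T \<subseteq> L" "\<And>w. w \<in> T \<Longrightarrow> dI I (s w) u \<le> R" and q: "\<And>w. w \<in> T \<Longrightarrow> 0 \<le> q w" "(\<Sum>w\<in>T. q w) = 1"
    and gain: "(\<Sum>w\<in>T. q w * nsq I (\<lambda>i. s w i - u i)) \<ge> (1 - del)\<^sup>2 * R\<^sup>2 * (1 - exp (- 2 * g\<^sup>2 / R\<^sup>2))"
    and orth: "(\<Sum>w\<in>T. \<Sum>v\<in>T. q w * q v * exp ((g / R\<^sup>2)\<^sup>2 * (\<Sum>i\<in>I. (s v i - u i) * (s w i - u i))))
       \<le> exp (dd * (g\<^sup>2 / R\<^sup>2)) + exp (- (g\<^sup>2 / R\<^sup>2))"
    by (rule orthogonal_prior[of L "\<lambda>_. 1 / real (card L)" b I s c R0 dd Rm g])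
       (use L pr box R0 Rm g sm in \<open>blast+\<close>)
  have del: "0 < 1 - del" by (simp add: power2_eq_square)
  have Rpos: "0 < R" using R(1) mult_pos_pos[OF del Rm(1)] by linarith
  define k where "k = g\<^sup>2 / R\<^sup>2"
  have k0: "0 \<le> k" by (simp add: k_def)
  have lamb: "2 * b * (g / R\<^sup>2) \<le> 1 / 32"
  proof -
    have "((1 - del) * Rm)\<^sup>2 \<le> R\<^sup>2" using R(1) del Rm by (intro power_mono mult_nonneg_nonneg) auto
    then have "64 * b * g \<le> R\<^sup>2" using C1 by linarith
    then show ?thesis using Rpos by (simp add: field_simps)
  qed
  define h where "h w = (\<lambda>i. (g / R\<^sup>2) * (s w i - u i))" for w
  have fT: "finite T" using T L finite_subset by blast
  have h1: "\<bar>h w i\<bar> \<le> 1 / 32" if "w \<in> T" "i \<in> I" for w i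
  proof -
    have "\<bar>s w i - u i\<bar> \<le> 2 * b" using box[of w i] u[of i] that T by fastforce
    then have "(g / R\<^sup>2) * \<bar>s w i - u i\<bar> \<le> (g / R\<^sup>2) * (2 * b)" using g by (intro mult_left_mono) auto
    moreover have "\<bar>h w i\<bar> = (g / R\<^sup>2) * \<bar>s w i - u i\<bar>" using g by (simp add: h_def abs_mult)
    moreover have "(g / R\<^sup>2) * (2 * b) = 2 * b * (g / R\<^sup>2)" by (simp only: mult.commute)
    ultimately show ?thesis using lamb by linarith
  qed
  have nh: "nsq I (h w) \<le> k" if "w \<in> T" for w
  proof -
    have "nsq I (h w) = (g / R\<^sup>2)\<^sup>2 * (dI I (s w) u)\<^sup>2" unfolding h_def nsq_scale dI_sq ..
    also have "\<dots> \<le> (g / R\<^sup>2)\<^sup>2 * R\<^sup>2" using T(2)[OF that] by (intro mult_left_mono power_mono) auto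
    also have "\<dots> = k" using Rpos by (simp add: k_def power2_eq_square)
    finally show ?thesis .
  qed
  define J where "J = (\<lambda>\<epsilon>. \<Sum>w\<in>T. q w * tilt I (h w) \<epsilon>)"
  have h1': "\<bar>h w i\<bar> \<le> 1" "\<bar>h w i\<bar> < 1" if "w \<in> T" "i \<in> I" for w i using h1[OF that] by auto
  have J: "\<And>\<epsilon>. \<epsilon> \<in> cube I \<Longrightarrow> 0 \<le> J \<epsilon>" "EE I J = 1"
    unfolding J_def by (rule EE_avg_tilt; use I fT q h1'(1) in blast)+
  have "(\<Sum>w\<in>T. \<Sum>v\<in>T. q w * q v * exp (\<Sum>i\<in>I. h v i * h w i)) \<le> exp (dd * k) + exp (- k)"
    using orth by (simp add: h_def k_def sum_distrib_left power2_eq_square mult_ac)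
  then have ent: "EE I (\<lambda>\<epsilon>. J \<epsilon> * ln (J \<epsilon>)) \<le> dd * k + 1"
    unfolding J_def by (intro EE_avg_tilt(3)[OF I fT q h1'(1) k0]) auto
  define Y' where "Y' = (\<Union>l\<in>T. H l)"
  have Tne: "T \<noteq> {}" using q(2) by auto
  have Y': "finite Y'" "Y' \<noteq> {}" "Y' \<subseteq> Y"
  proof -
    have TL: "l \<in> L" if "l \<in> T" for l using that T(1) by blast
    show "finite Y'" unfolding Y'_def using fT H(1) TL by blast
    show "Y' \<noteq> {}" unfolding Y'_def using Tne H(2) TL by blast
    show "Y' \<subseteq> Y" unfolding Y'_def using Y(2) TL by blast
  qed
  define F where "F \<epsilon> = (MAX y\<in>Y'. 0 + lf I (\<lambda>i. y i - u i) \<epsilon>)" for \<epsilon>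
  define M where "M l \<epsilon> = (MAX y\<in>H l. 0 + lf I (\<lambda>i. y i - s l i) \<epsilon>)" for l \<epsilon>
  have EF: "EE I F \<le> bb I Y"
    using bb_translate[OF I Y'(1,2), of "\<lambda>y. y" u] bb_mono[OF Y(1) Y'(3,2), of I] by (simp add: F_def[abs_def])
  \<comment> \<open>This value balances the errors: \<open>s2 * (4 * R\<^sup>2)\<close> and
    \<open>dd * k / s2\<close> both equal \<open>g / 32\<close>.\<close>
  define s2 where "s2 = g / (128 * R\<^sup>2)"
  have s2: "0 < s2" using g Rpos by (simp add: s2_def)
  have nY: "nsq I (\<lambda>i. y i - u i) \<le> 4 * R\<^sup>2" if "y \<in> Y'" for y
  proof -
    from that obtain l where l: "l \<in> T" "y \<in> H l" by (auto simp: Y'_def)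
    have "dI I y u \<le> \<tau> + R"
      using dI_triangle[of I y u "s l"] Hs[of l y] T l by fastforce
    then have "dI I y u \<le> 2 * R" using C3 R by linarith
    then show ?thesis using Rpos by (simp add: dI_le_iff power_mult_distrib)
  qed
  have up: "EE I (\<lambda>\<epsilon>. J \<epsilon> * F \<epsilon>) \<le> EE I F + s2 * (4 * R\<^sup>2) + EE I (\<lambda>\<epsilon>. J \<epsilon> * ln (J \<epsilon>)) / s2"
    unfolding F_def by (rule EE_tilted_max_le[OF I Y'(1,2) s2 nY J(1,2)])
  \<comment> \<open>Under the tilt towards \<open>s l\<close> the piece \<open>H l\<close> alone
    suffices: its centre receives the gain of the drift, and the maximum over the piece relative to
    its centre drops by at most \<open>g / 16\<close>.\<close>
  have low: "v - g / 16 + (g / R\<^sup>2) * nsq I (\<lambda>i. s l i - u i) \<le> EE I (\<lambda>\<epsilon>. tilt I (h l) \<epsilon> * F \<epsilon>)" if l: "l \<in> T" for l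
  proof -
    have lL: "l \<in> L" using l T by auto
    have t0: "\<And>\<epsilon>. \<epsilon> \<in> cube I \<Longrightarrow> 0 \<le> tilt I (h l) \<epsilon>"
      by (rule tilt_nonneg) (use h1'(1)[OF l] in auto)
    have "EE I (\<lambda>\<epsilon>. tilt I (h l) \<epsilon> * (lf I (\<lambda>i. s l i - u i) \<epsilon> + M l \<epsilon>)) \<le> EE I (\<lambda>\<epsilon>. tilt I (h l) \<epsilon> * F \<epsilon>)"
    proof (intro EE_mono mult_left_mono t0)
      fix \<epsilon> :: "'i \<Rightarrow> real"
      obtain y where y: "y \<in> H l" "M l \<epsilon> = 0 + lf I (\<lambda>i. y i - s l i) \<epsilon>"
        unfolding M_def using Max_ex[OF H(1)[OF lL] H(2)[OF lL]] by blast
      have "0 + lf I (\<lambda>i. y i - u i) \<epsilon> \<le> F \<epsilon>"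
        unfolding F_def using y l by (intro Max_ge_at[OF Y'(1)]) (auto simp: Y'_def)
      then show "lf I (\<lambda>i. s l i - u i) \<epsilon> + M l \<epsilon> \<le> F \<epsilon>"
        unfolding y(2) by (simp add: lf_diff)
    qed
    moreover have "EE I (\<lambda>\<epsilon>. tilt I (h l) \<epsilon> * (lf I (\<lambda>i. s l i - u i) \<epsilon> + M l \<epsilon>))
        = (g / R\<^sup>2) * nsq I (\<lambda>i. s l i - u i) + EE I (\<lambda>\<epsilon>. tilt I (h l) \<epsilon> * M l \<epsilon>)"
      by (simp add: distrib_left EE_add EE_tilt_lf[OF I])
         (simp add: h_def nsq_def power2_eq_square sum_distrib_left sum_divide_distrib mult_ac)
    moreover have "v - g / 16 \<le> EE I (\<lambda>\<epsilon>. tilt I (h l) \<epsilon> * M l \<epsilon>)"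
    proof -
      \<comment> \<open>The parameter \<open>1 / (2 * b)\<close> is the largest one allowed by
        \<open>EE_tilted_max_ge\<close>, because \<open>H l\<close> stays within
        \<open>2 * b\<close> of \<open>s l\<close> in each coordinate.\<close>
      have "EE I (M l) - 2 * (1 / (2 * b)) * \<tau>\<^sup>2 - EE I (\<lambda>\<epsilon>. tilt I (h l) \<epsilon> * ln (tilt I (h l) \<epsilon>)) / (1 / (2 * b))
          \<le> EE I (\<lambda>\<epsilon>. tilt I (h l) \<epsilon> * M l \<epsilon>)"
        unfolding M_def
      proof (rule EE_tilted_max_ge[OF I H(1)[OF lL] H(2)[OF lL] _ _ _ t0 EE_tilt[OF I]])
        fix y assume y: "y \<in> H l"
        show "nsq I (\<lambda>i. y i - s l i) \<le> \<tau>\<^sup>2"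
          using Hs[OF lL y] C3 by (simp add: dI_le_iff)
        fix i assume "i \<in> I"
        then show "1 / (2 * b) * \<bar>y i - s l i\<bar> \<le> 1" using Hb[OF lL y] b by (simp add: divide_le_eq)
      qed (use b in auto)
      moreover have "2 * (1 / (2 * b)) * \<tau>\<^sup>2 = \<tau>\<^sup>2 / b" "t / (1 / (2 * b)) = t * (2 * b)" for t
        using b by simp_all
      ultimately have "EE I (M l) - \<tau>\<^sup>2 / b - EE I (\<lambda>\<epsilon>. tilt I (h l) \<epsilon> * ln (tilt I (h l) \<epsilon>)) * (2 * b)
          \<le> EE I (\<lambda>\<epsilon>. tilt I (h l) \<epsilon> * M l \<epsilon>)" by (simp only:)
      moreover have "EE I (M l) = bb I (H l)"
        using bb_translate[OF I H(1)[OF lL] H(2)[OF lL], of "\<lambda>y. y" "s l"] by (simp add: M_def[abs_def])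
      moreover have "\<tau>\<^sup>2 / b \<le> g / 32" using C2 b by (simp add: field_simps)
      moreover have "EE I (\<lambda>\<epsilon>. tilt I (h l) \<epsilon> * ln (tilt I (h l) \<epsilon>)) * (2 * b) \<le> g / 32"
      proof -
        have "EE I (\<lambda>\<epsilon>. tilt I (h l) \<epsilon> * ln (tilt I (h l) \<epsilon>)) \<le> nsq I (h l)"
          by (rule EE_tilt_ln_le[OF I]) (use h1'(2)[OF l] in auto)
        then have "EE I (\<lambda>\<epsilon>. tilt I (h l) \<epsilon> * ln (tilt I (h l) \<epsilon>)) * (2 * b) \<le> k * (2 * b)"
          using nh[OF l] b by (intro mult_right_mono) auto
        also have "\<dots> = g * (2 * b * (g / R\<^sup>2))" by (simp add: k_def power2_eq_square)
        also have "\<dots> \<le> g * (1 / 32)" using lamb g by (intro mult_left_mono) auto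
        finally show ?thesis by simp
      qed
      ultimately show ?thesis using v[OF lL] by linarith
    qed
    ultimately show ?thesis by linarith
  qed
  have "(\<Sum>l\<in>T. q l * (v - g / 16 + (g / R\<^sup>2) * nsq I (\<lambda>i. s l i - u i))) \<le> (\<Sum>l\<in>T. q l * EE I (\<lambda>\<epsilon>. tilt I (h l) \<epsilon> * F \<epsilon>))"
    using low q by (intro sum_mono mult_left_mono) auto
  also have "\<dots> = EE I (\<lambda>\<epsilon>. J \<epsilon> * F \<epsilon>)"
    unfolding J_def sum_distrib_right EE_sum mult.assoc EE_cmult ..
  finally have main: "v - g / 16 + (g / R\<^sup>2) * (\<Sum>l\<in>T. q l * nsq I (\<lambda>i. s l i - u i)) \<le> EE I (\<lambda>\<epsilon>. J \<epsilon> * F \<epsilon>)"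
    using q(2) by (simp add: distrib_left sum.distrib sum_distrib_left sum_distrib_right[symmetric] mult_ac)
  have "g / 2 \<le> (g / R\<^sup>2) * (\<Sum>l\<in>T. q l * nsq I (\<lambda>i. s l i - u i))"
  proof (rule order_trans[OF tilt_gain[OF g Rpos] mult_left_mono[OF gain]])
    show "64 * R \<le> g" using R C4 by linarith
    show "0 \<le> g / R\<^sup>2" using g by simp
  qed
  moreover have "s2 * (4 * R\<^sup>2) = g / 32" using Rpos by (simp add: s2_def)
  moreover have "EE I (\<lambda>\<epsilon>. J \<epsilon> * ln (J \<epsilon>)) / s2 \<le> g / 16"
  proof -
    have "EE I (\<lambda>\<epsilon>. J \<epsilon> * ln (J \<epsilon>)) / s2 \<le> (dd * k + 1) / s2" using ent s2 by (intro divide_right_mono) auto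
    also have "\<dots> = g / 32 + 128 * R\<^sup>2 / g" using g Rpos by (simp add: s2_def k_def field_simps power2_eq_square)
    also have "128 * R\<^sup>2 / g \<le> g / 32"
    proof -
      have "(64 * R)\<^sup>2 \<le> g\<^sup>2" using R C4 Rpos by (intro power_mono) auto
      then show ?thesis using g by (simp add: field_simps power2_eq_square)
    qed
    finally show ?thesis by simp
  qed
  ultimately show ?thesis using main up EF g by linarith
qed

lemma neg_xlnx: "0 \<le> x \<Longrightarrow> x - 1 \<le> x * ln (x::real)"
proof (cases "x = 0")
  case False
  assume "0 \<le> x"
  with False have x: "0 < x" by simp
  then have "ln (1 / x) \<le> 1 / x - 1" by (intro ln_le_minus_one) auto
  then have "1 - 1 / x \<le> ln x" using x by (simp add: ln_div)
  then have "x * (1 - 1 / x) \<le> x * ln x" using x by (intro mult_left_mono) auto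
  then show ?thesis using x by (simp add: right_diff_distrib)
qed simp

text \<open>Now the centre depends on the signs: the prior is uniform over pairs of an index
  \<open>t\<close> and signs \<epsilon>, and the vector of a pair is the excess \<open>x\<close> of
  the maximiser of the parts \<open>a\<close> over \<open>A t\<close>. Signs \<delta> are tilted
  towards that excess. The maximiser keeps the first form at about \<open>v\<close>, and the second
  form gains \<open>g / 2\<close>. Restricting the prior biases \<epsilon>, and the tilt correlates
  \<delta> with \<epsilon>; both effects cost an entropy of order \<open>k\<close> divided by
  \<open>s1\<close>, which \<open>C5\<close> makes a small part of \<open>g\<close>.\<close>

lemma excess_gain:
  fixes a x :: "'y \<Rightarrow> 'i \<Rightarrow> real" and sel :: "'t \<Rightarrow> ('i \<Rightarrow> real) \<Rightarrow> 'y"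
  assumes I: "finite I" and E: "finite E" and Tm: "finite Tm" "Tm \<noteq> {}" and b: "0 < b"
    and sel: "\<And>t \<epsilon>. t \<in> Tm \<Longrightarrow> \<epsilon> \<in> cube I \<Longrightarrow> sel t \<epsilon> \<in> E"
    and box: "\<And>y i. y \<in> E \<Longrightarrow> i \<in> I \<Longrightarrow> \<bar>x y i - c i\<bar> \<le> b"
    and R0: "\<And>y. y \<in> E \<Longrightarrow> dI I (x y) c \<le> R0" and Rm: "0 < Rm" "Rm \<le> R0" and g: "0 < g"
    and A: "\<And>t. t \<in> Tm \<Longrightarrow> A t \<subseteq> E" "\<And>t. t \<in> Tm \<Longrightarrow> A t \<noteq> {}"
    and selmax: "\<And>t \<epsilon>. t \<in> Tm \<Longrightarrow> \<epsilon> \<in> cube I \<Longrightarrow>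
        lf I (a (sel t \<epsilon>)) \<epsilon> = (MAX y\<in>A t. lf I (a y) \<epsilon>)"
    and v: "\<And>t. t \<in> Tm \<Longrightarrow> v \<le> EE I (\<lambda>\<epsilon>. MAX y\<in>A t. lf I (a y) \<epsilon>)"
    and small: "\<And>u. (\<And>i. i \<in> I \<Longrightarrow> \<bar>u i - c i\<bar> \<le> b) \<Longrightarrow>
        (\<Sum>w\<in>{w\<in>Tm \<times> cube I. dI I (x (sel (fst w) (snd w))) u \<le> Rm}. 1 / (real (card Tm) * 2 ^ card I))
          < exp (- (g\<^sup>2 / del) / ((1 - del) * Rm)\<^sup>2)"
    and a: "\<And>y. y \<in> E \<Longrightarrow> dI I (a y) s \<le> \<sigma>" "\<And>y i. y \<in> E \<Longrightarrow> i \<in> I \<Longrightarrow> s1 * \<bar>a y i - s i\<bar> \<le> 1"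
    and s1: "0 < s1"
    and C1: "64 * b * g \<le> ((1 - del) * Rm)\<^sup>2" and C4: "64 * R0 \<le> g"
    and C5: "2 ^ 32 * g \<le> s1 * ((1 - del) * Rm)\<^sup>2" and C6: "96 * s1 * \<sigma>\<^sup>2 \<le> g"
  shows "v + g / 4 \<le> EE I (\<lambda>\<epsilon>. EE I (\<lambda>\<delta>. MAX y\<in>E. 0 + lf I (a y) \<epsilon> + lf I (x y) \<delta>))"
proof -
  define S where "S = Tm \<times> cube I"
  define pp where "pp = 1 / (real (card Tm) * 2 ^ card I)"
  define X where "X w = sel (fst w) (snd w)" for w :: "'t \<times> ('i \<Rightarrow> real)"
  have fS: "finite S" using Tm I by (simp add: S_def)
  have cT: "0 < real (card Tm)" using Tm by (simp add: card_gt_0_iff)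
  have pp: "0 < pp" using cT by (simp add: pp_def)
  have p1: "(\<Sum>w\<in>S. pp) = 1"
    using cT by (simp add: S_def card_cartesian_product card_cube[OF I] pp_def)
  have XE: "X w \<in> E" if "w \<in> S" for w using that sel by (auto simp: X_def S_def)
  have Sne: "S \<noteq> {}" using Tm by (simp add: S_def)
  have pr: "\<And>w. w \<in> S \<Longrightarrow> 0 \<le> pp" "0 \<le> b" "0 < dd" "dd \<le> 1" using pp b by auto
  have bx: "\<And>w i. w \<in> S \<Longrightarrow> i \<in> I \<Longrightarrow> \<bar>x (X w) i - c i\<bar> \<le> b"
    and rx: "\<And>w. w \<in> S \<Longrightarrow> dI I (x (X w)) c \<le> R0" using XE box R0 by auto
  have sm: "(\<Sum>w\<in>{w\<in>S. dI I (x (X w)) u \<le> Rm}. pp) < exp (- (g\<^sup>2 / del) / ((1 - del) * Rm)\<^sup>2)"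
    if "\<And>i. i \<in> I \<Longrightarrow> \<bar>u i - c i\<bar> \<le> b" for u
    using small[OF that] by (simp add: S_def X_def pp_def)
  obtain u R T q where u: "\<And>i. i \<in> I \<Longrightarrow> \<bar>u i - c i\<bar> \<le> b" and R: "(1 - del) * Rm \<le> R" "R \<le> R0"
    and T: "T \<subseteq> S" "\<And>w. w \<in> T \<Longrightarrow> dI I (x (X w)) u \<le> R" and q: "\<And>w. w \<in> T \<Longrightarrow> 0 \<le> q w" "(\<Sum>w\<in>T. q w) = 1"
    and qp: "\<And>w. w \<in> T \<Longrightarrow> q w \<le> pp * exp ((g\<^sup>2 / del) / R\<^sup>2)"
    and gain: "(\<Sum>w\<in>T. q w * nsq I (\<lambda>i. x (X w) i - u i)) \<ge> (1 - del)\<^sup>2 * R\<^sup>2 * (1 - exp (- 2 * g\<^sup>2 / R\<^sup>2))"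
    and orth: "(\<Sum>w\<in>T. \<Sum>v\<in>T. q w * q v * exp ((g / R\<^sup>2)\<^sup>2 * (\<Sum>i\<in>I. (x (X v) i - u i) * (x (X w) i - u i))))
       \<le> exp (dd * (g\<^sup>2 / R\<^sup>2)) + exp (- (g\<^sup>2 / R\<^sup>2))"
    by (rule orthogonal_prior[of S "\<lambda>_. pp" b I "\<lambda>w. x (X w)" c R0 dd Rm g])
       (use fS pr p1 bx rx Rm g sm in \<open>blast+\<close>)
  have del: "0 < 1 - del" by (simp add: power2_eq_square)
  have Rpos: "0 < R" using R(1) mult_pos_pos[OF del Rm(1)] by linarith
  define k where "k = g\<^sup>2 / R\<^sup>2"
  have k0: "0 < k" using g Rpos by (simp add: k_def)
  have RmR: "((1 - del) * Rm)\<^sup>2 \<le> R\<^sup>2" using R(1) del Rm by (intro power_mono mult_nonneg_nonneg) auto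
  have lamb: "2 * b * (g / R\<^sup>2) \<le> 1 / 32"
  proof -
    have "64 * b * g \<le> R\<^sup>2" using C1 RmR by linarith
    then show ?thesis using Rpos by (simp add: field_simps)
  qed
  define h where "h w = (\<lambda>i. (g / R\<^sup>2) * (x (X w) i - u i))" for w
  have fT: "finite T" using T fS finite_subset by blast
  have h1: "\<bar>h w i\<bar> \<le> 1 / 32" if "w \<in> T" "i \<in> I" for w i
  proof -
    have "\<bar>x (X w) i - u i\<bar> \<le> 2 * b" using bx[of w i] u[of i] that T by fastforce
    then have "(g / R\<^sup>2) * \<bar>x (X w) i - u i\<bar> \<le> (g / R\<^sup>2) * (2 * b)" using g by (intro mult_left_mono) auto
    moreover have "\<bar>h w i\<bar> = (g / R\<^sup>2) * \<bar>x (X w) i - u i\<bar>" using g by (simp add: h_def abs_mult)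
    moreover have "(g / R\<^sup>2) * (2 * b) = 2 * b * (g / R\<^sup>2)" by (simp only: mult.commute)
    ultimately show ?thesis using lamb by linarith
  qed
  have h1': "\<bar>h w i\<bar> \<le> 1" "\<bar>h w i\<bar> < 1" if "w \<in> T" "i \<in> I" for w i using h1[OF that] by auto
  have nh: "nsq I (h w) \<le> k" if "w \<in> T" for w
  proof -
    have "nsq I (h w) = (g / R\<^sup>2)\<^sup>2 * (dI I (x (X w)) u)\<^sup>2" unfolding h_def nsq_scale dI_sq ..
    also have "\<dots> \<le> (g / R\<^sup>2)\<^sup>2 * R\<^sup>2" using T(2)[OF that] by (intro mult_left_mono power_mono) auto
    also have "\<dots> = k" using Rpos by (simp add: k_def power2_eq_square)
    finally show ?thesis .
  qed
  define J where "J = (\<lambda>\<delta>. \<Sum>w\<in>T. q w * tilt I (h w) \<delta>)"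
  have J: "\<And>\<epsilon>. \<epsilon> \<in> cube I \<Longrightarrow> 0 \<le> J \<epsilon>" "EE I J = 1"
    unfolding J_def by (rule EE_avg_tilt; use I fT q h1'(1) in blast)+
  have "(\<Sum>w\<in>T. \<Sum>v\<in>T. q w * q v * exp (\<Sum>i\<in>I. h v i * h w i)) \<le> exp (dd * k) + exp (- k)"
    using orth by (simp add: h_def k_def sum_distrib_left power2_eq_square mult_ac)
  then have ent: "EE I (\<lambda>\<delta>. J \<delta> * ln (J \<delta>)) \<le> dd * k + 1"
    unfolding J_def by (intro EE_avg_tilt(3)[OF I fT q h1'(1) less_imp_le[OF k0]]) auto
  define E' where "E' = {y\<in>E. dI I (x y) u \<le> R}"
  have XE': "X w \<in> E'" if w: "w \<in> T" for w
  proof -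
    have "w \<in> S" using w T(1) by blast
    then show ?thesis using XE T(2)[OF w] by (simp add: E'_def)
  qed
  have Tne: "T \<noteq> {}" using q(2) by auto
  have E': "finite E'" "E' \<noteq> {}" "E' \<subseteq> E" using E XE' Tne by (auto simp: E'_def)
  have Ene: "E \<noteq> {}" using E' by auto
  define F where "F \<epsilon> \<delta> = (MAX y\<in>E'. lf I (\<lambda>i. a y i - s i) \<epsilon> + lf I (\<lambda>i. x y i - u i) \<delta>)" for \<epsilon> \<delta>
  have EF: "EE I (\<lambda>\<epsilon>. EE I (F \<epsilon>)) \<le> EE I (\<lambda>\<epsilon>. EE I (\<lambda>\<delta>. MAX y\<in>E. 0 + lf I (a y) \<epsilon> + lf I (x y) \<delta>))"
  proof -
    have "F \<epsilon> \<delta> \<le> (MAX y\<in>E. 0 + lf I (a y) \<epsilon> + lf I (x y) \<delta>) - lf I s \<epsilon> - lf I u \<delta>" for \<epsilon> \<delta>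
      unfolding F_def
    proof (rule Max_le_all[OF E'(1,2)])
      fix y assume "y \<in> E'"
      then have "0 + lf I (a y) \<epsilon> + lf I (x y) \<delta> \<le> (MAX y\<in>E. 0 + lf I (a y) \<epsilon> + lf I (x y) \<delta>)"
        using E'(3) by (intro Max_ge_at[OF E]) auto
      then show "lf I (\<lambda>i. a y i - s i) \<epsilon> + lf I (\<lambda>i. x y i - u i) \<delta>
          \<le> (MAX y\<in>E. 0 + lf I (a y) \<epsilon> + lf I (x y) \<delta>) - lf I s \<epsilon> - lf I u \<delta>"
        by (simp add: lf_diff)
    qed
    then have "EE I (\<lambda>\<epsilon>. EE I (F \<epsilon>)) \<le> EE I (\<lambda>\<epsilon>. EE I (\<lambda>\<delta>. (MAX y\<in>E. 0 + lf I (a y) \<epsilon> + lf I (x y) \<delta>) - lf I s \<epsilon> - lf I u \<delta>))"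
      by (intro EE_mono)
    also have "\<dots> = EE I (\<lambda>\<epsilon>. EE I (\<lambda>\<delta>. MAX y\<in>E. 0 + lf I (a y) \<epsilon> + lf I (x y) \<delta>))"
      unfolding EE_diff EE_const[OF I] EE_lf[OF I] by simp
    finally show ?thesis .
  qed
  define f where "f t \<epsilon> = (MAX y\<in>A t. 0 + lf I (\<lambda>i. a y i - s i) \<epsilon>)" for t \<epsilon>
  have fA: "finite (A t)" if "t \<in> Tm" for t using A(1)[OF that] E finite_subset by blast
  have fv: "v \<le> EE I (f t)" if "t \<in> Tm" for t
    using bb_translate[OF I fA[OF that] A(2)[OF that], of a s] v[OF that] by (simp add: f_def[abs_def])
  have fsel: "f t \<epsilon> = lf I (\<lambda>i. a (sel t \<epsilon>) i - s i) \<epsilon>" if "t \<in> Tm" "\<epsilon> \<in> cube I" for t \<epsilon>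
    using Max_add_const[OF fA[OF that(1)] A(2)[OF that(1)], of "\<lambda>y. lf I (a y) \<epsilon>" "- lf I s \<epsilon>"]
      selmax[OF that] by (simp add: f_def lf_diff)
  have na: "nsq I (\<lambda>i. a y i - s i) \<le> \<sigma>\<^sup>2" if "y \<in> E" for y
    using a(1)[OF that] power_mono[OF a(1)[OF that], of 2] by (simp add: dI_sq)
  \<comment> \<open>The density of the restricted prior against the uniform one;
    \<open>orthogonal_prior\<close> bounds it by the exponential of
    \<open>2 ^ 25 * k\<close>.\<close>
  define Q where "Q w = (if w \<in> T then q w / pp else 0)" for w
  have Q0: "0 \<le> Q w" for w using q pp by (simp add: Q_def)
  have sumQ: "(\<Sum>w\<in>S. pp * Q w * z w) = (\<Sum>w\<in>T. q w * z w)" for z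
    using fS T(1) pp
    by (subst sum.mono_neutral_cong_right[of S T _ "\<lambda>w. q w * z w"]) (auto simp: Q_def)
  have lnQ: "Q w * ln (Q w) \<le> Q w * (2 ^ 25 * k)" for w
  proof (cases "Q w = 0")
    case False
    then have w: "w \<in> T" by (auto simp: Q_def split: if_splits)
    then have "Q w \<le> exp ((g\<^sup>2 / del) / R\<^sup>2)" using qp[OF w] pp by (simp add: Q_def divide_le_eq mult.commute)
    moreover have "(g\<^sup>2 / del) / R\<^sup>2 = 2 ^ 25 * k" by (simp add: k_def power2_eq_square)
    ultimately have "ln (Q w) \<le> 2 ^ 25 * k"
      using False Q0[of w] by (intro ln_le_of_le_exp) auto
    then show ?thesis using Q0 by (rule mult_left_mono)
  qed simp
  have sumlnQ: "(\<Sum>w\<in>S. pp * Q w * ln (Q w)) \<le> 2 ^ 25 * k"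
  proof -
    have "(\<Sum>w\<in>S. pp * Q w * ln (Q w)) \<le> (\<Sum>w\<in>S. pp * Q w * (2 ^ 25 * k))"
      using lnQ pp by (intro sum_mono) (simp add: mult.assoc)
    also have "\<dots> = 2 ^ 25 * k" unfolding sumQ using q(2) by (simp add: sum_distrib_right[symmetric])
    finally show ?thesis .
  qed
  have Sprod: "(\<Sum>w\<in>S. pp * G (fst w) (snd w)) = (\<Sum>t\<in>Tm. EE I (G t)) / real (card Tm)" for G
  proof -
    have "(\<Sum>w\<in>S. pp * G (fst w) (snd w)) = (\<Sum>t\<in>Tm. \<Sum>\<epsilon>\<in>cube I. pp * G t \<epsilon>)"
      unfolding S_def by (subst sum.cartesian_product) (simp add: case_prod_unfold)
    then show ?thesis
      by (simp add: EE_def pp_def sum_divide_distrib sum_distrib_left[symmetric] field_simps)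
  qed
  \<comment> \<open>The price of the biased \<epsilon>: the entropy of the restricted prior divided
    by \<open>s1\<close>, and \<open>2 * s1 * \<sigma>\<^sup>2\<close> from the lower exponential
    moment.\<close>
  have vlow: "v - g / 32 - g / 64 \<le> (\<Sum>w\<in>T. q w * f (fst w) (snd w))"
  proof -
    have "s1 * (\<Sum>w\<in>S. pp * Q w * - f (fst w) (snd w))
      \<le> (\<Sum>w\<in>S. pp * Q w) * ln (\<Sum>w\<in>S. pp * exp (s1 * - f (fst w) (snd w)))
         + (\<Sum>w\<in>S. pp * Q w * ln (Q w)) - (\<Sum>w\<in>S. pp * Q w) * ln (\<Sum>w\<in>S. pp * Q w)"
      using fS pp Q0 s1 by (intro gibbs) auto
    moreover have "(\<Sum>w\<in>S. pp * Q w) = 1" using sumQ[of "\<lambda>_. 1"] q by simp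
    ultimately have G: "s1 * (\<Sum>w\<in>S. pp * Q w * - f (fst w) (snd w))
      \<le> ln (\<Sum>w\<in>S. pp * exp (s1 * - f (fst w) (snd w))) + 2 ^ 25 * k"
      using sumlnQ by simp
    have "(\<Sum>w\<in>S. pp * exp (s1 * - f (fst w) (snd w))) = (\<Sum>t\<in>Tm. EE I (\<lambda>\<epsilon>. exp (- s1 * f t \<epsilon>))) / real (card Tm)"
      using Sprod[of "\<lambda>t \<epsilon>. exp (- s1 * f t \<epsilon>)"] by simp
    also have "\<dots> \<le> (\<Sum>t\<in>Tm. exp (- s1 * v + 2 * s1\<^sup>2 * \<sigma>\<^sup>2)) / real (card Tm)"
    proof (intro divide_right_mono sum_mono)
      fix t assume t: "t \<in> Tm"
      have "EE I (\<lambda>\<epsilon>. exp (- s1 * f t \<epsilon>)) \<le> exp (- s1 * EE I (f t) + 2 * s1\<^sup>2 * \<sigma>\<^sup>2)"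
        unfolding f_def using A(1)[OF t] na a(2)
        by (intro EE_exp_max_lower[OF I fA[OF t] A(2)[OF t] s1]) auto
      also have "\<dots> \<le> exp (- s1 * v + 2 * s1\<^sup>2 * \<sigma>\<^sup>2)"
        using fv[OF t] s1 by simp
      finally show "EE I (\<lambda>\<epsilon>. exp (- s1 * f t \<epsilon>)) \<le> exp (- s1 * v + 2 * s1\<^sup>2 * \<sigma>\<^sup>2)" .
    qed simp
    also have "\<dots> = exp (- s1 * v + 2 * s1\<^sup>2 * \<sigma>\<^sup>2)" using cT by simp
    finally have "ln (\<Sum>w\<in>S. pp * exp (s1 * - f (fst w) (snd w))) \<le> - s1 * v + 2 * s1\<^sup>2 * \<sigma>\<^sup>2"
      using fS Sne pp by (intro ln_le_of_le_exp sum_pos) auto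
    with G have "s1 * (\<Sum>w\<in>T. q w * - f (fst w) (snd w)) \<le> - s1 * v + 2 * s1\<^sup>2 * \<sigma>\<^sup>2 + 2 ^ 25 * k"
      unfolding sumQ by linarith
    then have "s1 * (v - 2 * s1 * \<sigma>\<^sup>2 - 2 ^ 25 * k / s1) \<le> s1 * (\<Sum>w\<in>T. q w * f (fst w) (snd w))"
      using s1 by (simp add: sum_negf right_diff_distrib power2_eq_square algebra_simps)
    then have "v - 2 * s1 * \<sigma>\<^sup>2 - 2 ^ 25 * k / s1 \<le> (\<Sum>w\<in>T. q w * f (fst w) (snd w))"
      using s1 by (simp only: mult_le_cancel_left_pos)
    moreover have "2 ^ 25 * k / s1 \<le> g / 64"
    proof -
      have "2 ^ 32 * g \<le> s1 * R\<^sup>2" using C5 mult_left_mono[OF RmR, of s1] s1 by linarith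
      then have "2 ^ 32 * g * g \<le> s1 * R\<^sup>2 * g" using g by (intro mult_right_mono) auto
      then show ?thesis using s1 Rpos g by (simp add: k_def field_simps power2_eq_square)
    qed
    moreover have "2 * s1 * \<sigma>\<^sup>2 \<le> g / 48" using C6 by simp
    ultimately show ?thesis using g by linarith
  qed
  have klow: "(2 ^ 26 * k) / s1 \<le> g / 64"
  proof -
    have "2 ^ 32 * g \<le> s1 * R\<^sup>2" using C5 mult_left_mono[OF RmR, of s1] s1 by linarith
    then have "2 ^ 32 * g * g \<le> s1 * R\<^sup>2 * g" using g by (intro mult_right_mono) auto
    then show ?thesis using s1 Rpos g by (simp add: k_def field_simps power2_eq_square)
  qed
  have t0: "0 \<le> tilt I (h w) \<delta>" if "w \<in> T" "\<delta> \<in> cube I" for w \<delta>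
    using tilt_nonneg[OF that(2)] h1'(1)[OF that(1)] by blast
  \<comment> \<open>Joint law: a pair from the restricted prior, then \<delta> from the tilt towards
    its excess. The maximum \<open>F\<close> is bounded below by the value at the selected
    vector.\<close>
  have first: "v - g / 32 - g / 64 + g / 2
      \<le> (\<Sum>w\<in>T. q w * EE I (\<lambda>\<delta>. tilt I (h w) \<delta> * F (snd w) \<delta>))"
  proof -
    have "(\<Sum>w\<in>T. q w * (f (fst w) (snd w) + (g / R\<^sup>2) * nsq I (\<lambda>i. x (X w) i - u i)))
        \<le> (\<Sum>w\<in>T. q w * EE I (\<lambda>\<delta>. tilt I (h w) \<delta> * F (snd w) \<delta>))"
    proof (intro sum_mono mult_left_mono)
      fix w assume w: "w \<in> T"
      then have wS: "fst w \<in> Tm" "snd w \<in> cube I" using T(1) by (auto simp: S_def)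
      have "f (fst w) (snd w) + (g / R\<^sup>2) * nsq I (\<lambda>i. x (X w) i - u i)
          = EE I (\<lambda>\<delta>. tilt I (h w) \<delta> * (f (fst w) (snd w) + lf I (\<lambda>i. x (X w) i - u i) \<delta>))"
        by (simp add: distrib_left EE_add EE_tilt_lf[OF I] EE_multc EE_tilt[OF I])
           (simp add: h_def nsq_def power2_eq_square sum_distrib_left sum_divide_distrib mult_ac)
      also have "\<dots> \<le> EE I (\<lambda>\<delta>. tilt I (h w) \<delta> * F (snd w) \<delta>)"
      proof (intro EE_mono mult_left_mono t0 w)
        fix \<delta> :: "'i \<Rightarrow> real"
        have "lf I (\<lambda>i. a (X w) i - s i) (snd w) + lf I (\<lambda>i. x (X w) i - u i) \<delta> \<le> F (snd w) \<delta>"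
          unfolding F_def by (rule Max_ge_at[OF E'(1) XE'[OF w]])
        then show "f (fst w) (snd w) + lf I (\<lambda>i. x (X w) i - u i) \<delta> \<le> F (snd w) \<delta>"
          using fsel[OF wS] by (simp add: X_def)
      qed
      finally show "f (fst w) (snd w) + (g / R\<^sup>2) * nsq I (\<lambda>i. x (X w) i - u i)
          \<le> EE I (\<lambda>\<delta>. tilt I (h w) \<delta> * F (snd w) \<delta>)" .
    qed (use q in auto)
    moreover have "(\<Sum>w\<in>T. q w * (f (fst w) (snd w) + (g / R\<^sup>2) * nsq I (\<lambda>i. x (X w) i - u i)))
      = (\<Sum>w\<in>T. q w * f (fst w) (snd w)) + (g / R\<^sup>2) * (\<Sum>w\<in>T. q w * nsq I (\<lambda>i. x (X w) i - u i))"
      by (simp add: distrib_left sum.distrib sum_distrib_left mult_ac)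
    moreover have "g / 2 \<le> (g / R\<^sup>2) * (\<Sum>w\<in>T. q w * nsq I (\<lambda>i. x (X w) i - u i))"
    proof (rule order_trans[OF tilt_gain[OF g Rpos] mult_left_mono[OF gain]])
    show "64 * R \<le> g" using R C4 by linarith
    show "0 \<le> g / R\<^sup>2" using g by simp
  qed
    ultimately show ?thesis using vlow by linarith
  qed
  define G where "G \<delta> = EE I (\<lambda>\<epsilon>. F \<epsilon> \<delta>)" for \<delta>
  \<comment> \<open>Decoupling. For fixed \<delta> the conditional law of the pair has density
    \<open>Q w * tilt I (h w) \<delta> / J \<delta>\<close> against the uniform law.
    \<open>gibbs\<close> replaces \<epsilon> by independent uniform signs at the price of the
    conditional entropy, whose mean is at most \<open>2 ^ 26 * k\<close>.\<close>
  have second: "(\<Sum>w\<in>T. q w * EE I (\<lambda>\<delta>. tilt I (h w) \<delta> * F (snd w) \<delta>))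
      \<le> EE I (\<lambda>\<delta>. J \<delta> * G \<delta>) + s1 * \<sigma>\<^sup>2 + (2 ^ 26 * k) / s1"
  proof -
    have pt: "s1 * (\<Sum>w\<in>T. q w * (tilt I (h w) \<delta> * F (snd w) \<delta>))
        \<le> J \<delta> * (s1 * G \<delta> + s1\<^sup>2 * \<sigma>\<^sup>2) + (\<Sum>w\<in>T. q w * tilt I (h w) \<delta> * (2 ^ 25 * k + ln (tilt I (h w) \<delta>)))
           - J \<delta> + 1" if d: "\<delta> \<in> cube I" for \<delta>
    proof -
      let ?K = "\<lambda>w. Q w * tilt I (h w) \<delta>"
      have K0: "0 \<le> ?K w" if "w \<in> S" for w 
      proof (cases "w \<in> T")
        case True
        then show ?thesis using t0[OF True d] Q0[of w] by (rule_tac mult_nonneg_nonneg)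
      qed (simp add: Q_def)
      have RK: "(\<Sum>w\<in>S. pp * ?K w) = J \<delta>" using sumQ[of "\<lambda>w. tilt I (h w) \<delta>"] by (simp add: J_def mult_ac)
      have Z: "ln (\<Sum>w\<in>S. pp * exp (s1 * F (snd w) \<delta>)) \<le> s1 * G \<delta> + s1\<^sup>2 * \<sigma>\<^sup>2"
      proof (rule ln_le_of_le_exp)
        show "0 < (\<Sum>w\<in>S. pp * exp (s1 * F (snd w) \<delta>))" using fS Sne pp by (intro sum_pos) auto
        have "(\<Sum>w\<in>S. pp * exp (s1 * F (snd w) \<delta>)) = EE I (\<lambda>\<epsilon>. exp (s1 * F \<epsilon> \<delta>))"
          using Sprod[of "\<lambda>_ \<epsilon>. exp (s1 * F \<epsilon> \<delta>)"] cT by simp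
        also have "\<dots> = EE I (\<lambda>\<epsilon>. exp (s1 * (MAX y\<in>E'. lf I (\<lambda>i. x y i - u i) \<delta> + lf I (\<lambda>i. a y i - s i) \<epsilon>)))"
          unfolding F_def by (simp add: add.commute)
        also have "\<dots> \<le> exp (s1 * EE I (\<lambda>\<epsilon>. MAX y\<in>E'. lf I (\<lambda>i. x y i - u i) \<delta> + lf I (\<lambda>i. a y i - s i) \<epsilon>) + s1\<^sup>2 * \<sigma>\<^sup>2)"
          using na E'(3) by (intro EE_exp_max_upper[OF I E'(1,2) s1]) auto
        also have "EE I (\<lambda>\<epsilon>. MAX y\<in>E'. lf I (\<lambda>i. x y i - u i) \<delta> + lf I (\<lambda>i. a y i - s i) \<epsilon>) = G \<delta>"
          unfolding G_def F_def by (simp add: add.commute)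
        finally show "(\<Sum>w\<in>S. pp * exp (s1 * F (snd w) \<delta>)) \<le> exp (s1 * G \<delta> + s1\<^sup>2 * \<sigma>\<^sup>2)" .
      qed
      have "s1 * (\<Sum>w\<in>S. pp * ?K w * F (snd w) \<delta>)
        \<le> (\<Sum>w\<in>S. pp * ?K w) * ln (\<Sum>w\<in>S. pp * exp (s1 * F (snd w) \<delta>))
           + (\<Sum>w\<in>S. pp * ?K w * ln (?K w)) - (\<Sum>w\<in>S. pp * ?K w) * ln (\<Sum>w\<in>S. pp * ?K w)"
        using fS pp K0 s1 by (intro gibbs) auto
      moreover have "s1 * (\<Sum>w\<in>S. pp * ?K w * F (snd w) \<delta>) = s1 * (\<Sum>w\<in>T. q w * (tilt I (h w) \<delta> * F (snd w) \<delta>))"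
        using sumQ[of "\<lambda>w. tilt I (h w) \<delta> * F (snd w) \<delta>"] by (simp add: mult_ac)
      moreover have "J \<delta> * ln (\<Sum>w\<in>S. pp * exp (s1 * F (snd w) \<delta>)) \<le> J \<delta> * (s1 * G \<delta> + s1\<^sup>2 * \<sigma>\<^sup>2)"
        using Z J(1)[OF d] by (rule mult_left_mono)
      \<comment> \<open>A linear lower bound suffices for this term, since \<open>J\<close> has mean
        1 and the difference disappears after averaging over \<delta>.\<close>
      moreover have "J \<delta> - 1 \<le> J \<delta> * ln (J \<delta>)" using J(1)[OF d] by (rule neg_xlnx)
      moreover have "(\<Sum>w\<in>S. pp * ?K w * ln (?K w)) \<le> (\<Sum>w\<in>T. q w * tilt I (h w) \<delta> * (2 ^ 25 * k + ln (tilt I (h w) \<delta>)))"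
      proof -
        have "(\<Sum>w\<in>S. pp * ?K w * ln (?K w)) \<le> (\<Sum>w\<in>S. pp * Q w * (tilt I (h w) \<delta> * (2 ^ 25 * k + ln (tilt I (h w) \<delta>))))"
        proof (rule sum_mono)
          fix w assume "w \<in> S"
          have "?K w * ln (?K w) \<le> Q w * (tilt I (h w) \<delta> * (2 ^ 25 * k + ln (tilt I (h w) \<delta>)))"
          proof (cases "?K w = 0")
            case True
            then show ?thesis by auto
          next
            case False
            then have nz: "Q w \<noteq> 0" "tilt I (h w) \<delta> \<noteq> 0" by auto
            then have w: "w \<in> T" by (auto simp: Q_def split: if_splits)
            have pos: "0 < Q w" "0 < tilt I (h w) \<delta>" using nz Q0[of w] t0[OF w d] by auto
            have "ln (Q w) \<le> 2 ^ 25 * k" using lnQ[of w] pos by (simp only: mult_le_cancel_left_pos)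
            then have "ln (?K w) \<le> 2 ^ 25 * k + ln (tilt I (h w) \<delta>)" using pos by (simp add: ln_mult)
            then have "?K w * ln (?K w) \<le> ?K w * (2 ^ 25 * k + ln (tilt I (h w) \<delta>))" using pos by (intro mult_left_mono) auto
            then show ?thesis by (simp only: mult.assoc)
          qed
          then have "pp * (?K w * ln (?K w)) \<le> pp * (Q w * (tilt I (h w) \<delta> * (2 ^ 25 * k + ln (tilt I (h w) \<delta>))))"
            using pp by (intro mult_left_mono) auto
          then show "pp * ?K w * ln (?K w) \<le> pp * Q w * (tilt I (h w) \<delta> * (2 ^ 25 * k + ln (tilt I (h w) \<delta>)))"
            by (simp only: mult.assoc)
        qed
        then show ?thesis unfolding sumQ by (simp only: mult.assoc)
      qed
      ultimately show ?thesis unfolding RK by linarith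
    qed
    have "s1 * (\<Sum>w\<in>T. q w * EE I (\<lambda>\<delta>. tilt I (h w) \<delta> * F (snd w) \<delta>))
        = EE I (\<lambda>\<delta>. s1 * (\<Sum>w\<in>T. q w * (tilt I (h w) \<delta> * F (snd w) \<delta>)))"
      unfolding EE_cmult EE_sum ..
    also have "\<dots> \<le> EE I (\<lambda>\<delta>. J \<delta> * (s1 * G \<delta> + s1\<^sup>2 * \<sigma>\<^sup>2)
        + (\<Sum>w\<in>T. q w * tilt I (h w) \<delta> * (2 ^ 25 * k + ln (tilt I (h w) \<delta>))) - J \<delta> + 1)"
      by (intro EE_mono pt)
    also have "\<dots> = EE I (\<lambda>\<delta>. s1 * (J \<delta> * G \<delta>) + J \<delta> * (s1\<^sup>2 * \<sigma>\<^sup>2)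
        + (\<Sum>w\<in>T. q w * (tilt I (h w) \<delta> * (2 ^ 25 * k) + tilt I (h w) \<delta> * ln (tilt I (h w) \<delta>))) - J \<delta> + 1)"
      by (simp add: algebra_simps)
    also have "\<dots> = s1 * EE I (\<lambda>\<delta>. J \<delta> * G \<delta>) + s1\<^sup>2 * \<sigma>\<^sup>2
        + (\<Sum>w\<in>T. q w * (2 ^ 25 * k + EE I (\<lambda>\<delta>. tilt I (h w) \<delta> * ln (tilt I (h w) \<delta>))))"
      unfolding EE_add EE_diff EE_sum EE_cmult EE_multc EE_tilt[OF I] J(2) EE_const[OF I] by simp
    also have "(\<Sum>w\<in>T. q w * (2 ^ 25 * k + EE I (\<lambda>\<delta>. tilt I (h w) \<delta> * ln (tilt I (h w) \<delta>)))) \<le> (\<Sum>w\<in>T. q w * (2 ^ 26 * k))"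
    proof (intro sum_mono mult_left_mono)
      fix w assume w: "w \<in> T"
      show "2 ^ 25 * k + EE I (\<lambda>\<delta>. tilt I (h w) \<delta> * ln (tilt I (h w) \<delta>)) \<le> 2 ^ 26 * k"
      proof -
        have "EE I (\<lambda>\<delta>. tilt I (h w) \<delta> * ln (tilt I (h w) \<delta>)) \<le> nsq I (h w)"
          by (rule EE_tilt_ln_le[OF I]) (use h1'(2)[OF w] in auto)
        then show ?thesis using nh[OF w] k0 by simp
      qed
    qed (use q in auto)
    also have "\<dots> = 2 ^ 26 * k" using q(2) by (simp add: sum_distrib_right[symmetric])
    finally have "s1 * (\<Sum>w\<in>T. q w * EE I (\<lambda>\<delta>. tilt I (h w) \<delta> * F (snd w) \<delta>))
        \<le> s1 * (EE I (\<lambda>\<delta>. J \<delta> * G \<delta>) + s1 * \<sigma>\<^sup>2 + (2 ^ 26 * k) / s1)"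
      using s1 by (simp add: algebra_simps power2_eq_square)
    then show ?thesis using s1 by (simp only: mult_le_cancel_left_pos)
  qed
  \<comment> \<open>As in \<open>growth\<close>, but here all vectors lie within \<open>R\<close> of
    \<open>u\<close> instead of \<open>2 * R\<close>, so the balanced value is twice as
    large.\<close>
  define s2 where "s2 = g / (64 * R\<^sup>2)"
  have s2: "0 < s2" using g Rpos by (simp add: s2_def)
  have third: "EE I (\<lambda>\<delta>. J \<delta> * G \<delta>) \<le> EE I (\<lambda>\<epsilon>. EE I (F \<epsilon>)) + s2 * R\<^sup>2 + (dd * k + 1) / s2"
  proof -
    have "EE I (\<lambda>\<delta>. J \<delta> * G \<delta>) = EE I (\<lambda>\<epsilon>. EE I (\<lambda>\<delta>. J \<delta> * F \<epsilon> \<delta>))"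
      unfolding G_def EE_cmult[symmetric] by (rule EE_swap)
    also have "\<dots> \<le> EE I (\<lambda>\<epsilon>. EE I (F \<epsilon>) + (s2 * R\<^sup>2 + (dd * k + 1) / s2))"
    proof (rule EE_mono)
      fix \<epsilon> :: "'i \<Rightarrow> real"
      have "EE I (\<lambda>\<delta>. J \<delta> * F \<epsilon> \<delta>) \<le> EE I (F \<epsilon>) + s2 * R\<^sup>2 + EE I (\<lambda>\<delta>. J \<delta> * ln (J \<delta>)) / s2"
        unfolding F_def using Rpos
        by (intro EE_tilted_max_le[OF I E'(1,2) s2 _ J(1,2)]) (auto simp: E'_def dI_le_iff)
      also have "EE I (\<lambda>\<delta>. J \<delta> * ln (J \<delta>)) / s2 \<le> (dd * k + 1) / s2"
        using ent s2 by (intro divide_right_mono) auto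
      finally show "EE I (\<lambda>\<delta>. J \<delta> * F \<epsilon> \<delta>) \<le> EE I (F \<epsilon>) + (s2 * R\<^sup>2 + (dd * k + 1) / s2)" by simp
    qed
    finally show ?thesis by (simp add: EE_add I)
  qed
  have "s2 * R\<^sup>2 = g / 64" using Rpos by (simp add: s2_def)
  moreover have "(dd * k + 1) / s2 \<le> g / 32"
  proof -
    have "(dd * k + 1) / s2 = g / 64 + 64 * R\<^sup>2 / g"
      using g Rpos by (simp add: s2_def k_def field_simps power2_eq_square)
    also have "64 * R\<^sup>2 / g \<le> g / 64"
    proof -
      have "(64 * R)\<^sup>2 \<le> g\<^sup>2" using R C4 Rpos by (intro power_mono) auto
      then show ?thesis using g by (simp add: field_simps power2_eq_square)
    qed
    finally show ?thesis by simp
  qed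
  moreover have "s1 * \<sigma>\<^sup>2 \<le> g / 96" using C6 by simp
  ultimately show ?thesis using first second third klow EF g by linarith
qed

text \<open>Each step takes the point whose \<open>\<tau>\<close>-ball in the remaining set has the
  largest expected supremum, and removes all points within \<open>2 * Rm\<close> of it. If a point
  survives \<open>m\<close> steps, no ball of radius \<open>Rm\<close> contains two centres, so
  \<open>growth\<close> applies to \<open>m\<close> balls, each with at least the expected supremum
  of any ball that is left.\<close>

lemma greedy_cover:
  assumes I: "finite I" and Y: "finite Y" and b: "0 < b"
    and box: "\<And>y i. y \<in> Y \<Longrightarrow> i \<in> I \<Longrightarrow> \<bar>y i - w i\<bar> \<le> b"
    and R0: "\<And>y. y \<in> Y \<Longrightarrow> dI I y w \<le> R0" and Rm: "0 < Rm" "Rm \<le> R0" and g: "0 < g"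
    and m: "0 < m" "1 / real m < exp (- (g\<^sup>2 / del) / ((1 - del) * Rm)\<^sup>2)"
    and C1: "64 * b * g \<le> ((1 - del) * Rm)\<^sup>2" and C2: "32 * \<tau>\<^sup>2 \<le> b * g"
    and C3: "0 \<le> \<tau>" "\<tau> \<le> (1 - del) * Rm" and C4: "64 * R0 \<le> g"
  obtains S where "S \<subseteq> Y" "card S \<le> m"
    "\<And>z. z \<in> Y \<Longrightarrow> (\<And>s. s \<in> S \<Longrightarrow> 2 * Rm < dI I z s) \<Longrightarrow>
       bb I {y\<in>Y. (\<forall>s\<in>S. 2 * Rm < dI I y s) \<and> dI I y z \<le> \<tau>} + g / 4 \<le> bb I Y"
proof -
  define B where "B A s = {y\<in>A. dI I y s \<le> \<tau>}" for A s
  have "\<exists>s\<in>A. \<forall>z\<in>A. bb I (B A z) \<le> bb I (B A s)" if A: "finite A" "A \<noteq> {}" for A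
  proof -
    obtain s where s: "s \<in> A" "(MAX s\<in>A. bb I (B A s)) = bb I (B A s)"
      using Max_ex[OF A, of "\<lambda>s. bb I (B A s)"] by blast
    then have "\<forall>z\<in>A. bb I (B A z) \<le> bb I (B A s)"
      using Max_ge_at[OF A(1), of _ "\<lambda>s. bb I (B A s)"] by metis
    then show ?thesis using s by blast
  qed
  then obtain \<sigma> where \<sigma>: "\<And>A. finite A \<Longrightarrow> A \<noteq> {} \<Longrightarrow> \<sigma> A \<in> A"
    "\<And>A z. finite A \<Longrightarrow> A \<noteq> {} \<Longrightarrow> z \<in> A \<Longrightarrow> bb I (B A z) \<le> bb I (B A (\<sigma> A))"
    by metis
  define st where "st A = {y\<in>A. 2 * Rm < dI I y (\<sigma> A)}" for A
  define Rem where "Rem k = (st ^^ k) Y" for k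
  have Rem_Suc: "Rem (Suc k) = st (Rem k)" for k by (simp add: Rem_def)
  have Rem_0: "Rem 0 = Y" by (simp add: Rem_def)
  have Rem_anti: "Rem j \<subseteq> Rem i" if "i \<le> j" for i j
    using that by (induction j rule: dec_induct) (auto simp: Rem_Suc st_def)
  have Rem_Y: "Rem k \<subseteq> Y" for k using Rem_anti[of 0 k] by (simp add: Rem_0)
  have fRem: "finite (Rem k)" for k using Rem_Y Y finite_subset by blast
  define S where "S = (\<lambda>k. \<sigma> (Rem k)) ` {k. k < m \<and> Rem k \<noteq> {}}"
  \<comment> \<open>The guard is there because the choice \<open>\<sigma> {}\<close> carries no
    information once the remaining set is empty.\<close>
  have eq: "Rem k = {y\<in>Y. \<forall>j<k. Rem j \<noteq> {} \<longrightarrow> 2 * Rm < dI I y (\<sigma> (Rem j))}" for k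
  proof (induction k)
    case 0
    then show ?case by (simp add: Rem_0)
  next
    case (Suc k)
    show ?case
    proof (cases "Rem k = {}")
      case True
      then have "Rem (Suc k) = {}" by (simp add: Rem_Suc st_def)
      then show ?thesis using True Suc by (auto simp: less_Suc_eq)
    next
      case False
      have "Rem (Suc k) = {y \<in> Rem k. 2 * Rm < dI I y (\<sigma> (Rem k))}" by (simp add: Rem_Suc st_def)
      then show ?thesis using False Suc by (auto simp: less_Suc_eq)
    qed
  qed
  have eqZ: "{y\<in>Y. \<forall>s\<in>S. 2 * Rm < dI I y s} = Rem m"
    unfolding eq[of m] S_def by auto
  show ?thesis
  proof (rule that[of S])
    show "S \<subseteq> Y" using \<sigma>(1)[OF fRem] Rem_Y by (auto simp: S_def)
    have "card S \<le> card {k. k < m \<and> Rem k \<noteq> {}}" unfolding S_def by (rule card_image_le) simp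
    also have "\<dots> \<le> card {..<m}" by (rule card_mono) auto
    finally show "card S \<le> m" by simp
    fix z assume z: "z \<in> Y" "\<And>s. s \<in> S \<Longrightarrow> 2 * Rm < dI I z s"
    then have zm: "z \<in> Rem m" using eqZ by blast
    have ne: "Rem k \<noteq> {}" if "k \<le> m" for k using zm Rem_anti[OF that] by auto
    define s where "s k = \<sigma> (Rem k)" for k
    have s_in: "s k \<in> Rem k" if "k < m" for k using \<sigma>(1)[OF fRem ne] that by (simp add: s_def)
    have sY: "s k \<in> Y" if "k < m" for k using s_in[OF that] Rem_Y by blast
    have sep: "2 * Rm < dI I (s j) (s i)" if "i < j" "j < m" for i j
    proof -
      have "s j \<in> Rem (Suc i)" using s_in[OF that(2)] Rem_anti[of "Suc i" j] that by auto
      then show ?thesis by (simp add: Rem_Suc st_def s_def)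
    qed
    have Bsub: "B (Rem l) (s l) \<subseteq> Y" for l using Rem_Y by (auto simp: B_def)
    have "bb I (B (Rem m) z) + g / 4 \<le> bb I Y"
    proof (rule growth[where L = "{..<m}" and s = s and c = w and b = b and H = "\<lambda>l. B (Rem l) (s l)"
          and ?R0.0 = R0 and Rm = Rm and \<tau> = \<tau>, OF I _ _ b _ _ Rm g _ _ _ _ _ _ Y(1) _ C1 C2 C3 C4])
      fix u :: "'a \<Rightarrow> real"
      have "card {l \<in> {..<m}. dI I (s l) u \<le> Rm} \<le> Suc 0"
      proof (rule card_le_Suc0_iff_eq[THEN iffD2])
        show "\<forall>i\<in>{l \<in> {..<m}. dI I (s l) u \<le> Rm}. \<forall>j\<in>{l \<in> {..<m}. dI I (s l) u \<le> Rm}. i = j"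
        proof (intro ballI, rule ccontr)
          fix i j assume ij: "i \<in> {l \<in> {..<m}. dI I (s l) u \<le> Rm}" "j \<in> {l \<in> {..<m}. dI I (s l) u \<le> Rm}" "i \<noteq> j"
          have "dI I (s j) (s i) \<le> 2 * Rm" "dI I (s i) (s j) \<le> 2 * Rm"
            using ij dI_triangle[of I "s j" "s i" u] dI_triangle[of I "s i" "s j" u] dI_commute[of I u] by auto
          then show False using sep[of i j] sep[of j i] ij by (cases "i < j") auto
        qed
      qed simp
      then have "real (card {l \<in> {..<m}. dI I (s l) u \<le> Rm}) / real (card {..<m}) \<le> 1 / real m"
        by (intro frac_le) (use m in auto)
      then show "real (card {l \<in> {..<m}. dI I (s l) u \<le> Rm}) / real (card {..<m})
          < exp (- (g\<^sup>2 / del) / ((1 - del) * Rm)\<^sup>2)" using m by linarith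
    next
      fix l y i assume l: "l \<in> {..<m}" "y \<in> B (Rem l) (s l)" "i \<in> I"
      then have "\<bar>y i - w i\<bar> \<le> b" "\<bar>s l i - w i\<bar> \<le> b" using box[of y i] box[of "s l" i] Bsub[of l] sY[of l] by auto
      then show "\<bar>y i - s l i\<bar> \<le> 2 * b" by linarith
    next
      fix l assume l: "l \<in> {..<m}"
      then have zl: "z \<in> Rem l" using zm Rem_anti[of l m] by auto
      have "bb I (B (Rem m) z) \<le> bb I (B (Rem l) z)"
      proof (rule bb_mono)
        show "finite (B (Rem l) z)" using fRem by (simp add: B_def)
        show "B (Rem m) z \<subseteq> B (Rem l) z" using Rem_anti[of l m] l by (auto simp: B_def)
        show "B (Rem m) z \<noteq> {}" using zm C3 by (auto simp: B_def)
      qed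
      also have "\<dots> \<le> bb I (B (Rem l) (s l))"
        unfolding s_def using l by (intro \<sigma>(2)[OF fRem ne zl]) auto
      finally show "bb I (B (Rem m) z) \<le> bb I (B (Rem l) (s l))" .
    next
      fix l assume l: "l \<in> {..<m}"
      show "B (Rem l) (s l) \<noteq> {}" using s_in[of l] l C3 by (auto simp: B_def)
    qed (use m sY box R0 fRem Bsub in \<open>auto simp: B_def\<close>)
    also have "B (Rem m) z = {y\<in>Y. (\<forall>s\<in>S. 2 * Rm < dI I y s) \<and> dI I y z \<le> \<tau>}"
      unfolding B_def eqZ[symmetric] by auto
    finally show "bb I {y\<in>Y. (\<forall>s\<in>S. 2 * Rm < dI I y s) \<and> dI I y z \<le> \<tau>} + g / 4 \<le> bb I Y" .
  qed
qed

definition prb :: "'i set \<Rightarrow> (('i \<Rightarrow> real) \<Rightarrow> bool) \<Rightarrow> real" where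
  "prb I P = real (card {\<epsilon>\<in>cube I. P \<epsilon>}) / 2 ^ card I"

text \<open>\<open>U\<close> is a maximal family of values of \<open>X\<close> whose balls of
  doubled radius have probability at least \<open>e0\<close> and whose distances exceed
  \<open>4 * Rm\<close>. The doubled balls are disjoint, which bounds their number. A heavy ball
  contains a value of \<open>X\<close>, and that value is within \<open>4 * Rm\<close> of the
  family; the radius in the conclusion is Rm + Rm + 4 Rm.\<close>

lemma heavy_balls:
  fixes X :: "('i \<Rightarrow> real) \<Rightarrow> ('i \<Rightarrow> real)"
  assumes I: "finite I" and e0: "0 < e0" and Rm: "0 < Rm"
  obtains U where "finite U" "real (card U) \<le> 1 / e0"
    "\<And>u x. e0 \<le> prb I (\<lambda>\<epsilon>. dI I (X \<epsilon>) u \<le> Rm) \<Longrightarrow> dI I x u \<le> Rm \<Longrightarrow> \<exists>u'\<in>U. dI I x u' \<le> 6 * Rm"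
proof -
  define Hv where "Hv = {u \<in> X ` cube I. e0 \<le> prb I (\<lambda>\<epsilon>. dI I (X \<epsilon>) u \<le> 2 * Rm)}"
  have fHv: "finite Hv" using I by (simp add: Hv_def)
  define sepd where "sepd U \<longleftrightarrow> U \<subseteq> Hv \<and> (\<forall>u\<in>U. \<forall>v\<in>U. u \<noteq> v \<longrightarrow> 4 * Rm < dI I u v)" for U
  have fsep: "finite {U. sepd U}" by (rule finite_subset[of _ "Pow Hv"]) (auto simp: sepd_def fHv)
  have "sepd {}" by (simp add: sepd_def)
  then have "finite (card ` {U. sepd U})" "card ` {U. sepd U} \<noteq> {}" using fsep by auto
  then have "Max (card ` {U. sepd U}) \<in> card ` {U. sepd U}" by (rule Max_in)
  then obtain U where U: "sepd U" "card U = Max (card ` {U. sepd U})" by auto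
  have Umax: "card V \<le> card U" if "sepd V" for V
    unfolding U(2) using that fsep by (intro Max_ge) auto
  have fU: "finite U" using U fHv finite_subset by (auto simp: sepd_def)
  show ?thesis
  proof (rule that[of U])
    show "finite U" by fact
    have "e0 * real (card U) \<le> (\<Sum>u\<in>U. prb I (\<lambda>\<epsilon>. dI I (X \<epsilon>) u \<le> 2 * Rm))"
      using U sum_mono[of U "\<lambda>_. e0" "\<lambda>u. prb I (\<lambda>\<epsilon>. dI I (X \<epsilon>) u \<le> 2 * Rm)"]
      by (auto simp: sepd_def Hv_def mult.commute)
    also have "\<dots> = real (card (\<Union>u\<in>U. {\<epsilon>\<in>cube I. dI I (X \<epsilon>) u \<le> 2 * Rm})) / 2 ^ card I"
    proof (subst card_UN_disjoint)
      show "\<forall>i\<in>U. \<forall>j\<in>U. i \<noteq> j \<longrightarrow> {\<epsilon> \<in> cube I. dI I (X \<epsilon>) i \<le> 2 * Rm} \<inter> {\<epsilon> \<in> cube I. dI I (X \<epsilon>) j \<le> 2 * Rm} = {}"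
      proof (intro ballI impI, rule ccontr)
        fix i j assume ij: "i \<in> U" "j \<in> U" "i \<noteq> j"
          "{\<epsilon> \<in> cube I. dI I (X \<epsilon>) i \<le> 2 * Rm} \<inter> {\<epsilon> \<in> cube I. dI I (X \<epsilon>) j \<le> 2 * Rm} \<noteq> {}"
        then obtain \<epsilon> where "dI I (X \<epsilon>) i \<le> 2 * Rm" "dI I (X \<epsilon>) j \<le> 2 * Rm" by blast
        then have "dI I i j \<le> 4 * Rm" using dI_triangle[of I i j "X \<epsilon>"] dI_commute[of I i "X \<epsilon>"] by linarith
        then show False using U ij by (force simp: sepd_def)
      qed
    qed (use fU I in \<open>auto simp: prb_def sum_divide_distrib\<close>)
    also have "\<dots> \<le> real (card (cube I)) / 2 ^ card I"
      using I by (intro divide_right_mono of_nat_mono card_mono) auto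
    also have "\<dots> = 1" using card_cube[OF I] by simp
    finally show "real (card U) \<le> 1 / e0" using e0 by (simp add: field_simps)
    fix u x assume heavy: "e0 \<le> prb I (\<lambda>\<epsilon>. dI I (X \<epsilon>) u \<le> Rm)" and x: "dI I x u \<le> Rm"
    have "{\<epsilon>\<in>cube I. dI I (X \<epsilon>) u \<le> Rm} \<noteq> {}"
    proof
      assume "{\<epsilon>\<in>cube I. dI I (X \<epsilon>) u \<le> Rm} = {}"
      then have "prb I (\<lambda>\<epsilon>. dI I (X \<epsilon>) u \<le> Rm) = 0" by (simp only: prb_def card.empty)
      then show False using heavy e0 by simp
    qed
    then obtain \<epsilon>0 where e: "\<epsilon>0 \<in> cube I" "dI I (X \<epsilon>0) u \<le> Rm" by blast
    define z where "z = X \<epsilon>0"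
    have "prb I (\<lambda>\<epsilon>. dI I (X \<epsilon>) u \<le> Rm) \<le> prb I (\<lambda>\<epsilon>. dI I (X \<epsilon>) z \<le> 2 * Rm)"
      unfolding prb_def
    proof (intro divide_right_mono of_nat_mono card_mono)
      show "{\<epsilon> \<in> cube I. dI I (X \<epsilon>) u \<le> Rm} \<subseteq> {\<epsilon> \<in> cube I. dI I (X \<epsilon>) z \<le> 2 * Rm}"
      proof clarsimp
        fix \<epsilon> assume "dI I (X \<epsilon>) u \<le> Rm"
        then show "dI I (X \<epsilon>) z \<le> 2 * Rm"
          using dI_triangle[of I "X \<epsilon>" z u] dI_commute[of I u z] e by (simp add: z_def)
      qed
    qed (use I in auto)
    then have zH: "z \<in> Hv" using heavy e by (simp add: Hv_def z_def)
    have "\<exists>u'\<in>U. dI I z u' \<le> 4 * Rm"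
    proof (rule ccontr)
      assume "\<not> (\<exists>u'\<in>U. dI I z u' \<le> 4 * Rm)"
      then have far: "\<forall>u'\<in>U. 4 * Rm < dI I z u'" by auto
      have "z \<notin> U" using far Rm by force
      have "sepd (insert z U)" using U zH far by (auto simp: sepd_def dI_commute[of I _ z])
      from Umax[OF this] show False using \<open>z \<notin> U\<close> fU by simp
    qed
    then obtain u' where u': "u' \<in> U" "dI I z u' \<le> 4 * Rm" by blast
    have "dI I x u' \<le> 6 * Rm"
      using dI_triangle[of I x u' u] dI_triangle[of I u u' z] dI_commute[of I u z] x e u' by (simp add: z_def)
    then show "\<exists>u'\<in>U. dI I x u' \<le> 6 * Rm" using u' by blast
  qed
qed

text \<open>Vectors whose excess lies near a heavy ball, for the law of the excess of the current
  maximiser, are removed repeatedly. A ball that is heavy at one stage has probability 0 at all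
  later ones, so no ball has mass above \<open>2 * e0\<close> in the mixture of about
  \<open>1 / e0\<close> stages. If the parts \<open>a\<close> had expected supremum above
  \<open>bb I E - g / 8\<close> at every stage, \<open>excess_gain\<close> and
  \<open>EE_max_chop\<close> would give \<open>bb I E + g / 8 \<le> bb I E\<close>.\<close>

lemma excess_partition:
  fixes a x :: "('i \<Rightarrow> real) \<Rightarrow> 'i \<Rightarrow> real"
  assumes I: "finite I" and E: "finite E" "E \<noteq> {}" and b: "0 < b"
    and chop: "\<And>y z i. y \<in> E \<Longrightarrow> z \<in> E \<Longrightarrow> i \<in> I \<Longrightarrow> \<bar>a y i - a z i\<bar> + \<bar>x y i - x z i\<bar> \<le> \<bar>y i - z i\<bar>"
    and box: "\<And>y i. y \<in> E \<Longrightarrow> i \<in> I \<Longrightarrow> \<bar>x y i - c i\<bar> \<le> b"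
    and R0: "\<And>y. y \<in> E \<Longrightarrow> dI I (x y) c \<le> R0" and Rm: "0 < Rm" "Rm \<le> R0" and g: "0 < g"
    and e0: "0 < e0" "2 * e0 < exp (- (g\<^sup>2 / del) / ((1 - del) * Rm)\<^sup>2)"
    and a: "\<And>y. y \<in> E \<Longrightarrow> dI I (a y) s \<le> \<sigma>" "\<And>y i. y \<in> E \<Longrightarrow> i \<in> I \<Longrightarrow> s1 * \<bar>a y i - s i\<bar> \<le> 1"
    and s1: "0 < s1"
    and C1: "64 * b * g \<le> ((1 - del) * Rm)\<^sup>2" and C4: "64 * R0 \<le> g"
    and C5: "2 ^ 32 * g \<le> s1 * ((1 - del) * Rm)\<^sup>2" and C6: "96 * s1 * \<sigma>\<^sup>2 \<le> g"
  obtains U where "finite U" "real (card U) \<le> (1 / e0 + 1) * (1 / e0)"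
    "{y\<in>E. \<forall>u\<in>U. 6 * Rm < dI I (x y) u} \<noteq> {} \<Longrightarrow>
      EE I (\<lambda>\<epsilon>. MAX y\<in>{y\<in>E. \<forall>u\<in>U. 6 * Rm < dI I (x y) u}. lf I (a y) \<epsilon>) \<le> bb I E - g / 8"
proof -
  have "\<exists>y\<in>A. (MAX y\<in>A. lf I (a y) \<epsilon>) = lf I (a y) \<epsilon>" if "finite A" "A \<noteq> {}" for A \<epsilon>
    using Max_ex[OF that] .
  then obtain sel where sel: "\<And>A \<epsilon>. finite A \<Longrightarrow> A \<noteq> {} \<Longrightarrow> sel A \<epsilon> \<in> A"
    "\<And>A \<epsilon>. finite A \<Longrightarrow> A \<noteq> {} \<Longrightarrow> (MAX y\<in>A. lf I (a y) \<epsilon>) = lf I (a (sel A \<epsilon>)) \<epsilon>"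
    by metis
  have "\<exists>U. finite U \<and> real (card U) \<le> 1 / e0 \<and> (\<forall>u z. e0 \<le> prb I (\<lambda>\<epsilon>. dI I (x (sel A \<epsilon>)) u \<le> Rm)
      \<longrightarrow> dI I z u \<le> Rm \<longrightarrow> (\<exists>u'\<in>U. dI I z u' \<le> 6 * Rm))" for A
    using heavy_balls[OF I e0(1) Rm(1), of "\<lambda>\<epsilon>. x (sel A \<epsilon>)"] by metis
  then obtain UU where UU: "\<And>A. finite (UU A)" "\<And>A. real (card (UU A)) \<le> 1 / e0"
    "\<And>A u z. e0 \<le> prb I (\<lambda>\<epsilon>. dI I (x (sel A \<epsilon>)) u \<le> Rm) \<Longrightarrow> dI I z u \<le> Rm \<Longrightarrow> \<exists>u'\<in>UU A. dI I z u' \<le> 6 * Rm"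
    by metis
  define st where "st A = {y\<in>A. \<forall>u\<in>UU A. 6 * Rm < dI I (x y) u}" for A
  define Rem where "Rem k = (st ^^ k) E" for k
  have Rem_Suc: "Rem (Suc k) = st (Rem k)" for k by (simp add: Rem_def)
  have Rem_0: "Rem 0 = E" by (simp add: Rem_def)
  have Rem_anti: "Rem j \<subseteq> Rem i" if "i \<le> j" for i j
    using that by (induction j rule: dec_induct) (auto simp: Rem_Suc st_def)
  have Rem_E: "Rem k \<subseteq> E" for k using Rem_anti[of 0 k] by (simp add: Rem_0)
  have fRem: "finite (Rem k)" for k using Rem_E E finite_subset by blast
  have mem: "y \<in> Rem k \<longleftrightarrow> y \<in> E \<and> (\<forall>j<k. \<forall>u\<in>UU (Rem j). 6 * Rm < dI I (x y) u)" for y k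
  proof (induction k)
    case 0
    then show ?case by (simp add: Rem_0)
  next
    case (Suc k)
    have "y \<in> Rem (Suc k) \<longleftrightarrow> y \<in> Rem k \<and> (\<forall>u\<in>UU (Rem k). 6 * Rm < dI I (x y) u)"
      by (simp add: Rem_Suc st_def)
    then show ?case using Suc by (auto simp: less_Suc_eq)
  qed
  have eq: "Rem k = {y\<in>E. \<forall>u\<in>(\<Union>j<k. UU (Rem j)). 6 * Rm < dI I (x y) u}" for k
    by (rule set_eqI) (simp only: mem, blast)
  \<comment> \<open>Rounded up so that 1 / N \<le> \<open>e0\<close>: in the mixture the one heavy
    stage contributes at most 1 / N and the others at most \<open>e0\<close> together.\<close>
  define N where "N = nat \<lceil>1 / e0\<rceil>"
  have N: "1 / e0 \<le> real N" "real N \<le> 1 / e0 + 1" "0 < N"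
    using e0 by (simp_all add: N_def)
  define v where "v = bb I E - g / 8"
  have "\<exists>t<N. Rem t = {} \<or> EE I (\<lambda>\<epsilon>. MAX y\<in>Rem t. lf I (a y) \<epsilon>) \<le> v"
  proof (rule ccontr)
    assume "\<not> (\<exists>t<N. Rem t = {} \<or> EE I (\<lambda>\<epsilon>. MAX y\<in>Rem t. lf I (a y) \<epsilon>) \<le> v)"
    then have ne: "Rem t \<noteq> {}" and vt: "v \<le> EE I (\<lambda>\<epsilon>. MAX y\<in>Rem t. lf I (a y) \<epsilon>)" if "t < N" for t
      using that by (auto simp: not_le intro: less_imp_le)
    define P where "P t u = prb I (\<lambda>\<epsilon>. dI I (x (sel (Rem t) \<epsilon>)) u \<le> Rm)" for t u
    have once: "P j u = 0" if "i < j" "j < N" "e0 \<le> P i u" for i j u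
    proof -
      have "\<not> dI I (x (sel (Rem j) \<epsilon>)) u \<le> Rm" for \<epsilon>
      proof
        assume "dI I (x (sel (Rem j) \<epsilon>)) u \<le> Rm"
        then have "\<exists>u'\<in>UU (Rem i). dI I (x (sel (Rem j) \<epsilon>)) u' \<le> 6 * Rm"
          using UU(3) that(3) unfolding P_def by blast
        moreover have "sel (Rem j) \<epsilon> \<in> Rem (Suc i)"
          using sel(1)[OF fRem ne[OF that(2)]] Rem_anti[of "Suc i" j] that by auto
        ultimately show False by (fastforce simp: Rem_Suc st_def)
      qed
      then show ?thesis by (simp add: P_def prb_def)
    qed
    have P1: "P t u \<le> 1" for t u
    proof -
      have "real (card {\<epsilon>\<in>cube I. dI I (x (sel (Rem t) \<epsilon>)) u \<le> Rm}) \<le> real (card (cube I))"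
        using I by (intro of_nat_mono card_mono) auto
      then show ?thesis using card_cube[OF I] by (simp add: P_def prb_def)
    qed
    have sumP: "(\<Sum>t<N. P t u) \<le> real N * e0 + 1" for u
    proof (cases "\<exists>t<N. e0 \<le> P t u")
      case False
      then have "(\<Sum>t<N. P t u) \<le> (\<Sum>t<N. e0)" by (intro sum_mono) (auto simp: not_le)
      then show ?thesis by simp
    next
      case True
      then obtain t where t: "t < N" "e0 \<le> P t u" by blast
      have small: "P j u \<le> e0" if "j < N" "j \<noteq> t" for j
        using once[of t j u] once[of j t u] that t e0 by (cases "j < t") force+
      have "(\<Sum>t<N. P t u) = P t u + (\<Sum>j\<in>{..<N} - {t}. P j u)" using t by (simp add: sum.remove)
      also have "\<dots> \<le> 1 + (\<Sum>j\<in>{..<N} - {t}. e0)" using small P1 by (intro add_mono sum_mono) auto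
      also have "\<dots> \<le> 1 + (\<Sum>j<N. e0)" using e0 by (intro add_left_mono sum_mono2) auto
      finally show ?thesis by simp
    qed
    have "v + g / 4 \<le> EE I (\<lambda>\<epsilon>. EE I (\<lambda>\<delta>. MAX y\<in>E. 0 + lf I (a y) \<epsilon> + lf I (x y) \<delta>))"
    proof (rule excess_gain[where Tm = "{..<N}" and sel = "\<lambda>t. sel (Rem t)" and A = Rem and c = c
          and b = b and ?R0.0 = R0 and Rm = Rm and s = s and \<sigma> = \<sigma> and ?s1.0 = s1,
          OF I E(1) _ _ b _ _ _ Rm g _ _ _ _ _ _ _ s1 C1 C4 C5 C6])
      fix u :: "'i \<Rightarrow> real"
      have "(\<Sum>w\<in>{w \<in> {..<N} \<times> cube I. dI I (x (sel (Rem (fst w)) (snd w))) u \<le> Rm}. 1 / (real (card {..<N}) * 2 ^ card I))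
        = (\<Sum>w\<in>{..<N} \<times> cube I. if dI I (x (sel (Rem (fst w)) (snd w))) u \<le> Rm then 1 / (real N * 2 ^ card I) else 0)"
        unfolding card_lessThan using I by (subst sum.inter_filter) auto
      also have "\<dots> = (\<Sum>t<N. \<Sum>\<epsilon>\<in>cube I. if dI I (x (sel (Rem t) \<epsilon>)) u \<le> Rm then 1 / (real N * 2 ^ card I) else 0)"
        by (subst sum.cartesian_product) (simp add: case_prod_unfold)
      also have "\<dots> = (\<Sum>t<N. P t u / real N)"
        using I by (intro sum.cong refl) (subst sum.inter_filter[symmetric], auto simp: P_def prb_def)
      also have "\<dots> \<le> (real N * e0 + 1) / real N"
        unfolding sum_divide_distrib[symmetric] using sumP by (intro divide_right_mono) auto
      also have "\<dots> \<le> 2 * e0" using N e0 by (simp add: field_simps)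
      finally show "(\<Sum>w\<in>{w \<in> {..<N} \<times> cube I. dI I (x (sel (Rem (fst w)) (snd w))) u \<le> Rm}. 1 / (real (card {..<N}) * 2 ^ card I))
          < exp (- (g\<^sup>2 / del) / ((1 - del) * Rm)\<^sup>2)" using e0 by linarith
    next
      fix t :: nat and \<epsilon> :: "'i \<Rightarrow> real" assume t: "t \<in> {..<N}"
      show "sel (Rem t) \<epsilon> \<in> E" using sel(1)[OF fRem ne] t Rem_E by blast
      show "lf I (a (sel (Rem t) \<epsilon>)) \<epsilon> = (MAX y\<in>Rem t. lf I (a y) \<epsilon>)" using sel(2)[OF fRem ne] t by simp
    qed (use N Rem_E ne vt a box R0 in auto)
    \<comment> \<open>The independent signs of clipped part and excess are merged back into one
      family of signs.\<close>
    also have "\<dots> \<le> EE I (\<lambda>\<epsilon>. MAX y\<in>E. 0 + lf I y \<epsilon>)"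
      using chop by (intro EE_max_chop[OF I E]) auto
    finally show False using g by (simp add: v_def)
  qed
  then obtain t where t: "t < N" "Rem t = {} \<or> EE I (\<lambda>\<epsilon>. MAX y\<in>Rem t. lf I (a y) \<epsilon>) \<le> v" by blast
  show ?thesis
  proof (rule that[of "\<Union>j<t. UU (Rem j)"])
    show "finite (\<Union>j<t. UU (Rem j))" using UU(1) by blast
    have "real (card (\<Union>j<t. UU (Rem j))) \<le> real (\<Sum>j<t. card (UU (Rem j)))"
      by (intro of_nat_mono card_UN_le) simp
    also have "\<dots> \<le> (\<Sum>j<t. 1 / e0)" unfolding of_nat_sum by (rule sum_mono) (rule UU(2))
    also have "\<dots> = real t * (1 / e0)" by simp
    also have "\<dots> \<le> (1 / e0 + 1) * (1 / e0)" using t N e0 by (intro mult_right_mono) auto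
    finally show "real (card (\<Union>j<t. UU (Rem j))) \<le> (1 / e0 + 1) * (1 / e0)" .
    show "EE I (\<lambda>\<epsilon>. MAX y\<in>{y\<in>E. \<forall>u\<in>(\<Union>j<t. UU (Rem j)). 6 * Rm < dI I (x y) u}. lf I (a y) \<epsilon>) \<le> bb I E - g / 8"
      if "{y\<in>E. \<forall>u\<in>(\<Union>j<t. UU (Rem j)). 6 * Rm < dI I (x y) u} \<noteq> {}"
      using t(2) that unfolding eq[symmetric] v_def by blast
  qed
qed

section \<open>Clipping\<close>

definition clip :: "real \<Rightarrow> real \<Rightarrow> real \<Rightarrow> real" where
  "clip w b x = max (w - b) (min (w + b) x)"

definition clipv :: "('i \<Rightarrow> real) \<Rightarrow> real \<Rightarrow> ('i \<Rightarrow> real) \<Rightarrow> 'i \<Rightarrow> real" where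
  "clipv w b y = (\<lambda>i. clip (w i) b (y i))"

text \<open>Equivalently, both \<open>f\<close> and the residual x - f x are nondecreasing, so the
  absolute increments of the two add up to that of x. This is the hypothesis of
  \<open>EE_max_chop\<close>, and unlike the form of a single clipping it survives composition;
  three clippings will be composed.\<close>

definition slope01 :: "(real \<Rightarrow> real) \<Rightarrow> bool" where
  "slope01 f \<longleftrightarrow> (\<forall>x y. x \<le> y \<longrightarrow> 0 \<le> f y - f x \<and> f y - f x \<le> y - x)"

lemma slope01_clip: "slope01 (clip w b)"
  by (auto simp: slope01_def clip_def max_def min_def)

lemma slope01_comp: "slope01 f \<Longrightarrow> slope01 g \<Longrightarrow> slope01 (\<lambda>x. f (g x))"
  unfolding slope01_def by (smt (verit))

lemma slope01_chop: "slope01 f \<Longrightarrow> \<bar>f x - f y\<bar> + \<bar>(x - f x) - (y - f y)\<bar> \<le> \<bar>x - y\<bar>"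
  unfolding slope01_def by (smt (verit))

lemma slope01_contr: "slope01 f \<Longrightarrow> \<bar>f x - f y\<bar> \<le> \<bar>x - y\<bar>"
  using slope01_chop[of f x y] by linarith

lemma clip_near: "0 \<le> b \<Longrightarrow> \<bar>clip w b x - w\<bar> \<le> b"
  by (auto simp: clip_def)

lemma clip_closer: "0 \<le> b \<Longrightarrow> \<bar>clip w b x - w\<bar> \<le> \<bar>x - w\<bar>"
  by (auto simp: clip_def)

text \<open>The residual vanishes unless x is farther than \<open>b\<close> from \<open>w\<close>,
  and then a factor \<bar>x - w\<bar> / b is at least 1. In this way an l2-bound becomes an l1-bound
  for what is cut off.\<close>

lemma clip_residual:
  assumes "0 < b"
  shows "\<bar>x - clip w b x\<bar> \<le> (x - w)\<^sup>2 / b"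
proof -
  have "\<bar>x - clip w b x\<bar> * b \<le> \<bar>x - w\<bar> * \<bar>x - w\<bar>"
  proof (cases "\<bar>x - w\<bar> \<le> b")
    case True
    then have "x - clip w b x = 0" by (auto simp: clip_def)
    then show ?thesis by simp
  next
    case False
    then show ?thesis using assms by (intro mult_mono) (auto simp: clip_def)
  qed
  then show ?thesis using assms by (simp add: pos_le_divide_eq power2_eq_square)
qed

lemma dI_mono:
  assumes "\<And>i. i \<in> I \<Longrightarrow> \<bar>x i - y i\<bar> \<le> \<bar>x' i - y' i\<bar>"
  shows "dI I x y \<le> dI I x' y'"
  unfolding dI_def L2_set_def using assms by (intro real_sqrt_le_mono sum_mono) (simp add: abs_le_square_iff)

lemma clipv_dI: "0 \<le> b \<Longrightarrow> dI I (clipv w b y) w \<le> dI I y w"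
  by (rule dI_mono) (simp add: clipv_def clip_closer)

lemma clipv_L1:
  assumes "0 < b" "dI I y w \<le> R"
  shows "(\<Sum>i\<in>I. \<bar>y i - clipv w b y i\<bar>) \<le> R\<^sup>2 / b"
proof -
  have "(\<Sum>i\<in>I. \<bar>y i - clipv w b y i\<bar>) \<le> (\<Sum>i\<in>I. (y i - w i)\<^sup>2 / b)"
    unfolding clipv_def using assms by (intro sum_mono clip_residual)
  also have "\<dots> = (dI I y w)\<^sup>2 / b" by (simp add: dI_sq nsq_def sum_divide_distrib)
  also have "\<dots> \<le> R\<^sup>2 / b" using assms by (intro divide_right_mono power_mono) auto
  finally show ?thesis .
qed

lemma bb_nonneg:
  assumes "finite I" "finite Y" "Y \<noteq> {}"
  shows "0 \<le> bb I Y"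
proof -
  obtain y where y: "y \<in> Y" using assms by blast
  have "0 = EE I (lf I y)" using assms by simp
  also have "\<dots> \<le> bb I Y" by (rule EE_mono) (rule Max_ge_at[OF assms(2) y])
  finally show ?thesis .
qed

lemma bb_image_le:
  assumes "finite I" "finite Y" "Y \<noteq> {}" "\<And>y z i. y \<in> Y \<Longrightarrow> z \<in> Y \<Longrightarrow> i \<in> I \<Longrightarrow> \<bar>f y i - f z i\<bar> \<le> \<bar>y i - z i\<bar>"
  shows "bb I (f ` Y) \<le> bb I Y"
  using EE_max_contraction[OF assms(1-3), of f "\<lambda>y. y"] assms(4) by (simp add: image_image)

lemma lf_le_L1: "\<epsilon> \<in> cube I \<Longrightarrow> lf I v \<epsilon> \<le> (\<Sum>i\<in>I. \<bar>v i\<bar>)"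
  unfolding lf_def by (intro sum_mono) (auto dest!: cube_coord)

section \<open>Restriction to the sets of a class, and its cost\<close>

definition res :: "'i set \<Rightarrow> ('i \<Rightarrow> real) \<Rightarrow> 'i \<Rightarrow> real" where
  "res C v = (\<lambda>i. if i \<in> C then v i else 0)"

lemma nsq_res: "nsq I (res C v) \<le> nsq I v"
  unfolding nsq_def res_def by (intro sum_mono) auto

text \<open>\<open>V\<close> is the cost of the class for one vector. Together with finiteness it is
  all that the decomposition knows about the class.\<close>

locale vc_bound =
  fixes I :: "'i set" and CC :: "'i set set" and V :: real
  assumes I: "finite I" and CC: "finite CC" "CC \<noteq> {}" and V: "0 \<le> V"
    and VC: "\<And>v. EE I (\<lambda>\<epsilon>. MAX C\<in>CC. lf I (res C v) \<epsilon>) \<le> V * sqrt (nsq I v)"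
begin

text \<open>The centre \<open>w\<close> is carried along because, in contrast to \<open>bb\<close>,
  the value changes under translation: the set \<open>C\<close> may depend on the signs.\<close>

definition G :: "('i \<Rightarrow> real) set \<Rightarrow> ('i \<Rightarrow> real) \<Rightarrow> real" where
  "G Y w = EE I (\<lambda>\<epsilon>. MAX p\<in>Y \<times> CC. lf I (res (snd p) (\<lambda>i. fst p i - w i)) \<epsilon>)"

lemma G_trivial:
  assumes Y: "finite Y" "Y \<noteq> {}" and b: "\<And>y i. y \<in> Y \<Longrightarrow> i \<in> I \<Longrightarrow> \<bar>y i - w i\<bar> \<le> b"
  shows "G Y w \<le> real (card I) * b"
proof -
  have fin: "finite (Y \<times> CC)" "Y \<times> CC \<noteq> {}" using Y CC by auto
  have "G Y w \<le> EE I (\<lambda>_. real (card I) * b)"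
    unfolding G_def
  proof (intro EE_mono Max_le_all[OF fin])
    fix \<epsilon> :: "'i \<Rightarrow> real" and p assume e: "\<epsilon> \<in> cube I" and p: "p \<in> Y \<times> CC"
    have "lf I (res (snd p) (\<lambda>i. fst p i - w i)) \<epsilon> \<le> (\<Sum>i\<in>I. \<bar>res (snd p) (\<lambda>i. fst p i - w i) i\<bar>)"
      by (rule lf_le_L1[OF e])
    also have "\<dots> \<le> (\<Sum>i\<in>I. b)"
      using p b by (intro sum_mono) (fastforce simp: res_def intro: order_trans[OF abs_ge_zero])
    finally show "lf I (res (snd p) (\<lambda>i. fst p i - w i)) \<epsilon> \<le> real (card I) * b" by simp
  qed
  then show ?thesis using I by simp
qed

text \<open>A vector is written as (y - \<Theta> y) + (\<Theta> y - c) + (c - w). The first term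
  costs its l1-norm and the last one the class bound \<open>V * L\<close>. The suprema of the pieces
  have deviations of l2-scale \<open>L\<close> by \<open>EE_exp_max_upper\<close>, so a maximum over
  \<open>exp N\<close> pieces adds only \<open>N / s + 4 * s * L\<^sup>2\<close>.\<close>

lemma comb:
  fixes P :: "'k \<Rightarrow> ('i \<Rightarrow> real) set"
  assumes Y: "finite Y" "Y \<noteq> {}" and K: "finite K"
    and cover: "\<And>y. y \<in> Y \<Longrightarrow> \<exists>k\<in>K. y \<in> P k" and sub: "\<And>k. k \<in> K \<Longrightarrow> P k \<subseteq> Y"
    and X: "\<And>k. k \<in> K \<Longrightarrow> P k \<noteq> {} \<Longrightarrow> G (\<Theta> k ` P k) (c k) \<le> X"
    and L: "\<And>k y. k \<in> K \<Longrightarrow> y \<in> P k \<Longrightarrow> dI I (\<Theta> k y) (c k) \<le> L"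
      "\<And>k. k \<in> K \<Longrightarrow> P k \<noteq> {} \<Longrightarrow> dI I (c k) w \<le> L"
    and L1: "\<And>k y. k \<in> K \<Longrightarrow> y \<in> P k \<Longrightarrow> (\<Sum>i\<in>I. \<bar>y i - \<Theta> k y i\<bar>) \<le> \<Lambda>"
    and s: "0 < s" and N: "real (card K) \<le> exp N"
  shows "G Y w \<le> X + \<Lambda> + V * L + N / s + 4 * s * L\<^sup>2"
proof -
  define K' where "K' = {k\<in>K. P k \<noteq> {}}"
  have K': "finite K'" "K' \<noteq> {}" using K cover Y by (auto simp: K'_def)
  define A where "A k = ((\<Theta> k ` P k) \<times> CC) \<times> CC" for k
  have A: "finite (A k)" "A k \<noteq> {}" if k: "k \<in> K'" for k
  proof -
    have "finite (P k)" using k sub[of k] Y(1) finite_subset by (auto simp: K'_def)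
    then show "finite (A k)" "A k \<noteq> {}" using k CC by (auto simp: A_def K'_def)
  qed
  \<comment> \<open>The two summands may be restricted to different sets of the class. This only
    enlarges the supremum, and it separates the piece from the shift of its centre.\<close>
  define v where "v k q = (\<lambda>i. res (snd (fst q)) (\<lambda>i. fst (fst q) i - c k i) i + res (snd q) (\<lambda>i. c k i - w i) i)"
    for k and q :: "(('i \<Rightarrow> real) \<times> 'i set) \<times> 'i set"
  define Z where "Z k \<epsilon> = (MAX q\<in>A k. 0 + lf I (v k q) \<epsilon>)" for k \<epsilon>
  have pt: "(MAX p\<in>Y \<times> CC. lf I (res (snd p) (\<lambda>i. fst p i - w i)) \<epsilon>) \<le> (MAX k\<in>K'. Z k \<epsilon>) + \<Lambda>"
    if e: "\<epsilon> \<in> cube I" for \<epsilon>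
  proof (rule Max_le_all)
    show "finite (Y \<times> CC)" "Y \<times> CC \<noteq> {}" using Y CC by auto
    fix p assume "p \<in> Y \<times> CC"
    then obtain y C where p: "p = (y, C)" "y \<in> Y" "C \<in> CC" by auto
    obtain k where k: "k \<in> K" "y \<in> P k" using cover[OF p(2)] by blast
    then have kK: "k \<in> K'" by (auto simp: K'_def)
    have "res C (\<lambda>i. y i - w i) = (\<lambda>i. res C (\<lambda>i. y i - \<Theta> k y i) i + v k ((\<Theta> k y, C), C) i)"
      by (rule ext) (simp add: res_def v_def)
    then have "lf I (res C (\<lambda>i. y i - w i)) \<epsilon> = lf I (res C (\<lambda>i. y i - \<Theta> k y i)) \<epsilon> + lf I (v k ((\<Theta> k y, C), C)) \<epsilon>"
      by (simp only: lf_add)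
    moreover have "lf I (res C (\<lambda>i. y i - \<Theta> k y i)) \<epsilon> \<le> \<Lambda>"
    proof -
      have "lf I (res C (\<lambda>i. y i - \<Theta> k y i)) \<epsilon> \<le> (\<Sum>i\<in>I. \<bar>res C (\<lambda>i. y i - \<Theta> k y i) i\<bar>)"
        by (rule lf_le_L1[OF e])
      also have "\<dots> \<le> (\<Sum>i\<in>I. \<bar>y i - \<Theta> k y i\<bar>)" by (intro sum_mono) (simp add: res_def)
      finally show ?thesis using L1[OF k] by linarith
    qed
    moreover have "0 + lf I (v k ((\<Theta> k y, C), C)) \<epsilon> \<le> Z k \<epsilon>"
      unfolding Z_def using k p by (intro Max_ge_at[OF A(1)[OF kK]]) (auto simp: A_def)
    moreover have "Z k \<epsilon> \<le> (MAX k\<in>K'. Z k \<epsilon>)" by (rule Max_ge_at[OF K'(1) kK])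
    ultimately show "lf I (res (snd p) (\<lambda>i. fst p i - w i)) \<epsilon> \<le> (MAX k\<in>K'. Z k \<epsilon>) + \<Lambda>"
      by (simp add: p)
  qed
  have EZ: "EE I (Z k) \<le> X + V * L" if k: "k \<in> K'" for k
  proof -
    have kK: "k \<in> K" "P k \<noteq> {}" using k by (auto simp: K'_def)
    have fP: "finite (\<Theta> k ` P k)" using sub[OF kK(1)] Y finite_subset by blast
    have "Z k \<epsilon> \<le> (MAX p\<in>(\<Theta> k ` P k) \<times> CC. lf I (res (snd p) (\<lambda>i. fst p i - c k i)) \<epsilon>)
        + (MAX C\<in>CC. lf I (res C (\<lambda>i. c k i - w i)) \<epsilon>)" for \<epsilon>
      unfolding Z_def
    proof (rule Max_le_all[OF A[OF k]])
      fix q assume "q \<in> A k"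
      then have q: "fst q \<in> (\<Theta> k ` P k) \<times> CC" "snd q \<in> CC" by (auto simp: A_def)
      have f: "finite ((\<Theta> k ` P k) \<times> CC)" using fP CC by auto
      show "0 + lf I (v k q) \<epsilon> \<le> (MAX p\<in>(\<Theta> k ` P k) \<times> CC. lf I (res (snd p) (\<lambda>i. fst p i - c k i)) \<epsilon>)
        + (MAX C\<in>CC. lf I (res C (\<lambda>i. c k i - w i)) \<epsilon>)"
        unfolding v_def lf_add
        using Max_ge_at[OF f q(1), of "\<lambda>p. lf I (res (snd p) (\<lambda>i. fst p i - c k i)) \<epsilon>"]
          Max_ge_at[OF CC(1) q(2), of "\<lambda>C. lf I (res C (\<lambda>i. c k i - w i)) \<epsilon>"] by simp
    qed
    then have "EE I (Z k) \<le> G (\<Theta> k ` P k) (c k) + EE I (\<lambda>\<epsilon>. MAX C\<in>CC. lf I (res C (\<lambda>i. c k i - w i)) \<epsilon>)"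
      unfolding G_def EE_add[symmetric] by (intro EE_mono)
    also have "\<dots> \<le> X + V * sqrt (nsq I (\<lambda>i. c k i - w i))"
      by (intro add_mono X[OF kK] VC)
    also have "sqrt (nsq I (\<lambda>i. c k i - w i)) = dI I (c k) w" by (simp add: dI_def L2_set_def nsq_def)
    also have "V * dI I (c k) w \<le> V * L" using L(2)[OF kK] V by (rule mult_left_mono)
    finally show ?thesis by simp
  qed
  have nv: "nsq I (v k q) \<le> (2 * L)\<^sup>2" if k: "k \<in> K'" and q: "q \<in> A k" for k q
  proof -
    have kK: "k \<in> K" "P k \<noteq> {}" using k by (auto simp: K'_def)
    obtain y where y: "y \<in> P k" "fst (fst q) = \<Theta> k y" using q by (auto simp: A_def)
    have "sqrt (nsq I (v k q)) \<le> sqrt (nsq I (res (snd (fst q)) (\<lambda>i. fst (fst q) i - c k i)))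
        + sqrt (nsq I (res (snd q) (\<lambda>i. c k i - w i)))"
      using L2_set_triangle_ineq[of "res (snd (fst q)) (\<lambda>i. fst (fst q) i - c k i)" "res (snd q) (\<lambda>i. c k i - w i)" I]
      by (simp add: L2_set_def nsq_def v_def)
    also have "\<dots> \<le> sqrt (nsq I (\<lambda>i. fst (fst q) i - c k i)) + sqrt (nsq I (\<lambda>i. c k i - w i))"
      by (intro add_mono real_sqrt_le_mono nsq_res)
    also have "\<dots> = dI I (\<Theta> k y) (c k) + dI I (c k) w" by (simp add: y dI_def L2_set_def nsq_def)
    also have "\<dots> \<le> 2 * L" using L(1)[OF kK(1) y(1)] L(2)[OF kK] by simp
    finally have "(sqrt (nsq I (v k q)))\<^sup>2 \<le> (2 * L)\<^sup>2" by (intro power_mono) auto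
    then show ?thesis by simp
  qed
  have "s * EE I (\<lambda>\<epsilon>. 1 * (MAX k\<in>K'. Z k \<epsilon>)) \<le> ln (EE I (\<lambda>\<epsilon>. exp (s * (MAX k\<in>K'. Z k \<epsilon>)))) + EE I (\<lambda>\<epsilon>. 1 * ln 1)"
    by (rule gibbs_EE[OF I]) (use I s in auto)
  also have "ln (EE I (\<lambda>\<epsilon>. exp (s * (MAX k\<in>K'. Z k \<epsilon>)))) \<le> N + (s * (X + V * L) + s\<^sup>2 * (2 * L)\<^sup>2)"
  proof (rule ln_le_of_le_exp)
    show "0 < EE I (\<lambda>\<epsilon>. exp (s * (MAX k\<in>K'. Z k \<epsilon>)))" by (rule EE_pos[OF I]) simp
    have "EE I (\<lambda>\<epsilon>. exp (s * (MAX k\<in>K'. Z k \<epsilon>))) \<le> EE I (\<lambda>\<epsilon>. \<Sum>k\<in>K'. exp (s * Z k \<epsilon>))"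
    proof (rule EE_mono)
      fix \<epsilon> :: "'i \<Rightarrow> real"
      obtain k where k: "k \<in> K'" "(MAX k\<in>K'. Z k \<epsilon>) = Z k \<epsilon>" using Max_ex[OF K', of "\<lambda>k. Z k \<epsilon>"] by blast
      then show "exp (s * (MAX k\<in>K'. Z k \<epsilon>)) \<le> (\<Sum>k\<in>K'. exp (s * Z k \<epsilon>))"
        using K'(1) member_le_sum[of k K' "\<lambda>k. exp (s * Z k \<epsilon>)"] by simp
    qed
    also have "\<dots> = (\<Sum>k\<in>K'. EE I (\<lambda>\<epsilon>. exp (s * Z k \<epsilon>)))" by (rule EE_sum)
    also have "\<dots> \<le> (\<Sum>k\<in>K'. exp (s * (X + V * L) + s\<^sup>2 * (2 * L)\<^sup>2))"
    proof (rule sum_mono)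
      fix k assume k: "k \<in> K'"
      have "EE I (\<lambda>\<epsilon>. exp (s * Z k \<epsilon>)) \<le> exp (s * EE I (Z k) + s\<^sup>2 * (2 * L)\<^sup>2)"
        unfolding Z_def by (rule EE_exp_max_upper[OF I A[OF k] s nv[OF k]])
      also have "\<dots> \<le> exp (s * (X + V * L) + s\<^sup>2 * (2 * L)\<^sup>2)" using EZ[OF k] s by simp
      finally show "EE I (\<lambda>\<epsilon>. exp (s * Z k \<epsilon>)) \<le> exp (s * (X + V * L) + s\<^sup>2 * (2 * L)\<^sup>2)" .
    qed
    also have "\<dots> = real (card K') * exp (s * (X + V * L) + s\<^sup>2 * (2 * L)\<^sup>2)" by simp
    also have "real (card K') \<le> exp N"
      using N card_mono[OF K, of K'] by (simp add: K'_def)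
    finally show "EE I (\<lambda>\<epsilon>. exp (s * (MAX k\<in>K'. Z k \<epsilon>))) \<le> exp (N + (s * (X + V * L) + s\<^sup>2 * (2 * L)\<^sup>2))"
      by (simp add: exp_add)
  qed
  finally have "s * EE I (\<lambda>\<epsilon>. MAX k\<in>K'. Z k \<epsilon>) \<le> s * (X + V * L + N / s + 4 * s * L\<^sup>2)"
    using s I by (simp add: algebra_simps power2_eq_square)
  then have "EE I (\<lambda>\<epsilon>. MAX k\<in>K'. Z k \<epsilon>) \<le> X + V * L + N / s + 4 * s * L\<^sup>2"
    using s by (simp only: mult_le_cancel_left_pos)
  moreover have "G Y w \<le> EE I (\<lambda>\<epsilon>. MAX k\<in>K'. Z k \<epsilon>) + \<Lambda>"
  proof -
    have "G Y w \<le> EE I (\<lambda>\<epsilon>. (MAX k\<in>K'. Z k \<epsilon>) + \<Lambda>)" unfolding G_def using pt by (rule EE_mono)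
    then show ?thesis using I by (simp add: EE_add)
  qed
  ultimately show ?thesis by linarith
qed

end

section \<open>Decomposition of a set of vectors\<close>

text \<open>The radius is measured in units of the box: \<open>Q\<close> is their ratio, and \<open>Q\<^sup>2 b\<close> is the unit in which
  the gains and losses of a step are counted. The numerical constants are not optimized.\<close>

definition st :: "'i set \<Rightarrow> ('i \<Rightarrow> real) set \<Rightarrow> ('i \<Rightarrow> real) \<Rightarrow> real \<Rightarrow> real \<Rightarrow> bool" where
  "st I Y w b Q \<longleftrightarrow> finite Y \<and> Y \<noteq> {} \<and> (\<forall>y\<in>Y. \<forall>i\<in>I. \<bar>y i - w i\<bar> \<le> b) \<and> (\<forall>y\<in>Y. dI I y w \<le> Q * b)"

text \<open>The two constants are those of the residue in \<open>greedy_step\<close>: the radius is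
  its \<tau> and the gain its g / 4. The level \<phi> is a parameter of its own because the residue
  is compared with the set it was left over from.\<close>

definition sparse :: "'i set \<Rightarrow> ('i \<Rightarrow> real) set \<Rightarrow> real \<Rightarrow> real \<Rightarrow> real \<Rightarrow> bool" where
  "sparse I Z b Q \<phi> \<longleftrightarrow> (\<forall>z\<in>Z. bb I {y\<in>Z. dI I y z \<le> Q * b / 2 ^ 44} + Q\<^sup>2 * b / 2 ^ 85 \<le> \<phi>)"

lemma del_half: "1 / 2 \<le> (1 - del)\<^sup>2"
  by (simp add: power2_eq_square)

lemma ball_sq_half: "0 \<le> x \<Longrightarrow> x\<^sup>2 / 2 \<le> ((1 - del) * x)\<^sup>2"
  using mult_right_mono[OF del_half, of "x\<^sup>2"] by (simp add: power_mult_distrib)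

text \<open>The number of centres may be exponential in \<open>Q\<^sup>2\<close>: for vectors of
  length \<open>Q * b\<close>, a union over that many pieces costs just a multiple of the unit
  \<open>Q\<^sup>2 * b\<close>.\<close>

lemma greedy_step:
  assumes I: "finite I" and b: "0 < b" and Q: "2 ^ 117 \<le> Q" and Y: "st I Y w b Q"
  obtains S where "S \<subseteq> Y" "finite S" "real (card S) + 1 \<le> exp (2 * Q\<^sup>2)"
    "sparse I {y\<in>Y. \<forall>s\<in>S. Q * b / 2 ^ 34 < dI I y s} b Q (bb I Y)"
proof -
  define m where "m = nat \<lceil>exp (Q\<^sup>2)\<rceil>"
  have Q1: "1 \<le> Q" using Q by (rule order_trans[rotated]) simp
  have Qb: "0 < Q * b" using Q1 b by simp
  have m1: "exp (Q\<^sup>2) \<le> real m" "real m \<le> exp (Q\<^sup>2) + 1" by (simp_all add: m_def)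
  have m0: "0 < real m" using m1(1) exp_gt_zero[of "Q\<^sup>2"] by linarith
  \<comment> \<open>With these powers of 2, condition \<open>C2\<close> of
    \<open>greedy_cover\<close> holds with equality and \<open>?g / 4\<close> is the gain in
    \<open>sparse\<close>.\<close>
  let ?Rm = "Q * b / 2 ^ 35" and ?g = "Q\<^sup>2 * b / 2 ^ 83" and ?t = "Q * b / 2 ^ 44"
  have X: "Q\<^sup>2 * b\<^sup>2 / 2 ^ 71 \<le> ((1 - del) * ?Rm)\<^sup>2"
    using ball_sq_half[of ?Rm] Qb by (simp add: power_mult_distrib power_divide)
  have X0: "0 < Q\<^sup>2 * b\<^sup>2 / 2 ^ 71" using Q1 b by simp
  have gpos: "0 < ?g" using Q1 b by simp
  have ex: "1 / real m < exp (- (?g\<^sup>2 / del) / ((1 - del) * ?Rm)\<^sup>2)"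
  proof -
    have "?g\<^sup>2 / del = Q\<^sup>2 * (Q\<^sup>2 * b\<^sup>2 / 2 ^ 71) / 2 ^ 70"
      by (simp add: power2_eq_square)
    also have "\<dots> < Q\<^sup>2 * (Q\<^sup>2 * b\<^sup>2 / 2 ^ 71)"
    proof -
      have "0 < Q\<^sup>2 * (Q\<^sup>2 * b\<^sup>2 / 2 ^ 71)" using X0 Q1 by (intro mult_pos_pos) auto
      moreover have "A / 2 ^ 70 < A" if "0 < A" for A :: real using that by simp
      ultimately show ?thesis by blast
    qed
    also have "\<dots> \<le> Q\<^sup>2 * ((1 - del) * ?Rm)\<^sup>2" by (rule mult_left_mono[OF X]) simp
    finally have "(?g\<^sup>2 / del) / ((1 - del) * ?Rm)\<^sup>2 < Q\<^sup>2"
      using X X0 by (subst pos_divide_less_eq) (auto simp: mult.commute)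
    then have "exp (- Q\<^sup>2) < exp (- (?g\<^sup>2 / del) / ((1 - del) * ?Rm)\<^sup>2)" by simp
    moreover have "1 / real m \<le> exp (- Q\<^sup>2)"
      using m1(1) m0 by (simp add: exp_minus field_simps)
    ultimately show ?thesis by linarith
  qed
  have lin: "(1 - del) * ?Rm \<ge> ?Rm / 2" using Qb by (simp add: power2_eq_square)
  obtain S where S: "S \<subseteq> Y" "card S \<le> m"
    "\<And>z. z \<in> Y \<Longrightarrow> (\<And>s. s \<in> S \<Longrightarrow> 2 * ?Rm < dI I z s) \<Longrightarrow>
       bb I {y\<in>Y. (\<forall>s\<in>S. 2 * ?Rm < dI I y s) \<and> dI I y z \<le> ?t} + ?g / 4 \<le> bb I Y"
  proof (rule greedy_cover[where I = I and Y = Y and b = b and w = w and ?R0.0 = "Q * b" and Rm = ?Rm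
        and g = ?g and m = m and \<tau> = ?t])
    show "64 * b * ?g \<le> ((1 - del) * ?Rm)\<^sup>2"
      using X X0 by (simp add: power2_eq_square)
    show "32 * ?t\<^sup>2 \<le> b * ?g" using b by (simp add: power2_eq_square field_simps)
    show "?t \<le> (1 - del) * ?Rm" using lin Qb by simp
    show "64 * (Q * b) \<le> ?g"
      using mult_right_mono[of "2 ^ 117" Q "Q * b"] Q Qb by (simp add: power2_eq_square)
  qed (use I Y b Qb m0 ex gpos in \<open>auto simp: st_def\<close>)
  have fS: "finite S" using S(1) Y finite_subset by (auto simp: st_def)
  show ?thesis
  proof (rule that[OF S(1) fS])
    have "1 \<le> Q\<^sup>2" using Q1 by simp
    then have "2 \<le> exp (Q\<^sup>2)" using exp_ge_add_one_self[of "Q\<^sup>2"] by linarith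
    then have "exp (Q\<^sup>2) + 2 \<le> 2 * exp (Q\<^sup>2)" by simp
    also have "\<dots> \<le> exp (Q\<^sup>2) * exp (Q\<^sup>2)" using \<open>2 \<le> exp (Q\<^sup>2)\<close> by (intro mult_right_mono) auto
    also have "\<dots> = exp (2 * Q\<^sup>2)" by (simp add: exp_add[symmetric])
    finally show "real (card S) + 1 \<le> exp (2 * Q\<^sup>2)" using S(2) m1(2) by linarith
    have eq: "{y \<in> {y\<in>Y. \<forall>s\<in>S. Q * b / 2 ^ 34 < dI I y s}. dI I y z \<le> ?t}
        = {y\<in>Y. (\<forall>s\<in>S. 2 * ?Rm < dI I y s) \<and> dI I y z \<le> ?t}" for z
      by auto
    show "sparse I {y\<in>Y. \<forall>s\<in>S. Q * b / 2 ^ 34 < dI I y s} b Q (bb I Y)"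
      unfolding sparse_def eq using S(3) by fastforce
  qed
qed

lemma dI_split:
  assumes "\<And>i. i \<in> I \<Longrightarrow> y i - z i = (p i - p' i) + (q i - q' i)"
  shows "dI I y z \<le> dI I p p' + dI I q q'"
proof -
  have "dI I y z = L2_set (\<lambda>i. (p i - p' i) + (q i - q' i)) I"
    unfolding dI_def by (rule L2_set_cong) (use assms in auto)
  then show ?thesis using L2_set_triangle_ineq[of "\<lambda>i. p i - p' i" "\<lambda>i. q i - q' i" I] by (simp add: dI_def)
qed

text \<open>The excess is \<open>y - \<Theta> y\<close>. \<open>excess_partition\<close> leaves one
  part on which the clipped vectors have an expected supremum lower by g / 8, and parts whose excess
  lies in a small ball. In the latter the clipped vectors are close together too, so the unclipped
  part lies in a small ball of \<open>Z\<close>, and there sparsity supplies the gain.\<close>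

lemma piece_step:
  assumes I: "finite I" and b: "0 < b" and Q: "2 ^ 117 \<le> Q" and Z: "st I Z w b Q"
    and E: "E \<subseteq> Z" "E \<noteq> {}" and slope: "\<And>i. i \<in> I \<Longrightarrow> slope01 (\<theta> i)"
    and near: "\<And>y. y \<in> E \<Longrightarrow> dI I (\<lambda>i. \<theta> i (y i)) s \<le> Q * b / 2 ^ 68"
    and box: "\<And>y i. y \<in> E \<Longrightarrow> i \<in> I \<Longrightarrow> \<bar>\<theta> i (y i) - s i\<bar> \<le> b / 2 ^ 198"
    and phi: "bb I Z \<le> \<phi>" "sparse I Z b Q \<phi>"
  obtains PP where "finite PP" "\<Union>PP = E" "real (card PP) \<le> exp (4 * Q\<^sup>2)"
    "\<And>P. P \<in> PP \<Longrightarrow> P \<noteq> {} \<Longrightarrow> bb I ((\<lambda>y i. \<theta> i (y i)) ` P) + Q\<^sup>2 * b / 2 ^ 113 \<le> \<phi>"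
proof -
  define \<Theta> where "\<Theta> y = (\<lambda>i. \<theta> i (y i))" for y :: "'a \<Rightarrow> real"
  define x where "x y = (\<lambda>i. y i - \<Theta> y i)" for y
  define c where "c i = w i - s i" for i
  have Q1: "1 \<le> Q" using Q by (rule order_trans[rotated]) simp
  have Qb: "0 < Q * b" using Q1 b by simp
  have fE: "finite E" using E Z finite_subset by (auto simp: st_def)
  \<comment> \<open>Condition \<open>C4\<close> now reads 2^7 Q b \<le> Q^2 b / 2^110, which is the
    origin of the threshold 2^117. \<open>12 * ?Rm\<close> plus twice the radius of the clipped
    vectors stays below the radius in \<open>sparse\<close>.\<close>
  let ?Rm = "Q * b / 2 ^ 48" and ?g = "Q\<^sup>2 * b / 2 ^ 110" and ?e = "exp (- Q\<^sup>2) / 2"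
  have X: "Q\<^sup>2 * b\<^sup>2 / 2 ^ 97 \<le> ((1 - del) * ?Rm)\<^sup>2"
    using ball_sq_half[of ?Rm] Qb by (simp add: power_mult_distrib power_divide)
  have X0: "0 < Q\<^sup>2 * b\<^sup>2 / 2 ^ 97" using Q1 b by simp
  have gpos: "0 < ?g" using Q1 b by simp
  have ex: "2 * ?e < exp (- (?g\<^sup>2 / del) / ((1 - del) * ?Rm)\<^sup>2)"
  proof -
    have "?g\<^sup>2 / del = Q\<^sup>2 * (Q\<^sup>2 * b\<^sup>2 / 2 ^ 97) / 2 ^ 98"
      by (simp add: power2_eq_square)
    also have "\<dots> < Q\<^sup>2 * (Q\<^sup>2 * b\<^sup>2 / 2 ^ 97)"
    proof -
      have "0 < Q\<^sup>2 * (Q\<^sup>2 * b\<^sup>2 / 2 ^ 97)" using X0 Q1 by (intro mult_pos_pos) auto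
      moreover have "A / 2 ^ 98 < A" if "0 < A" for A :: real using that by simp
      ultimately show ?thesis by blast
    qed
    also have "\<dots> \<le> Q\<^sup>2 * ((1 - del) * ?Rm)\<^sup>2" by (rule mult_left_mono[OF X]) simp
    finally have "(?g\<^sup>2 / del) / ((1 - del) * ?Rm)\<^sup>2 < Q\<^sup>2"
      using X X0 by (subst pos_divide_less_eq) (auto simp: mult.commute)
    then show ?thesis by simp
  qed
  have chop: "\<bar>\<Theta> y i - \<Theta> z i\<bar> + \<bar>x y i - x z i\<bar> \<le> \<bar>y i - z i\<bar>" if "i \<in> I" for y z i
    using slope01_chop[OF slope[OF that], of "y i" "z i"] by (simp add: \<Theta>_def x_def)
  have b198: "b / 2 ^ 198 \<le> b" using b by (simp add: divide_le_eq)
  obtain U where U: "finite U" "real (card U) \<le> (1 / ?e + 1) * (1 / ?e)"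
    "{y\<in>E. \<forall>u\<in>U. 6 * ?Rm < dI I (x y) u} \<noteq> {} \<Longrightarrow>
      EE I (\<lambda>\<epsilon>. MAX y\<in>{y\<in>E. \<forall>u\<in>U. 6 * ?Rm < dI I (x y) u}. lf I (\<Theta> y) \<epsilon>) \<le> bb I E - ?g / 8"
  \<comment> \<open>Box and radius are doubled because an excess combines a vector of
    \<open>Z\<close> with a clipped vector. The value of \<open>s1\<close> is essentially forced:
    \<open>C5\<close> holds with equality at the lower bound \<open>X\<close>, and \<open>C6\<close>
    with the factor 96/128 to spare.\<close>
  proof (rule excess_partition[where I = I and E = E and b = "2 * b" and a = \<Theta> and x = x and c = c
        and ?R0.0 = "2 * (Q * b)" and Rm = ?Rm and g = ?g and ?e0.0 = ?e and s = s
        and \<sigma> = "Q * b / 2 ^ 68" and ?s1.0 = "2 ^ 19 / b"])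
    fix y assume y: "y \<in> E"
    have yZ: "dI I y w \<le> Q * b" "\<And>i. i \<in> I \<Longrightarrow> \<bar>y i - w i\<bar> \<le> b" using y E Z by (auto simp: st_def)
    have "dI I (x y) c \<le> dI I y w + dI I s (\<Theta> y)"
      by (rule dI_split) (simp add: x_def c_def)
    also have "\<dots> \<le> Q * b + Q * b / 2 ^ 68"
      using yZ(1) near[OF y] by (intro add_mono) (auto simp: \<Theta>_def dI_commute[of I s])
    also have "\<dots> \<le> 2 * (Q * b)" using Qb by simp
    finally show "dI I (x y) c \<le> 2 * (Q * b)" .
    show "dI I (\<Theta> y) s \<le> Q * b / 2 ^ 68" using near[OF y] by (simp add: \<Theta>_def)
    fix i assume i: "i \<in> I"
    have "x y i - c i = (y i - w i) - (\<theta> i (y i) - s i)" by (simp add: x_def c_def \<Theta>_def)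
    then show "\<bar>x y i - c i\<bar> \<le> 2 * b" using yZ(2)[OF i] box[OF y i] b198 by linarith
    have "2 ^ 19 / b * \<bar>\<Theta> y i - s i\<bar> \<le> 2 ^ 19 / b * (b / 2 ^ 198)"
      using box[OF y i] b by (intro mult_left_mono) (auto simp: \<Theta>_def)
    also have "\<dots> \<le> 1" using b by simp
    finally show "2 ^ 19 / b * \<bar>\<Theta> y i - s i\<bar> \<le> 1" .
  next
    show "64 * (2 * b) * ?g \<le> ((1 - del) * ?Rm)\<^sup>2" using X X0 by (simp add: power2_eq_square)
    show "64 * (2 * (Q * b)) \<le> ?g"
      using mult_right_mono[of "2 ^ 117" Q "Q * b"] Q Qb by (simp add: power2_eq_square)
    have "2 ^ 32 * ?g \<le> 2 ^ 19 / b * (Q\<^sup>2 * b\<^sup>2 / 2 ^ 97)" using b by (simp add: power2_eq_square field_simps)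
    also have "\<dots> \<le> 2 ^ 19 / b * ((1 - del) * ?Rm)\<^sup>2" using b by (intro mult_left_mono[OF X]) auto
    finally show "2 ^ 32 * ?g \<le> 2 ^ 19 / b * ((1 - del) * ?Rm)\<^sup>2" .
    show "96 * (2 ^ 19 / b) * (Q * b / 2 ^ 68)\<^sup>2 \<le> ?g" using b Q1 by (simp add: power2_eq_square field_simps)
  qed (use I fE E b Qb gpos ex chop in auto)
  define P1 where "P1 u = {y\<in>E. dI I (x y) u \<le> 6 * ?Rm}" for u
  define P2 where "P2 = {y\<in>E. \<forall>u\<in>U. 6 * ?Rm < dI I (x y) u}"
  define PP where "PP = insert P2 (P1 ` U)"
  have low: "Q\<^sup>2 * b / 2 ^ 113 \<le> Q\<^sup>2 * b / 2 ^ 85" using b by (simp add: field_simps)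
  show ?thesis
  proof (rule that[of PP])
    show "finite PP" using U(1) by (simp add: PP_def)
    show "\<Union>PP = E" by (auto simp: PP_def P1_def P2_def not_less)
    define t where "t = 2 * exp (Q\<^sup>2)"
    have t: "1 / ?e = t" unfolding t_def exp_minus by (simp add: field_simps)
    have "1 \<le> Q\<^sup>2" using Q1 by simp
    have eQ: "8 \<le> exp (2 * Q\<^sup>2)"
    proof -
      have "2 ^ 117 * 1 \<le> Q * Q" using Q Q1 by (intro mult_mono) auto
      then have "7 \<le> 2 * Q\<^sup>2" by (simp add: power2_eq_square)
      then show ?thesis using exp_ge_add_one_self[of "2 * Q\<^sup>2"] by linarith
    qed
    have t2: "2 \<le> t" by (simp add: t_def)
    have "real (card PP) \<le> real (card U) + 1"
    proof -
      have "card PP \<le> Suc (card (P1 ` U))" unfolding PP_def using U(1) by (simp add: card_insert_if)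
      also have "card (P1 ` U) \<le> card U" using U(1) by (rule card_image_le)
      finally show ?thesis by simp
    qed
    also have "\<dots> \<le> (t + 1) * t + 1" using U(2) unfolding t by simp
    also have "\<dots> \<le> 2 * (t * t)"
    proof -
      have "2 * t \<le> t * t" using t2 by (intro mult_right_mono) auto
      moreover have "(t + 1) * t = t * t + t" by (simp add: distrib_right)
      ultimately show ?thesis using t2 by linarith
    qed
    also have "\<dots> = 8 * exp (2 * Q\<^sup>2)" by (simp add: t_def exp_add[symmetric])
    also have "\<dots> \<le> exp (2 * Q\<^sup>2) * exp (2 * Q\<^sup>2)" using eQ by (intro mult_right_mono) auto
    also have "\<dots> = exp (4 * Q\<^sup>2)" by (simp add: exp_add[symmetric])
    finally show "real (card PP) \<le> exp (4 * Q\<^sup>2)" .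
    fix P assume P: "P \<in> PP" "P \<noteq> {}"
    have im: "(\<lambda>y i. \<theta> i (y i)) ` P = \<Theta> ` P" by (simp add: \<Theta>_def)
    consider "P = P2" | u where "u \<in> U" "P = P1 u" using P(1) by (auto simp: PP_def)
    then show "bb I ((\<lambda>y i. \<theta> i (y i)) ` P) + Q\<^sup>2 * b / 2 ^ 113 \<le> \<phi>"
    proof cases
      case 1
      have "bb I (\<Theta> ` P2) \<le> bb I E - ?g / 8"
        using U(3) P(2) unfolding 1 P2_def[symmetric] by (simp add: image_image)
      moreover have "bb I E \<le> bb I Z" using Z E by (intro bb_mono) (auto simp: st_def)
      ultimately have "bb I (\<Theta> ` P) + Q\<^sup>2 * b / 2 ^ 113 \<le> \<phi>" using phi(1) 1 by simp
      then show ?thesis unfolding im .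
    next
      case (2 u)
      obtain z where z: "z \<in> P" using P(2) by blast
      have PE: "P \<subseteq> E" by (auto simp: 2 P1_def)
      have "dI I y z \<le> Q * b / 2 ^ 44" if y: "y \<in> P" for y
      proof -
        have "dI I y z \<le> dI I (\<Theta> y) (\<Theta> z) + dI I (x y) (x z)"
          by (rule dI_split) (simp add: x_def)
        moreover have "dI I (\<Theta> y) (\<Theta> z) \<le> Q * b / 2 ^ 68 + Q * b / 2 ^ 68"
          using dI_triangle[of I "\<Theta> y" "\<Theta> z" s] near[of y] near[of z] dI_commute[of I s "\<Theta> z"] y z PE
          by (force simp: \<Theta>_def)
        moreover have "dI I (x y) (x z) \<le> 12 * ?Rm"
          using dI_triangle[of I "x y" "x z" u] dI_commute[of I u "x z"] y z by (simp add: 2 P1_def)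
        ultimately show ?thesis using Qb by simp
      qed
      then have sub: "P \<subseteq> {y\<in>Z. dI I y z \<le> Q * b / 2 ^ 44}" using PE E by auto
      have fP: "finite P" using PE fE finite_subset by blast
      have "bb I (\<Theta> ` P) \<le> bb I P"
      proof (rule bb_image_le[OF I fP P(2)])
        fix y z i assume "i \<in> I"
        then show "\<bar>\<Theta> y i - \<Theta> z i\<bar> \<le> \<bar>y i - z i\<bar>" using chop[of i y z] by linarith
      qed
      also have "\<dots> \<le> bb I {y\<in>Z. dI I y z \<le> Q * b / 2 ^ 44}"
        using sub Z P(2) by (intro bb_mono) (auto simp: st_def)
      finally have "bb I (\<Theta> ` P) + Q\<^sup>2 * b / 2 ^ 85 \<le> \<phi>"
        using phi(2) z PE E by (fastforce simp: sparse_def)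
      then show ?thesis unfolding im using low by linarith
    qed
  qed
qed

text \<open>Bookkeeping for the unit when the ratio is multiplied by \<open>c\<close> and the box is
  divided by \<open>d\<close>.\<close>

lemma sq_scaled: "(c * Q)\<^sup>2 * (b / d) = c\<^sup>2 / d * (Q\<^sup>2 * b)" for c :: real
  by (simp add: power_mult_distrib)

lemma st_clip:
  assumes "finite P" "P \<noteq> {}" "0 < b" "\<And>y. y \<in> P \<Longrightarrow> dI I y s \<le> Q * b"
  shows "st I (clipv s b ` P) s b Q"
  unfolding st_def
proof (intro conjI ballI)
  fix y i assume "y \<in> clipv s b ` P"
  then show "\<bar>y i - s i\<bar> \<le> b" using assms(3) by (auto simp: clipv_def intro: clip_near)
next
  fix y assume "y \<in> clipv s b ` P"
  then obtain z where z: "z \<in> P" "y = clipv s b z" by blast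
  have "dI I y s \<le> dI I z s" unfolding z(2) using assms(3) by (intro clipv_dI) auto
  then show "dI I y s \<le> Q * b" using assms(4)[OF z(1)] by linarith
qed (use assms in auto)

lemma clipv_contr: "\<bar>clipv w b y i - clipv w b z i\<bar> \<le> \<bar>y i - z i\<bar>"
  unfolding clipv_def by (rule slope01_contr[OF slope01_clip])

lemma bb_clipv_le:
  assumes "finite I" "finite Y" "Y \<noteq> {}"
  shows "bb I (clipv w b ` Y) \<le> bb I Y"
  using assms by (rule bb_image_le) (rule clipv_contr)

section \<open>The recursion over the ratio of radius and box\<close>

context vc_bound
begin

text \<open>\<open>comb\<close> with a single piece, so without any entropy; the l1-loss
  \<open>(Q * b)\<^sup>2 / (b / 2 ^ 66)\<close> dominates. The radius stays, hence the ratio and the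
  unit both grow by the factor 2^66.\<close>

lemma clip_step:
  assumes b: "0 < b" and Q: "2 ^ 117 \<le> Q" and Y: "st I Y w b Q"
  shows "G Y w \<le> G (clipv w (b / 2 ^ 66) ` Y) w + (V + 2 ^ 67) * (Q\<^sup>2 * b)"
proof -
  have Q1: "1 \<le> Q" using Q by (rule order_trans[rotated]) simp
  have Qb: "0 < Q * b" using Q1 b by simp
  have "Q * (Q * b) \<ge> 1 * (Q * b)" using Q1 Qb by (intro mult_right_mono) auto
  then have QW: "Q * b \<le> Q\<^sup>2 * b" by (simp add: power2_eq_square)
  have st: "finite Y" "Y \<noteq> {}" "\<And>y. y \<in> Y \<Longrightarrow> dI I y w \<le> Q * b" using Y by (auto simp: st_def)
  have b': "0 < b / 2 ^ 66" using b by simp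
  have "G Y w \<le> G (clipv w (b / 2 ^ 66) ` Y) w + (Q * b)\<^sup>2 / (b / 2 ^ 66) + V * (Q * b) + 0 / (1 / b) + 4 * (1 / b) * (Q * b)\<^sup>2"
  proof (rule comb[where K = "{()}" and P = "\<lambda>_. Y" and \<Theta> = "\<lambda>_. clipv w (b / 2 ^ 66)" and c = "\<lambda>_. w"])
    fix y assume "y \<in> Y"
    then show "dI I (clipv w (b / 2 ^ 66) y) w \<le> Q * b"
      using clipv_dI[of "b / 2 ^ 66" I w y] st(3)[of y] b' by linarith
    show "(\<Sum>i\<in>I. \<bar>y i - clipv w (b / 2 ^ 66) y i\<bar>) \<le> (Q * b)\<^sup>2 / (b / 2 ^ 66)"
      using \<open>y \<in> Y\<close> st(3) b' by (intro clipv_L1) auto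
  qed (use st b Qb in auto)
  also have "\<dots> = G (clipv w (b / 2 ^ 66) ` Y) w + V * (Q * b) + (2 ^ 66 + 4) * (Q\<^sup>2 * b)"
    using b by (simp add: power2_eq_square field_simps)
  also have "V * (Q * b) \<le> V * (Q\<^sup>2 * b)" using QW V by (rule mult_left_mono)
  also have "(2 ^ 66 + 4) * (Q\<^sup>2 * b) \<le> 2 ^ 67 * (Q\<^sup>2 * b)" using b by (intro mult_right_mono) auto
  finally show ?thesis by (simp add: distrib_right)
qed

text \<open>Index \<open>None\<close> is the sparse residue, left unclipped about \<open>w\<close>;
  index \<open>Some s\<close> is a ball around \<open>s\<close>, recentred and clipped. The radius
  of a ball drops by 2^34 and its box by 2^66, so the ratio becomes \<open>2 ^ 32 * Q\<close> and
  the unit is divided by 4.\<close>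

lemma cover_step:
  assumes b: "0 < b" and Q: "2 ^ 117 \<le> Q" and Y: "st I Y w b Q"
    and left: "\<And>Z. Z \<subseteq> Y \<Longrightarrow> st I Z w b Q \<Longrightarrow> bb I Z \<le> bb I Y \<Longrightarrow> sparse I Z b Q (bb I Y) \<Longrightarrow> G Z w \<le> X"
    and piece: "\<And>P s. P \<subseteq> Y \<Longrightarrow> P \<noteq> {} \<Longrightarrow> (\<And>y. y \<in> P \<Longrightarrow> dI I y s \<le> Q * b / 2 ^ 34) \<Longrightarrow>
       st I (clipv s (b / 2 ^ 66) ` P) s (b / 2 ^ 66) (2 ^ 32 * Q) \<Longrightarrow> G (clipv s (b / 2 ^ 66) ` P) s \<le> X"
  shows "G Y w \<le> X + (V + 7) * (Q\<^sup>2 * b)"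
proof -
  have Q1: "1 \<le> Q" using Q by (rule order_trans[rotated]) simp
  have Qb: "0 < Q * b" using Q1 b by simp
  have "Q * (Q * b) \<ge> 1 * (Q * b)" using Q1 Qb by (intro mult_right_mono) auto
  then have QW: "Q * b \<le> Q\<^sup>2 * b" by (simp add: power2_eq_square)
  have st: "finite Y" "Y \<noteq> {}" "\<And>y. y \<in> Y \<Longrightarrow> dI I y w \<le> Q * b" using Y by (auto simp: st_def)
  have b': "0 < b / 2 ^ 66" using b by simp
  obtain S where S: "S \<subseteq> Y" "finite S" "real (card S) + 1 \<le> exp (2 * Q\<^sup>2)"
    "sparse I {y\<in>Y. \<forall>s\<in>S. Q * b / 2 ^ 34 < dI I y s} b Q (bb I Y)"
    using greedy_step[OF I b Q Y] by blast
  define Z where "Z = {y\<in>Y. \<forall>s\<in>S. Q * b / 2 ^ 34 < dI I y s}"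
  define P where "P k = (case k of None \<Rightarrow> Z | Some s \<Rightarrow> {y\<in>Y. dI I y s \<le> Q * b / 2 ^ 34})" for k
  define T where "T k = (case k of None \<Rightarrow> (\<lambda>y. y) | Some s \<Rightarrow> clipv s (b / 2 ^ 66))" for k :: "('i \<Rightarrow> real) option"
  define c where "c k = (case k of None \<Rightarrow> w | Some s \<Rightarrow> s)" for k
  have "G Y w \<le> X + (Q * b / 2 ^ 34)\<^sup>2 / (b / 2 ^ 66) + V * (Q * b) + (2 * Q\<^sup>2) / (1 / b) + 4 * (1 / b) * (Q * b)\<^sup>2"
  proof (rule comb[where K = "insert None (Some ` S)" and P = P and \<Theta> = T and c = c])
    show "\<exists>k\<in>insert None (Some ` S). y \<in> P k" if "y \<in> Y" for y
      using that by (auto simp: P_def Z_def not_less)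
    show "G (T k ` P k) (c k) \<le> X" if k: "k \<in> insert None (Some ` S)" "P k \<noteq> {}" for k
    proof (cases k)
      case None
      have ZY: "Z \<subseteq> Y" by (auto simp: Z_def)
      have Zne: "Z \<noteq> {}" using k(2) None by (simp add: P_def)
      have "G Z w \<le> X"
      proof (rule left[OF ZY])
        show "st I Z w b Q" using Y ZY Zne finite_subset by (auto simp: st_def)
        show "bb I Z \<le> bb I Y" by (rule bb_mono[OF st(1) ZY Zne])
        show "sparse I Z b Q (bb I Y)" using S(4) by (simp add: Z_def)
      qed
      then show ?thesis using None by (simp add: P_def T_def c_def)
    next
      case (Some s)
      define P' where "P' = {y\<in>Y. dI I y s \<le> Q * b / 2 ^ 34}"
      have ne: "P' \<noteq> {}" using k(2) Some by (simp add: P_def P'_def)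
      have "G (clipv s (b / 2 ^ 66) ` P') s \<le> X"
      proof (rule piece[OF _ ne])
        show "st I (clipv s (b / 2 ^ 66) ` P') s (b / 2 ^ 66) (2 ^ 32 * Q)"
          using st(1) ne b' by (intro st_clip) (auto simp: P'_def)
      qed (auto simp: P'_def)
      then show ?thesis using Some by (simp add: P_def P'_def T_def c_def)
    qed
    show "dI I (T k y) (c k) \<le> Q * b" if "k \<in> insert None (Some ` S)" "y \<in> P k" for k y
    proof (cases k)
      case None
      then show ?thesis using that st(3) by (auto simp: P_def Z_def T_def c_def)
    next
      case (Some s)
      have "dI I (clipv s (b / 2 ^ 66) y) s \<le> dI I y s" using b by (intro clipv_dI) auto
      also have "\<dots> \<le> Q * b / 2 ^ 34" using that Some by (simp add: P_def)
      also have "\<dots> \<le> Q * b" using Qb by simp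
      finally show ?thesis using Some by (simp add: T_def c_def)
    qed
    show "dI I (c k) w \<le> Q * b" if "k \<in> insert None (Some ` S)" for k
      using that S(1) st(3) Qb by (auto simp: c_def)
    show "(\<Sum>i\<in>I. \<bar>y i - T k y i\<bar>) \<le> (Q * b / 2 ^ 34)\<^sup>2 / (b / 2 ^ 66)"
      if "k \<in> insert None (Some ` S)" "y \<in> P k" for k y
    proof (cases k)
      case None
      then show ?thesis using b by (simp add: T_def)
    next
      case (Some s)
      then show ?thesis using that b clipv_L1[OF b', of I y s "Q * b / 2 ^ 34"] by (simp add: P_def T_def)
    qed
    have "card (insert None (Some ` S)) \<le> Suc (card S)"
      using S(2) by (simp add: card_image card_insert_if)
    then show "real (card (insert None (Some ` S))) \<le> exp (2 * Q\<^sup>2)" using S(3) by linarith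
  qed (use st b S(2) in \<open>auto simp: P_def Z_def\<close>)
  also have "\<dots> = X + V * (Q * b) + (2 ^ 66 / 2 ^ 68 + 6) * (Q\<^sup>2 * b)"
    using b by (simp add: power2_eq_square field_simps)
  also have "V * (Q * b) \<le> V * (Q\<^sup>2 * b)" using QW V by (rule mult_left_mono)
  also have "(2 ^ 66 / 2 ^ 68 + 6) * (Q\<^sup>2 * b) \<le> 7 * (Q\<^sup>2 * b)" using b by (intro mult_right_mono) auto
  finally show ?thesis by (simp add: distrib_right)
qed

text \<open>\<open>be\<close> closes the recursion for covers:
  \<open>be / 4 + (V + 7) \<le> be\<close>. \<open>ga\<close> makes the gain at a sparse residue of
  unit 2^64 W or 2^66 W outweigh the losses on the way there and the gain promised at unit W.
  \<open>al\<close> turns a drop of the expected supremum by W / 2^113 into more than all these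
  amounts.\<close>

definition al :: real where "al = (V + 8) * 2 ^ 200"
definition be :: real where "be = 2 * (V + 7)"
definition ga :: real where "ga = (V + 8) * 2 ^ 5"

text \<open>The two claims are proved by induction from large \<open>Q\<close> downwards, where \<open>Q \<ge> 2 |I|\<close> is trivial.
  \<open>claimL\<close> gains a multiple of \<open>Q\<^sup>2 b\<close> for sets all of whose small balls have a small expected supremum;
  this pays for the passage from \<open>Q\<close> to \<open>2\<^sup>6\<^sup>6 Q\<close>.\<close>

definition claimN :: "real \<Rightarrow> bool" where
  "claimN Q \<longleftrightarrow> (\<forall>Y w b. 0 < b \<longrightarrow> st I Y w b Q \<longrightarrow> G Y w \<le> al * bb I Y + be * (Q\<^sup>2 * b))"

definition claimL :: "real \<Rightarrow> bool" where
  "claimL Q \<longleftrightarrow> (\<forall>Z w b \<phi>. 0 < b \<longrightarrow> st I Z w b Q \<longrightarrow> bb I Z \<le> \<phi> \<longrightarrow> sparse I Z b Q \<phi> \<longrightarrow>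
     G Z w \<le> al * \<phi> - ga * (Q\<^sup>2 * b))"

text \<open>Every linear form is at most the number of indices times \<open>b\<close>, hence at most
  one unit. For \<open>claimL\<close>, expected suprema are nonnegative, so sparsity at any point
  gives \<open>Q\<^sup>2 * b / 2 ^ 85 \<le> \<phi>\<close>, and \<open>al\<close> is large enough to
  make this outweigh \<open>ga + 1\<close> units.\<close>

lemma claim_base:
  assumes Q: "2 ^ 117 \<le> Q" "2 * real (card I) \<le> Q"
  shows "claimN Q" "claimL Q"
proof -
  have Q1: "1 \<le> Q" using Q(1) by (rule order_trans[rotated]) simp
  have triv: "G Y w \<le> Q\<^sup>2 * b" if "0 < b" "st I Y w b Q" for Y w b
  proof -
    have "G Y w \<le> real (card I) * b" using that by (intro G_trivial) (auto simp: st_def)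
    also have "\<dots> \<le> (1 * Q) * b" using Q Q1 that by (intro mult_right_mono) auto
    also have "\<dots> \<le> (Q * Q) * b" using Q1 that by (intro mult_right_mono) auto
    finally show ?thesis by (simp add: power2_eq_square)
  qed
  have al0: "0 \<le> al" using V by (simp add: al_def)
  show "claimN Q"
    unfolding claimN_def
  proof (intro allI impI)
    fix Y w b assume b: "0 < (b::real)" and Y: "st I Y w b Q"
    have "0 \<le> bb I Y" using Y by (intro bb_nonneg[OF I]) (auto simp: st_def)
    then have "0 \<le> al * bb I Y" using al0 by simp
    moreover have "1 * (Q\<^sup>2 * b) \<le> be * (Q\<^sup>2 * b)" using V b by (intro mult_right_mono) (auto simp: be_def)
    ultimately show "G Y w \<le> al * bb I Y + be * (Q\<^sup>2 * b)" using triv[OF b Y] by linarith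
  qed
  show "claimL Q"
    unfolding claimL_def
  proof (intro allI impI)
    fix Z w b \<phi> assume b: "0 < (b::real)" and Z: "st I Z w b Q" and sp: "sparse I Z b Q \<phi>"
    obtain z where z: "z \<in> Z" using Z by (auto simp: st_def)
    have "0 \<le> bb I {y\<in>Z. dI I y z \<le> Q * b / 2 ^ 44}"
      using Z z b Q1 by (intro bb_nonneg[OF I]) (auto simp: st_def intro!: exI[of _ z])
    then have "Q\<^sup>2 * b / 2 ^ 85 \<le> \<phi>" using sp z by (fastforce simp: sparse_def)
    then have "al * (Q\<^sup>2 * b / 2 ^ 85) \<le> al * \<phi>" using al0 by (rule mult_left_mono)
    moreover have "(ga + 1) * (Q\<^sup>2 * b) \<le> (al / 2 ^ 85) * (Q\<^sup>2 * b)"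
      using V b by (intro mult_right_mono) (auto simp: al_def ga_def)
    ultimately have "(ga + 1) * (Q\<^sup>2 * b) \<le> al * \<phi>" by simp
    then show "G Z w \<le> al * \<phi> - ga * (Q\<^sup>2 * b)" using triv[OF b Z] by (simp add: distrib_right)
  qed
qed

text \<open>Clip once and cover twice: the ratios are 2^66 Q, 2^98 Q and 2^130 Q, the units 2^66 W,
  2^64 W and 2^62 W. The residues of the covers are sparse at ratios where the claim is known, and
  they gain \<open>ga\<close> larger units. One cover would leave clipped pieces of radius Q b /
  2^34, wider than the balls in \<open>sparse\<close>; after two covers the radius is Q b / 2^68,
  and \<open>piece_step\<close> applies to the preimages in \<open>Z\<close>.\<close>

lemma claim_L_step:
  assumes Q: "2 ^ 117 \<le> Q" and IH: "\<And>Q'. 2 * Q \<le> Q' \<Longrightarrow> claimN Q' \<and> claimL Q'"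
  shows "claimL Q"
  unfolding claimL_def
proof (intro allI impI)
  fix Z w b \<phi> assume b: "0 < (b::real)" and Z: "st I Z w b Q" and phi: "bb I Z \<le> \<phi>" and sp: "sparse I Z b Q \<phi>"
  define W where "W = Q\<^sup>2 * b"
  have Q1: "1 \<le> Q" using Q by (rule order_trans[rotated]) simp
  have Qb: "0 < Q * b" using Q1 b by simp
  have W0: "0 < W" using Q1 b by (simp add: W_def)
  have al0: "0 \<le> al" using V by (simp add: al_def)
  define b1 where "b1 = b / 2 ^ 66"
  define Q1' where "Q1' = 2 ^ 66 * Q"
  define b2 where "b2 = b1 / 2 ^ 66"
  define Q2 where "Q2 = 2 ^ 32 * Q1'"
  define b3 where "b3 = b2 / 2 ^ 66"
  define Q3 where "Q3 = 2 ^ 32 * Q2"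
  have bs: "0 < b1" "0 < b2" "0 < b3" using b by (simp_all add: b1_def b2_def b3_def)
  have Qs: "2 * Q \<le> Q1'" "2 * Q \<le> Q2" "2 * Q \<le> Q3" "2 ^ 117 \<le> Q1'" "2 ^ 117 \<le> Q2"
    using Q by (simp_all add: Q1'_def Q2_def Q3_def)
  have W1: "Q1'\<^sup>2 * b1 = 2 ^ 66 * W" unfolding Q1'_def b1_def W_def sq_scaled by simp
  have W2: "Q2\<^sup>2 * b2 = 2 ^ 64 * W" unfolding Q2_def b2_def sq_scaled W1 by simp
  have W3: "Q3\<^sup>2 * b3 = 2 ^ 62 * W" unfolding Q3_def b3_def sq_scaled W2 by simp
  define Z1 where "Z1 = clipv w b1 ` Z"
  have Zf: "finite Z" "Z \<noteq> {}" "\<And>y. y \<in> Z \<Longrightarrow> dI I y w \<le> Q * b" using Z by (auto simp: st_def)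
  have st1: "st I Z1 w b1 Q1'"
    unfolding Z1_def using Zf bs by (intro st_clip) (auto simp: Q1'_def b1_def)
  have bbZ1: "bb I Z1 \<le> \<phi>"
    unfolding Z1_def using bb_clipv_le[OF I Zf(1,2), of w b1] phi by linarith
  \<comment> \<open>The budget that is left after \<open>clip_step\<close> and the first
    cover.\<close>
  define X where "X = al * \<phi> - ga * W - (V + 2 ^ 67) * W - (V + 7) * (2 ^ 66 * W)"
  have Xeq: "X = al * \<phi> - (ga + (V + 2 ^ 67) + (V + 7) * 2 ^ 66) * W" by (simp add: X_def algebra_simps)
  have C: "(ga + (V + 2 ^ 67) + (V + 7) * 2 ^ 66) * W + (V + 7) * (2 ^ 64 * W) \<le> ga * (2 ^ 64 * W)"
  proof -
    have "(ga + (V + 2 ^ 67) + (V + 7) * 2 ^ 66) + (V + 7) * 2 ^ 64 \<le> ga * 2 ^ 64" using V by (simp add: ga_def)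
    then have "((ga + (V + 2 ^ 67) + (V + 7) * 2 ^ 66) + (V + 7) * 2 ^ 64) * W \<le> (ga * 2 ^ 64) * W"
      using W0 by (intro mult_right_mono) auto
    then show ?thesis by (simp add: algebra_simps)
  qed
  have "G Z1 w \<le> X + (V + 7) * (Q1'\<^sup>2 * b1)"
  proof (rule cover_step[OF bs(1) Qs(4) st1])
    fix Z' assume Z': "st I Z' w b1 Q1'" "bb I Z' \<le> bb I Z1" "sparse I Z' b1 Q1' (bb I Z1)"
    have "G Z' w \<le> al * bb I Z1 - ga * (Q1'\<^sup>2 * b1)"
      using IH[OF Qs(1)] bs(1) Z' unfolding claimL_def by blast
    also have "al * bb I Z1 \<le> al * \<phi>" using bbZ1 al0 by (rule mult_left_mono)
    finally have "G Z' w \<le> al * \<phi> - ga * (Q1'\<^sup>2 * b1)" by simp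
    moreover have "ga * (Q1'\<^sup>2 * b1) \<ge> (ga + (V + 2 ^ 67) + (V + 7) * 2 ^ 66) * W"
    proof -
      have "(ga + (V + 2 ^ 67) + (V + 7) * 2 ^ 66) * W \<le> ga * (2 ^ 64 * W)"
        using C V W0 by (smt (verit) mult_nonneg_nonneg zero_le_power)
      also have "\<dots> \<le> ga * (2 ^ 66 * W)" using V W0 by (intro mult_left_mono mult_right_mono) (auto simp: ga_def)
      finally show ?thesis by (simp only: W1)
    qed
    ultimately show "G Z' w \<le> X" unfolding Xeq by linarith
  next
    fix P1 s assume P1: "P1 \<subseteq> Z1" "P1 \<noteq> {}" "\<And>y. y \<in> P1 \<Longrightarrow> dI I y s \<le> Q1' * b1 / 2 ^ 34"
      and st2: "st I (clipv s (b1 / 2 ^ 66) ` P1) s (b1 / 2 ^ 66) (2 ^ 32 * Q1')"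
    define Z2 where "Z2 = clipv s b2 ` P1"
    have st2': "st I Z2 s b2 Q2" using st2 by (simp add: Z2_def b2_def Q2_def)
    have fP1: "finite P1" using P1(1) Zf(1) finite_subset by (auto simp: Z1_def)
    have bbP1: "bb I P1 \<le> bb I Z1" using Zf P1 by (intro bb_mono) (auto simp: Z1_def)
    have bbZ2: "bb I Z2 \<le> \<phi>"
      unfolding Z2_def using bb_clipv_le[OF I fP1 P1(2), of s b2] bbP1 bbZ1 by linarith
    define X2 where "X2 = X - (V + 7) * (2 ^ 64 * W)"
    have X2eq: "X2 = al * \<phi> - ((ga + (V + 2 ^ 67) + (V + 7) * 2 ^ 66) * W + (V + 7) * (2 ^ 64 * W))"
      unfolding X2_def Xeq by simp
    have "G Z2 s \<le> X2 + (V + 7) * (Q2\<^sup>2 * b2)"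
    proof (rule cover_step[OF bs(2) Qs(5) st2'])
      fix Z' assume Z': "st I Z' s b2 Q2" "bb I Z' \<le> bb I Z2" "sparse I Z' b2 Q2 (bb I Z2)"
      have "G Z' s \<le> al * bb I Z2 - ga * (Q2\<^sup>2 * b2)"
        using IH[OF Qs(2)] bs(2) Z' unfolding claimL_def by blast
      also have "al * bb I Z2 \<le> al * \<phi>" using bbZ2 al0 by (rule mult_left_mono)
      finally show "G Z' s \<le> X2" unfolding X2eq W2 using C by linarith
    next
      fix P2 s' assume P2: "P2 \<subseteq> Z2" "P2 \<noteq> {}" "\<And>y. y \<in> P2 \<Longrightarrow> dI I y s' \<le> Q2 * b2 / 2 ^ 34"
        and st3: "st I (clipv s' (b2 / 2 ^ 66) ` P2) s' (b2 / 2 ^ 66) (2 ^ 32 * Q2)"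
      define Z3 where "Z3 = clipv s' b3 ` P2"
      have st3': "st I Z3 s' b3 Q3" using st3 by (simp add: Z3_def b3_def Q3_def)
      define \<theta> where "\<theta> i t = clip (s' i) b3 (clip (s i) b2 (clip (w i) b1 t))" for i t
      define E where "E = {y\<in>Z. clipv w b1 y \<in> P1 \<and> clipv s b2 (clipv w b1 y) \<in> P2}"
      have \<theta>_eq: "(\<lambda>i. \<theta> i (y i)) = clipv s' b3 (clipv s b2 (clipv w b1 y))" for y
        by (simp add: \<theta>_def clipv_def)
      have imE: "(\<lambda>y i. \<theta> i (y i)) ` E = Z3"
      proof
        show "(\<lambda>y i. \<theta> i (y i)) ` E \<subseteq> Z3" by (auto simp: \<theta>_eq E_def Z3_def)
        show "Z3 \<subseteq> (\<lambda>y i. \<theta> i (y i)) ` E"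
        proof
          fix z assume "z \<in> Z3"
          then obtain p2 where p2: "p2 \<in> P2" "z = clipv s' b3 p2" by (auto simp: Z3_def)
          then obtain p1 where p1: "p1 \<in> P1" "p2 = clipv s b2 p1" using P2(1) by (auto simp: Z2_def)
          then obtain y where "y \<in> Z" "p1 = clipv w b1 y" using P1(1) by (auto simp: Z1_def)
          then have "y \<in> E" "z = (\<lambda>i. \<theta> i (y i))" using p1 p2 by (auto simp: E_def \<theta>_eq)
          then show "z \<in> (\<lambda>y i. \<theta> i (y i)) ` E" by blast
        qed
      qed
      have Z3ne: "Z3 \<noteq> {}" using P2(2) by (simp add: Z3_def)
      have rho: "Q2 * b2 / 2 ^ 34 = Q * b / 2 ^ 68" "b3 = b / 2 ^ 198"
        by (simp_all add: Q2_def Q1'_def b3_def b2_def b1_def)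
      obtain PP where PP: "finite PP" "\<Union>PP = E" "real (card PP) \<le> exp (4 * Q\<^sup>2)"
        "\<And>P. P \<in> PP \<Longrightarrow> P \<noteq> {} \<Longrightarrow> bb I ((\<lambda>y i. \<theta> i (y i)) ` P) + Q\<^sup>2 * b / 2 ^ 113 \<le> \<phi>"
      proof (rule piece_step[OF I b Q Z _ _ _ _ _ phi sp, of E \<theta> s'])
        show "E \<subseteq> Z" by (auto simp: E_def)
        show "E \<noteq> {}" using imE Z3ne by blast
        show "slope01 (\<theta> i)" for i unfolding \<theta>_def by (rule slope01_comp[OF slope01_clip slope01_comp[OF slope01_clip slope01_clip]])
        show "dI I (\<lambda>i. \<theta> i (y i)) s' \<le> Q * b / 2 ^ 68" if "y \<in> E" for y
        proof -
          have "dI I (\<lambda>i. \<theta> i (y i)) s' \<le> dI I (clipv s b2 (clipv w b1 y)) s'"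
            unfolding \<theta>_eq using bs by (intro clipv_dI) auto
          then show ?thesis using P2(3)[of "clipv s b2 (clipv w b1 y)"] that rho by (simp add: E_def)
        qed
        show "\<bar>\<theta> i (y i) - s' i\<bar> \<le> b / 2 ^ 198" for y i
          unfolding \<theta>_def rho(2)[symmetric] using bs by (intro clip_near) auto
      qed blast
      \<comment> \<open>The drop found by \<open>piece_step\<close>, multiplied by
        \<open>al\<close>, against the cost of \<open>claimN\<close> at the unit 2^62 W.\<close>
      define X3 where "X3 = al * \<phi> - al / 2 ^ 113 * W + be * (2 ^ 62 * W)"
      have "G Z3 s' \<le> X3 + 0 + V * (Q * b) + (4 * Q\<^sup>2) / (1 / b) + 4 * (1 / b) * (Q * b)\<^sup>2"
      proof (rule comb[where K = PP and P = "\<lambda>P. (\<lambda>y i. \<theta> i (y i)) ` P" and \<Theta> = "\<lambda>_ y. y" and c = "\<lambda>_. s'"])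
        show "finite Z3" "Z3 \<noteq> {}" using st3' by (auto simp: st_def)
        show "\<exists>P\<in>PP. y \<in> (\<lambda>y i. \<theta> i (y i)) ` P" if "y \<in> Z3" for y
          using that unfolding imE[symmetric] PP(2)[symmetric] by blast
        show sub: "(\<lambda>y i. \<theta> i (y i)) ` P \<subseteq> Z3" if "P \<in> PP" for P
          unfolding imE[symmetric] PP(2)[symmetric] using that by blast
        show "G ((\<lambda>y. y) ` (\<lambda>y i. \<theta> i (y i)) ` P) s' \<le> X3"
          if P: "P \<in> PP" "(\<lambda>y i. \<theta> i (y i)) ` P \<noteq> {}" for P
        proof -
          let ?P = "(\<lambda>y i. \<theta> i (y i)) ` P"
          have "finite ?P" using sub[OF P(1)] st3' finite_subset by (auto simp: st_def)
          then have "st I ?P s' b3 Q3"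
            using st3' subsetD[OF sub[OF P(1)]] P(2) unfolding st_def by simp
          then have "G ?P s' \<le> al * bb I ?P + be * (Q3\<^sup>2 * b3)"
            using IH[OF Qs(3)] bs(3) unfolding claimN_def by blast
          moreover have "al * (bb I ?P + W / 2 ^ 113) \<le> al * \<phi>"
            using PP(4)[OF P(1)] P(2) al0 by (intro mult_left_mono) (auto simp: W_def)
          ultimately show ?thesis unfolding X3_def W3 by (simp add: distrib_left)
        qed
        show "dI I y s' \<le> Q * b" if "P \<in> PP" "y \<in> (\<lambda>y i. \<theta> i (y i)) ` P" for P y
        proof -
          have "y \<in> Z3" using sub that by blast
          then have "dI I y s' \<le> Q3 * b3" using st3' by (auto simp: st_def)
          also have "\<dots> = Q * b / 2 ^ 68" by (simp add: Q3_def Q2_def Q1'_def b3_def b2_def b1_def)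
          also have "\<dots> \<le> Q * b" using Qb by simp
          finally show ?thesis .
        qed
      qed (use PP b Qb in auto)
      also have "\<dots> = X3 + V * (Q * b) + 8 * W"
        using b by (simp add: power2_eq_square field_simps W_def)
      also have "V * (Q * b) \<le> V * W"
      proof -
        have "1 * (Q * b) \<le> Q * (Q * b)" using Q1 Qb by (intro mult_right_mono) auto
        then show ?thesis using V by (intro mult_left_mono) (auto simp: W_def power2_eq_square)
      qed
      also have "X3 + V * W + 8 * W \<le> X2"
      proof -
        have "be * 2 ^ 62 + V + 8 + (ga + (V + 2 ^ 67) + (V + 7) * 2 ^ 66) + (V + 7) * 2 ^ 64 \<le> al / 2 ^ 113"
          using V by (simp add: ga_def be_def al_def)
        then have "(be * 2 ^ 62 + V + 8 + (ga + (V + 2 ^ 67) + (V + 7) * 2 ^ 66) + (V + 7) * 2 ^ 64) * W \<le> al / 2 ^ 113 * W"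
          using W0 by (intro mult_right_mono) auto
        then show ?thesis unfolding X3_def X2eq by (simp add: algebra_simps)
      qed
      finally show "G (clipv s' (b2 / 2 ^ 66) ` P2) s' \<le> X2" by (simp add: Z3_def b3_def)
    qed
    then have "G Z2 s \<le> X" unfolding X2_def W2 by simp
    then show "G (clipv s (b1 / 2 ^ 66) ` P1) s \<le> X" by (simp add: Z2_def b2_def)
  qed
  then have "G Z1 w \<le> al * \<phi> - ga * W - (V + 2 ^ 67) * W" by (simp add: X_def W1)
  then show "G Z w \<le> al * \<phi> - ga * (Q\<^sup>2 * b)"
    using clip_step[OF b Q Z] by (simp add: Z1_def b1_def W_def)
qed

text \<open>On the residue \<open>claimL\<close> does even better than required. On the balls the
  unit is divided by 4, so the costs of repeated covers form a convergent geometric series, which is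
  summed in \<open>be\<close>.\<close>

lemma claim_N_step:
  assumes Q: "2 ^ 117 \<le> Q" and L: "claimL Q" and IH: "claimN (2 ^ 32 * Q)"
  shows "claimN Q"
  unfolding claimN_def
proof (intro allI impI)
  fix Y w b assume b: "0 < (b::real)" and Y: "st I Y w b Q"
  have Q1: "1 \<le> Q" using Q by (rule order_trans[rotated]) simp
  define W where "W = Q\<^sup>2 * b"
  have W0: "0 < W" using Q1 b by (simp add: W_def)
  have al0: "0 \<le> al" "0 \<le> be" "0 \<le> ga" using V by (auto simp: al_def be_def ga_def)
  have Yf: "finite Y" using Y by (simp add: st_def)
  have "G Y w \<le> (al * bb I Y + be * (W / 4)) + (V + 7) * (Q\<^sup>2 * b)"
  proof (rule cover_step[OF b Q Y])
    fix Z assume Z: "st I Z w b Q" "bb I Z \<le> bb I Y" "sparse I Z b Q (bb I Y)"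
    have "G Z w \<le> al * bb I Y - ga * (Q\<^sup>2 * b)" using L b Z unfolding claimL_def by blast
    moreover have "0 \<le> ga * W" "0 \<le> be * (W / 4)" using al0 W0 by auto
    ultimately show "G Z w \<le> al * bb I Y + be * (W / 4)" by (simp add: W_def)
  next
    fix P s assume P: "P \<subseteq> Y" "P \<noteq> {}" and st: "st I (clipv s (b / 2 ^ 66) ` P) s (b / 2 ^ 66) (2 ^ 32 * Q)"
    have fP: "finite P" using P Yf finite_subset by blast
    have "0 < b / 2 ^ 66" using b by simp
    then have "G (clipv s (b / 2 ^ 66) ` P) s
        \<le> al * bb I (clipv s (b / 2 ^ 66) ` P) + be * ((2 ^ 32 * Q)\<^sup>2 * (b / 2 ^ 66))"
      using IH st unfolding claimN_def by blast
    also have "(2 ^ 32 * Q)\<^sup>2 * (b / 2 ^ 66) = W / 4" unfolding sq_scaled W_def by simp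
    also have "al * bb I (clipv s (b / 2 ^ 66) ` P) \<le> al * bb I Y"
    proof (rule mult_left_mono[OF _ al0(1)])
      have "bb I (clipv s (b / 2 ^ 66) ` P) \<le> bb I P" by (rule bb_clipv_le[OF I fP P(2)])
      also have "\<dots> \<le> bb I Y" by (rule bb_mono[OF Yf P])
      finally show "bb I (clipv s (b / 2 ^ 66) ` P) \<le> bb I Y" .
    qed
    finally show "G (clipv s (b / 2 ^ 66) ` P) s \<le> al * bb I Y + be * (W / 4)" by simp
  qed
  also have "be * (W / 4) + (V + 7) * W \<le> be * W"
  proof -
    have "(be / 4 + (V + 7)) * W \<le> be * W" using V W0 by (intro mult_right_mono) (auto simp: be_def)
    then show ?thesis by (simp add: distrib_right)
  qed
  then have "(al * bb I Y + be * (W / 4)) + (V + 7) * (Q\<^sup>2 * b) \<le> al * bb I Y + be * (Q\<^sup>2 * b)"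
    by (simp add: W_def)
  finally show "G Y w \<le> al * bb I Y + be * (Q\<^sup>2 * b)" .
qed

text \<open>\<open>n\<close> counts the doublings of \<open>Q\<close> that lead to the trivial
  range; the downward induction on \<open>Q\<close> becomes an induction on
  \<open>n\<close>.\<close>

lemma claims:
  "2 ^ 117 \<le> Q \<Longrightarrow> 2 * real (card I) \<le> Q * 2 ^ n \<Longrightarrow> claimN Q \<and> claimL Q"
proof (induction n arbitrary: Q)
  case 0
  then show ?case using claim_base[of Q] by simp
next
  case (Suc n)
  have Q0: "0 \<le> Q" using Suc.prems(1) by (rule order_trans[rotated]) simp
  have IH: "claimN Q' \<and> claimL Q'" if "2 * Q \<le> Q'" for Q'
  proof (rule Suc.IH)
    show "2 ^ 117 \<le> Q'" using Suc.prems(1) that Q0 by linarith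
    have "2 * real (card I) \<le> (2 * Q) * 2 ^ n" using Suc.prems(2) by simp
    also have "\<dots> \<le> Q' * 2 ^ n" using that by (intro mult_right_mono) auto
    finally show "2 * real (card I) \<le> Q' * 2 ^ n" .
  qed
  have L: "claimL Q" by (rule claim_L_step[OF Suc.prems(1) IH])
  moreover have "claimN Q" using IH[of "2 ^ 32 * Q"] Q0 by (intro claim_N_step[OF Suc.prems(1) L]) auto
  ultimately show ?case by blast
qed

lemma claimN_all: "2 ^ 117 \<le> Q \<Longrightarrow> claimN Q"
proof -
  assume Q: "2 ^ 117 \<le> Q"
  have Q1: "1 \<le> Q" using Q by (rule order_trans[rotated]) simp
  obtain n where n: "2 * real (card I) < 2 ^ n" using real_arch_pow[of 2 "2 * real (card I)"] by auto
  have "1 * 2 ^ n \<le> Q * 2 ^ n" using Q1 by (intro mult_right_mono) auto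
  then have "2 * real (card I) \<le> Q * 2 ^ n" using n by linarith
  then show ?thesis using claims[OF Q, of n] by blast
qed

end

section \<open>Comparison of expectations\<close>

lemma EE_lf_pow2: "finite I \<Longrightarrow> EE I (\<lambda>\<epsilon>. (lf I v \<epsilon>)\<^sup>2) = nsq I v"
proof (induction I rule: finite_induct)
  case empty
  then show ?case by (simp add: lf_def nsq_def)
next
  case (insert i I)
  have "EE (insert i I) (\<lambda>\<epsilon>. (lf (insert i I) v \<epsilon>)\<^sup>2)
      = (EE I (\<lambda>\<epsilon>. (v i + lf I v \<epsilon>)\<^sup>2) + EE I (\<lambda>\<epsilon>. (- v i + lf I v \<epsilon>)\<^sup>2)) / 2"
    using insert(1,2) by (simp add: EE_insert lf_insert_upd)
  also have "\<dots> = EE I (\<lambda>\<epsilon>. (v i)\<^sup>2 + (lf I v \<epsilon>)\<^sup>2)"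
    unfolding EE_add[symmetric] EE_divc[symmetric] by (rule EE_cong) (simp add: power2_eq_square algebra_simps)
  also have "\<dots> = (v i)\<^sup>2 + nsq I v" unfolding EE_add using insert by simp
  finally show ?case using insert(1,2) by (simp add: nsq_insert)
qed

lemma EE_lf_pow4: "finite I \<Longrightarrow> EE I (\<lambda>\<epsilon>. (lf I v \<epsilon>) ^ 4) \<le> 3 * (nsq I v)\<^sup>2"
proof (induction I rule: finite_induct)
  case empty
  then show ?case by (simp add: lf_def nsq_def)
next
  case (insert i I)
  have "EE (insert i I) (\<lambda>\<epsilon>. (lf (insert i I) v \<epsilon>) ^ 4)
      = (EE I (\<lambda>\<epsilon>. (v i + lf I v \<epsilon>) ^ 4) + EE I (\<lambda>\<epsilon>. (- v i + lf I v \<epsilon>) ^ 4)) / 2"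
    using insert(1,2) by (simp add: EE_insert lf_insert_upd)
  also have "\<dots> = EE I (\<lambda>\<epsilon>. (v i) ^ 4 + 6 * (v i)\<^sup>2 * (lf I v \<epsilon>)\<^sup>2 + (lf I v \<epsilon>) ^ 4)"
    unfolding EE_add[symmetric] EE_divc[symmetric]
    by (rule EE_cong) (simp add: power2_eq_square power4_eq_xxxx algebra_simps)
  also have "\<dots> = (v i) ^ 4 + 6 * (v i)\<^sup>2 * nsq I v + EE I (\<lambda>\<epsilon>. (lf I v \<epsilon>) ^ 4)"
    unfolding EE_add EE_cmult using insert by (simp add: EE_lf_pow2)
  also have "\<dots> \<le> (v i) ^ 4 + 6 * (v i)\<^sup>2 * nsq I v + 3 * (nsq I v)\<^sup>2" using insert.IH by simp
  also have "\<dots> \<le> 3 * ((v i)\<^sup>2 + nsq I v)\<^sup>2"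
  proof -
    have "0 \<le> (v i) ^ 4" by simp
    then show ?thesis by (simp add: power2_eq_square power4_eq_xxxx algebra_simps)
  qed
  finally show ?case using insert(1,2) by (simp add: nsq_insert)
qed

text \<open>For t = \<bar>x\<bar> it reduces to 1 - t + t^3 / 4 \<ge> 0, which for t \<le> 2 follows
  from (t - 1)^2 (t + 2) \<ge> 0. It bounds a first absolute moment below by the second and fourth
  moments.\<close>

lemma abs_ge_quartic: "x\<^sup>2 - x ^ 4 / 4 \<le> \<bar>x :: real\<bar>"
proof -
  have *: "t\<^sup>2 - t ^ 4 / 4 \<le> t" if "0 \<le> t" for t :: real
  proof -
    have "0 \<le> 1 - t + t ^ 3 / 4"
    proof (cases "t \<le> 2")
      case True
      have "0 \<le> (t - 1)\<^sup>2 * (t + 2)" using that by simp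
      then have "3 * t - 2 \<le> t ^ 3" by (simp add: power2_eq_square power3_eq_cube algebra_simps)
      then show ?thesis using True by simp
    next
      case False
      then have "2 * 2 \<le> t * t" by (intro mult_mono) auto
      then have "4 * t \<le> (t * t) * t" using that by (intro mult_right_mono) auto
      then show ?thesis by (simp add: power3_eq_cube)
    qed
    then have "0 \<le> t * (1 - t + t ^ 3 / 4)" using that by simp
    then show ?thesis by (simp add: power2_eq_square power3_eq_cube power4_eq_xxxx algebra_simps)
  qed
  show ?thesis using *[of "\<bar>x\<bar>"] by simp
qed

text \<open>\<open>abs_ge_quartic\<close> at the form divided by 2 \<sigma>: the second moment
  contributes 1/4 and the fourth takes away at most 3/64, so the mean absolute value is at least
  13/32 of \<sigma>.\<close>

lemma khinchine: "finite I \<Longrightarrow> sqrt (nsq I v) \<le> 4 * EE I (\<lambda>\<epsilon>. \<bar>lf I v \<epsilon>\<bar>)"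
proof (cases "nsq I v = 0")
  case True
  then show ?thesis by (simp add: EE_nonneg)
next
  case False
  assume I: "finite I"
  define \<sigma> where "\<sigma> = sqrt (nsq I v)"
  have s: "0 < \<sigma>" "nsq I v = \<sigma>\<^sup>2" using False nsq_nonneg[of I v] by (simp_all add: \<sigma>_def less_le)
  have "EE I (\<lambda>\<epsilon>. (lf I v \<epsilon>)\<^sup>2 * (1 / (2 * \<sigma>)\<^sup>2) - (lf I v \<epsilon>) ^ 4 * (1 / (4 * (2 * \<sigma>) ^ 4)))
      \<le> EE I (\<lambda>\<epsilon>. \<bar>lf I v \<epsilon>\<bar> * (1 / (2 * \<sigma>)))"
  proof (rule EE_mono)
    fix \<epsilon> :: "'a \<Rightarrow> real"
    show "(lf I v \<epsilon>)\<^sup>2 * (1 / (2 * \<sigma>)\<^sup>2) - (lf I v \<epsilon>) ^ 4 * (1 / (4 * (2 * \<sigma>) ^ 4)) \<le> \<bar>lf I v \<epsilon>\<bar> * (1 / (2 * \<sigma>))"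
      using abs_ge_quartic[of "lf I v \<epsilon> / (2 * \<sigma>)"] s(1)
      by (simp add: power_divide abs_divide mult.commute)
  qed
  then have "nsq I v * (1 / (2 * \<sigma>)\<^sup>2) - EE I (\<lambda>\<epsilon>. (lf I v \<epsilon>) ^ 4) * (1 / (4 * (2 * \<sigma>) ^ 4))
      \<le> EE I (\<lambda>\<epsilon>. \<bar>lf I v \<epsilon>\<bar>) * (1 / (2 * \<sigma>))"
    unfolding EE_diff EE_multc EE_lf_pow2[OF I] .
  moreover have "EE I (\<lambda>\<epsilon>. (lf I v \<epsilon>) ^ 4) * (1 / (4 * (2 * \<sigma>) ^ 4)) \<le> 3 * (\<sigma>\<^sup>2)\<^sup>2 * (1 / (4 * (2 * \<sigma>) ^ 4))"
    using EE_lf_pow4[OF I, of v] s by (intro mult_right_mono) auto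
  moreover have "3 * (\<sigma>\<^sup>2)\<^sup>2 * (1 / (4 * (2 * \<sigma>) ^ 4)) = 3 / 64"
    using s(1) by (simp add: power_mult_distrib power_mult[symmetric])
  moreover have "nsq I v * (1 / (2 * \<sigma>)\<^sup>2) = 1 / 4" using s by (simp add: power_mult_distrib)
  ultimately have "13 / 64 \<le> EE I (\<lambda>\<epsilon>. \<bar>lf I v \<epsilon>\<bar>) * (1 / (2 * \<sigma>))" by linarith
  then have "13 / 32 * \<sigma> \<le> EE I (\<lambda>\<epsilon>. \<bar>lf I v \<epsilon>\<bar>)" using s(1) by (simp add: field_simps)
  then show ?thesis unfolding \<sigma>_def[symmetric] using s(1) by simp
qed

text \<open>This is \<open>al + 4 * be * (2 ^ 117)\<^sup>2\<close>: the constants of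
  \<open>claimN\<close> at the smallest ratio, for a box of about \<open>4 * bb I T\<close>.\<close>

definition Kb :: "real \<Rightarrow> real" where
  "Kb V = (V + 8) * 2 ^ 200 + 8 * (V + 7) * 2 ^ 234"

text \<open>Khinchine's inequality and the symmetry of \<open>T\<close> bound each l2-norm by
  \<open>4 * bb I T\<close>. This one number bounds the coordinates as well as the radius, so
  \<open>claimN\<close> can be started at the origin with the smallest admissible ratio.\<close>

lemma (in vc_bound) bernoulli:
  assumes T: "finite T" "T \<noteq> {}" and sym: "\<And>t. t \<in> T \<Longrightarrow> (\<lambda>i. - t i) \<in> T"
  shows "EE I (\<lambda>\<epsilon>. MAX p\<in>T \<times> CC. lf I (res (snd p) (fst p)) \<epsilon>) \<le> Kb V * bb I T"
proof -
  have nrm: "sqrt (nsq I t) \<le> 4 * bb I T" if t: "t \<in> T" for t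
  proof -
    have "EE I (\<lambda>\<epsilon>. \<bar>lf I t \<epsilon>\<bar>) \<le> bb I T"
    proof (rule EE_mono)
      fix \<epsilon> :: "'i \<Rightarrow> real"
      have "lf I (\<lambda>i. - t i) \<epsilon> = - lf I t \<epsilon>" by (simp add: lf_def sum_negf)
      then show "\<bar>lf I t \<epsilon>\<bar> \<le> (MAX y\<in>T. lf I y \<epsilon>)"
        using Max_ge_at[OF T(1) t, of "\<lambda>y. lf I y \<epsilon>"] Max_ge_at[OF T(1) sym[OF t], of "\<lambda>y. lf I y \<epsilon>"] by linarith
    qed
    then show ?thesis using khinchine[OF I, of t] by linarith
  qed
  have bb0: "0 \<le> bb I T" by (rule bb_nonneg[OF I T])
  have G: "G T (\<lambda>_. 0) = EE I (\<lambda>\<epsilon>. MAX p\<in>T \<times> CC. lf I (res (snd p) (fst p)) \<epsilon>)"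
    by (simp add: G_def)
  have "G T (\<lambda>_. 0) \<le> Kb V * bb I T + e" if e: "0 < e" for e
  proof -
    \<comment> \<open>The second summand keeps \<open>b\<close> positive even if
      \<open>bb I T = 0\<close>, and it adds exactly \<open>e\<close> to the bound.\<close>
    define b where "b = 4 * bb I T + e / (be * (2 ^ 117)\<^sup>2)"
    have be0: "0 < be" using V by (simp add: be_def)
    have e': "0 < e / (be * (2 ^ 117)\<^sup>2)" using e be0 by simp
    have b: "0 < b" using bb0 e' by (simp add: b_def add_nonneg_pos)
    have "st I T (\<lambda>_. 0) b (2 ^ 117)"
      unfolding st_def
    proof (intro conjI ballI T)
      fix t assume t: "t \<in> T"
      have tb: "sqrt (nsq I t) \<le> b" using nrm[OF t] e' by (simp add: b_def)
      have "dI I t (\<lambda>_. 0) = sqrt (nsq I t)" by (simp add: dI_def L2_set_def nsq_def)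
      also have "\<dots> \<le> 1 * b" using tb by simp
      also have "\<dots> \<le> 2 ^ 117 * b" using b by (intro mult_right_mono) auto
      finally show "dI I t (\<lambda>_. 0) \<le> 2 ^ 117 * b" .
      fix i assume i: "i \<in> I"
      have "(t i)\<^sup>2 \<le> nsq I t" unfolding nsq_def using I i by (intro member_le_sum) auto
      then have "sqrt ((t i)\<^sup>2) \<le> sqrt (nsq I t)" by (rule real_sqrt_le_mono)
      then show "\<bar>t i - 0\<bar> \<le> b" using tb by simp
    qed
    then have "G T (\<lambda>_. 0) \<le> al * bb I T + be * ((2 ^ 117)\<^sup>2 * b)"
      using claimN_all[of "2 ^ 117"] b unfolding claimN_def by blast
    also have "be * ((2 ^ 117)\<^sup>2 * b) = (be * (2 ^ 117)\<^sup>2) * (4 * bb I T) + e"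
    proof -
      have "be * ((2 ^ 117)\<^sup>2 * b) = (be * (2 ^ 117)\<^sup>2) * b" by simp
      also have "\<dots> = (be * (2 ^ 117)\<^sup>2) * (4 * bb I T) + (be * (2 ^ 117)\<^sup>2) * (e / (be * (2 ^ 117)\<^sup>2))"
        unfolding b_def by (rule distrib_left)
      also have "(be * (2 ^ 117)\<^sup>2) * (e / (be * (2 ^ 117)\<^sup>2)) = e"
      proof -
        have "c * (e / c) = e" if "0 < c" for c using that by simp
        then show ?thesis using be0 by simp
      qed
      finally show ?thesis .
    qed
    also have "al * bb I T + ((be * (2 ^ 117)\<^sup>2) * (4 * bb I T) + e) = Kb V * bb I T + e"
      by (simp add: Kb_def al_def be_def algebra_simps)
    finally show ?thesis .
  qed
  then show ?thesis unfolding G by (rule field_le_epsilon)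
qed

text \<open>The sub-Gaussian maximal inequality, with \<open>s\<close> left open because chaining
  uses a different value at each level.\<close>

lemma EE_max_finite:
  assumes I: "finite I" and A: "finite A" "A \<noteq> {}" and s: "0 < s"
    and L: "\<And>a. a \<in> A \<Longrightarrow> nsq I (v a) \<le> L" and N: "real (card A) \<le> exp N"
  shows "EE I (\<lambda>\<epsilon>. MAX a\<in>A. lf I (v a) \<epsilon>) \<le> N / s + s * L"
proof -
  let ?Z = "\<lambda>\<epsilon>. MAX a\<in>A. lf I (v a) \<epsilon>"
  have "s * EE I (\<lambda>\<epsilon>. 1 * ?Z \<epsilon>) \<le> ln (EE I (\<lambda>\<epsilon>. exp (s * ?Z \<epsilon>))) + EE I (\<lambda>\<epsilon>. 1 * ln 1)"
    by (rule gibbs_EE[OF I]) (use I s in auto)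
  also have "ln (EE I (\<lambda>\<epsilon>. exp (s * ?Z \<epsilon>))) \<le> N + s\<^sup>2 * L"
  proof (rule ln_le_of_le_exp)
    show "0 < EE I (\<lambda>\<epsilon>. exp (s * ?Z \<epsilon>))" by (rule EE_pos[OF I]) simp
    have "EE I (\<lambda>\<epsilon>. exp (s * ?Z \<epsilon>)) \<le> EE I (\<lambda>\<epsilon>. \<Sum>a\<in>A. exp (s * lf I (v a) \<epsilon>))"
    proof (rule EE_mono)
      fix \<epsilon> :: "'a \<Rightarrow> real"
      obtain a where a: "a \<in> A" "?Z \<epsilon> = lf I (v a) \<epsilon>" using Max_ex[OF A, of "\<lambda>a. lf I (v a) \<epsilon>"] by blast
      then show "exp (s * ?Z \<epsilon>) \<le> (\<Sum>a\<in>A. exp (s * lf I (v a) \<epsilon>))"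
        using A(1) member_le_sum[of a A "\<lambda>a. exp (s * lf I (v a) \<epsilon>)"] by simp
    qed
    also have "\<dots> = (\<Sum>a\<in>A. EE I (\<lambda>\<epsilon>. exp (s * lf I (v a) \<epsilon>)))" by (rule EE_sum)
    also have "\<dots> \<le> (\<Sum>a\<in>A. exp (s\<^sup>2 * L))"
    proof (rule sum_mono)
      fix a assume a: "a \<in> A"
      have "EE I (\<lambda>\<epsilon>. exp (s * (MAX b\<in>{a}. 0 + lf I (v b) \<epsilon>)))
          \<le> exp (s * EE I (\<lambda>\<epsilon>. MAX b\<in>{a}. 0 + lf I (v b) \<epsilon>) + s\<^sup>2 * L)"
        by (rule EE_exp_max_upper[OF I _ _ s]) (use L[OF a] in auto)
      then show "EE I (\<lambda>\<epsilon>. exp (s * lf I (v a) \<epsilon>)) \<le> exp (s\<^sup>2 * L)" using I by simp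
    qed
    also have "\<dots> = real (card A) * exp (s\<^sup>2 * L)" by simp
    also have "\<dots> \<le> exp N * exp (s\<^sup>2 * L)" using N by (intro mult_right_mono) auto
    finally show "EE I (\<lambda>\<epsilon>. exp (s * ?Z \<epsilon>)) \<le> exp (N + s\<^sup>2 * L)" by (simp add: exp_add)
  qed
  finally have "s * EE I ?Z \<le> s * (N / s + s * L)"
    using s I by (simp add: algebra_simps power2_eq_square)
  then show ?thesis using s by (simp only: mult_le_cancel_left_pos)
qed

section \<open>Vapnik--Chervonenkis classes\<close>

definition shatters :: "'i set set \<Rightarrow> 'i set \<Rightarrow> bool" where
  "shatters F B \<longleftrightarrow> (\<forall>S\<subseteq>B. \<exists>C\<in>F. C \<inter> B = S)"

lemma shatters_mono: "shatters F B \<Longrightarrow> F \<subseteq> F' \<Longrightarrow> shatters F' B"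
  unfolding shatters_def by (meson subsetD)

lemma VC_class_not_shatters:
  assumes "VC_class I \<C> d" "B \<subseteq> I" "card B = Suc d"
  shows "\<not> shatters \<C> B"
proof
  assume sh: "shatters \<C> B"
  have sub: "Pow B \<subseteq> {C \<inter> B | C. C \<in> \<C>}"
  proof
    fix S assume "S \<in> Pow B"
    then obtain C where "C \<in> \<C>" "C \<inter> B = S" using sh unfolding shatters_def by blast
    then show "S \<in> {C \<inter> B | C. C \<in> \<C>}" by blast
  qed
  have fB: "finite B" using assms(3) card_ge_0_finite[of B] by simp
  then have "finite {C \<inter> B | C. C \<in> \<C>}" by (rule_tac finite_subset[of _ "Pow B"]) auto
  then have "2 ^ (d + 1) \<le> card {C \<inter> B | C. C \<in> \<C>}"
    using card_mono[OF _ sub] fB assms(3) by (simp add: card_Pow)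
  moreover have "card {C \<inter> B | C. C \<in> \<C>} < 2 ^ (d + 1)"
    using assms unfolding VC_class_def by simp
  ultimately show False by simp
qed

text \<open>Removing \<open>x\<close> gives card F = card (F0 \<union> F1) + card (F0 \<inter> F1).
  A set shattered by the union is shattered by \<open>F\<close>; a set shattered by the intersection
  remains shattered by \<open>F\<close> after \<open>x\<close> is added, so the intersection has
  order one less. The polynomial form is closed under this recursion.\<close>

lemma sauer_shelah:
  assumes "finite A" "F \<subseteq> Pow A" "\<And>B. B \<subseteq> A \<Longrightarrow> card B = Suc d \<Longrightarrow> \<not> shatters F B"
  shows "card F \<le> (card A + 1) ^ d"
  using assms
proof (induction A arbitrary: d F rule: finite_induct)
  case empty
  then have "F \<subseteq> {{}}" by auto
  then have "card F \<le> card {{} :: 'a set}" by (intro card_mono) auto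
  then show ?case by simp
next
  case (insert x A)
  define F0 where "F0 = {S\<in>F. x \<notin> S}"
  define F1 where "F1 = {S\<in>Pow A. insert x S \<in> F}"
  have fF: "finite F" using insert.prems(1) insert.hyps(1) finite_subset by fastforce
  have sub: "F0 \<subseteq> Pow A" "F1 \<subseteq> Pow A" using insert.prems(1) by (auto simp: F0_def F1_def)
  have fin: "finite F0" "finite F1"
    using finite_subset[OF sub(1)] finite_subset[OF sub(2)] insert.hyps(1) by simp_all
  have inj: "inj_on (insert x) F1" using insert.hyps(2) by (auto simp: F1_def inj_on_def)
  have "F = F0 \<union> insert x ` F1"
  proof
    show "F \<subseteq> F0 \<union> insert x ` F1"
    proof
      fix S assume S: "S \<in> F"
      show "S \<in> F0 \<union> insert x ` F1"
      proof (cases "x \<in> S")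
        case True
        then have "S - {x} \<in> F1" "S = insert x (S - {x})"
          using S insert.prems(1) by (auto simp: F1_def insert_absorb)
        then show ?thesis by blast
      qed (use S in \<open>simp add: F0_def\<close>)
    qed
  qed (auto simp: F0_def F1_def)
  then have "card F = card (F0 \<union> insert x ` F1)" by simp
  also have "\<dots> = card F0 + card (insert x ` F1)"
    using fin by (intro card_Un_disjoint) (auto simp: F0_def)
  also have "\<dots> = card (F0 \<union> F1) + card (F0 \<inter> F1)"
    using card_Un_Int[OF fin] by (simp add: card_image[OF inj])
  finally have cF: "card F = card (F0 \<union> F1) + card (F0 \<inter> F1)" .
  have "card (F0 \<union> F1) \<le> (card A + 1) ^ d"
  proof (rule insert.IH)
    show "F0 \<union> F1 \<subseteq> Pow A" using sub by blast
    fix B assume B: "B \<subseteq> A" "card B = Suc d"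
    have "\<exists>C'\<in>F. C' \<inter> B = C \<inter> B" if C: "C \<in> F0 \<union> F1" for C
    proof (cases "C \<in> F0")
      case False
      then have "insert x C \<in> F" using C by (simp add: F1_def)
      moreover have "insert x C \<inter> B = C \<inter> B" using B insert.hyps(2) by auto
      ultimately show ?thesis by blast
    qed (auto simp: F0_def)
    moreover have "\<not> shatters F B" using insert.prems(2)[of B] B by auto
    ultimately show "\<not> shatters (F0 \<union> F1) B" unfolding shatters_def by metis
  qed
  \<comment> \<open>Order 0 is separate: no two members may differ exactly in \<open>x\<close>, so
    the intersection is empty, while the truncated exponent \<open>d - 1\<close> would still allow
    one element.\<close>
  moreover have "card (F0 \<inter> F1) \<le> (if d = 0 then 0 else (card A + 1) ^ (d - 1))"
  proof (cases d)
    case 0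
    have "F0 \<inter> F1 = {}"
    proof (rule ccontr)
      assume "F0 \<inter> F1 \<noteq> {}"
      then obtain S where "S \<in> F" "insert x S \<in> F" "x \<notin> S" by (auto simp: F0_def F1_def)
      then have "shatters F {x}" unfolding shatters_def
        by (metis Int_insert_right_if0 Int_insert_right_if1 inf_bot_right insertI1 subset_singletonD)
      then show False using insert.prems(2)[of "{x}"] 0 by auto
    qed
    then show ?thesis by simp
  next
    case (Suc e)
    have "card (F0 \<inter> F1) \<le> (card A + 1) ^ e"
    proof (rule insert.IH)
      show "F0 \<inter> F1 \<subseteq> Pow A" using sub by blast
      fix B assume B: "B \<subseteq> A" "card B = Suc e"
      show "\<not> shatters (F0 \<inter> F1) B"
      proof
        assume sh: "shatters (F0 \<inter> F1) B"
        have xB: "x \<notin> B" using B insert.hyps(2) by auto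
        have "shatters F (insert x B)"
          unfolding shatters_def
        proof (intro allI impI)
          fix S assume S: "S \<subseteq> insert x B"
          then have "S - {x} \<subseteq> B" by auto
          then obtain C where C: "C \<in> F0" "C \<in> F1" "C \<inter> B = S - {x}" using sh unfolding shatters_def by blast
          show "\<exists>C\<in>F. C \<inter> insert x B = S"
          proof (cases "x \<in> S")
            case True
            have "insert x C \<inter> insert x B = insert x (C \<inter> B)" by blast
            also have "\<dots> = S" unfolding C(3) using True by (simp add: insert_absorb)
            finally have "insert x C \<inter> insert x B = S" .
            moreover have "insert x C \<in> F" using C(2) by (simp add: F1_def)
            ultimately show ?thesis by (intro bexI[of _ "insert x C"])
          next
            case False
            have "C \<inter> insert x B = C \<inter> B" using C(1) by (simp add: F0_def)
            also have "\<dots> = S" unfolding C(3) using False by simp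
            finally have "C \<inter> insert x B = S" .
            moreover have "C \<in> F" using C(1) by (simp add: F0_def)
            ultimately show ?thesis by (intro bexI[of _ C])
          qed
        qed
        moreover have "card (insert x B) = Suc d"
          using B xB Suc finite_subset[OF B(1) insert.hyps(1)] by simp
        ultimately show False using insert.prems(2)[of "insert x B"] B(1) by auto
      qed
    qed
    then show ?thesis using Suc by simp
  qed
  moreover have "(card A + 1) ^ d + (if d = 0 then 0 else (card A + 1) ^ (d - 1)) \<le> (card (insert x A) + 1) ^ d"
  proof (cases d)
    case (Suc e)
    have "(card A + 1) ^ d + (card A + 1) ^ e = (card A + 2) * (card A + 1) ^ e" using Suc by simp
    also have "\<dots> \<le> (card A + 2) * (card A + 2) ^ e" by (intro mult_left_mono power_mono) auto
    finally show ?thesis using Suc insert.hyps by simp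
  qed simp
  ultimately show ?case using cF by linarith
qed

text \<open>Greedy version of random sampling: some index separates at least the average number of
  the pairs not separated so far.\<close>

lemma separating_indices:
  fixes w :: "'i \<Rightarrow> real" and D :: "'r \<Rightarrow> 'i set"
  assumes I: "finite I" and R: "finite R" and w: "\<And>i. i \<in> I \<Longrightarrow> 0 \<le> w i" "0 < (\<Sum>i\<in>I. w i)"
    and sep: "\<And>r. r \<in> R \<Longrightarrow> \<eta> * (\<Sum>i\<in>I. w i) \<le> (\<Sum>i\<in>I \<inter> D r. w i)" and \<eta>: "\<eta> \<le> 1"
  shows "\<exists>A\<subseteq>I. card A \<le> n \<and> real (card {r\<in>R. A \<inter> D r = {}}) \<le> (1 - \<eta>) ^ n * real (card R)"
proof (induction n)
  case 0
  show ?case by (rule exI[of _ "{}"]) simp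
next
  case (Suc n)
  then obtain A where A: "A \<subseteq> I" "card A \<le> n" "real (card {r\<in>R. A \<inter> D r = {}}) \<le> (1 - \<eta>) ^ n * real (card R)"
    by blast
  define R' where "R' = {r\<in>R. A \<inter> D r = {}}"
  have fR': "finite R'" using R by (simp add: R'_def)
  define c where "c i = real (card {r\<in>R'. i \<in> D r})" for i
  have "\<exists>i\<in>I. \<eta> * real (card R') \<le> c i"
  proof (rule ccontr)
    assume neg: "\<not> (\<exists>i\<in>I. \<eta> * real (card R') \<le> c i)"
    have "\<not> (\<forall>j\<in>I. w j \<le> 0)" using w(2) sum_nonpos[of I w] by auto
    then obtain j where j: "j \<in> I" "0 < w j" by (auto simp: not_le)
    have "(\<Sum>i\<in>I. w i * c i) < (\<Sum>i\<in>I. w i * (\<eta> * real (card R')))"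
    proof (rule sum_strict_mono_ex1[OF I])
      show "\<forall>i\<in>I. w i * c i \<le> w i * (\<eta> * real (card R'))" using w neg by (auto intro!: mult_left_mono)
      show "\<exists>i\<in>I. w i * c i < w i * (\<eta> * real (card R'))" using j neg by (auto intro!: bexI[of _ j])
    qed
    also have "\<dots> = (\<Sum>r\<in>R'. \<eta> * (\<Sum>i\<in>I. w i))" by (simp add: sum_distrib_right[symmetric])
    also have "\<dots> \<le> (\<Sum>r\<in>R'. \<Sum>i\<in>I \<inter> D r. w i)" by (intro sum_mono sep) (simp add: R'_def)
    also have "\<dots> = (\<Sum>r\<in>R'. \<Sum>i\<in>I. if i \<in> D r then w i else 0)" by (simp add: sum.inter_restrict[OF I])
    also have "\<dots> = (\<Sum>i\<in>I. \<Sum>r\<in>R'. if i \<in> D r then w i else 0)" by (rule sum.swap)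
    also have "\<dots> = (\<Sum>i\<in>I. w i * c i)"
    proof (rule sum.cong[OF refl])
      fix i
      have "(\<Sum>r\<in>R'. if i \<in> D r then w i else 0) = (\<Sum>r\<in>R' \<inter> {r. i \<in> D r}. w i)"
        by (subst sum.inter_restrict[OF fR']) simp
      also have "R' \<inter> {r. i \<in> D r} = {r\<in>R'. i \<in> D r}" by auto
      finally show "(\<Sum>r\<in>R'. if i \<in> D r then w i else 0) = w i * c i" by (simp add: c_def)
    qed
    finally show False by simp
  qed
  then obtain i where i: "i \<in> I" "\<eta> * real (card R') \<le> c i" by blast
  have "{r\<in>R. insert i A \<inter> D r = {}} = R' - {r\<in>R'. i \<in> D r}" by (auto simp: R'_def)
  then have "real (card {r\<in>R. insert i A \<inter> D r = {}}) = real (card R') - c i"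
    using fR' by (simp add: card_Diff_subset c_def of_nat_diff card_mono)
  also have "\<dots> \<le> (1 - \<eta>) * real (card R')" using i by (simp add: algebra_simps)
  also have "\<dots> \<le> (1 - \<eta>) * ((1 - \<eta>) ^ n * real (card R))"
    using A(3) \<eta> by (intro mult_left_mono) (auto simp: R'_def)
  finally have "real (card {r\<in>R. insert i A \<inter> D r = {}}) \<le> (1 - \<eta>) ^ Suc n * real (card R)" by simp
  moreover have "card (insert i A) \<le> Suc n" using A(2) card_insert_le_m1[of "Suc n" A i] by simp
  ultimately show ?case using A(1) i(1) by (intro exI[of _ "insert i A"]) auto
qed

text \<open>With y the logarithm of the cardinality, about 2 y / \<eta> indices separate all pairs.
  The traces on these indices are distinct, and \<open>sauer_shelah\<close> bounds their number by a
  polynomial in y / \<eta>. This leaves an inequality of the form y \<le> D ln (2 y / \<eta> + 2),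
  which is then solved for y.\<close>

lemma packing_ln_card:
  fixes w :: "'i \<Rightarrow> real"
  assumes I: "finite I" and w: "\<And>i. i \<in> I \<Longrightarrow> 0 \<le> w i" "0 < (\<Sum>i\<in>I. w i)"
    and F: "finite F" "F \<noteq> {}" and vc: "\<And>B. B \<subseteq> I \<Longrightarrow> card B = Suc d \<Longrightarrow> \<not> shatters F B"
    and \<eta>: "0 < \<eta>" "\<eta> \<le> 1"
    and sep: "\<And>C C'. C \<in> F \<Longrightarrow> C' \<in> F \<Longrightarrow> C \<noteq> C' \<Longrightarrow>
      \<eta> * (\<Sum>i\<in>I. w i) \<le> (\<Sum>i\<in>I \<inter> ((C - C') \<union> (C' - C)). w i)"
  shows "ln (real (card F)) \<le> 2 * (real d + 1) * ln (4 * (real d + 1) / \<eta>)"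
proof -
  define D where "D = real d + 1"
  define m where "m = real (card F)"
  define y where "y = ln m"
  have D1: "1 \<le> D" by (simp add: D_def)
  have m1: "1 \<le> m" using F by (simp add: m_def Suc_le_eq card_gt_0_iff)
  have y0: "0 \<le> y" using m1 by (simp add: y_def)
  define R where "R = {p\<in>F \<times> F. fst p \<noteq> snd p}"
  \<comment> \<open>Strictly larger than 2 y / \<eta>, so that the number of unseparated pairs, at
    most \<open>exp (2 * y - real n * \<eta>)\<close>, is below 1 and hence 0.\<close>
  define n where "n = Suc (nat \<lfloor>2 * y / \<eta>\<rfloor>)"
  have n: "2 * y / \<eta> < real n" "real n \<le> 2 * y / \<eta> + 1"
    using y0 \<eta> unfolding n_def by (simp_all add: of_nat_nat) linarith+
  obtain A where A: "A \<subseteq> I" "card A \<le> n"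
    "real (card {r\<in>R. A \<inter> ((fst r - snd r) \<union> (snd r - fst r)) = {}}) \<le> (1 - \<eta>) ^ n * real (card R)"
    using separating_indices[OF I _ w, of R \<eta> "\<lambda>r. (fst r - snd r) \<union> (snd r - fst r)" n] sep \<eta> F(1)
    by (auto simp: R_def)
  have fA: "finite A" using A(1) I finite_subset by blast
  have "(1 - \<eta>) ^ n * real (card R) < 1"
  proof -
    have "card R \<le> card (F \<times> F)" unfolding R_def using F(1) by (intro card_mono) auto
    then have "real (card R) \<le> m * m" by (simp add: card_cartesian_product m_def of_nat_mult[symmetric] del: of_nat_mult)
    moreover have "(1 - \<eta>) ^ n \<le> exp (- \<eta>) ^ n"
      using exp_ge_add_one_self[of "- \<eta>"] \<eta> by (intro power_mono) auto
    ultimately have "(1 - \<eta>) ^ n * real (card R) \<le> exp (- \<eta>) ^ n * (m * m)"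
      using \<eta> by (intro mult_mono) auto
    also have "\<dots> = exp (2 * y - real n * \<eta>)"
    proof -
      have "m = exp y" using m1 by (simp add: y_def)
      then have "m * m = exp (2 * y)" by (metis exp_add mult_2)
      moreover have "exp (- \<eta>) ^ n = exp (real n * - \<eta>)" by (rule exp_of_nat_mult[symmetric])
      ultimately have "exp (- \<eta>) ^ n * (m * m) = exp (real n * - \<eta> + 2 * y)" by (simp only: exp_add)
      then show ?thesis by simp
    qed
    also have "\<dots> < 1" using n(1) \<eta> by (simp add: divide_less_eq)
    finally show ?thesis .
  qed
  then have "card {r\<in>R. A \<inter> ((fst r - snd r) \<union> (snd r - fst r)) = {}} = 0" using A(3) by linarith
  moreover have "finite R" using F(1) by (simp add: R_def)
  ultimately have none: "{r\<in>R. A \<inter> ((fst r - snd r) \<union> (snd r - fst r)) = {}} = {}" by simp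
  have inj: "inj_on (\<lambda>C. C \<inter> A) F"
  proof (rule inj_onI, rule ccontr)
    fix C C' assume C: "C \<in> F" "C' \<in> F" "C \<inter> A = C' \<inter> A" "C \<noteq> C'"
    have "(C, C') \<in> R" using C by (simp add: R_def)
    moreover have "A \<inter> ((C - C') \<union> (C' - C)) = {}" using C(3) by blast
    ultimately have "(C, C') \<in> {r\<in>R. A \<inter> ((fst r - snd r) \<union> (snd r - fst r)) = {}}" by simp
    then show False using none by blast
  qed
  have "card ((\<lambda>C. C \<inter> A) ` F) \<le> (card A + 1) ^ d"
  proof (rule sauer_shelah[OF fA])
    fix B assume B: "B \<subseteq> A" "card B = Suc d"
    have "shatters F B" if "shatters ((\<lambda>C. C \<inter> A) ` F) B"
      unfolding shatters_def
    proof (intro allI impI)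
      fix S assume "S \<subseteq> B"
      then have "\<exists>S'\<in>(\<lambda>C. C \<inter> A) ` F. S' \<inter> B = S" using that unfolding shatters_def by simp
      then obtain C where C: "C \<in> F" "C \<inter> A \<inter> B = S" by auto
      have "C \<inter> B = C \<inter> A \<inter> B" using B(1) by auto
      then show "\<exists>C\<in>F. C \<inter> B = S" using C by (intro bexI[of _ C]) simp_all
    qed
    then show "\<not> shatters ((\<lambda>C. C \<inter> A) ` F) B" using vc[of B] B order_trans[OF B(1) A(1)] by auto
  qed auto
  then have "m \<le> (real (card A) + 1) ^ d"
    unfolding m_def card_image[OF inj] by (metis (mono_tags) of_nat_1 of_nat_add of_nat_le_iff of_nat_power)
  also have "\<dots> \<le> (real n + 1) ^ d" using A(2) by (intro power_mono) auto
  also have "\<dots> \<le> (real n + 1) ^ Suc d" by (intro power_increasing) auto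
  also have "\<dots> \<le> (2 * y / \<eta> + 2) ^ Suc d" using n(2) by (intro power_mono) auto
  finally have "y \<le> ln ((2 * y / \<eta> + 2) ^ Suc d)" unfolding y_def[symmetric] using m1 by (simp add: y_def)
  also have "\<dots> = D * ln (2 * y / \<eta> + 2)"
    using y0 \<eta> by (subst ln_realpow) (auto simp: D_def add_nonneg_pos)
  finally have y: "y \<le> D * ln (2 * y / \<eta> + 2)" .
  have "(2 * D) * ((y + \<eta>) / (2 * D)) = y + \<eta>" using D1 by simp
  moreover have "2 * y / \<eta> + 2 = (2 / \<eta>) * (y + \<eta>)" using \<eta> by (simp add: field_simps)
  ultimately have "ln (2 * y / \<eta> + 2) = ln ((2 / \<eta>) * (2 * D) * ((y + \<eta>) / (2 * D)))"
    by (simp only: mult.assoc)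
  also have "\<dots> = ln ((2 / \<eta>) * (2 * D)) + ln ((y + \<eta>) / (2 * D))"
    using \<eta> D1 y0 by (intro ln_mult_pos) auto
  \<comment> \<open>The scaling by \<open>2 * D\<close> makes the term in \<open>y\<close>, after
    multiplication by \<open>D\<close>, equal to y / 2, which is absorbed on the left.\<close>
  also have "ln ((y + \<eta>) / (2 * D)) \<le> (y + \<eta>) / (2 * D) - 1"
    using \<eta> D1 y0 by (intro ln_le_minus_one) auto
  also have "(2 / \<eta>) * (2 * D) = 4 * D / \<eta>" by simp
  finally have "D * ln (2 * y / \<eta> + 2) \<le> D * (ln (4 * D / \<eta>) + ((y + \<eta>) / (2 * D) - 1))"
    using D1 by (intro mult_left_mono) auto
  also have "\<dots> = D * ln (4 * D / \<eta>) + (y + \<eta>) / 2 - D" using D1 by (simp add: field_simps)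
  finally have "y \<le> D * ln (4 * D / \<eta>) + (y + \<eta>) / 2 - D" using y by linarith
  then have "y \<le> 2 * (D * ln (4 * D / \<eta>))" using \<eta> D1 by argo
  then show ?thesis unfolding mult.assoc by (simp only: y_def m_def D_def)
qed

section \<open>Nets and chaining over a class\<close>

lemma nsq_res_diff:
  "finite I \<Longrightarrow> nsq I (\<lambda>i. res C v i - res C' v i) = (\<Sum>i\<in>I \<inter> ((C - C') \<union> (C' - C)). (v i)\<^sup>2)"
  unfolding nsq_def by (subst sum.inter_restrict) (auto simp: res_def intro!: sum.cong)

text \<open>A maximal separated subfamily is a net, and \<open>packing_ln_card\<close> with weights
  (v i)^2 and \<eta> = 4^-k bounds its size. The square of d + 1 stems from the crude estimate ln (4
  D) \<le> 4 D - 1.\<close>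

lemma vc_net:
  assumes I: "finite I" and CC: "finite CC" "CC \<noteq> {}"
    and vc: "\<And>B. B \<subseteq> I \<Longrightarrow> card B = Suc d \<Longrightarrow> \<not> shatters CC B" and pos: "0 < nsq I v"
  shows "\<exists>F\<subseteq>CC. F \<noteq> {} \<and> real (card F) \<le> exp (8 * (real d + 1)\<^sup>2 * (real k + 1)) \<and>
    (\<forall>C\<in>CC. \<exists>C'\<in>F. nsq I (\<lambda>i. res C v i - res C' v i) \<le> nsq I v / 4 ^ k)"
proof -
  define sepd where "sepd F \<longleftrightarrow> (\<forall>C\<in>F. \<forall>C'\<in>F. C \<noteq> C' \<longrightarrow> nsq I v / 4 ^ k \<le> nsq I (\<lambda>i. res C v i - res C' v i))"
    for F
  obtain C0 where C0: "C0 \<in> CC" using CC by blast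
  define SS where "SS = {F. F \<subseteq> CC \<and> F \<noteq> {} \<and> sepd F}"
  have "finite SS" using CC by (intro finite_subset[of SS "Pow CC"]) (auto simp: SS_def)
  moreover have "{C0} \<in> SS" using C0 by (simp add: sepd_def SS_def)
  then have "SS \<noteq> {}" by blast
  ultimately obtain F where "F \<in> SS" and max: "\<forall>F'\<in>SS. F \<le> F' \<longrightarrow> F = F'"
    using finite_has_maximal[of SS] by blast
  then have F: "F \<subseteq> CC" "F \<noteq> {}" "sepd F" by (simp_all add: SS_def)
  have fF: "finite F" using F(1) CC(1) by (rule finite_subset)
  define D where "D = real d + 1"
  have D1: "1 \<le> D" by (simp add: D_def)
  have "ln (real (card F)) \<le> 2 * (real d + 1) * ln (4 * (real d + 1) / (1 / 4 ^ k))"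
  proof (rule packing_ln_card[OF I, where w = "\<lambda>i. (v i)\<^sup>2"])
    show "0 < (\<Sum>i\<in>I. (v i)\<^sup>2)" using pos by (simp add: nsq_def)
    show "\<not> shatters F B" if "B \<subseteq> I" "card B = Suc d" for B
      using vc[OF that] shatters_mono[OF _ F(1)] by blast
    fix C C' assume "C \<in> F" "C' \<in> F" "C \<noteq> C'"
    then have "nsq I v / 4 ^ k \<le> nsq I (\<lambda>i. res C v i - res C' v i)" using F(3) unfolding sepd_def by blast
    then show "1 / 4 ^ k * (\<Sum>i\<in>I. (v i)\<^sup>2) \<le> (\<Sum>i\<in>I \<inter> ((C - C') \<union> (C' - C)). (v i)\<^sup>2)"
      unfolding nsq_res_diff[OF I] by (simp add: nsq_def)
  qed (use fF F(2) in auto)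
  also have "4 * (real d + 1) / (1 / 4 ^ k) = 4 * D * 4 ^ k" by (simp add: D_def)
  also have "ln (4 * D * 4 ^ k) = ln (4 * D) + real k * ln 4"
    using D1 by (subst ln_mult_pos) (auto simp: ln_realpow)
  also have "\<dots> \<le> (4 * D - 1) + real k * 3"
    using D1 by (intro add_mono mult_left_mono ln_le_minus_one) (auto intro: order_trans[OF ln_le_minus_one])
  also have "\<dots> \<le> 4 * D * (real k + 1)"
  proof -
    have "real k * 3 \<le> real k * (4 * D)" using D1 by (intro mult_left_mono) auto
    then show ?thesis by (simp add: algebra_simps)
  qed
  finally have "ln (real (card F)) \<le> 2 * D * (4 * D * (real k + 1))" using D1 by (simp add: D_def)
  then have "real (card F) \<le> exp (2 * D * (4 * D * (real k + 1)))"
    using fF F(2) by (subst ln_le_cancel_iff[symmetric]) (auto simp: card_gt_0_iff)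
  also have "2 * D * (4 * D * (real k + 1)) = 8 * D\<^sup>2 * (real k + 1)" by (simp add: power2_eq_square)
  finally have card: "real (card F) \<le> exp (8 * (real d + 1)\<^sup>2 * (real k + 1))" by (simp add: D_def)
  have "\<exists>C'\<in>F. nsq I (\<lambda>i. res C v i - res C' v i) \<le> nsq I v / 4 ^ k" if C: "C \<in> CC" for C
  proof (rule ccontr)
    assume neg: "\<not> ?thesis"
    have "sepd (insert C F)"
      unfolding sepd_def
    proof (intro ballI impI)
      fix A B assume AB: "A \<in> insert C F" "B \<in> insert C F" "A \<noteq> B"
      have sw: "nsq I (\<lambda>i. res A v i - res B v i) = nsq I (\<lambda>i. res B v i - res A v i)"
        by (simp add: nsq_def power2_commute)
      show "nsq I v / 4 ^ k \<le> nsq I (\<lambda>i. res A v i - res B v i)"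
      proof (cases "A \<in> F \<and> B \<in> F")
        case True
        then show ?thesis using F(3) AB(3) unfolding sepd_def by blast
      next
        case False
        then consider "A = C" "B \<in> F" | "B = C" "A \<in> F" using AB by auto
        then show ?thesis using neg sw by cases (auto simp: not_le intro: less_imp_le)
      qed
    qed
    then have "insert C F \<in> SS" using F C by (simp add: SS_def)
    then have "F = insert C F" using max by blast
    then have "C \<in> F" by blast
    moreover have "nsq I (\<lambda>i. res C v i - res C v i) \<le> nsq I v / 4 ^ k" using pos by (simp add: nsq_def)
    ultimately show False using neg by blast
  qed
  then show ?thesis using F card by blast
qed

lemma chain_step:
  assumes I: "finite I" and A: "finite A" "A \<noteq> {}" and B: "finite B" and s: "0 < s"
    and near: "\<And>C. C \<in> A \<Longrightarrow> \<exists>C'\<in>B. nsq I (\<lambda>i. res C v i - res C' v i) \<le> L"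
    and N: "real (card A) \<le> exp N"
  shows "EE I (\<lambda>\<epsilon>. MAX C\<in>A. lf I (res C v) \<epsilon>) \<le> EE I (\<lambda>\<epsilon>. MAX C\<in>B. lf I (res C v) \<epsilon>) + (N / s + s * L)"
proof -
  obtain p where p: "\<And>C. C \<in> A \<Longrightarrow> p C \<in> B" "\<And>C. C \<in> A \<Longrightarrow> nsq I (\<lambda>i. res C v i - res (p C) v i) \<le> L"
    using near by metis
  have "EE I (\<lambda>\<epsilon>. MAX C\<in>A. lf I (res C v) \<epsilon>)
      \<le> EE I (\<lambda>\<epsilon>. (MAX C\<in>B. lf I (res C v) \<epsilon>) + (MAX C\<in>A. lf I (\<lambda>i. res C v i - res (p C) v i) \<epsilon>))"
  proof (intro EE_mono Max_le_all[OF A])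
    fix \<epsilon> :: "'a \<Rightarrow> real" and C assume C: "C \<in> A"
    show "lf I (res C v) \<epsilon> \<le> (MAX C\<in>B. lf I (res C v) \<epsilon>) + (MAX C\<in>A. lf I (\<lambda>i. res C v i - res (p C) v i) \<epsilon>)"
      using Max_ge_at[OF B p(1)[OF C], of "\<lambda>C. lf I (res C v) \<epsilon>"]
        Max_ge_at[OF A(1) C, of "\<lambda>C. lf I (\<lambda>i. res C v i - res (p C) v i) \<epsilon>"]
      by (simp add: lf_diff)
  qed
  also have "\<dots> = EE I (\<lambda>\<epsilon>. MAX C\<in>B. lf I (res C v) \<epsilon>) + EE I (\<lambda>\<epsilon>. MAX C\<in>A. lf I (\<lambda>i. res C v i - res (p C) v i) \<epsilon>)"
    by (rule EE_add)
  also have "EE I (\<lambda>\<epsilon>. MAX C\<in>A. lf I (\<lambda>i. res C v i - res (p C) v i) \<epsilon>) \<le> N / s + s * L"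
    by (rule EE_max_finite[OF I A s p(2) N])
  finally show ?thesis by simp
qed

lemma sum_arith_geom: "(\<Sum>k<n. (real k + 1) / 2 ^ k) = 4 - 2 * (real n + 2) / 2 ^ n"
proof (induction n)
  case (Suc n)
  have "(real n + 1) / 2 ^ n = 2 * (real n + 2) / 2 ^ n - 2 * (real (Suc n) + 2) / 2 ^ Suc n"
    by (simp add: field_simps)
  then show ?case using Suc by simp
qed simp

text \<open>Chaining through nets of mesh \<sigma> / 2^k. The logarithms of their sizes grow only
  linearly in k, so with s = 2^k / \<sigma> the k-th link costs a multiple of (k + 1) / 2^k, which
  is summable.\<close>

lemma vc_chaining:
  assumes I: "finite I" and CC: "finite CC" "CC \<noteq> {}"
    and vc: "\<And>B. B \<subseteq> I \<Longrightarrow> card B = Suc d \<Longrightarrow> \<not> shatters CC B"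
  shows "EE I (\<lambda>\<epsilon>. MAX C\<in>CC. lf I (res C v) \<epsilon>) \<le> 100 * (real d + 1)\<^sup>2 * sqrt (nsq I v)"
proof (cases "nsq I v = 0")
  case True
  then have "lf I (res C v) \<epsilon> = 0" for C \<epsilon>
    using I unfolding nsq_def lf_def res_def by (auto simp: sum_nonneg_eq_0_iff intro!: sum.neutral)
  then show ?thesis using I CC True by simp
next
  case False
  then have pos: "0 < nsq I v" using nsq_nonneg[of I v] by (simp add: less_le)
  define \<sigma> where "\<sigma> = sqrt (nsq I v)"
  have s: "0 < \<sigma>" "nsq I v = \<sigma>\<^sup>2" using pos by (simp_all add: \<sigma>_def)
  define D where "D = (real d + 1)\<^sup>2"
  have D1: "1 \<le> D" by (simp add: D_def)
  have "\<forall>k. \<exists>F\<subseteq>CC. F \<noteq> {} \<and> real (card F) \<le> exp (8 * (real d + 1)\<^sup>2 * (real k + 1)) \<and>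
    (\<forall>C\<in>CC. \<exists>C'\<in>F. nsq I (\<lambda>i. res C v i - res C' v i) \<le> nsq I v / 4 ^ k)"
    using vc_net[OF I CC vc pos] by blast
  from choice[OF this] obtain F where "\<forall>k. F k \<subseteq> CC \<and> F k \<noteq> {} \<and>
      real (card (F k)) \<le> exp (8 * (real d + 1)\<^sup>2 * (real k + 1)) \<and>
    (\<forall>C\<in>CC. \<exists>C'\<in>F k. nsq I (\<lambda>i. res C v i - res C' v i) \<le> nsq I v / 4 ^ k)" ..
  then have F: "\<And>k. F k \<subseteq> CC" "\<And>k. F k \<noteq> {}" "\<And>k. real (card (F k)) \<le> exp (8 * D * (real k + 1))"
    "\<And>k C. C \<in> CC \<Longrightarrow> \<exists>C'\<in>F k. nsq I (\<lambda>i. res C v i - res C' v i) \<le> nsq I v / 4 ^ k"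
    unfolding D_def by simp_all
  have fF: "finite (F k)" for k using F(1) CC(1) by (rule finite_subset)
  define e where "e A = EE I (\<lambda>\<epsilon>. MAX C\<in>A. lf I (res C v) \<epsilon>)" for A
  obtain C0 where C0: "C0 \<in> CC" using CC by blast
  \<comment> \<open>The chain starts at the empty set, whose restricted form vanishes.\<close>
  have "e (F 0) \<le> e {{}} + (8 * D * (real 0 + 1) / (1 / \<sigma>) + (1 / \<sigma>) * \<sigma>\<^sup>2)"
    unfolding e_def
  proof (rule chain_step[OF I fF F(2) _ _ _ F(3)])
    show "\<exists>C'\<in>{{}}. nsq I (\<lambda>i. res C v i - res C' v i) \<le> \<sigma>\<^sup>2" for C
      using nsq_res[of I C v] s by (simp add: res_def)
  qed (use s in auto)
  also have "e {{}} = 0" using I by (simp add: e_def)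
  also have "0 + (8 * D * (real 0 + 1) / (1 / \<sigma>) + (1 / \<sigma>) * \<sigma>\<^sup>2) = (8 * D + 1) * \<sigma>"
    using s by (simp add: power2_eq_square algebra_simps)
  also have "\<dots> \<le> (9 * D) * \<sigma>" using D1 s by (intro mult_right_mono) auto
  finally have base: "e (F 0) \<le> 9 * D * \<sigma>" .
  have step: "e (F (Suc k)) \<le> e (F k) + 17 * D * \<sigma> * ((real k + 1) / 2 ^ k)" for k
  proof -
    have "e (F (Suc k)) \<le> e (F k) + (8 * D * (real (Suc k) + 1) / (2 ^ k / \<sigma>) + (2 ^ k / \<sigma>) * (nsq I v / 4 ^ k))"
      unfolding e_def
    proof (rule chain_step[OF I fF F(2) fF _ _ F(3)])
      show "\<exists>C'\<in>F k. nsq I (\<lambda>i. res C v i - res C' v i) \<le> nsq I v / 4 ^ k" if "C \<in> F (Suc k)" for C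
        using F(4)[of C k] that F(1)[of "Suc k"] by blast
    qed (use s in auto)
    also have "(2 ^ k / \<sigma>) * (nsq I v / 4 ^ k) = \<sigma> / 2 ^ k"
    proof -
      have "(4 :: real) ^ k = 2 ^ k * 2 ^ k" by (simp add: power_mult_distrib[symmetric])
      then show ?thesis using s by (simp add: power2_eq_square)
    qed
    also have "8 * D * (real (Suc k) + 1) / (2 ^ k / \<sigma>) + \<sigma> / 2 ^ k
        = (8 * D * (real k + 2) + 1) * (\<sigma> / 2 ^ k)" using s by (simp add: field_simps)
    also have "\<dots> \<le> (17 * D * (real k + 1)) * (\<sigma> / 2 ^ k)"
    proof (rule mult_right_mono)
      have "D * real k \<ge> 0" using D1 by simp
      moreover have "17 * D * (real k + 1) = 8 * D * (real k + 2) + D + 9 * (D * real k)"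
        by (simp add: algebra_simps)
      ultimately show "8 * D * (real k + 2) + 1 \<le> 17 * D * (real k + 1)" using D1 by linarith
    qed (use s in simp)
    finally show ?thesis by (simp add: mult_ac)
  qed
  have chain: "e (F n) \<le> 9 * D * \<sigma> + 17 * D * \<sigma> * (\<Sum>k<n. (real k + 1) / 2 ^ k)" for n
  proof (induction n)
    case (Suc n)
    then show ?case using step[of n] by (simp add: distrib_left)
  qed (use base in simp)
  have chain': "e (F n) \<le> 77 * D * \<sigma>" for n
  proof -
    have "(\<Sum>k<n. (real k + 1) / 2 ^ k) \<le> 4" unfolding sum_arith_geom by simp
    then have "17 * D * \<sigma> * (\<Sum>k<n. (real k + 1) / 2 ^ k) \<le> 17 * D * \<sigma> * 4"
      using D1 s by (intro mult_left_mono) auto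
    then show ?thesis using chain[of n] by simp
  qed
  \<comment> \<open>The last link leads from a net to the whole class. It is taken at a mesh so fine
    that even the logarithm of the size of the finite class is negligible.\<close>
  obtain n where n: "ln (real (card CC)) + 1 < 2 ^ n" using real_arch_pow[of 2 "ln (real (card CC)) + 1"] by auto
  have cCC: "0 < real (card CC)" using CC by (simp add: card_gt_0_iff)
  have "e CC \<le> e (F n) + (ln (real (card CC)) / (2 ^ n / \<sigma>) + (2 ^ n / \<sigma>) * (nsq I v / 4 ^ n))"
    unfolding e_def
    by (rule chain_step[OF I CC fF]) (use s F(4) cCC in auto)
  also have "(2 ^ n / \<sigma>) * (nsq I v / 4 ^ n) = \<sigma> / 2 ^ n"
  proof -
    have "(4 :: real) ^ n = 2 ^ n * 2 ^ n" by (simp add: power_mult_distrib[symmetric])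
    then show ?thesis using s by (simp add: power2_eq_square)
  qed
  also have "ln (real (card CC)) / (2 ^ n / \<sigma>) + \<sigma> / 2 ^ n = (ln (real (card CC)) + 1) / 2 ^ n * \<sigma>"
    using s by (simp add: field_simps)
  also have "\<dots> \<le> 1 * \<sigma>" using s n by (intro mult_right_mono) auto
  also have "1 * \<sigma> \<le> D * \<sigma>" using s D1 by (intro mult_right_mono) auto
  finally have "e CC \<le> 78 * D * \<sigma>" using chain'[of n] by simp
  also have "\<dots> \<le> 100 * D * \<sigma>" using s D1 by (intro mult_right_mono) auto
  finally show ?thesis by (simp add: e_def D_def \<sigma>_def)
qed

definition Kd :: "nat \<Rightarrow> real" where
  "Kd d = Kb (100 * (real d + 1)\<^sup>2)"

text \<open>Adding the negatives of the vectors turns absolute values into plain maxima and supplies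
  the symmetry required by \<open>bernoulli\<close>.\<close>

lemma vc_bernoulli:
  assumes I: "finite I" and CC: "finite CC" "CC \<noteq> {}"
    and vc: "\<And>B. B \<subseteq> I \<Longrightarrow> card B = Suc d \<Longrightarrow> \<not> shatters CC B"
    and J: "finite J" "J \<noteq> {}"
  shows "EE I (\<lambda>\<epsilon>. MAX p\<in>J \<times> CC. \<bar>lf I (res (snd p) (y (fst p))) \<epsilon>\<bar>)
    \<le> Kd d * EE I (\<lambda>\<epsilon>. MAX j\<in>J. \<bar>lf I (y j) \<epsilon>\<bar>)"
proof -
  interpret vc_bound I CC "100 * (real d + 1)\<^sup>2"
    using vc_chaining[OF I CC vc] I CC by unfold_locales auto
  define T where "T = y ` J \<union> (\<lambda>j i. - y j i) ` J"
  have T: "finite T" "T \<noteq> {}" using J by (auto simp: T_def)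
  have neg: "lf I (\<lambda>i. - t i) \<epsilon> = - lf I t \<epsilon>" "lf I (res C (\<lambda>i. - t i)) \<epsilon> = - lf I (res C t) \<epsilon>" for t C \<epsilon>
    by (auto simp: lf_def res_def sum_negf[symmetric] intro!: sum.cong)
  have JC: "finite (J \<times> CC)" "J \<times> CC \<noteq> {}" using J CC by auto
  have "EE I (\<lambda>\<epsilon>. MAX p\<in>J \<times> CC. \<bar>lf I (res (snd p) (y (fst p))) \<epsilon>\<bar>)
      \<le> EE I (\<lambda>\<epsilon>. MAX p\<in>T \<times> CC. lf I (res (snd p) (fst p)) \<epsilon>)"
  proof (intro EE_mono Max_le_all[OF JC])
    fix \<epsilon> :: "'a \<Rightarrow> real" and p assume p: "p \<in> J \<times> CC"
    have f: "finite (T \<times> CC)" using T CC by simp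
    have "lf I (res (snd p) (y (fst p))) \<epsilon> \<le> (MAX p\<in>T \<times> CC. lf I (res (snd p) (fst p)) \<epsilon>)"
      using Max_ge_at[OF f, of "(y (fst p), snd p)" "\<lambda>p. lf I (res (snd p) (fst p)) \<epsilon>"] p by (auto simp: T_def)
    moreover have "- lf I (res (snd p) (y (fst p))) \<epsilon> \<le> (MAX p\<in>T \<times> CC. lf I (res (snd p) (fst p)) \<epsilon>)"
      using Max_ge_at[OF f, of "(\<lambda>i. - y (fst p) i, snd p)" "\<lambda>p. lf I (res (snd p) (fst p)) \<epsilon>"] p
      by (auto simp: T_def neg)
    ultimately show "\<bar>lf I (res (snd p) (y (fst p))) \<epsilon>\<bar> \<le> (MAX p\<in>T \<times> CC. lf I (res (snd p) (fst p)) \<epsilon>)"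
      by linarith
  qed
  also have "\<dots> \<le> Kb (100 * (real d + 1)\<^sup>2) * bb I T"
    by (rule bernoulli[OF T]) (auto simp: T_def)
  also have "bb I T \<le> EE I (\<lambda>\<epsilon>. MAX j\<in>J. \<bar>lf I (y j) \<epsilon>\<bar>)"
  proof (intro EE_mono Max_le_all[OF T])
    fix \<epsilon> :: "'a \<Rightarrow> real" and t assume "t \<in> T"
    then obtain j where j: "j \<in> J" "t = y j \<or> t = (\<lambda>i. - y j i)" by (auto simp: T_def)
    then have "lf I t \<epsilon> \<le> \<bar>lf I (y j) \<epsilon>\<bar>" by (auto simp: neg)
    also have "\<dots> \<le> (MAX j\<in>J. \<bar>lf I (y j) \<epsilon>\<bar>)" by (rule Max_ge_at[OF J(1) j(1)])
    finally show "lf I t \<epsilon> \<le> (MAX j\<in>J. \<bar>lf I (y j) \<epsilon>\<bar>)" .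
  qed
  finally show ?thesis by (simp add: Kd_def Kb_def mult_left_mono)
qed

section \<open>Tails on the cube\<close>

definition pr :: "'i set \<Rightarrow> (('i \<Rightarrow> real) \<Rightarrow> bool) \<Rightarrow> real" where
  "pr I P = EE I (\<lambda>\<epsilon>. of_bool (P \<epsilon>))"

lemma pr_mono: "(\<And>\<epsilon>. \<epsilon> \<in> cube I \<Longrightarrow> P \<epsilon> \<Longrightarrow> Q \<epsilon>) \<Longrightarrow> pr I P \<le> pr I Q"
  unfolding pr_def by (intro EE_mono) auto

lemma pr_nonneg: "0 \<le> pr I P"
  unfolding pr_def by (intro EE_nonneg) auto

lemma pr_not: "finite I \<Longrightarrow> pr I (\<lambda>\<epsilon>. \<not> P \<epsilon>) = 1 - pr I P"
proof -
  assume I: "finite I"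
  have "pr I (\<lambda>\<epsilon>. \<not> P \<epsilon>) = EE I (\<lambda>\<epsilon>. 1 - of_bool (P \<epsilon>))"
    unfolding pr_def by (intro EE_cong) auto
  then show ?thesis using I by (simp add: EE_diff pr_def)
qed

lemma pr_le_1: "finite I \<Longrightarrow> pr I P \<le> 1"
  using pr_not[of I P] pr_nonneg[of I "\<lambda>\<epsilon>. \<not> P \<epsilon>"] by simp

lemma Max_abs_lf:
  assumes J: "finite J" "J \<noteq> {}"
  shows "(MAX j\<in>J. \<bar>lf I (y j) \<epsilon>\<bar>) = (MAX a\<in>J \<times> {-1, 1}. 0 + lf I (\<lambda>i. snd a * y (fst a) i) \<epsilon>)"
proof (rule antisym)
  have F: "finite (J \<times> {-1, 1 :: real})" "J \<times> {-1, 1 :: real} \<noteq> {}" using J by auto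
  show "(MAX j\<in>J. \<bar>lf I (y j) \<epsilon>\<bar>) \<le> (MAX a\<in>J \<times> {-1, 1}. 0 + lf I (\<lambda>i. snd a * y (fst a) i) \<epsilon>)"
  proof (rule Max_le_all[OF J])
    fix j assume j: "j \<in> J"
    show "\<bar>lf I (y j) \<epsilon>\<bar> \<le> (MAX a\<in>J \<times> {-1, 1}. 0 + lf I (\<lambda>i. snd a * y (fst a) i) \<epsilon>)"
      using Max_ge_at[OF F(1), of "(j, 1)" "\<lambda>a. 0 + lf I (\<lambda>i. snd a * y (fst a) i) \<epsilon>"]
        Max_ge_at[OF F(1), of "(j, -1)" "\<lambda>a. 0 + lf I (\<lambda>i. snd a * y (fst a) i) \<epsilon>"] j
      unfolding lf_scale by (auto simp: abs_le_iff)
  qed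
  show "(MAX a\<in>J \<times> {-1, 1}. 0 + lf I (\<lambda>i. snd a * y (fst a) i) \<epsilon>) \<le> (MAX j\<in>J. \<bar>lf I (y j) \<epsilon>\<bar>)"
  proof (rule Max_le_all[OF F])
    fix a assume a: "a \<in> J \<times> {-1, 1 :: real}"
    then have "0 + lf I (\<lambda>i. snd a * y (fst a) i) \<epsilon> \<le> \<bar>lf I (y (fst a)) \<epsilon>\<bar>"
      unfolding lf_scale by auto
    also have "\<dots> \<le> (MAX j\<in>J. \<bar>lf I (y j) \<epsilon>\<bar>)" using a by (intro Max_ge_at[OF J(1)]) auto
    finally show "0 + lf I (\<lambda>i. snd a * y (fst a) i) \<epsilon> \<le> (MAX j\<in>J. \<bar>lf I (y j) \<epsilon>\<bar>)" .
  qed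
qed

text \<open>With a the mean of \<open>Z\<close>, Khinchine's inequality bounds all
  \<open>nsq I (y j)\<close> by 16 a^2, so the exponential moment of \<open>Z\<close> at 1 / a is at
  most exp (1 + 16). The second moment is then at most \<open>2 * a\<^sup>2 * exp 17\<close>, and
  the classical argument applies.\<close>

lemma paley_zygmund_cube:
  fixes y :: "'j \<Rightarrow> 'i \<Rightarrow> real"
  assumes I: "finite I" and J: "finite J" "J \<noteq> {}"
  defines "Z \<equiv> \<lambda>\<epsilon>. MAX j\<in>J. \<bar>lf I (y j) \<epsilon>\<bar>"
  assumes A: "0 < EE I Z"
  shows "exp (- 17) / 8 \<le> pr I (\<lambda>\<epsilon>. EE I Z / 2 \<le> Z \<epsilon>)"
proof -
  define a where "a = EE I Z"
  have a0: "0 < a" using A by (simp add: a_def)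
  have Z0: "0 \<le> Z \<epsilon>" for \<epsilon>
    using J Max_ge_at[OF J(1), of _ "\<lambda>j. \<bar>lf I (y j) \<epsilon>\<bar>"] unfolding Z_def by (meson abs_ge_zero ex_in_conv order_trans)
  have nsq: "nsq I (y j) \<le> 16 * a\<^sup>2" if j: "j \<in> J" for j
  proof -
    have "EE I (\<lambda>\<epsilon>. \<bar>lf I (y j) \<epsilon>\<bar>) \<le> a"
      unfolding a_def Z_def by (intro EE_mono) (rule Max_ge_at[OF J(1) j])
    then have "sqrt (nsq I (y j)) \<le> 4 * a" using khinchine[OF I, of "y j"] by linarith
    then have "(sqrt (nsq I (y j)))\<^sup>2 \<le> (4 * a)\<^sup>2" by (intro power_mono) auto
    then show ?thesis by (simp add: power_mult_distrib)
  qed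
  have ZM: "Z = (\<lambda>\<epsilon>. MAX b\<in>J \<times> {-1, 1}. 0 + lf I (\<lambda>i. snd b * y (fst b) i) \<epsilon>)"
    unfolding Z_def by (rule ext) (rule Max_abs_lf[OF J])
  have "EE I (\<lambda>\<epsilon>. exp ((1 / a) * Z \<epsilon>)) \<le> exp ((1 / a) * EE I Z + (1 / a)\<^sup>2 * (16 * a\<^sup>2))"
    unfolding ZM
  proof (rule EE_exp_max_upper[OF I])
    fix b assume "b \<in> J \<times> {-1, 1 :: real}"
    then show "nsq I (\<lambda>i. snd b * y (fst b) i) \<le> 16 * a\<^sup>2" using nsq[of "fst b"] by (auto simp: nsq_scale)
  qed (use J a0 in auto)
  also have "(1 / a) * EE I Z + (1 / a)\<^sup>2 * (16 * a\<^sup>2) = 17"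
    using a0 by (simp add: a_def[symmetric] power_divide)
  finally have ex: "EE I (\<lambda>\<epsilon>. exp ((1 / a) * Z \<epsilon>)) \<le> exp 17" .
  have "EE I (\<lambda>\<epsilon>. (Z \<epsilon>)\<^sup>2 * (1 / (2 * a\<^sup>2))) \<le> EE I (\<lambda>\<epsilon>. exp ((1 / a) * Z \<epsilon>))"
  proof (rule EE_mono)
    fix \<epsilon> :: "'i \<Rightarrow> real"
    have x: "0 \<le> (1 / a) * Z \<epsilon>" using Z0 a0 by simp
    have "(Z \<epsilon>)\<^sup>2 * (1 / (2 * a\<^sup>2)) = ((1 / a) * Z \<epsilon>)\<^sup>2 / 2" by (simp add: power_mult_distrib power_divide)
    also have "\<dots> \<le> exp ((1 / a) * Z \<epsilon>)" using exp_lower_Taylor_quadratic[OF x] x by linarith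
    finally show "(Z \<epsilon>)\<^sup>2 * (1 / (2 * a\<^sup>2)) \<le> exp ((1 / a) * Z \<epsilon>)" .
  qed
  then have "EE I (\<lambda>\<epsilon>. (Z \<epsilon>)\<^sup>2) * (1 / (2 * a\<^sup>2)) \<le> exp 17" using ex unfolding EE_multc by linarith
  then have Z2: "EE I (\<lambda>\<epsilon>. (Z \<epsilon>)\<^sup>2) \<le> 2 * a\<^sup>2 * exp 17" using a0 by (simp add: field_simps)
  \<comment> \<open>Cauchy-Schwarz is used in the additive form Z \<le> rr Z^2 / 2 + 1 / (2 rr);
    this \<open>rr\<close> makes the bound for the first mean a / 4.\<close>
  define rr where "rr = exp (- 17) / (4 * a)"
  have l0: "0 < rr" using a0 by (simp add: rr_def)
  define p where "p = pr I (\<lambda>\<epsilon>. a / 2 \<le> Z \<epsilon>)"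
  have "EE I Z \<le> EE I (\<lambda>\<epsilon>. a / 2 + ((Z \<epsilon>)\<^sup>2 * (rr / 2) + of_bool (a / 2 \<le> Z \<epsilon>) * (1 / (2 * rr))))"
  proof (rule EE_mono)
    fix \<epsilon> :: "'i \<Rightarrow> real"
    show "Z \<epsilon> \<le> a / 2 + ((Z \<epsilon>)\<^sup>2 * (rr / 2) + of_bool (a / 2 \<le> Z \<epsilon>) * (1 / (2 * rr)))"
    proof (cases "a / 2 \<le> Z \<epsilon>")
      case True
      have "0 \<le> (rr * Z \<epsilon> - 1)\<^sup>2 / (2 * rr)" using l0 by simp
      also have "\<dots> = (Z \<epsilon>)\<^sup>2 * (rr / 2) + 1 / (2 * rr) - Z \<epsilon>"
        using l0 by (simp add: power2_eq_square field_simps)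
      finally show ?thesis using True a0 by simp
    next
      case False
      have "0 \<le> (Z \<epsilon>)\<^sup>2 * (rr / 2)" using l0 by simp
      then show ?thesis using False by simp
    qed
  qed
  also have "\<dots> = a / 2 + (EE I (\<lambda>\<epsilon>. (Z \<epsilon>)\<^sup>2) * (rr / 2) + p * (1 / (2 * rr)))"
    unfolding EE_add EE_multc p_def pr_def using I by simp
  also have "EE I (\<lambda>\<epsilon>. (Z \<epsilon>)\<^sup>2) * (rr / 2) \<le> (2 * a\<^sup>2 * exp 17) * (rr / 2)"
    using Z2 l0 by (intro mult_right_mono) auto
  also have "(2 * a\<^sup>2 * exp 17) * (rr / 2) = a / 4"
    using a0 by (simp add: rr_def exp_minus power2_eq_square field_simps)
  finally have "a / 4 \<le> p * (1 / (2 * rr))" by (simp add: a_def)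
  then have "a / 4 * (2 * rr) \<le> p" using l0 by (simp add: field_simps)
  moreover have "a / 4 * (2 * rr) = exp (- 17) / 8" using a0 by (simp add: rr_def)
  ultimately show ?thesis by (simp add: p_def a_def)
qed

section \<open>Independent copies of the cube\<close>

lemma EE_mult_disjoint:
  assumes "finite I" "finite J" "I \<inter> J = {}"
    and "\<And>\<epsilon> \<delta>. (\<And>i. i \<in> I \<Longrightarrow> \<epsilon> i = \<delta> i) \<Longrightarrow> g \<epsilon> = g \<delta>"
    and "\<And>\<epsilon> \<delta>. (\<And>i. i \<in> J \<Longrightarrow> \<epsilon> i = \<delta> i) \<Longrightarrow> h \<epsilon> = h \<delta>"
  shows "EE (I \<union> J) (\<lambda>\<epsilon>. g \<epsilon> * h \<epsilon>) = EE I g * EE J h"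
  using assms(1,3,4)
proof (induction I arbitrary: g rule: finite_induct)
  case empty
  have gc: "g \<epsilon> = g (\<lambda>_. undefined)" for \<epsilon> by (rule empty.prems(2)) simp
  have "EE J (\<lambda>\<epsilon>. g \<epsilon> * h \<epsilon>) = EE J (\<lambda>\<epsilon>. g (\<lambda>_. undefined) * h \<epsilon>)"
  proof (rule EE_cong)
    fix \<epsilon>
    show "g \<epsilon> * h \<epsilon> = g (\<lambda>_. undefined) * h \<epsilon>" by (subst gc[of \<epsilon>]) (rule refl)
  qed
  also have "\<dots> = g (\<lambda>_. undefined) * EE J h" by (rule EE_cmult)
  finally show ?case by (simp only: Un_empty_left EE_empty)
next
  case (insert i I)
  have iJ: "i \<notin> I \<union> J" using insert.hyps(2) insert.prems(1) by auto
  have hc: "h (\<epsilon>(i := c)) = h \<epsilon>" for \<epsilon> c by (rule assms(5)) (use iJ in auto)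
  have IH: "EE (I \<union> J) (\<lambda>\<epsilon>. g (\<epsilon>(i := c)) * h \<epsilon>) = EE I (\<lambda>\<epsilon>. g (\<epsilon>(i := c))) * EE J h" for c
  proof (rule insert.IH)
    show "I \<inter> J = {}" using insert.prems(1) by auto
    show "g (\<epsilon>(i := c)) = g (\<delta>(i := c))" if "\<And>k. k \<in> I \<Longrightarrow> \<epsilon> k = \<delta> k" for \<epsilon> \<delta>
      by (rule insert.prems(2)) (use that in auto)
  qed
  have "EE (insert i I \<union> J) (\<lambda>\<epsilon>. g \<epsilon> * h \<epsilon>)
      = (EE (I \<union> J) (\<lambda>\<epsilon>. g (\<epsilon>(i := 1)) * h \<epsilon>) + EE (I \<union> J) (\<lambda>\<epsilon>. g (\<epsilon>(i := -1)) * h \<epsilon>)) / 2"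
    using EE_insert[of "I \<union> J" i "\<lambda>\<epsilon>. g \<epsilon> * h \<epsilon>"] insert.hyps(1) assms(2) iJ by (simp add: hc)
  also have "\<dots> = EE (insert i I) g * EE J h"
    unfolding IH using insert.hyps by (simp add: EE_insert distrib_right)
  finally show ?case .
qed

lemma EE_reindex:
  assumes "finite I" "inj_on f I"
    and "\<And>\<epsilon> \<delta>. (\<And>i. i \<in> I \<Longrightarrow> \<epsilon> i = \<delta> i) \<Longrightarrow> g \<epsilon> = g \<delta>"
  shows "EE (f ` I) (\<lambda>\<epsilon>. g (\<lambda>i. \<epsilon> (f i))) = EE I g"
  using assms
proof (induction I arbitrary: g rule: finite_induct)
  case (insert i I)
  have fi: "f i \<notin> f ` I" "finite (f ` I)" using insert.prems(1) insert.hyps by (auto simp: inj_on_def)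
  have eq: "g (\<lambda>j. (\<epsilon>(f i := c)) (f j)) = g ((\<lambda>j. \<epsilon> (f j))(i := c))" for \<epsilon> c
  proof (rule insert.prems(2))
    fix j assume j: "j \<in> insert i I"
    show "(\<epsilon>(f i := c)) (f j) = ((\<lambda>j. \<epsilon> (f j))(i := c)) j"
    proof (cases "j = i")
      case False
      then have "f j \<in> f ` I" using j by simp
      then have "f j \<noteq> f i" using fi(1) by auto
      then show ?thesis using False by simp
    qed simp
  qed
  have IH: "EE (f ` I) (\<lambda>\<epsilon>. g ((\<lambda>j. \<epsilon> (f j))(i := c))) = EE I (\<lambda>\<epsilon>. g (\<epsilon>(i := c)))" for c
  proof (rule insert.IH)
    show "inj_on f I" using insert.prems(1) by simp
    show "g (\<epsilon>(i := c)) = g (\<delta>(i := c))" if "\<And>k. k \<in> I \<Longrightarrow> \<epsilon> k = \<delta> k" for \<epsilon> \<delta>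
      by (rule insert.prems(2)) (use that in auto)
  qed
  show ?case
    using EE_insert[OF fi(2,1), of "\<lambda>\<epsilon>. g (\<lambda>j. \<epsilon> (f j))"] EE_insert[OF insert.hyps, of g]
    by (simp only: image_insert eq IH)
qed simp

lemma EE_blocks:
  assumes I: "finite I" and g: "\<And>\<epsilon> \<delta>. (\<And>i. i \<in> I \<Longrightarrow> \<epsilon> i = \<delta> i) \<Longrightarrow> g \<epsilon> = g \<delta>"
  shows "EE (I \<times> {..<N}) (\<lambda>\<epsilon>. \<Prod>l<N. g (\<lambda>i. \<epsilon> (i, l))) = (EE I g) ^ N"
proof (induction N)
  case (Suc N)
  have split: "I \<times> {..<Suc N} = (\<lambda>i. (i, N)) ` I \<union> I \<times> {..<N}" by auto
  have "EE (I \<times> {..<Suc N}) (\<lambda>\<epsilon>. \<Prod>l<Suc N. g (\<lambda>i. \<epsilon> (i, l)))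
      = EE ((\<lambda>i. (i, N)) ` I \<union> I \<times> {..<N}) (\<lambda>\<epsilon>. g (\<lambda>i. \<epsilon> (i, N)) * (\<Prod>l<N. g (\<lambda>i. \<epsilon> (i, l))))"
    unfolding split by (simp add: mult.commute)
  also have "\<dots> = EE ((\<lambda>i. (i, N)) ` I) (\<lambda>\<epsilon>. g (\<lambda>i. \<epsilon> (i, N))) * EE (I \<times> {..<N}) (\<lambda>\<epsilon>. \<Prod>l<N. g (\<lambda>i. \<epsilon> (i, l)))"
  proof (rule EE_mult_disjoint)
    show "g (\<lambda>i. \<epsilon> (i, N)) = g (\<lambda>i. \<delta> (i, N))"
      if "\<And>q. q \<in> (\<lambda>i. (i, N)) ` I \<Longrightarrow> \<epsilon> q = \<delta> q" for \<epsilon> \<delta>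
      by (rule g) (use that in auto)
    show "(\<Prod>l<N. g (\<lambda>i. \<epsilon> (i, l))) = (\<Prod>l<N. g (\<lambda>i. \<delta> (i, l)))"
      if "\<And>q. q \<in> I \<times> {..<N} \<Longrightarrow> \<epsilon> q = \<delta> q" for \<epsilon> \<delta>
      by (intro prod.cong refl g) (use that in auto)
  qed (use I in auto)
  also have "EE ((\<lambda>i. (i, N)) ` I) (\<lambda>\<epsilon>. g (\<lambda>i. \<epsilon> (i, N))) = EE I g"
  proof (rule EE_reindex[OF I])
    show "inj_on (\<lambda>i. (i, N)) I" by (simp add: inj_on_def)
  qed (rule g)
  finally show ?case using Suc by simp
qed simp

lemma pr_blocks:
  assumes I: "finite I" and Q: "\<And>\<epsilon> \<delta>. (\<And>i. i \<in> I \<Longrightarrow> \<epsilon> i = \<delta> i) \<Longrightarrow> Q \<epsilon> = Q \<delta>"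
  shows "pr (I \<times> {..<N}) (\<lambda>\<epsilon>. \<exists>l<N. Q (\<lambda>i. \<epsilon> (i, l))) = 1 - (1 - pr I Q) ^ N"
proof -
  have "pr (I \<times> {..<N}) (\<lambda>\<epsilon>. \<not> (\<exists>l<N. Q (\<lambda>i. \<epsilon> (i, l))))
      = EE (I \<times> {..<N}) (\<lambda>\<epsilon>. \<Prod>l<N. of_bool (\<not> Q (\<lambda>i. \<epsilon> (i, l))))"
    unfolding pr_def
  proof (rule EE_cong)
    fix \<epsilon> :: "'a \<times> nat \<Rightarrow> real"
    show "of_bool (\<not> (\<exists>l<N. Q (\<lambda>i. \<epsilon> (i, l)))) = (\<Prod>l<N. of_bool (\<not> Q (\<lambda>i. \<epsilon> (i, l))) :: real)"
    proof (cases "\<exists>l<N. Q (\<lambda>i. \<epsilon> (i, l))")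
      case True
      then obtain l where "l < N" "Q (\<lambda>i. \<epsilon> (i, l))" by blast
      then have "(\<Prod>l<N. of_bool (\<not> Q (\<lambda>i. \<epsilon> (i, l))) :: real) = 0" by (intro prod_zero) auto
      then show ?thesis using True by simp
    next
      case False
      then have "(\<Prod>l<N. of_bool (\<not> Q (\<lambda>i. \<epsilon> (i, l))) :: real) = 1" by (intro prod.neutral) auto
      then show ?thesis using False by simp
    qed
  qed
  also have "\<dots> = (EE I (\<lambda>\<epsilon>. of_bool (\<not> Q \<epsilon>))) ^ N"
  proof (rule EE_blocks[OF I, of "\<lambda>\<epsilon>. of_bool (\<not> Q \<epsilon>)"])
    show "of_bool (\<not> Q \<epsilon>) = (of_bool (\<not> Q \<delta>) :: real)" if "\<And>i. i \<in> I \<Longrightarrow> \<epsilon> i = \<delta> i" for \<epsilon> \<delta>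
      using Q[OF that] by simp
  qed
  also have "EE I (\<lambda>\<epsilon>. of_bool (\<not> Q \<epsilon>)) = 1 - pr I Q" using pr_not[OF I, of Q] by (simp add: pr_def)
  finally have "1 - pr (I \<times> {..<N}) (\<lambda>\<epsilon>. \<exists>l<N. Q (\<lambda>i. \<epsilon> (i, l))) = (1 - pr I Q) ^ N"
    by (subst pr_not[symmetric]) (use I in auto)
  then show ?thesis by simp
qed

lemma Kd_ge: "8 \<le> Kd d"
proof -
  have "8 * 1 \<le> (100 * (real d + 1)\<^sup>2 + 8) * 2 ^ 200" by (intro mult_mono) auto
  moreover have "0 \<le> 8 * (100 * (real d + 1)\<^sup>2 + 7) * 2 ^ 234" by simp
  ultimately show ?thesis unfolding Kd_def Kb_def by linarith
qed

text \<open>A tail at \<open>v\<close> below the Paley-Zygmund probability forces the mean of the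
  plain maximum to be at most \<open>2 * v\<close>. \<open>vc_bernoulli\<close> carries this over to
  the class, and Markov's inequality finishes.\<close>

lemma cube_weak:
  assumes I: "finite I" and CC: "finite CC" "CC \<noteq> {}"
    and vc: "\<And>B. B \<subseteq> I \<Longrightarrow> card B = Suc d \<Longrightarrow> \<not> shatters CC B"
    and J: "finite J" "J \<noteq> {}" and v: "0 < v"
    and small: "pr I (\<lambda>\<epsilon>. \<exists>j\<in>J. v \<le> \<bar>lf I (y j) \<epsilon>\<bar>) < exp (- 17) / 8"
  shows "pr I (\<lambda>\<epsilon>. \<exists>j\<in>J. \<exists>C\<in>CC. 8 * Kd d * v \<le> \<bar>lf I (res C (y j)) \<epsilon>\<bar>) \<le> 1 / 4"
proof -
  define Z where "Z \<epsilon> = (MAX j\<in>J. \<bar>lf I (y j) \<epsilon>\<bar>)" for \<epsilon>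
  have "EE I Z \<le> 2 * v"
  proof (rule ccontr)
    assume "\<not> ?thesis"
    then have A: "2 * v < EE I Z" by simp
    have "exp (- 17) / 8 \<le> pr I (\<lambda>\<epsilon>. EE I Z / 2 \<le> Z \<epsilon>)"
      using paley_zygmund_cube[OF I J, of y] A v unfolding Z_def by linarith
    also have "\<dots> \<le> pr I (\<lambda>\<epsilon>. \<exists>j\<in>J. v \<le> \<bar>lf I (y j) \<epsilon>\<bar>)"
    proof (rule pr_mono)
      fix \<epsilon> assume "EE I Z / 2 \<le> Z \<epsilon>"
      then have "v \<le> Z \<epsilon>" using A by linarith
      then show "\<exists>j\<in>J. v \<le> \<bar>lf I (y j) \<epsilon>\<bar>"
        using Max_ex[OF J, of "\<lambda>j. \<bar>lf I (y j) \<epsilon>\<bar>"] unfolding Z_def by auto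
    qed
    finally show False using small by simp
  qed
  moreover have K: "8 \<le> Kd d" by (rule Kd_ge)
  ultimately have "Kd d * EE I Z \<le> Kd d * (2 * v)" by (intro mult_left_mono) auto
  moreover have "EE I (\<lambda>\<epsilon>. MAX p\<in>J \<times> CC. \<bar>lf I (res (snd p) (y (fst p))) \<epsilon>\<bar>) \<le> Kd d * EE I Z"
    unfolding Z_def by (rule vc_bernoulli[OF I CC vc J])
  moreover have "pr I (\<lambda>\<epsilon>. \<exists>j\<in>J. \<exists>C\<in>CC. 8 * Kd d * v \<le> \<bar>lf I (res C (y j)) \<epsilon>\<bar>) * (8 * Kd d * v)
      \<le> EE I (\<lambda>\<epsilon>. MAX p\<in>J \<times> CC. \<bar>lf I (res (snd p) (y (fst p))) \<epsilon>\<bar>)"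
    unfolding pr_def EE_multc[symmetric]
  proof (rule EE_mono)
    fix \<epsilon> :: "'a \<Rightarrow> real"
    have f: "finite (J \<times> CC)" using J CC by simp
    have ge: "\<bar>lf I (res C (y j)) \<epsilon>\<bar> \<le> (MAX p\<in>J \<times> CC. \<bar>lf I (res (snd p) (y (fst p))) \<epsilon>\<bar>)"
      if "j \<in> J" "C \<in> CC" for j C
      using Max_ge_at[OF f, of "(j, C)" "\<lambda>p. \<bar>lf I (res (snd p) (y (fst p))) \<epsilon>\<bar>"] that by simp
    obtain j C where "j \<in> J" "C \<in> CC" using J CC by blast
    then have "0 \<le> (MAX p\<in>J \<times> CC. \<bar>lf I (res (snd p) (y (fst p))) \<epsilon>\<bar>)"
      using ge order_trans[OF abs_ge_zero] by blast
    then show "of_bool (\<exists>j\<in>J. \<exists>C\<in>CC. 8 * Kd d * v \<le> \<bar>lf I (res C (y j)) \<epsilon>\<bar>) * (8 * Kd d * v)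
        \<le> (MAX p\<in>J \<times> CC. \<bar>lf I (res (snd p) (y (fst p))) \<epsilon>\<bar>)"
      using ge by (auto intro: order_trans)
  qed
  ultimately have "pr I (\<lambda>\<epsilon>. \<exists>j\<in>J. \<exists>C\<in>CC. 8 * Kd d * v \<le> \<bar>lf I (res C (y j)) \<epsilon>\<bar>) * (8 * Kd d * v)
      \<le> Kd d * (2 * v)" by linarith
  also have "Kd d * (2 * v) = (1 / 4) * (8 * Kd d * v)" by simp
  finally show ?thesis by (rule mult_right_le_imp_le) (use K v in simp)
qed

lemma lf_block:
  fixes l N :: nat
  assumes I: "finite I" and l: "l < N"
  shows "lf (I \<times> {..<N}) (\<lambda>q. if snd q = l then f (fst q) else 0) \<epsilon> = lf I f (\<lambda>i. \<epsilon> (i, l))"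
proof -
  have "lf (I \<times> {..<N}) (\<lambda>q. if snd q = l then f (fst q) else 0) \<epsilon>
      = (\<Sum>i\<in>I. \<Sum>m<N. if l = m then \<epsilon> (i, m) * f i else 0)"
    unfolding lf_def sum.cartesian_product by (intro sum.cong) auto
  also have "\<dots> = lf I f (\<lambda>i. \<epsilon> (i, l))" unfolding lf_def
  proof (rule sum.cong[OF refl])
    fix i
    show "(\<Sum>m<N. if l = m then \<epsilon> (i, m) * f i else 0) = \<epsilon> (i, l) * f i"
      using sum.delta'[of "{..<N}" l "\<lambda>m. \<epsilon> (i, m) * f i"] l by simp
  qed
  finally show ?thesis .
qed

lemma lf_cong: "(\<And>i. i \<in> I \<Longrightarrow> v i = w i) \<Longrightarrow> (\<And>i. i \<in> I \<Longrightarrow> \<epsilon> i = \<delta> i) \<Longrightarrow> lf I v \<epsilon> = lf I w \<delta>"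
  unfolding lf_def by (intro sum.cong) auto

text \<open>A set of the form \<open>C \<times> L\<close> cannot distinguish two copies of one
  index, so a shattered set contains at most one copy of each index and keeps its size under
  projection.\<close>

lemma shatters_blocks:
  assumes sh: "shatters ((\<lambda>C. C \<times> L) ` CC) B" and B: "B \<subseteq> I \<times> L"
  shows "shatters CC (fst ` B)" "inj_on fst B"
proof -
  show "shatters CC (fst ` B)"
    unfolding shatters_def
  proof (intro allI impI)
    fix S assume S: "S \<subseteq> fst ` B"
    have "\<exists>D\<in>(\<lambda>C. C \<times> L) ` CC. D \<inter> B = {b\<in>B. fst b \<in> S}" using sh unfolding shatters_def by simp
    then obtain C where C: "C \<in> CC" "(C \<times> L) \<inter> B = {b\<in>B. fst b \<in> S}" by blast
    have iff: "fst b \<in> C \<longleftrightarrow> fst b \<in> S" if "b \<in> B" for b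
    proof -
      have "b \<in> C \<times> L \<longleftrightarrow> fst b \<in> C" using that B by (cases b) auto
      moreover have "b \<in> (C \<times> L) \<inter> B \<longleftrightarrow> b \<in> {b\<in>B. fst b \<in> S}" unfolding C(2) ..
      ultimately show ?thesis using that by simp
    qed
    have "C \<inter> fst ` B = S" using S iff by auto
    then show "\<exists>C\<in>CC. C \<inter> fst ` B = S" using C(1) by (intro bexI[of _ C])
  qed
  show "inj_on fst B"
  proof (rule inj_onI)
    fix a b assume ab: "a \<in> B" "b \<in> B" "fst a = fst b"
    have "\<exists>D\<in>(\<lambda>C. C \<times> L) ` CC. D \<inter> B = {a}" using sh ab unfolding shatters_def by simp
    then obtain C where C: "(C \<times> L) \<inter> B = {a}" by blast
    have "a \<in> C \<times> L" using C by blast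
    then have "b \<in> C \<times> L" using ab B by (cases a; cases b) auto
    then have "b \<in> {a}" using C ab(2) by blast
    then show "a = b" by simp
  qed
qed

text \<open>\<open>8 * Kd d\<close> rescales the threshold in \<open>cube_weak\<close>, and
  \<open>8 * exp 17\<close> is the inverse of the Paley-Zygmund probability. The sum serves for both
  purposes.\<close>

definition K1 :: "nat \<Rightarrow> real" where "K1 d = 8 * Kd d + 8 * exp 17"

lemma K1_ge: "1 \<le> K1 d"
  using Kd_ge[of d] exp_gt_zero[of "17 :: real"] unfolding K1_def by linarith

text \<open>Tail comparison on the cube. The weak estimate is applied to \<open>N\<close> independent copies with
  \<open>N\<close> of the order of the inverse of the small tail; the copies share the class, so its order
  does not change.\<close>

lemma cube_tail:
  assumes I: "finite I" and CC: "finite CC" "CC \<noteq> {}"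
    and vc: "\<And>B. B \<subseteq> I \<Longrightarrow> card B = Suc d \<Longrightarrow> \<not> shatters CC B"
    and J: "finite J" "J \<noteq> {}" and v: "0 < v"
  shows "pr I (\<lambda>\<epsilon>. \<exists>j\<in>J. \<exists>C\<in>CC. K1 d * v \<le> \<bar>lf I (res C (y j)) \<epsilon>\<bar>)
    \<le> K1 d * pr I (\<lambda>\<epsilon>. \<exists>j\<in>J. v \<le> \<bar>lf I (y j) \<epsilon>\<bar>)"
proof -
  define Q where "Q \<epsilon> \<longleftrightarrow> (\<exists>j\<in>J. v \<le> \<bar>lf I (y j) \<epsilon>\<bar>)" for \<epsilon>
  define Q' where "Q' \<epsilon> \<longleftrightarrow> (\<exists>j\<in>J. \<exists>C\<in>CC. 8 * Kd d * v \<le> \<bar>lf I (res C (y j)) \<epsilon>\<bar>)" for \<epsilon>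
  define p where "p = pr I Q"
  define p' where "p' = pr I Q'"
  define c where "c = exp (- 17) / (8 :: real)"
  have c0: "0 < c" by (simp add: c_def)
  have p01: "0 \<le> p" "p \<le> 1" "0 \<le> p'" "p' \<le> 1"
    unfolding p_def p'_def using pr_nonneg pr_le_1[OF I] by auto
  have Qd: "Q \<epsilon> = Q \<delta>" if "\<And>i. i \<in> I \<Longrightarrow> \<epsilon> i = \<delta> i" for \<epsilon> \<delta>
    unfolding Q_def using lf_cong[OF refl that, of I] by simp
  have Q'd: "Q' \<epsilon> = Q' \<delta>" if "\<And>i. i \<in> I \<Longrightarrow> \<epsilon> i = \<delta> i" for \<epsilon> \<delta>
    unfolding Q'_def using lf_cong[OF refl that, of I] by simp
  \<comment> \<open>If the small tail, summed over the copies, is below \<open>c\<close>, then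
    \<open>cube_weak\<close> bounds by 1/4 the probability that some copy is large. So (1 - p')^N
    \<ge> 3/4, and this forces N p' < 1/2.\<close>
  have N: "real N * p' < 1 / 2" if N: "0 < N" "real N * p < c" for N
  proof -
    define y' where "y' jl q = (if snd q = snd jl then y (fst jl) (fst q) else 0)" for jl :: "'b \<times> nat" and q :: "'a \<times> nat"
    define IN where "IN = I \<times> {..<N}"
    define CN where "CN = (\<lambda>C. C \<times> {..<N}) ` CC"
    have lfy: "lf IN (y' (j, l)) \<epsilon> = lf I (y j) (\<lambda>i. \<epsilon> (i, l))" if "l < N" for j l \<epsilon>
      unfolding IN_def y'_def fst_conv snd_conv by (rule lf_block[OF I that])
    have lfC: "lf IN (res (C \<times> {..<N}) (y' (j, l))) \<epsilon> = lf I (res C (y j)) (\<lambda>i. \<epsilon> (i, l))" if "l < N" for C j l \<epsilon>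
    proof -
      have "lf IN (res (C \<times> {..<N}) (y' (j, l))) \<epsilon> = lf IN (\<lambda>q. if snd q = l then res C (y j) (fst q) else 0) \<epsilon>"
        by (rule lf_cong) (auto simp: IN_def res_def y'_def)
      then show ?thesis unfolding IN_def using lf_block[OF I that, of "res C (y j)"] by simp
    qed
    have "pr IN (\<lambda>\<epsilon>. \<exists>jl\<in>J \<times> {..<N}. v \<le> \<bar>lf IN (y' jl) \<epsilon>\<bar>) = pr IN (\<lambda>\<epsilon>. \<exists>l<N. Q (\<lambda>i. \<epsilon> (i, l)))"
      by (rule arg_cong[where f = "pr IN"]) (auto simp: Q_def lfy)
    also have "\<dots> = 1 - (1 - p) ^ N" unfolding IN_def p_def by (rule pr_blocks[OF I Qd])
    also have "\<dots> \<le> real N * p" using Bernoulli_inequality[of "- p" N] p01 by simp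
    also have "\<dots> < exp (- 17) / 8" using N by (simp add: c_def)
    finally have small: "pr IN (\<lambda>\<epsilon>. \<exists>jl\<in>J \<times> {..<N}. v \<le> \<bar>lf IN (y' jl) \<epsilon>\<bar>) < exp (- 17) / 8" .
    have "pr IN (\<lambda>\<epsilon>. \<exists>jl\<in>J \<times> {..<N}. \<exists>C\<in>CN. 8 * Kd d * v \<le> \<bar>lf IN (res C (y' jl)) \<epsilon>\<bar>) \<le> 1 / 4"
    proof (rule cube_weak[OF _ _ _ _ _ _ v small])
      fix B assume B: "B \<subseteq> IN" "card B = Suc d"
      show "\<not> shatters CN B"
      proof
        assume "shatters CN B"
        then have sh: "shatters CC (fst ` B)" "inj_on fst B"
          using shatters_blocks[of "{..<N}" CC B I] B(1) by (auto simp: CN_def IN_def)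
        have "fst ` B \<subseteq> I" using B(1) by (auto simp: IN_def)
        moreover have "card (fst ` B) = Suc d" using B(2) card_image[OF sh(2)] by simp
        ultimately show False using vc[of "fst ` B"] sh(1) by simp
      qed
    qed (use I CC J N in \<open>auto simp: IN_def CN_def\<close>)
    also have "pr IN (\<lambda>\<epsilon>. \<exists>jl\<in>J \<times> {..<N}. \<exists>C\<in>CN. 8 * Kd d * v \<le> \<bar>lf IN (res C (y' jl)) \<epsilon>\<bar>)
        = pr IN (\<lambda>\<epsilon>. \<exists>l<N. Q' (\<lambda>i. \<epsilon> (i, l)))"
      by (rule arg_cong[where f = "pr IN"]) (auto simp: Q'_def CN_def lfC)
    also have "\<dots> = 1 - (1 - p') ^ N" unfolding IN_def p'_def by (rule pr_blocks[OF I Q'd])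
    finally have "3 / 4 \<le> (1 - p') ^ N" by simp
    also have "\<dots> \<le> exp (- p') ^ N" using exp_ge_add_one_self[of "- p'"] p01 by (intro power_mono) auto
    also have "\<dots> = exp (- (real N * p'))" by (simp add: exp_of_nat_mult[symmetric])
    finally have e: "3 / 4 \<le> exp (- (real N * p'))" .
    show ?thesis
    proof (rule ccontr)
      assume "\<not> ?thesis"
      then have "exp (- (real N * p')) \<le> exp (- (1 / 2))" by simp
      also have "\<dots> \<le> 2 / 3" using exp_ge_add_one_self[of "1 / 2 :: real"] by (simp add: exp_minus field_simps)
      finally show False using e by simp
    qed
  qed
  have "p' * c \<le> p"
  proof (cases "c \<le> p")
    case True
    have "p' * c \<le> 1 * c" using p01 c0 by (intro mult_right_mono) auto
    then show ?thesis using True by simp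
  next
    case False
    show ?thesis
    \<comment> \<open>For p = 0 any number of copies is admissible, which forces p' = 0.\<close>
    proof (cases "p = 0")
      case True
      have "p' = 0"
      proof (rule ccontr)
        assume "p' \<noteq> 0"
        then have "0 < p'" using p01 by simp
        then obtain n where "1 < real n * p'" using reals_Archimedean3 by blast
        moreover from this have "0 < n" by (cases n) auto
        ultimately show False using N[of n] True c0 by simp
      qed
      then show ?thesis using p01 by simp
    next
      case nz: False
      then have p0: "0 < p" using p01 by simp
      \<comment> \<open>The largest number of copies with n p < c. Since p < c it is at least 1, and
        therefore c \<le> (n + 1) p \<le> 2 n p.\<close>
      define n where "n = nat (\<lceil>c / p\<rceil> - 1)"
      have gt: "1 < c / p" using False p0 by simp
      then have "1 < \<lceil>c / p\<rceil>" by (simp add: less_ceiling_iff)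
      then have n: "real n = of_int \<lceil>c / p\<rceil> - 1" "0 < n" by (simp_all add: n_def)
      have "real n < c / p" "c / p \<le> real n + 1" using n(1) by linarith+
      then have np: "real n * p < c" "c \<le> (real n + 1) * p" using p0 by (simp_all add: field_simps)
      have "p' * c \<le> p' * ((real n + 1) * p)" using np(2) p01 by (intro mult_left_mono) auto
      also have "\<dots> \<le> p' * ((2 * real n) * p)" using n(2) p01 by (intro mult_left_mono mult_right_mono) auto
      also have "\<dots> = (2 * (real n * p')) * p" by simp
      also have "\<dots> \<le> 1 * p" using N[OF n(2) np(1)] p01 by (intro mult_right_mono) auto
      finally show ?thesis by simp
    qed
  qed
  then have "p' \<le> 8 * exp 17 * p" by (simp add: c_def exp_minus field_simps)
  also have "\<dots> \<le> K1 d * p" using Kd_ge[of d] p01 by (intro mult_right_mono) (auto simp: K1_def)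
  finally have "p' \<le> K1 d * p" .
  moreover have "pr I (\<lambda>\<epsilon>. \<exists>j\<in>J. \<exists>C\<in>CC. K1 d * v \<le> \<bar>lf I (res C (y j)) \<epsilon>\<bar>) \<le> p'"
    unfolding p'_def Q'_def
  proof (rule pr_mono)
    fix \<epsilon> assume "\<exists>j\<in>J. \<exists>C\<in>CC. K1 d * v \<le> \<bar>lf I (res C (y j)) \<epsilon>\<bar>"
    moreover have "8 * Kd d * v \<le> K1 d * v" using v by (intro mult_right_mono) (auto simp: K1_def)
    ultimately show "\<exists>j\<in>J. \<exists>C\<in>CC. 8 * Kd d * v \<le> \<bar>lf I (res C (y j)) \<epsilon>\<bar>"
      by (meson order_trans)
  qed
  ultimately show ?thesis unfolding p_def Q_def by linarith
qed

section \<open>Symmetric families\<close>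

abbreviation RN :: "(nat \<Rightarrow> real) measure" where
  "RN \<equiv> PiM UNIV (\<lambda>_. borel)"

lemma RN_measurable:
  assumes "\<And>k. (\<lambda>\<omega>. f \<omega> k) \<in> borel_measurable M"
  shows "f \<in> M \<rightarrow>\<^sub>M RN"
proof -
  have "(\<lambda>\<omega> k. f \<omega> k) \<in> M \<rightarrow>\<^sub>M RN"
  proof (rule measurable_PiM_single')
    show "(\<lambda>\<omega>. f \<omega> k) \<in> borel_measurable M" for k by (rule assms)
    show "(\<lambda>\<omega> k. f \<omega> k) \<in> space M \<rightarrow> (\<Pi>\<^sub>E k\<in>UNIV. space borel)" by simp
  qed
  then show ?thesis .
qed

lemma RN_coord: "f \<in> M \<rightarrow>\<^sub>M RN \<Longrightarrow> (\<lambda>\<omega>. f \<omega> k) \<in> borel_measurable M"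
  by (rule measurable_compose[OF _ measurable_component_singleton]) (assumption, simp)

lemma space_RN [simp]: "space RN = UNIV"
  by (simp add: space_PiM)

lemma RN_scale: "(\<lambda>z k. c * z k) \<in> RN \<rightarrow>\<^sub>M RN"
  by (rule RN_measurable) measurable

text \<open>Values are coordinate sequences from here on: the event that a norm is large then
  becomes a countable union of events for single coordinates. The index set follows the convention
  of \<open>partial_sum\<close>.\<close>

definition SS :: "('i \<Rightarrow> 'w \<Rightarrow> nat \<Rightarrow> real) \<Rightarrow> 'i set \<Rightarrow> 'w \<Rightarrow> nat \<Rightarrow> real" where
  "SS \<xi> C \<omega> k = (\<Sum>i\<in>{i\<in>C. \<xi> i \<omega> \<noteq> (\<lambda>_. 0)}. \<xi> i \<omega> k)"

context prob_space
begin

text \<open>By independence both laws are products of their marginals, and no marginal changes under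
  its sign.\<close>

lemma sign_flip_law:
  assumes I: "I \<noteq> {}" and ind: "indep_vars (\<lambda>_. RN) \<xi> I" and rv: "\<And>i. i \<in> I \<Longrightarrow> \<xi> i \<in> M \<rightarrow>\<^sub>M RN"
    and sym: "\<And>i. i \<in> I \<Longrightarrow> distr M RN (\<xi> i) = distr M RN (\<lambda>\<omega> k. - \<xi> i \<omega> k)"
    and e: "\<And>i. i \<in> I \<Longrightarrow> \<epsilon> i = 1 \<or> \<epsilon> i = - 1"
  shows "distr M (PiM I (\<lambda>_. RN)) (\<lambda>\<omega>. \<lambda>i\<in>I. (\<lambda>k. \<epsilon> i * \<xi> i \<omega> k))
    = distr M (PiM I (\<lambda>_. RN)) (\<lambda>\<omega>. \<lambda>i\<in>I. \<xi> i \<omega>)"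
proof -
  have rve: "(\<lambda>\<omega> k. \<epsilon> i * \<xi> i \<omega> k) \<in> M \<rightarrow>\<^sub>M RN" if "i \<in> I" for i
    using measurable_compose[OF rv[OF that] RN_scale[of "\<epsilon> i"]] .
  have inde: "indep_vars (\<lambda>_. RN) (\<lambda>i \<omega> k. \<epsilon> i * \<xi> i \<omega> k) I"
    by (rule indep_vars_compose2[OF ind, where Y = "\<lambda>i z k. \<epsilon> i * z k"]) (rule RN_scale)
  have "distr M (PiM I (\<lambda>_. RN)) (\<lambda>\<omega>. \<lambda>i\<in>I. (\<lambda>k. \<epsilon> i * \<xi> i \<omega> k))
      = PiM I (\<lambda>i. distr M RN (\<lambda>\<omega> k. \<epsilon> i * \<xi> i \<omega> k))"
    using indep_vars_iff_distr_eq_PiM'[OF I, where M' = "\<lambda>_. RN" and X = "\<lambda>i \<omega> k. \<epsilon> i * \<xi> i \<omega> k"] rve inde by simp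
  also have "\<dots> = PiM I (\<lambda>i. distr M RN (\<xi> i))"
  proof (rule PiM_cong[OF refl])
    fix i assume i: "i \<in> I"
    show "distr M RN (\<lambda>\<omega> k. \<epsilon> i * \<xi> i \<omega> k) = distr M RN (\<xi> i)"
      using e[OF i] sym[OF i] by auto
  qed
  also have "\<dots> = distr M (PiM I (\<lambda>_. RN)) (\<lambda>\<omega>. \<lambda>i\<in>I. \<xi> i \<omega>)"
    using indep_vars_iff_distr_eq_PiM'[OF I, where M' = "\<lambda>_. RN" and X = \<xi>] rv ind by simp
  finally show ?thesis .
qed

text \<open>Fixed signs change neither probability, so both may be averaged over the signs. Under
  the integral this leaves \<open>cube_tail\<close> for the vectors frozen at \<omega>. The class
  \<open>{UNIV}\<close> gives the two events a common shape.\<close>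

lemma sym_finite:
  assumes I: "finite I" and CC: "finite CC" "CC \<noteq> {}"
    and vc: "\<And>B. B \<subseteq> I \<Longrightarrow> card B = Suc d \<Longrightarrow> \<not> shatters CC B"
    and ind: "I \<noteq> {} \<Longrightarrow> indep_vars (\<lambda>_. RN) \<xi> I" and rv: "\<And>i. i \<in> I \<Longrightarrow> \<xi> i \<in> M \<rightarrow>\<^sub>M RN"
    and sym: "\<And>i. i \<in> I \<Longrightarrow> distr M RN (\<xi> i) = distr M RN (\<lambda>\<omega> k. - \<xi> i \<omega> k)"
    and v: "0 < v"
  shows "prob {\<omega>\<in>space M. \<exists>k\<in>{..<n}. \<exists>C\<in>CC. K1 d * v \<le> \<bar>\<Sum>i\<in>I \<inter> C. \<xi> i \<omega> k\<bar>}
    \<le> K1 d * prob {\<omega>\<in>space M. \<exists>k\<in>{..<n}. \<exists>C\<in>{UNIV}. v \<le> \<bar>\<Sum>i\<in>I \<inter> C. \<xi> i \<omega> k\<bar>}"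
proof (cases "I = {} \<or> n = 0")
  case True
  have "0 < K1 d * v" using K1_ge[of d] v by simp
  then have "{\<omega>\<in>space M. \<exists>k\<in>{..<n}. \<exists>C\<in>CC. K1 d * v \<le> \<bar>\<Sum>i\<in>I \<inter> C. \<xi> i \<omega> k\<bar>} = {}" using True by auto
  moreover have "0 \<le> K1 d * prob {\<omega>\<in>space M. \<exists>k\<in>{..<n}. \<exists>C\<in>{UNIV}. v \<le> \<bar>\<Sum>i\<in>I \<inter> C. \<xi> i \<omega> k\<bar>}"
    using K1_ge[of d] by simp
  ultimately show ?thesis by (simp only: measure_empty)
next
  case False
  then have Ine: "I \<noteq> {}" and n: "n \<noteq> 0" by auto
  define A where "A DD t \<epsilon> = {\<omega>\<in>space M. \<exists>k\<in>{..<n}. \<exists>C\<in>DD. t \<le> \<bar>\<Sum>i\<in>I \<inter> C. \<epsilon> i * \<xi> i \<omega> k\<bar>}" for DD t \<epsilon>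
  define E where "E DD t = {x\<in>space (PiM I (\<lambda>_. RN)). \<exists>k\<in>{..<n}. \<exists>C\<in>DD. t \<le> \<bar>\<Sum>i\<in>I \<inter> C. x i k\<bar>}" for DD t
  have co: "(\<lambda>x. x i k) \<in> borel_measurable (PiM I (\<lambda>_. RN))" if "i \<in> I" for i k
    using RN_coord[OF measurable_component_singleton[OF that, of "\<lambda>_. RN"], of k] by simp
  have Em: "E DD t \<in> sets (PiM I (\<lambda>_. RN))" if "finite DD" for DD t
  proof -
    have [measurable]: "(\<lambda>x. \<Sum>i\<in>I \<inter> C. x i k) \<in> borel_measurable (PiM I (\<lambda>_. RN))" for C k
      by (rule borel_measurable_sum) (use co in blast)
    have "E DD t = (\<Union>k\<in>{..<n}. \<Union>C\<in>DD. {x\<in>space (PiM I (\<lambda>_. RN)). t \<le> \<bar>\<Sum>i\<in>I \<inter> C. x i k\<bar>})"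
      by (auto simp: E_def)
    also have "\<dots> \<in> sets (PiM I (\<lambda>_. RN))"
      by (intro sets.finite_UN that finite_lessThan) measurable
    finally show ?thesis .
  qed
  have Xm: "(\<lambda>\<omega>. \<lambda>i\<in>I. (\<lambda>k. \<epsilon> i * \<xi> i \<omega> k)) \<in> M \<rightarrow>\<^sub>M PiM I (\<lambda>_. RN)" for \<epsilon>
    by (rule measurable_restrict) (rule measurable_compose[OF rv RN_scale])
  have AE: "A DD t \<epsilon> = (\<lambda>\<omega>. \<lambda>i\<in>I. (\<lambda>k. \<epsilon> i * \<xi> i \<omega> k)) -` E DD t \<inter> space M" for DD t \<epsilon>
  proof -
    have "(\<Sum>i\<in>I \<inter> C. (\<lambda>i\<in>I. (\<lambda>k. \<epsilon> i * \<xi> i \<omega> k)) i k) = (\<Sum>i\<in>I \<inter> C. \<epsilon> i * \<xi> i \<omega> k)" for C k \<omega>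
      by (intro sum.cong) auto
    then show ?thesis using measurable_space[OF Xm[of \<epsilon>]] unfolding A_def E_def by auto
  qed
  have Am: "A DD t \<epsilon> \<in> events" if "finite DD" for DD t \<epsilon>
    unfolding AE by (rule measurable_sets[OF Xm Em[OF that]])
  have flip: "prob (A DD t \<epsilon>) = prob (A DD t (\<lambda>_. 1))" if fD: "finite DD" and e: "\<epsilon> \<in> cube I" for DD t \<epsilon>
  proof -
    have "distr M (PiM I (\<lambda>_. RN)) (\<lambda>\<omega>. \<lambda>i\<in>I. (\<lambda>k. \<epsilon> i * \<xi> i \<omega> k))
        = distr M (PiM I (\<lambda>_. RN)) (\<lambda>\<omega>. \<lambda>i\<in>I. (\<lambda>k. 1 * \<xi> i \<omega> k))"
      using sign_flip_law[OF Ine ind[OF Ine] rv sym cube_coord[OF e]] by simp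
    then have "measure (distr M (PiM I (\<lambda>_. RN)) (\<lambda>\<omega>. \<lambda>i\<in>I. (\<lambda>k. \<epsilon> i * \<xi> i \<omega> k))) (E DD t)
        = measure (distr M (PiM I (\<lambda>_. RN)) (\<lambda>\<omega>. \<lambda>i\<in>I. (\<lambda>k. 1 * \<xi> i \<omega> k))) (E DD t)" by (rule arg_cong)
    then show ?thesis
      unfolding measure_distr[OF Xm[of \<epsilon>] Em[OF fD]] measure_distr[OF Xm[of "\<lambda>_. 1"] Em[OF fD]] AE by simp
  qed
  have fc: "finite (cube I)" using I by simp
  have avg: "prob (A DD t (\<lambda>_. 1)) = (\<integral>\<omega>. EE I (\<lambda>\<epsilon>. indicator (A DD t \<epsilon>) \<omega>) \<partial>M)"
    and int: "integrable M (\<lambda>\<omega>. EE I (\<lambda>\<epsilon>. indicator (A DD t \<epsilon>) \<omega>))" if fD: "finite DD" for DD t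
  proof -
    have i1: "integrable M (\<lambda>\<omega>. indicator (A DD t \<epsilon>) \<omega> :: real)" for \<epsilon>
      by (rule integrable_real_indicator) (use Am[OF fD] in \<open>auto simp: emeasure_eq_measure\<close>)
    show "integrable M (\<lambda>\<omega>. EE I (\<lambda>\<epsilon>. indicator (A DD t \<epsilon>) \<omega>))" unfolding EE_def using i1 by simp
    have "prob (A DD t (\<lambda>_. 1)) = EE I (\<lambda>\<epsilon>. prob (A DD t (\<lambda>_. 1)))" using I by simp
    also have "\<dots> = EE I (\<lambda>\<epsilon>. prob (A DD t \<epsilon>))" by (rule EE_cong) (rule flip[OF fD, symmetric])
    also have "\<dots> = (\<integral>\<omega>. EE I (\<lambda>\<epsilon>. indicator (A DD t \<epsilon>) \<omega>) \<partial>M)"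
      unfolding EE_def using i1 Am[OF fD] by simp
    finally show "prob (A DD t (\<lambda>_. 1)) = (\<integral>\<omega>. EE I (\<lambda>\<epsilon>. indicator (A DD t \<epsilon>) \<omega>) \<partial>M)" .
  qed
  have lfr: "lf I (res C y) \<epsilon> = (\<Sum>i\<in>I \<inter> C. \<epsilon> i * y i)" for C y \<epsilon>
    unfolding lf_def sum.inter_restrict[OF I] by (intro sum.cong) (auto simp: res_def)
  have pt: "EE I (\<lambda>\<epsilon>. indicator (A CC (K1 d * v) \<epsilon>) \<omega>) \<le> K1 d * EE I (\<lambda>\<epsilon>. indicator (A {UNIV} v \<epsilon>) \<omega>)"
    if w: "\<omega> \<in> space M" for \<omega>
  proof -
    have "EE I (\<lambda>\<epsilon>. indicator (A CC (K1 d * v) \<epsilon>) \<omega>)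
        = pr I (\<lambda>\<epsilon>. \<exists>k\<in>{..<n}. \<exists>C\<in>CC. K1 d * v \<le> \<bar>lf I (res C (\<lambda>i. \<xi> i \<omega> k)) \<epsilon>\<bar>)"
      unfolding pr_def lfr by (rule EE_cong) (simp add: A_def w indicator_def)
    also have "\<dots> \<le> K1 d * pr I (\<lambda>\<epsilon>. \<exists>k\<in>{..<n}. v \<le> \<bar>lf I (\<lambda>i. \<xi> i \<omega> k) \<epsilon>\<bar>)"
      by (rule cube_tail[OF I CC vc _ _ v, where y = "\<lambda>k i. \<xi> i \<omega> k"]) (use n in auto)
    also have "pr I (\<lambda>\<epsilon>. \<exists>k\<in>{..<n}. v \<le> \<bar>lf I (\<lambda>i. \<xi> i \<omega> k) \<epsilon>\<bar>) = EE I (\<lambda>\<epsilon>. indicator (A {UNIV} v \<epsilon>) \<omega>)"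
      unfolding pr_def lf_def by (rule EE_cong) (simp add: A_def w indicator_def)
    finally show ?thesis .
  qed
  have "prob (A CC (K1 d * v) (\<lambda>_. 1)) \<le> (\<integral>\<omega>. K1 d * EE I (\<lambda>\<epsilon>. indicator (A {UNIV} v \<epsilon>) \<omega>) \<partial>M)"
    unfolding avg[OF CC(1)] by (rule integral_mono) (use int CC(1) pt in auto)
  also have "\<dots> = K1 d * prob (A {UNIV} v (\<lambda>_. 1))" using int[of "{UNIV}" v] by (simp add: avg)
  finally show ?thesis by (simp add: A_def)
qed

text \<open>The limit of truncated sums that are replaced by 0 as long as a nonzero term lies beyond
  the truncation. If infinitely many terms are nonzero all truncations are 0, in agreement with the
  value of a sum over an infinite set.\<close>

lemma SS_measurable:
  fixes \<xi> :: "nat \<Rightarrow> 'a \<Rightarrow> nat \<Rightarrow> real"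
  assumes rv: "\<And>i. \<xi> i \<in> M \<rightarrow>\<^sub>M RN"
  shows "(\<lambda>\<omega>. SS \<xi> C \<omega> k) \<in> borel_measurable M"
proof (rule borel_measurable_LIMSEQ_real)
  note RN_coord[OF rv, measurable]
  define f where "f n \<omega> = (if \<forall>i. i \<in> C \<longrightarrow> n \<le> i \<longrightarrow> (\<forall>k. \<xi> i \<omega> k = 0)
    then \<Sum>i\<in>C \<inter> {..<n}. \<xi> i \<omega> k else 0)" for n \<omega>
  show "f n \<in> borel_measurable M" for n unfolding f_def by measurable
  show "(\<lambda>n. f n \<omega>) \<longlonglongrightarrow> SS \<xi> C \<omega> k" if "\<omega> \<in> space M" for \<omega>
  proof (cases "finite {i\<in>C. \<xi> i \<omega> \<noteq> (\<lambda>_. 0)}")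
    case True
    then obtain N where N: "\<forall>i\<in>{i\<in>C. \<xi> i \<omega> \<noteq> (\<lambda>_. 0)}. i < N" unfolding finite_nat_set_iff_bounded by blast
    have "f n \<omega> = SS \<xi> C \<omega> k" if n: "N \<le> n" for n
    proof -
      have z: "\<xi> i \<omega> k = 0" if "i \<in> C" "n \<le> i" for i k
      proof -
        have "\<xi> i \<omega> = (\<lambda>_. 0)" using N n that by force
        then show ?thesis by simp
      qed
      have "f n \<omega> = (\<Sum>i\<in>C \<inter> {..<n}. \<xi> i \<omega> k)" using z by (simp add: f_def)
      also have "\<dots> = SS \<xi> C \<omega> k"
        unfolding SS_def using N n by (intro sum.mono_neutral_right) (auto simp: fun_eq_iff intro: less_le_trans)
      finally show ?thesis .
    qed
    then have "eventually (\<lambda>n. f n \<omega> = SS \<xi> C \<omega> k) sequentially"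
      by (auto simp: eventually_sequentially)
    then show ?thesis by (rule tendsto_eventually)
  next
    case False
    have "f n \<omega> = 0" for n
    proof -
      have "\<not> {i\<in>C. \<xi> i \<omega> \<noteq> (\<lambda>_. 0)} \<subseteq> {..<n}" using False finite_subset by blast
      then obtain i where "i \<in> {i\<in>C. \<xi> i \<omega> \<noteq> (\<lambda>_. 0)}" "i \<notin> {..<n}" by blast
      then have i: "i \<in> C" "\<xi> i \<omega> \<noteq> (\<lambda>_. 0)" "n \<le> i" by simp_all
      then have "\<not> (\<forall>i. i \<in> C \<longrightarrow> n \<le> i \<longrightarrow> (\<forall>k. \<xi> i \<omega> k = 0))" by (metis ext)
      then show ?thesis unfolding f_def by (rule if_not_P)
    qed
    then show ?thesis using False by (simp add: SS_def)
  qed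
qed

lemma finite_support_event:
  fixes \<xi> :: "nat \<Rightarrow> 'a \<Rightarrow> nat \<Rightarrow> real"
  assumes rv: "\<And>i. \<xi> i \<in> M \<rightarrow>\<^sub>M RN" and fin: "AE \<omega> in M. finite {i\<in>I. \<xi> i \<omega> \<noteq> (\<lambda>_. 0)}"
  defines "G \<equiv> {\<omega>\<in>space M. finite {i\<in>I. \<xi> i \<omega> \<noteq> (\<lambda>_. 0)}}"
  shows "G \<in> events" "prob G = 1"
proof -
  note RN_coord[OF rv, measurable]
  show G: "G \<in> events" unfolding G_def fun_eq_iff by measurable
  show "prob G = 1"
    by (subst prob_eq_1[OF G]) (use fin in \<open>auto simp: G_def\<close>)
qed

lemma prob_le_Int:
  assumes "A \<in> events" "G \<in> events" "prob G = 1" "B \<in> events" "A \<inter> G \<subseteq> B"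
  shows "prob A \<le> prob B"
proof -
  have "AE \<omega> in M. \<omega> \<in> G" using assms(2,3) by (simp add: AE_in_set_eq_1)
  then have "prob A \<le> prob B" using assms by (intro finite_measure_mono_AE) auto
  then show ?thesis .
qed

text \<open>Index set, class and coordinates are truncated at n simultaneously. The truncated events
  are not monotone in n; the inequality therefore passes to the limit inferior on the left and the
  limit superior on the right, which are compared with the actual events where only finitely many
  terms are nonzero.\<close>

lemma sym_inf:
  fixes \<xi> :: "nat \<Rightarrow> 'a \<Rightarrow> nat \<Rightarrow> real"
  assumes CC: "countable CC" "\<And>C. C \<in> CC \<Longrightarrow> C \<subseteq> I"
    and vc: "\<And>B. B \<subseteq> I \<Longrightarrow> card B = Suc d \<Longrightarrow> \<not> shatters CC B"
    and ind: "\<And>J. finite J \<Longrightarrow> J \<noteq> {} \<Longrightarrow> J \<subseteq> I \<Longrightarrow> indep_vars (\<lambda>_. RN) \<xi> J"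
    and rv: "\<And>i. \<xi> i \<in> M \<rightarrow>\<^sub>M RN"
    and sym: "\<And>i. i \<in> I \<Longrightarrow> distr M RN (\<xi> i) = distr M RN (\<lambda>\<omega> k. - \<xi> i \<omega> k)"
    and fin: "AE \<omega> in M. finite {i\<in>I. \<xi> i \<omega> \<noteq> (\<lambda>_. 0)}" and v: "0 < v"
  shows "prob {\<omega>\<in>space M. \<exists>C\<in>CC. \<exists>k. K1 d * v \<le> \<bar>SS \<xi> C \<omega> k\<bar>}
    \<le> K1 d * prob {\<omega>\<in>space M. \<exists>k. v \<le> \<bar>SS \<xi> I \<omega> k\<bar>}"
proof (cases "CC = {}")
  case True
  then show ?thesis using K1_ge[of d] by simp
next
  case ne: False
  note RN_coord[OF rv, measurable] SS_measurable[OF rv, measurable]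
  define G where "G = {\<omega>\<in>space M. finite {i\<in>I. \<xi> i \<omega> \<noteq> (\<lambda>_. 0)}}"
  have G: "G \<in> events" "prob G = 1" unfolding G_def by (rule finite_support_event[OF rv fin])+
  define F where "F n = from_nat_into CC ` {..n}" for n :: nat
  have FCC: "F n \<subseteq> CC" for n unfolding F_def using from_nat_into[OF ne] by auto
  have Ffin: "finite (F n)" "F n \<noteq> {}" for n by (simp_all add: F_def)
  define A where "A DD t n = {\<omega>\<in>space M. \<exists>k\<in>{..<n}. \<exists>C\<in>DD. t \<le> \<bar>\<Sum>i\<in>(I \<inter> {..<n}) \<inter> C. \<xi> i \<omega> k\<bar>}" for DD t and n :: nat
  have Am [measurable]: "A DD t n \<in> events" if "finite DD" for DD t n
  proof -
    have "A DD t n = (\<Union>k\<in>{..<n}. \<Union>C\<in>DD. {\<omega>\<in>space M. t \<le> \<bar>\<Sum>i\<in>(I \<inter> {..<n}) \<inter> C. \<xi> i \<omega> k\<bar>})"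
      by (auto simp: A_def)
    also have "\<dots> \<in> events" by (intro sets.finite_UN that finite_lessThan) measurable
    finally show ?thesis .
  qed
  have le: "prob (A (F n) (K1 d * v) n) \<le> K1 d * prob (A {UNIV} v n)" for n
    unfolding A_def
  proof (rule sym_finite[OF _ Ffin _ _ rv _ v])
    show "\<not> shatters (F n) B" if "B \<subseteq> I \<inter> {..<n}" "card B = Suc d" for B
      using vc[of B] shatters_mono[OF _ FCC, of n B] that by auto
    show "indep_vars (\<lambda>_. RN) \<xi> (I \<inter> {..<n})" if "I \<inter> {..<n} \<noteq> {}"
      by (rule ind) (use that in auto)
  qed (use sym in auto)
  define A' where "A' m = (\<Inter>n\<in>{m..}. A (F n) (K1 d * v) n)" for m
  define B' where "B' m = (\<Union>n\<in>{m..}. A {UNIV} v n)" for m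
  have A'm: "A' m \<in> events" for m unfolding A'_def by (intro sets.countable_INT') (use Am Ffin in auto)
  have B'm: "B' m \<in> events" for m unfolding B'_def by (intro sets.countable_UN') (use Am in auto)
  have limA: "(\<lambda>m. prob (A' m)) \<longlonglongrightarrow> prob (\<Union>m. A' m)"
    by (rule finite_Lim_measure_incseq) (use A'm in \<open>auto simp: incseq_def A'_def\<close>)
  have limB: "(\<lambda>m. prob (B' m)) \<longlonglongrightarrow> prob (\<Inter>m. B' m)"
    by (rule finite_Lim_measure_decseq) (use B'm in \<open>fastforce simp: decseq_def B'_def\<close>)+
  have "prob (A' m) \<le> K1 d * prob (B' m)" for m
  proof -
    have "prob (A' m) \<le> prob (A (F m) (K1 d * v) m)"
      by (rule finite_measure_mono) (use Am Ffin in \<open>auto simp: A'_def\<close>)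
    also have "\<dots> \<le> K1 d * prob (A {UNIV} v m)" by (rule le)
    also have "prob (A {UNIV} v m) \<le> prob (B' m)"
      by (rule finite_measure_mono) (use B'm in \<open>auto simp: B'_def\<close>)
    finally show ?thesis using K1_ge[of d] by simp
  qed
  then have lim: "prob (\<Union>m. A' m) \<le> K1 d * prob (\<Inter>m. B' m)"
    by (intro LIMSEQ_le[OF limA tendsto_mult_left[OF limB]]) auto
  \<comment> \<open>One \<open>N\<close> serves all sets and all coordinates, since it bounds the
    support of the whole family at \<omega>.\<close>
  have stab: "\<exists>N. \<forall>n\<ge>N. \<forall>C\<subseteq>I. \<forall>k. (\<Sum>i\<in>(I \<inter> {..<n}) \<inter> C. \<xi> i \<omega> k) = SS \<xi> C \<omega> k" if w: "\<omega> \<in> G" for \<omega>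
  proof -
    have "finite {i\<in>I. \<xi> i \<omega> \<noteq> (\<lambda>_. 0)}" using w by (simp add: G_def)
    then obtain N where N: "\<forall>i\<in>{i\<in>I. \<xi> i \<omega> \<noteq> (\<lambda>_. 0)}. i < N" unfolding finite_nat_set_iff_bounded by blast
    have "(\<Sum>i\<in>(I \<inter> {..<n}) \<inter> C. \<xi> i \<omega> k) = SS \<xi> C \<omega> k" if "N \<le> n" "C \<subseteq> I" for n C k
      unfolding SS_def
    proof (rule sum.mono_neutral_right)
      show "{i \<in> C. \<xi> i \<omega> \<noteq> (\<lambda>_. 0)} \<subseteq> I \<inter> {..<n} \<inter> C"
      proof
        fix i assume i: "i \<in> {i \<in> C. \<xi> i \<omega> \<noteq> (\<lambda>_. 0)}"
        then have "i < N" using N that(2) by blast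
        then show "i \<in> I \<inter> {..<n} \<inter> C" using i that by auto
      qed
      show "\<forall>i\<in>I \<inter> {..<n} \<inter> C - {i \<in> C. \<xi> i \<omega> \<noteq> (\<lambda>_. 0)}. \<xi> i \<omega> k = 0" by simp
    qed simp
    then show ?thesis by blast
  qed
  have "prob {\<omega>\<in>space M. \<exists>C\<in>CC. \<exists>k. K1 d * v \<le> \<bar>SS \<xi> C \<omega> k\<bar>} \<le> prob (\<Union>m. A' m)"
  proof (rule prob_le_Int[OF _ G])
    have "{\<omega>\<in>space M. \<exists>C\<in>CC. \<exists>k. K1 d * v \<le> \<bar>SS \<xi> C \<omega> k\<bar>}
        = (\<Union>C\<in>CC. {\<omega>\<in>space M. \<exists>k. K1 d * v \<le> \<bar>SS \<xi> C \<omega> k\<bar>})" by auto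
    also have "\<dots> \<in> events" by (intro sets.countable_UN'[OF CC(1)]) auto
    finally show "{\<omega>\<in>space M. \<exists>C\<in>CC. \<exists>k. K1 d * v \<le> \<bar>SS \<xi> C \<omega> k\<bar>} \<in> events" .
    show "(\<Union>m. A' m) \<in> events" using A'm by auto
    show "{\<omega>\<in>space M. \<exists>C\<in>CC. \<exists>k. K1 d * v \<le> \<bar>SS \<xi> C \<omega> k\<bar>} \<inter> G \<subseteq> (\<Union>m. A' m)"
    proof
      fix \<omega> assume w: "\<omega> \<in> {\<omega>\<in>space M. \<exists>C\<in>CC. \<exists>k. K1 d * v \<le> \<bar>SS \<xi> C \<omega> k\<bar>} \<inter> G"
      then obtain C k where C: "C \<in> CC" "K1 d * v \<le> \<bar>SS \<xi> C \<omega> k\<bar>" by blast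
      obtain N where N: "\<And>n C k. N \<le> n \<Longrightarrow> C \<subseteq> I \<Longrightarrow> (\<Sum>i\<in>(I \<inter> {..<n}) \<inter> C. \<xi> i \<omega> k) = SS \<xi> C \<omega> k"
        using stab[of \<omega>] w by blast
      obtain j where j: "C = from_nat_into CC j" using from_nat_into_surj[OF CC(1) C(1)] by metis
      have "\<omega> \<in> A (F n) (K1 d * v) n" if n: "N + j + Suc k \<le> n" for n
      proof -
        have "C \<in> F n" unfolding F_def j using n by auto
        moreover have "(\<Sum>i\<in>(I \<inter> {..<n}) \<inter> C. \<xi> i \<omega> k) = SS \<xi> C \<omega> k" using N n CC(2)[OF C(1)] by simp
        moreover have "k \<in> {..<n}" using n by simp
        ultimately show ?thesis unfolding A_def using C(2) w by (auto intro!: bexI[of _ k] bexI[of _ C])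
      qed
      then have "\<omega> \<in> A' (N + j + Suc k)" by (simp add: A'_def)
      then show "\<omega> \<in> (\<Union>m. A' m)" by blast
    qed
  qed
  also note lim
  also have "prob (\<Inter>m. B' m) \<le> prob {\<omega>\<in>space M. \<exists>k. v \<le> \<bar>SS \<xi> I \<omega> k\<bar>}"
  proof (rule prob_le_Int[OF _ G])
    show "(\<Inter>m. B' m) \<in> events"
    proof (rule sets.countable_INT')
      show "B' ` UNIV \<subseteq> events" using B'm by (rule image_subsetI)
    qed simp_all
    show "(\<Inter>m. B' m) \<inter> G \<subseteq> {\<omega>\<in>space M. \<exists>k. v \<le> \<bar>SS \<xi> I \<omega> k\<bar>}"
    proof
      fix \<omega> assume w: "\<omega> \<in> (\<Inter>m. B' m) \<inter> G"
      have wG: "\<omega> \<in> G" by (rule IntD2[OF w])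
      have wB: "\<omega> \<in> B' m" for m by (rule INT_D[OF IntD1[OF w] UNIV_I])
      obtain N where N: "\<And>n C k. N \<le> n \<Longrightarrow> C \<subseteq> I \<Longrightarrow> (\<Sum>i\<in>(I \<inter> {..<n}) \<inter> C. \<xi> i \<omega> k) = SS \<xi> C \<omega> k"
        using stab[OF wG] by blast
      obtain n where n: "N \<le> n" "\<omega> \<in> A {UNIV} v n" using wB[of N] unfolding B'_def by blast
      then obtain k where k: "v \<le> \<bar>\<Sum>i\<in>I \<inter> {..<n}. \<xi> i \<omega> k\<bar>" "\<omega> \<in> space M" by (auto simp: A_def)
      have "(\<Sum>i\<in>I \<inter> {..<n} \<inter> I. \<xi> i \<omega> k) = SS \<xi> I \<omega> k" by (rule N[OF n(1) order_refl])
      moreover have "I \<inter> {..<n} \<inter> I = I \<inter> {..<n}" by auto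
      ultimately show "\<omega> \<in> {\<omega>\<in>space M. \<exists>k. v \<le> \<bar>SS \<xi> I \<omega> k\<bar>}" using k by auto
    qed
  qed measurable
  finally show ?thesis using K1_ge[of d] by simp
qed

end

section \<open>Norming functionals and embeddings\<close>

definition sublinear :: "('b::real_vector \<Rightarrow> real) \<Rightarrow> bool" where
  "sublinear p \<longleftrightarrow> (\<forall>x y. p (x + y) \<le> p x + p y) \<and> (\<forall>t\<ge>0. \<forall>x. p (t *\<^sub>R x) = t * p x)"

lemma sublinear_zero: "sublinear p \<Longrightarrow> p 0 = 0"
  unfolding sublinear_def by (metis mult_zero_left order_refl scaleR_zero_left)

lemma sublinear_minus_ge: "sublinear p \<Longrightarrow> - p (- x) \<le> p x"
  using sublinear_zero[of p] unfolding sublinear_def by (smt (verit) add.right_inverse)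

text \<open>A minimal sublinear functional \<open>p\<close> satisfies \<open>lower p y = p\<close> for all \<open>y\<close>, hence it is odd and
  therefore linear. This is the Hahn--Banach theorem used here.\<close>

definition lower :: "('b::real_vector \<Rightarrow> real) \<Rightarrow> 'b \<Rightarrow> 'b \<Rightarrow> real" where
  "lower p y x = (INF t\<in>{0..}. p (x + t *\<^sub>R y) - t * p y)"

lemma lower_bdd:
  assumes p: "sublinear p"
  shows "bdd_below ((\<lambda>t. p (x + t *\<^sub>R y) - t * p y) ` {0..})"
proof (rule bdd_belowI2[of _ "- p (- x)"])
  fix t :: real assume t: "t \<in> {0..}"
  have "t * p y = p ((x + t *\<^sub>R y) + (- x))" using p t by (simp add: sublinear_def)
  also have "\<dots> \<le> p (x + t *\<^sub>R y) + p (- x)" using p unfolding sublinear_def by blast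
  finally show "- p (- x) \<le> p (x + t *\<^sub>R y) - t * p y" by linarith
qed

lemma lower_le: "sublinear p \<Longrightarrow> 0 \<le> t \<Longrightarrow> lower p y x \<le> p (x + t *\<^sub>R y) - t * p y"
  unfolding lower_def by (rule cINF_lower[OF lower_bdd]) auto

lemma lower_greatest: "(\<And>t. 0 \<le> t \<Longrightarrow> c \<le> p (x + t *\<^sub>R y) - t * p y) \<Longrightarrow> c \<le> lower p y x"
  unfolding lower_def by (rule cINF_greatest) auto

text \<open>Subadditivity adds the parameters of two candidates, and homogeneity rescales the
  parameter. The parameter 1 yields the value at \<open>- y\<close>; together with minimality it
  will force oddness.\<close>

lemma sublinear_lower:
  assumes p: "sublinear p"
  shows "sublinear (lower p y)" "lower p y x \<le> p x" "lower p y (- y) \<le> - p y"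
proof -
  have sub: "p (u + w) \<le> p u + p w" and hom: "0 \<le> t \<Longrightarrow> p (t *\<^sub>R u) = t * p u" for u w t
    using p unfolding sublinear_def by auto
  show "lower p y x \<le> p x" using lower_le[OF p, of 0 y x] by simp
  show "lower p y (- y) \<le> - p y" using lower_le[OF p, of 1 y "- y"] sublinear_zero[OF p] by simp
  show "sublinear (lower p y)"
    unfolding sublinear_def
  proof (intro conjI allI impI)
    fix u w
    have "lower p y (u + w) - (p (u + s *\<^sub>R y) - s * p y) \<le> lower p y w" if s: "0 \<le> s" for s
    proof (rule lower_greatest)
      fix t :: real assume t: "0 \<le> t"
      have "lower p y (u + w) \<le> p (u + w + (s + t) *\<^sub>R y) - (s + t) * p y" using s t by (intro lower_le[OF p]) auto
      also have "u + w + (s + t) *\<^sub>R y = (u + s *\<^sub>R y) + (w + t *\<^sub>R y)" by (simp add: scaleR_left_distrib)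
      also have "p \<dots> \<le> p (u + s *\<^sub>R y) + p (w + t *\<^sub>R y)" by (rule sub)
      finally show "lower p y (u + w) - (p (u + s *\<^sub>R y) - s * p y) \<le> p (w + t *\<^sub>R y) - t * p y"
        by (simp add: distrib_right)
    qed
    then have "lower p y (u + w) - lower p y w \<le> lower p y u"
      by (intro lower_greatest) (smt (verit))
    then show "lower p y (u + w) \<le> lower p y u + lower p y w" by linarith
  next
    fix r :: real and u assume r: "0 \<le> r"
    show "lower p y (r *\<^sub>R u) = r * lower p y u"
    proof (cases "r = 0")
      case True
      have "lower p y 0 \<le> 0" using lower_le[OF p, of 0 y 0] sublinear_zero[OF p] by simp
      moreover have "0 \<le> lower p y 0" by (rule lower_greatest) (simp add: hom)
      ultimately show ?thesis using True by simp
    next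
      case False
      then have r0: "0 < r" using r by simp
      have ge: "r * lower p y u \<le> lower p y (r *\<^sub>R u)" if r0: "0 < r" for r u
      proof (rule lower_greatest)
        fix t :: real assume t: "0 \<le> t"
        have "r * lower p y u \<le> r * (p (u + (t / r) *\<^sub>R y) - t / r * p y)"
          using r0 t by (intro mult_left_mono lower_le[OF p]) auto
        also have "\<dots> = p (r *\<^sub>R (u + (t / r) *\<^sub>R y)) - t * p y"
          using r0 hom[of r "u + (t / r) *\<^sub>R y"] by (simp add: right_diff_distrib)
        also have "r *\<^sub>R (u + (t / r) *\<^sub>R y) = r *\<^sub>R u + t *\<^sub>R y" using r0 by (simp add: scaleR_right_distrib)
        finally show "r * lower p y u \<le> p (r *\<^sub>R u + t *\<^sub>R y) - t * p y" .
      qed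
      have "1 / r * lower p y (r *\<^sub>R u) \<le> lower p y ((1 / r) *\<^sub>R (r *\<^sub>R u))" using r0 by (intro ge) simp
      then have "lower p y (r *\<^sub>R u) \<le> r * lower p y u" using r0 by (simp add: field_simps)
      then show ?thesis using ge[OF r0, of u] by linarith
    qed
  qed
qed

text \<open>Lower bounds of chains for Zorn's lemma. Two members can be replaced by the smaller one,
  which gives subadditivity; the common majorant \<open>p\<close> keeps the infimum finite through
  \<open>sublinear_minus_ge\<close>.\<close>

lemma sublinear_INF:
  assumes C: "C \<noteq> {}" and sl: "\<And>q. q \<in> C \<Longrightarrow> sublinear q" and le: "\<And>q x. q \<in> C \<Longrightarrow> q x \<le> p x"
    and chain: "\<And>q q'. q \<in> C \<Longrightarrow> q' \<in> C \<Longrightarrow> q \<le> q' \<or> q' \<le> q"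
  shows "sublinear (\<lambda>x. INF q\<in>C. q x)" "\<And>q x. q \<in> C \<Longrightarrow> (INF q\<in>C. q x) \<le> q x"
proof -
  have bdd: "bdd_below ((\<lambda>q. q x) ` C)" for x
  proof (rule bdd_belowI2)
    fix q assume q: "q \<in> C"
    show "- p (- x) \<le> q x" using sublinear_minus_ge[OF sl[OF q], of x] le[OF q, of "- x"] by linarith
  qed
  show low: "(INF q\<in>C. q x) \<le> q x" if "q \<in> C" for q x by (rule cINF_lower[OF bdd that])
  show "sublinear (\<lambda>x. INF q\<in>C. q x)"
    unfolding sublinear_def
  proof (intro conjI allI impI)
    fix x y
    have pair: "(INF q\<in>C. q (x + y)) \<le> q x + q' y" if q: "q \<in> C" "q' \<in> C" for q q'
    proof -
      obtain r where r: "r \<in> C" "r \<le> q" "r \<le> q'" using chain[OF q] q by blast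
      have "(INF q\<in>C. q (x + y)) \<le> r (x + y)" by (rule low[OF r(1)])
      also have "\<dots> \<le> r x + r y" using sl[OF r(1)] unfolding sublinear_def by blast
      also have "\<dots> \<le> q x + q' y" using r by (intro add_mono) (auto simp: le_fun_def)
      finally show ?thesis .
    qed
    have "(INF q\<in>C. q (x + y)) - q x \<le> (INF q\<in>C. q y)" if q: "q \<in> C" for q
      using pair[OF q] by (intro cINF_greatest[OF C]) (smt (verit))
    then have "(INF q\<in>C. q (x + y)) - (INF q\<in>C. q y) \<le> (INF q\<in>C. q x)"
      by (intro cINF_greatest[OF C]) (smt (verit))
    then show "(INF q\<in>C. q (x + y)) \<le> (INF q\<in>C. q x) + (INF q\<in>C. q y)" by linarith
  next
    fix t :: real and x assume t: "0 \<le> t"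
    have ge: "r * (INF q\<in>C. q x) \<le> (INF q\<in>C. q (r *\<^sub>R x))" if r: "0 \<le> r" for r x
    proof (rule cINF_greatest[OF C])
      fix q assume q: "q \<in> C"
      have "r * (INF q\<in>C. q x) \<le> r * q x" using low[OF q] r by (rule mult_left_mono)
      then show "r * (INF q\<in>C. q x) \<le> q (r *\<^sub>R x)" using sl[OF q] r unfolding sublinear_def by simp
    qed
    show "(INF q\<in>C. q (t *\<^sub>R x)) = t * (INF q\<in>C. q x)"
    proof (cases "t = 0")
      case True
      have "(INF q\<in>C. q (0 :: 'a)) = (INF q\<in>C. 0)" by (rule INF_cong) (simp_all add: sublinear_zero sl)
      then show ?thesis using True C by simp
    next
      case False
      then have t0: "0 < t" using t by simp
      have "1 / t * (INF q\<in>C. q (t *\<^sub>R x)) \<le> (INF q\<in>C. q ((1 / t) *\<^sub>R (t *\<^sub>R x)))" using t by (intro ge) simp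
      then have "(INF q\<in>C. q (t *\<^sub>R x)) \<le> t * (INF q\<in>C. q x)" using t0 by (simp add: field_simps)
      then show ?thesis using ge[OF t, of x] by linarith
    qed
  qed
qed

text \<open>Zorn's lemma is applied below \<open>lower norm z\<close> instead of below the norm:
  there every functional is at most \<open>- norm z\<close> at \<open>- z\<close>, so a linear one
  attains the norm at \<open>z\<close>.\<close>

lemma norming_functional:
  fixes z :: "'b::real_normed_vector"
  shows "\<exists>f. linear f \<and> (\<forall>x. f x \<le> norm x) \<and> f z = norm z"
proof -
  have nsl: "sublinear (norm :: 'b \<Rightarrow> real)" unfolding sublinear_def by (auto intro: norm_triangle_ineq)
  define p0 where "p0 = lower norm z"
  have p0: "sublinear p0" "p0 x \<le> norm x" "p0 (- z) \<le> - norm z" for x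
    unfolding p0_def using sublinear_lower[OF nsl] by blast+
  define A where "A = {q. sublinear q \<and> q \<le> p0}"
  define P where "P q q' \<longleftrightarrow> q' \<le> q" for q q' :: "'b \<Rightarrow> real"
  have "\<exists>m\<in>A. \<forall>a\<in>A. P m a \<longrightarrow> a = m"
  proof (rule predicate_Zorn)
    show "partial_order_on A (relation_of P A)"
      by (rule partial_order_on_relation_ofI) (auto simp: P_def)
    fix C assume "C \<in> Chains (relation_of P A)"
    then have C: "q \<in> C \<Longrightarrow> q \<in> A" "q \<in> C \<Longrightarrow> q' \<in> C \<Longrightarrow> q \<le> q' \<or> q' \<le> q" for q q'
      unfolding Chains_def relation_of_def P_def by auto
    show "\<exists>u\<in>A. \<forall>a\<in>C. P a u"
    proof (cases "C = {}")
      case True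
      then show ?thesis using p0 by (auto simp: A_def)
    next
      case False
      have INF: "sublinear (\<lambda>x. INF q\<in>C. q x)" "\<And>q x. q \<in> C \<Longrightarrow> (INF q\<in>C. q x) \<le> q x"
        using sublinear_INF[OF False, of p0] C by (auto simp: A_def le_fun_def)
      obtain q where q: "q \<in> C" using False by blast
      have "(\<lambda>x. INF q\<in>C. q x) \<le> p0"
      proof (rule le_funI)
        fix x
        have "(INF q\<in>C. q x) \<le> q x" by (rule INF(2)[OF q])
        also have "\<dots> \<le> p0 x" using C(1)[OF q] by (simp add: A_def le_fun_def)
        finally show "(INF q\<in>C. q x) \<le> p0 x" .
      qed
      then have "(\<lambda>x. INF q\<in>C. q x) \<in> A" using INF(1) by (simp add: A_def)
      moreover have "\<forall>a\<in>C. P a (\<lambda>x. INF q\<in>C. q x)" using INF(2) by (simp add: P_def le_fun_def)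
      ultimately show ?thesis by blast
    qed
  qed
  then obtain m where m: "sublinear m" "m \<le> p0" and min: "\<And>a. sublinear a \<Longrightarrow> a \<le> m \<Longrightarrow> a = m"
    unfolding A_def P_def by (auto intro: order_trans)
  have mp0: "m x \<le> p0 x" for x using m(2) by (rule le_funD)
  have odd: "m (- y) = - m y" for y
  proof -
    have "lower m y = m"
      using sublinear_lower[OF m(1), of y] by (intro min) (auto simp: le_fun_def)
    then have "m (- y) \<le> - m y" using sublinear_lower(3)[OF m(1), of y] by simp
    moreover have "- m y \<le> m (- y)" using sublinear_minus_ge[OF m(1), of "- y"] by simp
    ultimately show ?thesis by linarith
  qed
  have sub: "m (x + y) \<le> m x + m y" for x y using m(1) unfolding sublinear_def by blast
  have add: "m (x + y) = m x + m y" for x y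
  proof -
    have "m (- x + - y) \<le> m (- x) + m (- y)" by (rule sub)
    also have "- x + - y = - (x + y)" by simp
    finally have "m x + m y \<le> m (x + y)" unfolding odd by linarith
    then show ?thesis using sub[of x y] by linarith
  qed
  have scale: "m (r *\<^sub>R x) = r *\<^sub>R m x" for r x
  proof (cases "0 \<le> r")
    case True
    then show ?thesis using m(1) unfolding sublinear_def by simp
  next
    case False
    then have "0 \<le> - r" by simp
    then have "m ((- r) *\<^sub>R x) = (- r) * m x" using m(1) unfolding sublinear_def by blast
    then show ?thesis using odd[of "r *\<^sub>R x"] by simp
  qed
  have "linear m" by (rule linearI) (auto simp: add scale)
  moreover have "m x \<le> norm x" for x using mp0[of x] p0(2)[of x] by linarith
  moreover have "m z = norm z" using odd[of z] mp0[of "- z"] p0(3) calculation(2)[of z] by linarith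
  ultimately show ?thesis by blast
qed

text \<open>The coordinates are functionals norming the points of a countable dense set, and by
  density their supremum is the norm everywhere. Bounded sequences are continuous because the index
  space is discrete.\<close>

lemma isometric_embedding:
  "\<exists>\<Phi> :: 'b::{banach, second_countable_topology} \<Rightarrow> (nat \<Rightarrow>\<^sub>C real).
     bounded_linear \<Phi> \<and> (\<forall>x. norm (\<Phi> x) = norm x)"
proof -
  obtain D :: "'b set" where D: "countable D" "\<And>U. open U \<Longrightarrow> U \<noteq> {} \<Longrightarrow> \<exists>d\<in>D. d \<in> U"
    using countable_dense_exists by blast
  have Dne: "D \<noteq> {}" using D(2)[of UNIV] by auto
  define z where "z = from_nat_into D"
  have "\<forall>k. \<exists>f. linear f \<and> (\<forall>x. f x \<le> norm x) \<and> f (z k) = norm (z k)"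
    using norming_functional by blast
  from choice[OF this] obtain f where "\<forall>k. linear (f k) \<and> (\<forall>x. f k x \<le> norm x) \<and> f k (z k) = norm (z k)" ..
  then have f: "\<And>k. linear (f k)" "\<And>k x. f k x \<le> norm x" "\<And>k. f k (z k) = norm (z k)" by auto
  have fabs: "\<bar>f k x\<bar> \<le> norm x" for k x
    using f(2)[of k x] f(2)[of k "- x"] linear_neg[OF f(1)[of k]] by (simp add: abs_le_iff)
  define \<Phi> where "\<Phi> x = Bcontfun (\<lambda>k. f k x)" for x
  have app: "apply_bcontfun (\<Phi> x) k = f k x" for x k
  proof -
    have "(\<lambda>k. f k x) \<in> bcontfun" by (rule bcontfun_normI[where b = "norm x"]) (auto simp: fabs)
    then show ?thesis by (simp add: \<Phi>_def Bcontfun_inverse)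
  qed
  have le: "norm (\<Phi> x) \<le> norm x" for x by (rule norm_bound) (simp add: app fabs)
  have lin: "linear \<Phi>"
    by (rule linearI) (auto intro!: bcontfun_eqI simp: app linear_add[OF f(1)] linear_cmul[OF f(1)])
  have "norm x \<le> norm (\<Phi> x)" for x
  proof (rule field_le_epsilon)
    fix e :: real assume e: "0 < e"
    obtain d where d: "d \<in> D" "d \<in> ball x (e / 2)" using D(2)[of "ball x (e / 2)"] e by auto
    obtain k where k: "d = z k" using from_nat_into_surj[OF D(1) d(1)] unfolding z_def by metis
    have dist: "norm (x - d) \<le> e / 2" using d(2) by (simp add: dist_norm)
    have "norm x \<le> norm d + norm (x - d)" using norm_triangle_ineq[of d "x - d"] by simp
    also have "norm d = f k d" using f(3) k by simp
    also have "f k d = f k x - f k (x - d)" using linear_diff[OF f(1)[of k], of x d] by simp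
    finally have "norm x \<le> f k x - f k (x - d) + norm (x - d)" .
    moreover have "- f k (x - d) \<le> norm (x - d)" using fabs[of k "x - d"] by linarith
    moreover have "f k x \<le> norm (\<Phi> x)" using norm_bounded[of "\<Phi> x" k] by (simp add: app)
    ultimately show "norm x \<le> norm (\<Phi> x) + e" using dist by linarith
  qed
  then have eq: "norm (\<Phi> x) = norm x" for x using le[of x] by (simp add: antisym)
  have "bounded_linear \<Phi>"
    by (rule bounded_linear_intro[where K = 1]) (auto simp: linear_add[OF lin] linear_cmul[OF lin] eq)
  then show ?thesis using eq by blast
qed

section \<open>Symmetrization\<close>

context prob_space
begin

lemma box_prob:
  assumes J: "finite J" "J \<noteq> {}" and ind: "indep_vars (\<lambda>_. RN) \<xi> J" and rv: "\<And>i. \<xi> i \<in> M \<rightarrow>\<^sub>M RN"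
    and B: "\<And>i. i \<in> J \<Longrightarrow> B i \<in> sets RN"
  shows "emeasure M {x\<in>space M. \<forall>i\<in>J. \<xi> i x \<in> B i} = (\<Prod>i\<in>J. emeasure M {x\<in>space M. \<xi> i x \<in> B i})"
proof -
  interpret P: product_sigma_finite "\<lambda>i. distr M RN (\<xi> i)"
    by (intro product_sigma_finite.intro prob_space_imp_sigma_finite prob_space_distr rv)
  have law: "distr M (PiM J (\<lambda>_. RN)) (\<lambda>x. \<lambda>i\<in>J. \<xi> i x) = PiM J (\<lambda>i. distr M RN (\<xi> i))"
    using indep_vars_iff_distr_eq_PiM'[OF J(2), where M' = "\<lambda>_. RN" and X = \<xi>] rv ind by simp
  have Xm: "(\<lambda>x. \<lambda>i\<in>J. \<xi> i x) \<in> M \<rightarrow>\<^sub>M PiM J (\<lambda>_. RN)" by (rule measurable_restrict) (rule rv)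
  have Bm: "Pi\<^sub>E J B \<in> sets (PiM J (\<lambda>_. RN))" by (rule sets_PiM_I_finite[OF J(1) B])
  have "{x\<in>space M. \<forall>i\<in>J. \<xi> i x \<in> B i} = (\<lambda>x. \<lambda>i\<in>J. \<xi> i x) -` Pi\<^sub>E J B \<inter> space M" by (auto simp: PiE_iff)
  then have "emeasure M {x\<in>space M. \<forall>i\<in>J. \<xi> i x \<in> B i} = emeasure (PiM J (\<lambda>i. distr M RN (\<xi> i))) (Pi\<^sub>E J B)"
    unfolding law[symmetric] emeasure_distr[OF Xm Bm] by simp
  also have "\<dots> = (\<Prod>i\<in>J. emeasure (distr M RN (\<xi> i)) (B i))" by (rule P.emeasure_PiM[OF J(1)]) (use B in simp)
  also have "\<dots> = (\<Prod>i\<in>J. emeasure M {x\<in>space M. \<xi> i x \<in> B i})"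
  proof (rule prod.cong[OF refl])
    fix i assume i: "i \<in> J"
    have "\<xi> i -` B i \<inter> space M = {x\<in>space M. \<xi> i x \<in> B i}" by auto
    then show "emeasure (distr M RN (\<xi> i)) (B i) = emeasure M {x\<in>space M. \<xi> i x \<in> B i}"
      by (simp add: emeasure_distr[OF rv B[OF i]])
  qed
  finally show ?thesis .
qed

lemma prod_nn_integral_indep:
  assumes J: "finite J" "J \<noteq> {}" and ind: "indep_vars (\<lambda>_. RN) \<xi> J" and rv: "\<And>i. \<xi> i \<in> M \<rightarrow>\<^sub>M RN"
    and f: "\<And>i. i \<in> J \<Longrightarrow> f i \<in> borel_measurable RN"
  shows "(\<integral>\<^sup>+x. (\<Prod>i\<in>J. f i (\<xi> i x)) \<partial>M) = (\<Prod>i\<in>J. \<integral>\<^sup>+x. f i (\<xi> i x) \<partial>M)"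
proof -
  interpret P: product_sigma_finite "\<lambda>i. distr M RN (\<xi> i)"
    by (intro product_sigma_finite.intro prob_space_imp_sigma_finite prob_space_distr rv)
  have law: "distr M (PiM J (\<lambda>_. RN)) (\<lambda>x. \<lambda>i\<in>J. \<xi> i x) = PiM J (\<lambda>i. distr M RN (\<xi> i))"
    using indep_vars_iff_distr_eq_PiM'[OF J(2), where M' = "\<lambda>_. RN" and X = \<xi>] rv ind by simp
  have Xm: "(\<lambda>x. \<lambda>i\<in>J. \<xi> i x) \<in> M \<rightarrow>\<^sub>M PiM J (\<lambda>_. RN)" by (rule measurable_restrict) (rule rv)
  have fm: "(\<lambda>w. \<Prod>i\<in>J. f i (w i)) \<in> borel_measurable (PiM J (\<lambda>_. RN))"
  proof (rule borel_measurable_prod_ennreal)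
    fix i assume i: "i \<in> J"
    show "(\<lambda>w. f i (w i)) \<in> borel_measurable (PiM J (\<lambda>_. RN))"
      by (rule measurable_compose[OF measurable_component_singleton[OF i] f[OF i]])
  qed
  have "(\<integral>\<^sup>+x. (\<Prod>i\<in>J. f i (\<xi> i x)) \<partial>M) = (\<integral>\<^sup>+x. (\<Prod>i\<in>J. f i ((\<lambda>i\<in>J. \<xi> i x) i)) \<partial>M)" by simp
  also have "\<dots> = (\<integral>\<^sup>+w. (\<Prod>i\<in>J. f i (w i)) \<partial>(PiM J (\<lambda>i. distr M RN (\<xi> i))))"
    unfolding law[symmetric] by (rule nn_integral_distr[OF Xm, symmetric]) (use fm in simp)
  also have "\<dots> = (\<Prod>i\<in>J. \<integral>\<^sup>+z. f i z \<partial>(distr M RN (\<xi> i)))"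
    by (rule P.product_nn_integral_prod[OF J(1)]) (use f in simp)
  also have "\<dots> = (\<Prod>i\<in>J. \<integral>\<^sup>+x. f i (\<xi> i x) \<partial>M)"
  proof (rule prod.cong[OF refl])
    fix i assume "i \<in> J"
    then show "(\<integral>\<^sup>+z. f i z \<partial>(distr M RN (\<xi> i))) = (\<integral>\<^sup>+x. f i (\<xi> i x) \<partial>M)"
      by (intro nn_integral_distr[OF rv]) (use f in simp)
  qed
  finally show ?thesis .
qed

definition dif :: "('i \<Rightarrow> 'a \<Rightarrow> nat \<Rightarrow> real) \<Rightarrow> 'i \<Rightarrow> 'a \<times> 'a \<Rightarrow> nat \<Rightarrow> real" where
  "dif \<xi> i p k = \<xi> i (fst p) k - \<xi> i (snd p) k"

lemma dif_pair: "dif \<xi> i (x, y) = (\<lambda>k. \<xi> i x k - \<xi> i y k)"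
  by (rule ext) (simp add: dif_def)

lemma dif_measurable:
  assumes rv: "\<xi> i \<in> M \<rightarrow>\<^sub>M RN"
  shows "dif \<xi> i \<in> (M \<Otimes>\<^sub>M M) \<rightarrow>\<^sub>M RN"
proof (rule RN_measurable)
  note RN_coord[OF rv, measurable]
  show "(\<lambda>p. dif \<xi> i p k) \<in> borel_measurable (M \<Otimes>\<^sub>M M)" for k unfolding dif_def by measurable
qed

lemma dif_symmetric:
  assumes rv: "\<xi> i \<in> M \<rightarrow>\<^sub>M RN"
  shows "distr (M \<Otimes>\<^sub>M M) RN (dif \<xi> i) = distr (M \<Otimes>\<^sub>M M) RN (\<lambda>p k. - dif \<xi> i p k)"
proof -
  interpret MM: pair_prob_space M M ..
  have "distr (M \<Otimes>\<^sub>M M) RN (dif \<xi> i)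
      = distr (distr (M \<Otimes>\<^sub>M M) (M \<Otimes>\<^sub>M M) (\<lambda>(x, y). (y, x))) RN (dif \<xi> i)"
    using MM.distr_pair_swap by simp
  also have "\<dots> = distr (M \<Otimes>\<^sub>M M) RN (dif \<xi> i \<circ> (\<lambda>(x, y). (y, x)))"
    by (rule distr_distr[OF dif_measurable[where \<xi> = \<xi> and i = i, OF rv] measurable_pair_swap'])
  also have "dif \<xi> i \<circ> (\<lambda>(x, y). (y, x)) = (\<lambda>p k. - dif \<xi> i p k)" by (auto simp: fun_eq_iff dif_def)
  finally show ?thesis .
qed

text \<open>The joint law is identified on boxes. For a fixed first point the section of a box event
  factorises by \<open>box_prob\<close>; its i-th factor depends on the first point only through the
  i-th variable, so the outer integral factorises as well.\<close>

lemma dif_indep: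
  assumes J: "finite J" "J \<noteq> {}" and ind: "indep_vars (\<lambda>_. RN) \<xi> J" and rv: "\<And>i. \<xi> i \<in> M \<rightarrow>\<^sub>M RN"
  shows "prob_space.indep_vars (M \<Otimes>\<^sub>M M) (\<lambda>_. RN) (dif \<xi>) J"
proof -
  interpret MM: pair_prob_space M M ..
  have dm: "dif \<xi> i \<in> (M \<Otimes>\<^sub>M M) \<rightarrow>\<^sub>M RN" for i by (rule dif_measurable) (rule rv)
  interpret P: product_sigma_finite "\<lambda>i. distr (M \<Otimes>\<^sub>M M) RN (dif \<xi> i)"
    by (intro product_sigma_finite.intro prob_space_imp_sigma_finite MM.prob_space_distr dm)
  have Xm: "(\<lambda>x. \<lambda>i\<in>J. dif \<xi> i x) \<in> (M \<Otimes>\<^sub>M M) \<rightarrow>\<^sub>M PiM J (\<lambda>_. RN)" by (rule measurable_restrict) (rule dm)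
  have "distr (M \<Otimes>\<^sub>M M) (PiM J (\<lambda>_. RN)) (\<lambda>x. \<lambda>i\<in>J. dif \<xi> i x) = PiM J (\<lambda>i. distr (M \<Otimes>\<^sub>M M) RN (dif \<xi> i))"
  proof (rule P.PiM_eqI[OF J(1)])
    show "sets (distr (M \<Otimes>\<^sub>M M) (PiM J (\<lambda>_. RN)) (\<lambda>x. \<lambda>i\<in>J. dif \<xi> i x))
        = sets (PiM J (\<lambda>i. distr (M \<Otimes>\<^sub>M M) RN (dif \<xi> i)))"
      unfolding sets_distr by (rule sets_PiM_cong) simp_all
    fix A assume "\<And>i. i \<in> J \<Longrightarrow> A i \<in> sets (distr (M \<Otimes>\<^sub>M M) RN (dif \<xi> i))"
    then have A: "\<And>i. i \<in> J \<Longrightarrow> A i \<in> sets RN" by simp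
    have Am: "Pi\<^sub>E J A \<in> sets (PiM J (\<lambda>_. RN))" by (rule sets_PiM_I_finite[OF J(1) A])
    define Q where "Q i = {p\<in>space (RN \<Otimes>\<^sub>M M). (\<lambda>k. fst p k - \<xi> i (snd p) k) \<in> A i}" for i
    have Qm: "Q i \<in> sets (RN \<Otimes>\<^sub>M M)" if i: "i \<in> J" for i
    proof -
      have "(\<lambda>p. (\<lambda>k. fst p k - \<xi> i (snd p) k)) \<in> (RN \<Otimes>\<^sub>M M) \<rightarrow>\<^sub>M RN"
      proof (rule RN_measurable)
        note RN_coord[OF rv, measurable]
        show "(\<lambda>p. fst p k - \<xi> i (snd p) k) \<in> borel_measurable (RN \<Otimes>\<^sub>M M)" for k by measurable
      qed
      from measurable_sets[OF this A[OF i]]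
      have "(\<lambda>p. (\<lambda>k. fst p k - \<xi> i (snd p) k)) -` A i \<inter> space (RN \<Otimes>\<^sub>M M) \<in> sets (RN \<Otimes>\<^sub>M M)" .
      moreover have "(\<lambda>p. (\<lambda>k. fst p k - \<xi> i (snd p) k)) -` A i \<inter> space (RN \<Otimes>\<^sub>M M) = Q i" by (auto simp: Q_def)
      ultimately show ?thesis by simp
    qed
    \<comment> \<open>The probability that \<open>z\<close> minus a copy of the i-th variable lies
      in \<open>A i\<close>; measurability in \<open>z\<close> is that of the measure of a
      section.\<close>
    define f where "f i z = emeasure M (Pair z -` Q i)" for i z
    have fm: "f i \<in> borel_measurable RN" if "i \<in> J" for i
      unfolding f_def by (rule measurable_emeasure_Pair[OF Qm[OF that]])
    have feq: "f i (\<xi> i x) = emeasure M {y\<in>space M. dif \<xi> i (x, y) \<in> A i}" for i x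
    proof -
      have "Pair (\<xi> i x) -` Q i = {y\<in>space M. dif \<xi> i (x, y) \<in> A i}"
        by (auto simp: Q_def dif_pair space_pair_measure)
      then show ?thesis by (simp add: f_def)
    qed
    have Di: "{p\<in>space (M \<Otimes>\<^sub>M M). dif \<xi> i p \<in> A i} \<in> sets (M \<Otimes>\<^sub>M M)" if i: "i \<in> J" for i
      using measurable_sets[OF dm A[OF i]] by (simp add: vimage_def Int_def conj_commute)
    have DJ: "{p\<in>space (M \<Otimes>\<^sub>M M). \<forall>i\<in>J. dif \<xi> i p \<in> A i} \<in> sets (M \<Otimes>\<^sub>M M)"
      by (rule sets.sets_Collect_finite_All[OF Di J(1)])
    have "emeasure (distr (M \<Otimes>\<^sub>M M) (PiM J (\<lambda>_. RN)) (\<lambda>x. \<lambda>i\<in>J. dif \<xi> i x)) (Pi\<^sub>E J A)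
        = emeasure (M \<Otimes>\<^sub>M M) {p\<in>space (M \<Otimes>\<^sub>M M). \<forall>i\<in>J. dif \<xi> i p \<in> A i}"
      unfolding emeasure_distr[OF Xm Am] by (rule arg_cong[where f = "emeasure (M \<Otimes>\<^sub>M M)"]) (auto simp: PiE_iff)
    also have "\<dots> = (\<integral>\<^sup>+x. emeasure M (Pair x -` {p\<in>space (M \<Otimes>\<^sub>M M). \<forall>i\<in>J. dif \<xi> i p \<in> A i}) \<partial>M)"
      by (rule emeasure_pair_measure_alt[OF DJ])
    also have "\<dots> = (\<integral>\<^sup>+x. (\<Prod>i\<in>J. f i (\<xi> i x)) \<partial>M)"
    proof (rule nn_integral_cong)
      fix x assume x: "x \<in> space M"
      define B where "B i = {z\<in>space RN. (\<lambda>k. \<xi> i x k - z k) \<in> A i}" for i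
      have Bm: "B i \<in> sets RN" if i: "i \<in> J" for i
      proof -
        have "(\<lambda>z k. \<xi> i x k - z k) \<in> RN \<rightarrow>\<^sub>M RN" by (rule RN_measurable) measurable
        from measurable_sets[OF this A[OF i]]
        have "(\<lambda>z k. \<xi> i x k - z k) -` A i \<inter> space RN \<in> sets RN" .
        moreover have "(\<lambda>z k. \<xi> i x k - z k) -` A i \<inter> space RN = B i" by (auto simp: B_def)
        ultimately show ?thesis by simp
      qed
      have "Pair x -` {p\<in>space (M \<Otimes>\<^sub>M M). \<forall>i\<in>J. dif \<xi> i p \<in> A i} = {y\<in>space M. \<forall>i\<in>J. \<xi> i y \<in> B i}"
        using x by (auto simp: B_def dif_pair space_pair_measure)
      then have "emeasure M (Pair x -` {p\<in>space (M \<Otimes>\<^sub>M M). \<forall>i\<in>J. dif \<xi> i p \<in> A i})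
          = (\<Prod>i\<in>J. emeasure M {y\<in>space M. \<xi> i y \<in> B i})"
        using box_prob[OF J ind rv Bm] by simp
      also have "\<dots> = (\<Prod>i\<in>J. f i (\<xi> i x))"
        unfolding feq by (intro prod.cong refl arg_cong[where f = "emeasure M"]) (auto simp: B_def dif_pair)
      finally show "emeasure M (Pair x -` {p\<in>space (M \<Otimes>\<^sub>M M). \<forall>i\<in>J. dif \<xi> i p \<in> A i}) = (\<Prod>i\<in>J. f i (\<xi> i x))" .
    qed
    also have "\<dots> = (\<Prod>i\<in>J. \<integral>\<^sup>+x. f i (\<xi> i x) \<partial>M)" by (rule prod_nn_integral_indep[OF J ind rv fm])
    also have "\<dots> = (\<Prod>i\<in>J. emeasure (distr (M \<Otimes>\<^sub>M M) RN (dif \<xi> i)) (A i))"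
    proof (rule prod.cong[OF refl])
      fix i assume i: "i \<in> J"
      have "dif \<xi> i -` A i \<inter> space (M \<Otimes>\<^sub>M M) = {p\<in>space (M \<Otimes>\<^sub>M M). dif \<xi> i p \<in> A i}" by auto
      then have "emeasure (distr (M \<Otimes>\<^sub>M M) RN (dif \<xi> i)) (A i) = emeasure (M \<Otimes>\<^sub>M M) {p\<in>space (M \<Otimes>\<^sub>M M). dif \<xi> i p \<in> A i}"
        by (simp add: emeasure_distr[OF dm A[OF i]])
      also have "\<dots> = (\<integral>\<^sup>+x. emeasure M (Pair x -` {p\<in>space (M \<Otimes>\<^sub>M M). dif \<xi> i p \<in> A i}) \<partial>M)"
        by (rule emeasure_pair_measure_alt[OF Di[OF i]])
      also have "\<dots> = (\<integral>\<^sup>+x. f i (\<xi> i x) \<partial>M)"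
        unfolding feq
        by (intro nn_integral_cong arg_cong[where f = "emeasure M"]) (auto simp: space_pair_measure)
      finally show "(\<integral>\<^sup>+x. f i (\<xi> i x) \<partial>M) = emeasure (distr (M \<Otimes>\<^sub>M M) RN (dif \<xi> i)) (A i)" by simp
    qed
    finally show "emeasure (distr (M \<Otimes>\<^sub>M M) (PiM J (\<lambda>_. RN)) (\<lambda>x. \<lambda>i\<in>J. dif \<xi> i x)) (Pi\<^sub>E J A)
        = (\<Prod>i\<in>J. emeasure (distr (M \<Otimes>\<^sub>M M) RN (dif \<xi> i)) (A i))" .
  qed
  then show ?thesis
    using MM.indep_vars_iff_distr_eq_PiM'[OF J(2), where M' = "\<lambda>_. RN" and X = "dif \<xi>"] dm by simp
qed

text \<open>Both supports must be finite, since the conventional value 0 would destroy additivity.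
  Cancellation may make the support of the difference smaller than the union of the supports, so all
  three sums are extended to the common index set \<open>U\<close>.\<close>

lemma SS_dif:
  fixes \<xi> :: "nat \<Rightarrow> 'a \<Rightarrow> nat \<Rightarrow> real"
  assumes "finite {i\<in>C. \<xi> i x \<noteq> (\<lambda>_. 0)}" "finite {i\<in>C. \<xi> i y \<noteq> (\<lambda>_. 0)}"
  shows "SS (dif \<xi>) C (x, y) k = SS \<xi> C x k - SS \<xi> C y k"
proof -
  define U where "U = {i\<in>C. \<xi> i x \<noteq> (\<lambda>_. 0)} \<union> {i\<in>C. \<xi> i y \<noteq> (\<lambda>_. 0)}"
  have U: "finite U" "U \<subseteq> C" using assms by (auto simp: U_def)
  have zero: "\<xi> i x = (\<lambda>_. 0)" "\<xi> i y = (\<lambda>_. 0)" if "i \<in> C" "i \<notin> U" for i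
    using that by (auto simp: U_def)
  have sub: "{i\<in>C. dif \<xi> i (x, y) \<noteq> (\<lambda>_. 0)} \<subseteq> U"
  proof
    fix i assume i: "i \<in> {i\<in>C. dif \<xi> i (x, y) \<noteq> (\<lambda>_. 0)}"
    show "i \<in> U"
    proof (rule ccontr)
      assume "i \<notin> U"
      then have "dif \<xi> i (x, y) = (\<lambda>_. 0)" using i zero[of i] by (auto simp: dif_def fun_eq_iff)
      then show False using i by blast
    qed
  qed
  have 1: "SS (dif \<xi>) C (x, y) k = (\<Sum>i\<in>U. dif \<xi> i (x, y) k)"
    unfolding SS_def using U sub by (intro sum.mono_neutral_left) auto
  have 2: "SS \<xi> C x k = (\<Sum>i\<in>U. \<xi> i x k)"
    unfolding SS_def using U by (intro sum.mono_neutral_left) (auto simp: U_def)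
  have 3: "SS \<xi> C y k = (\<Sum>i\<in>U. \<xi> i y k)"
    unfolding SS_def using U by (intro sum.mono_neutral_left) (auto simp: U_def)
  show ?thesis unfolding 1 2 3 by (simp add: dif_def sum_subtractf)
qed

text \<open>If a sum reaches 2 t at the first point while the same sum stays below t at an
  independent copy, an event of probability at least 1/2, then the difference reaches t. This costs
  a factor 2 and leads to \<open>sym_inf\<close>. A full symmetrised sum of size \<open>v\<close> in
  turn makes one of the two copies at least \<open>v / 2\<close>, which costs a second factor
  2.\<close>

lemma nonsym_inf:
  fixes \<xi> :: "nat \<Rightarrow> 'a \<Rightarrow> nat \<Rightarrow> real"
  assumes CC: "countable CC" "\<And>C. C \<in> CC \<Longrightarrow> C \<subseteq> I"
    and vc: "\<And>B. B \<subseteq> I \<Longrightarrow> card B = Suc d \<Longrightarrow> \<not> shatters CC B"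
    and ind: "\<And>J. finite J \<Longrightarrow> J \<noteq> {} \<Longrightarrow> J \<subseteq> I \<Longrightarrow> indep_vars (\<lambda>_. RN) \<xi> J"
    and rv: "\<And>i. \<xi> i \<in> M \<rightarrow>\<^sub>M RN"
    and fin: "AE \<omega> in M. finite {i\<in>I. \<xi> i \<omega> \<noteq> (\<lambda>_. 0)}" and v: "0 < v"
    and half: "\<And>C. C \<in> CC \<Longrightarrow> prob {\<omega>\<in>space M. \<exists>k. K1 d * v \<le> \<bar>SS \<xi> C \<omega> k\<bar>} \<le> 1 / 2"
  shows "prob {\<omega>\<in>space M. \<exists>C\<in>CC. \<exists>k. 2 * (K1 d * v) \<le> \<bar>SS \<xi> C \<omega> k\<bar>}
    \<le> 4 * K1 d * prob {\<omega>\<in>space M. \<exists>k. v / 2 \<le> \<bar>SS \<xi> I \<omega> k\<bar>}"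
proof -
  interpret MM: pair_prob_space M M ..
  have dm: "dif \<xi> i \<in> (M \<Otimes>\<^sub>M M) \<rightarrow>\<^sub>M RN" for i by (rule dif_measurable) (rule rv)
  note SS_measurable[OF rv, measurable] MM.SS_measurable[OF dm, measurable]
  define t where "t = K1 d * v"
  define G where "G = {\<omega>\<in>space M. finite {i\<in>I. \<xi> i \<omega> \<noteq> (\<lambda>_. 0)}}"
  have G: "G \<in> events" "prob G = 1" unfolding G_def by (rule finite_support_event[OF rv fin])+
  have GG: "G \<times> G \<in> sets (M \<Otimes>\<^sub>M M)" using G by simp
  have "emeasure (M \<Otimes>\<^sub>M M) (G \<times> G) = 1"
    using G by (simp add: emeasure_pair_measure_Times emeasure_eq_measure)
  then have pGG: "MM.prob (G \<times> G) = 1" by (simp add: measure_def)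
  have SSd: "SS (dif \<xi>) C (x, y) k = SS \<xi> C x k - SS \<xi> C y k" if "x \<in> G" "y \<in> G" "C \<subseteq> I" for x y C k
  proof (rule SS_dif)
    show "finite {i\<in>C. \<xi> i x \<noteq> (\<lambda>_. 0)}"
      by (rule finite_subset[of _ "{i\<in>I. \<xi> i x \<noteq> (\<lambda>_. 0)}"]) (use that in \<open>auto simp: G_def\<close>)
    show "finite {i\<in>C. \<xi> i y \<noteq> (\<lambda>_. 0)}"
      by (rule finite_subset[of _ "{i\<in>I. \<xi> i y \<noteq> (\<lambda>_. 0)}"]) (use that in \<open>auto simp: G_def\<close>)
  qed
  define L where "L = {\<omega>\<in>space M. \<exists>C\<in>CC. \<exists>k. 2 * t \<le> \<bar>SS \<xi> C \<omega> k\<bar>}"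
  define LD where "LD = {p\<in>space (M \<Otimes>\<^sub>M M). \<exists>C\<in>CC. \<exists>k. t \<le> \<bar>SS (dif \<xi>) C p k\<bar>}"
  define R where "R = {\<omega>\<in>space M. \<exists>k. v / 2 \<le> \<bar>SS \<xi> I \<omega> k\<bar>}"
  define RD where "RD = {p\<in>space (M \<Otimes>\<^sub>M M). \<exists>k. v \<le> \<bar>SS (dif \<xi>) I p k\<bar>}"
  have Rm: "R \<in> events" "RD \<in> sets (M \<Otimes>\<^sub>M M)" unfolding R_def RD_def by measurable
  have Lm: "L \<in> events"
  proof -
    have "L = (\<Union>C\<in>CC. {\<omega>\<in>space M. \<exists>k. 2 * t \<le> \<bar>SS \<xi> C \<omega> k\<bar>})" by (auto simp: L_def)
    also have "\<dots> \<in> events" by (intro sets.countable_UN'[OF CC(1)]) auto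
    finally show ?thesis .
  qed
  have LDm: "LD \<in> sets (M \<Otimes>\<^sub>M M)"
  proof -
    have "LD = (\<Union>C\<in>CC. {p\<in>space (M \<Otimes>\<^sub>M M). \<exists>k. t \<le> \<bar>SS (dif \<xi>) C p k\<bar>})" by (auto simp: LD_def)
    also have "\<dots> \<in> sets (M \<Otimes>\<^sub>M M)" by (intro sets.countable_UN'[OF CC(1)]) auto
    finally show ?thesis .
  qed
  have "ennreal (1 / 2) * emeasure M (L \<inter> G) = (\<integral>\<^sup>+x. ennreal (1 / 2) * indicator (L \<inter> G) x \<partial>M)"
    using Lm G(1) by (simp add: nn_integral_cmult_indicator)
  also have "\<dots> \<le> (\<integral>\<^sup>+x. emeasure M (Pair x -` LD) \<partial>M)"
  proof (rule nn_integral_mono)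
    fix x assume x: "x \<in> space M"
    show "ennreal (1 / 2) * indicator (L \<inter> G) x \<le> emeasure M (Pair x -` LD)"
    proof (cases "x \<in> L \<inter> G")
      case True
      \<comment> \<open>Set and coordinate are chosen from the first point alone, so the hypothesis
        on single sums bounds the measure of the section uniformly.\<close>
      then obtain C k where C: "C \<in> CC" "2 * t \<le> \<bar>SS \<xi> C x k\<bar>" by (auto simp: L_def)
      define S where "S = {\<omega>\<in>space M. \<exists>k. t \<le> \<bar>SS \<xi> C \<omega> k\<bar>}"
      have Sm: "S \<in> events" unfolding S_def by measurable
      have "prob S \<le> 1 / 2" using half[OF C(1)] by (simp add: S_def t_def)
      then have "1 / 2 \<le> prob (space M - S)" using prob_compl[OF Sm] by linarith
      also have "\<dots> \<le> prob (Pair x -` LD)"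
      proof (rule prob_le_Int[OF _ G])
        show "Pair x -` LD \<in> events" by (rule sets_Pair1[OF LDm])
        show "(space M - S) \<inter> G \<subseteq> Pair x -` LD"
        proof
          fix y assume y: "y \<in> (space M - S) \<inter> G"
          then have "\<bar>SS \<xi> C y k\<bar> < t" by (auto simp: S_def not_le)
          moreover have "SS (dif \<xi>) C (x, y) k = SS \<xi> C x k - SS \<xi> C y k"
            using True y CC(2)[OF C(1)] by (intro SSd) auto
          ultimately have "t \<le> \<bar>SS (dif \<xi>) C (x, y) k\<bar>" using C(2) by linarith
          then show "y \<in> Pair x -` LD" using x y C(1) by (auto simp: LD_def space_pair_measure)
        qed
      qed (use Sm in auto)
      finally have "ennreal (1 / 2) \<le> emeasure M (Pair x -` LD)"
        unfolding emeasure_eq_measure by (rule ennreal_leI)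
      then show ?thesis using True by (simp only: indicator_simps mult_1_right)
    qed simp
  qed
  also have "\<dots> = emeasure (M \<Otimes>\<^sub>M M) LD" by (rule emeasure_pair_measure_alt[OF LDm, symmetric])
  finally have "ennreal (1 / 2 * prob (L \<inter> G)) \<le> ennreal (MM.prob LD)"
    unfolding emeasure_eq_measure MM.emeasure_eq_measure by (subst ennreal_mult) simp_all
  then have "1 / 2 * prob (L \<inter> G) \<le> MM.prob LD" by (subst (asm) ennreal_le_iff) auto
  moreover have "prob L \<le> prob (L \<inter> G)" by (rule prob_le_Int[OF Lm G]) (use Lm G in auto)
  ultimately have 1: "prob L \<le> 2 * MM.prob LD" by linarith
  have 2: "MM.prob LD \<le> K1 d * MM.prob RD"
    unfolding LD_def RD_def t_def
  proof (rule MM.sym_inf[OF CC vc _ dm _ _ v])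
    show "MM.indep_vars (\<lambda>_. RN) (dif \<xi>) J" if "finite J" "J \<noteq> {}" "J \<subseteq> I" for J
      by (rule dif_indep[OF that(1,2) ind[OF that] rv])
    show "distr (M \<Otimes>\<^sub>M M) RN (dif \<xi> i) = distr (M \<Otimes>\<^sub>M M) RN (\<lambda>p k. - dif \<xi> i p k)" for i
      by (rule dif_symmetric[OF rv])
    have "AE p in M \<Otimes>\<^sub>M M. p \<in> G \<times> G" using GG pGG by (simp add: MM.AE_in_set_eq_1)
    then show "AE p in M \<Otimes>\<^sub>M M. finite {i\<in>I. dif \<xi> i p \<noteq> (\<lambda>_. 0)}"
    proof eventually_elim
      case (elim p)
      have "{i\<in>I. dif \<xi> i p \<noteq> (\<lambda>_. 0)} \<subseteq> {i\<in>I. \<xi> i (fst p) \<noteq> (\<lambda>_. 0)} \<union> {i\<in>I. \<xi> i (snd p) \<noteq> (\<lambda>_. 0)}"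
        by (auto simp: dif_def fun_eq_iff)
      moreover have "finite ({i\<in>I. \<xi> i (fst p) \<noteq> (\<lambda>_. 0)} \<union> {i\<in>I. \<xi> i (snd p) \<noteq> (\<lambda>_. 0)})"
        using elim by (auto simp: G_def)
      ultimately show ?case by (rule finite_subset)
    qed
  qed
  have 3: "MM.prob RD \<le> 2 * prob R"
  proof -
    have "MM.prob RD \<le> MM.prob (R \<times> space M \<union> space M \<times> R)"
    proof (rule MM.prob_le_Int[OF Rm(2) GG pGG])
      show "RD \<inter> G \<times> G \<subseteq> R \<times> space M \<union> space M \<times> R"
      proof
        fix p assume p: "p \<in> RD \<inter> G \<times> G"
        obtain x y where xy: "p = (x, y)" "x \<in> G" "y \<in> G" using p by auto
        then obtain k where "v \<le> \<bar>SS (dif \<xi>) I (x, y) k\<bar>" using p by (auto simp: RD_def)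
        then have "v / 2 \<le> \<bar>SS \<xi> I x k\<bar> \<or> v / 2 \<le> \<bar>SS \<xi> I y k\<bar>"
          unfolding SSd[OF xy(2,3) order_refl] by linarith
        moreover have "x \<in> space M" "y \<in> space M" using xy by (auto simp: G_def)
        ultimately show "p \<in> R \<times> space M \<union> space M \<times> R" using xy by (auto simp: R_def)
      qed
    qed (use Rm in auto)
    also have "\<dots> \<le> MM.prob (R \<times> space M) + MM.prob (space M \<times> R)"
      by (rule measure_Un_le) (use Rm in auto)
    also have "MM.prob (R \<times> space M) = prob R"
      using emeasure_pair_measure_Times[OF Rm(1) sets.top[of M]] by (simp add: measure_def emeasure_space_1)
    also have "MM.prob (space M \<times> R) = prob R"
      using emeasure_pair_measure_Times[OF sets.top[of M] Rm(1)] by (simp add: measure_def emeasure_space_1)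
    finally show ?thesis by simp
  qed
  have "prob L \<le> 2 * (K1 d * (2 * prob R))"
  proof -
    have "K1 d * MM.prob RD \<le> K1 d * (2 * prob R)" using 3 K1_ge[of d] by (intro mult_left_mono) auto
    then show ?thesis using 1 2 by linarith
  qed
  then show ?thesis by (simp add: L_def R_def t_def)
qed

end

section \<open>Families of bounded sequences\<close>

lemma apply_bcontfun_sum: "apply_bcontfun (\<Sum>i\<in>A. f i) k = (\<Sum>i\<in>A. apply_bcontfun (f i) k)"
  for f :: "'i \<Rightarrow> (nat \<Rightarrow>\<^sub>C real)"
  by (induction A rule: infinite_finite_induct) auto

lemma measurable_bcontfun_coord: "(\<lambda>x :: nat \<Rightarrow>\<^sub>C real. apply_bcontfun x k) \<in> borel_measurable borel"
proof (rule borel_measurable_continuous_onI)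
  show "continuous_on UNIV (\<lambda>x :: nat \<Rightarrow>\<^sub>C real. apply_bcontfun x k)"
    unfolding continuous_on_iff using le_less_trans[OF dist_bounded] by blast
qed

lemma measurable_bcontfun_RN: "(\<lambda>(x :: nat \<Rightarrow>\<^sub>C real) k. apply_bcontfun x k) \<in> borel \<rightarrow>\<^sub>M RN"
  by (rule RN_measurable) (rule measurable_bcontfun_coord)

text \<open>Zero outside \<open>I\<close>, so that all these maps are measurable without a condition
  on the index.\<close>

definition coords :: "nat set \<Rightarrow> (nat \<Rightarrow> 'w \<Rightarrow> (nat \<Rightarrow>\<^sub>C real)) \<Rightarrow> nat \<Rightarrow> 'w \<Rightarrow> nat \<Rightarrow> real" where
  "coords I X i \<omega> k = (if i \<in> I then apply_bcontfun (X i \<omega>) k else 0)"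

lemma coords_in: "i \<in> I \<Longrightarrow> coords I X i = (\<lambda>\<omega> k. apply_bcontfun (X i \<omega>) k)"
  by (intro ext) (simp add: coords_def)

lemma coords_eq_0_iff: "i \<in> I \<Longrightarrow> coords I X i \<omega> = (\<lambda>_. 0) \<longleftrightarrow> X i \<omega> = 0"
  by (auto simp: coords_def fun_eq_iff intro: bcontfun_eqI)

lemma SS_coords:
  assumes "C \<subseteq> I"
  shows "SS (coords I X) C \<omega> k = apply_bcontfun (partial_sum X C \<omega>) k"
proof -
  have "{i\<in>C. coords I X i \<omega> \<noteq> (\<lambda>_. 0)} = {i\<in>C. X i \<omega> \<noteq> 0}"
    using assms coords_eq_0_iff[of _ I X \<omega>] by blast
  then show ?thesis
    unfolding SS_def partial_sum_def apply_bcontfun_sum using assms by (intro sum.cong) (auto simp: coords_def)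
qed

lemma norm_less_coord: "u < norm (x :: nat \<Rightarrow>\<^sub>C real) \<Longrightarrow> \<exists>k. u < \<bar>apply_bcontfun x k\<bar>"
  using norm_bound[of x u] by (force simp: not_less)

lemma coord_le_norm: "\<bar>apply_bcontfun x k\<bar> \<le> norm (x :: nat \<Rightarrow>\<^sub>C real)"
  using norm_bounded[of x k] by simp

context prob_space
begin

lemma coords_measurable:
  fixes X :: "nat \<Rightarrow> 'a \<Rightarrow> (nat \<Rightarrow>\<^sub>C real)"
  assumes "\<forall>i\<in>I. X i \<in> borel_measurable M"
  shows "coords I X i \<in> M \<rightarrow>\<^sub>M RN"
proof (cases "i \<in> I")
  case True
  then show ?thesis using measurable_compose[OF bspec[OF assms True] measurable_bcontfun_RN] by (simp add: coords_in)
next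
  case False
  then have "coords I X i = (\<lambda>\<omega> k. 0)" by (intro ext) (simp add: coords_def)
  then show ?thesis by (simp add: RN_measurable)
qed

text \<open>The threshold drops to \<open>u / 2\<close> because neither of the two suprema, over the
  class and over the coordinates, need be attained.\<close>

lemma sup_tail_le:
  fixes X :: "nat \<Rightarrow> 'a \<Rightarrow> (nat \<Rightarrow>\<^sub>C real)"
  assumes X: "\<forall>i\<in>I. X i \<in> borel_measurable M"
    and CC: "countable CC" "\<And>C. C \<in> CC \<Longrightarrow> C \<subseteq> I" and u: "0 < u"
  shows "sup_tail M X CC u \<le> prob {\<omega>\<in>space M. \<exists>C\<in>CC. \<exists>k. u / 2 \<le> \<bar>SS (coords I X) C \<omega> k\<bar>}"
  unfolding sup_tail_def
proof (rule finite_measure_mono)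
  note SS_measurable[OF coords_measurable[OF X], measurable]
  have "{\<omega>\<in>space M. \<exists>C\<in>CC. \<exists>k. u / 2 \<le> \<bar>SS (coords I X) C \<omega> k\<bar>}
      = (\<Union>C\<in>CC. {\<omega>\<in>space M. \<exists>k. u / 2 \<le> \<bar>SS (coords I X) C \<omega> k\<bar>})" by auto
  also have "\<dots> \<in> events" by (intro sets.countable_UN'[OF CC(1)]) auto
  finally show "{\<omega>\<in>space M. \<exists>C\<in>CC. \<exists>k. u / 2 \<le> \<bar>SS (coords I X) C \<omega> k\<bar>} \<in> events" .
  show "{\<omega>\<in>space M. ennreal u \<le> (SUP C\<in>CC. ennreal (norm (partial_sum X C \<omega>)))}
      \<subseteq> {\<omega>\<in>space M. \<exists>C\<in>CC. \<exists>k. u / 2 \<le> \<bar>SS (coords I X) C \<omega> k\<bar>}"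
  proof
    fix \<omega> assume w: "\<omega> \<in> {\<omega>\<in>space M. ennreal u \<le> (SUP C\<in>CC. ennreal (norm (partial_sum X C \<omega>)))}"
    have "ennreal (u / 2) < ennreal u" using u by (simp add: ennreal_less_iff del: ennreal_divide_numeral)
    also have "\<dots> \<le> (SUP C\<in>CC. ennreal (norm (partial_sum X C \<omega>)))" using w by blast
    finally obtain C where C: "C \<in> CC" "ennreal (u / 2) < ennreal (norm (partial_sum X C \<omega>))"
      unfolding less_SUP_iff by blast
    then have "u / 2 < norm (partial_sum X C \<omega>)"
      using u by (simp add: ennreal_less_iff del: ennreal_divide_numeral)
    then obtain k where "u / 2 < \<bar>apply_bcontfun (partial_sum X C \<omega>) k\<bar>" using norm_less_coord by blast
    then have "u / 2 \<le> \<bar>SS (coords I X) C \<omega> k\<bar>" unfolding SS_coords[OF CC(2)[OF C(1)]] by linarith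
    then show "\<omega> \<in> {\<omega>\<in>space M. \<exists>C\<in>CC. \<exists>k. u / 2 \<le> \<bar>SS (coords I X) C \<omega> k\<bar>}" using w C(1) by blast
  qed
qed

text \<open>A non-strict bound on a supremum is a countable intersection of strict bounds attained
  at some coordinate. Measurability matters because a non-measurable event has measure 0 by
  convention and could not serve as an upper bound.\<close>

lemma sum_tail_event:
  fixes X :: "nat \<Rightarrow> 'a \<Rightarrow> (nat \<Rightarrow>\<^sub>C real)"
  assumes X: "\<forall>i\<in>I. X i \<in> borel_measurable M" and C: "C \<subseteq> I"
  shows "{\<omega>\<in>space M. w \<le> norm (partial_sum X C \<omega>)} \<in> events"
proof -
  note SS_measurable[OF coords_measurable[OF X], measurable]
  have "w \<le> norm (partial_sum X C \<omega>) \<longleftrightarrow> (\<forall>n. \<exists>k. w - inverse (real (Suc n)) < \<bar>SS (coords I X) C \<omega> k\<bar>)" for \<omega>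
    unfolding SS_coords[OF C]
  proof
    assume w: "w \<le> norm (partial_sum X C \<omega>)"
    show "\<forall>n. \<exists>k. w - inverse (real (Suc n)) < \<bar>apply_bcontfun (partial_sum X C \<omega>) k\<bar>"
    proof
      fix n
      have "0 < inverse (real (Suc n))" by simp
      then have "w - inverse (real (Suc n)) < norm (partial_sum X C \<omega>)" using w by linarith
      then show "\<exists>k. w - inverse (real (Suc n)) < \<bar>apply_bcontfun (partial_sum X C \<omega>) k\<bar>" by (rule norm_less_coord)
    qed
  next
    assume a: "\<forall>n. \<exists>k. w - inverse (real (Suc n)) < \<bar>apply_bcontfun (partial_sum X C \<omega>) k\<bar>"
    show "w \<le> norm (partial_sum X C \<omega>)"
    proof (rule ccontr)
      assume "\<not> ?thesis"
      then have "0 < w - norm (partial_sum X C \<omega>)" by simp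
      then obtain n where n: "inverse (real (Suc n)) < w - norm (partial_sum X C \<omega>)" using reals_Archimedean by blast
      obtain k where "w - inverse (real (Suc n)) < \<bar>apply_bcontfun (partial_sum X C \<omega>) k\<bar>" using a by blast
      then show False using coord_le_norm[of "partial_sum X C \<omega>" k] n by linarith
    qed
  qed
  then have "{\<omega>\<in>space M. w \<le> norm (partial_sum X C \<omega>)}
      = {\<omega>\<in>space M. \<forall>n. \<exists>k. w - inverse (real (Suc n)) < \<bar>SS (coords I X) C \<omega> k\<bar>}" by simp
  also have "\<dots> \<in> events" by measurable
  finally show ?thesis .
qed

lemma sum_tail_ge:
  fixes X :: "nat \<Rightarrow> 'a \<Rightarrow> (nat \<Rightarrow>\<^sub>C real)"
  assumes X: "\<forall>i\<in>I. X i \<in> borel_measurable M" and C: "C \<subseteq> I" and w: "w' \<le> w"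
  shows "prob {\<omega>\<in>space M. \<exists>k. w \<le> \<bar>SS (coords I X) C \<omega> k\<bar>} \<le> sum_tail M X C w'"
  unfolding sum_tail_def
proof (rule finite_measure_mono[OF _ sum_tail_event[OF X C]])
  show "{\<omega>\<in>space M. \<exists>k. w \<le> \<bar>SS (coords I X) C \<omega> k\<bar>} \<subseteq> {\<omega>\<in>space M. w' \<le> norm (partial_sum X C \<omega>)}"
    unfolding SS_coords[OF C] using coord_le_norm w by (blast intro: order_trans)
qed

text \<open>If all single sums exceed the symmetrization level with probability at most 1/2,
  \<open>nonsym_inf\<close> applies. Otherwise one of them makes the right-hand side at least K / 2
  \<ge> 1, and the bound is trivial; this is what the supremum over single sums is for.\<close>

lemma universal_case:
  fixes X :: "nat \<Rightarrow> 'a \<Rightarrow> (nat \<Rightarrow>\<^sub>C real)"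
  assumes ind: "indep_vars (\<lambda>_. borel) X I" and fin: "AE \<omega> in M. finite {i\<in>I. X i \<omega> \<noteq> 0}"
    and CC: "countable CC" and VC: "VC_class I CC d"
  defines "K \<equiv> 8 * K1 d"
  shows "\<And>u. 0 < u \<Longrightarrow> sup_tail M X CC u \<le> K * (SUP C\<in>CC \<union> {I}. sum_tail M X C (u / K))"
    and "\<And>u. \<forall>i\<in>I. symmetric_rv M (X i) \<Longrightarrow> 0 < u \<Longrightarrow> sup_tail M X CC u \<le> K * sum_tail M X I (u / K)"
proof -
  have K1: "1 \<le> K1 d" by (rule K1_ge)
  have X: "\<forall>i\<in>I. X i \<in> borel_measurable M" using ind by (simp add: indep_vars_def2)
  note rv = coords_measurable[OF X]
  have CI: "C \<subseteq> I" if "C \<in> CC" for C using VC that by (auto simp: VC_class_def)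
  have vc: "\<not> shatters CC B" if "B \<subseteq> I" "card B = Suc d" for B by (rule VC_class_not_shatters[OF VC that])
  have ind': "indep_vars (\<lambda>_. RN) (coords I X) J" if J: "J \<subseteq> I" for J
  proof -
    have "indep_vars (\<lambda>_. RN) (\<lambda>i \<omega>. (\<lambda>x k. apply_bcontfun x k) (X i \<omega>)) J"
      by (rule indep_vars_compose2[OF indep_vars_subset[OF ind J]]) (rule measurable_bcontfun_RN)
    moreover have "coords I X i = (\<lambda>\<omega>. (\<lambda>x k. apply_bcontfun x k) (X i \<omega>))" if "i \<in> J" for i
      using coords_in[of i I X] J that by blast
    ultimately show ?thesis using indep_vars_cong[of J J "coords I X"] by simp
  qed
  have fin': "AE \<omega> in M. finite {i\<in>I. coords I X i \<omega> \<noteq> (\<lambda>_. 0)}"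
  proof -
    have "{i\<in>I. coords I X i \<omega> \<noteq> (\<lambda>_. 0)} = {i\<in>I. X i \<omega> \<noteq> 0}" for \<omega>
      using coords_eq_0_iff[of _ I X \<omega>] by blast
    then show ?thesis using fin by simp
  qed
  have st01: "0 \<le> sum_tail M X C w" "sum_tail M X C w \<le> 1" for C w by (simp_all add: sum_tail_def)
  show "sup_tail M X CC u \<le> K * (SUP C\<in>CC \<union> {I}. sum_tail M X C (u / K))" if u: "0 < u" for u
  proof -
    have bdd: "bdd_above ((\<lambda>C. sum_tail M X C (u / K)) ` (CC \<union> {I}))"
      by (rule bdd_aboveI2[where M = 1]) (rule st01)
    have up: "sum_tail M X C (u / K) \<le> (SUP C\<in>CC \<union> {I}. sum_tail M X C (u / K))" if "C \<in> CC \<union> {I}" for C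
      by (rule cSUP_upper[OF that bdd])
    \<comment> \<open>Chosen so that \<open>2 * (K1 d * v)\<close> is the level \<open>u / 2\<close>
      left by \<open>sup_tail_le\<close>; then \<open>v / 2\<close> is \<open>u / K\<close>, which
      explains the factor 8.\<close>
    define v where "v = u / (4 * K1 d)"
    have v: "0 < v" "K1 d * v = u / 4" "v / 2 = u / K" using u K1 by (simp_all add: v_def K_def)
    show ?thesis
    proof (cases "\<forall>C\<in>CC. prob {\<omega>\<in>space M. \<exists>k. K1 d * v \<le> \<bar>SS (coords I X) C \<omega> k\<bar>} \<le> 1 / 2")
      case True
      have "sup_tail M X CC u \<le> prob {\<omega>\<in>space M. \<exists>C\<in>CC. \<exists>k. 2 * (K1 d * v) \<le> \<bar>SS (coords I X) C \<omega> k\<bar>}"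
      proof -
        have u2: "2 * (K1 d * v) = u / 2" using v(2) by simp
        show ?thesis unfolding u2 by (rule sup_tail_le[OF X CC CI u])
      qed
      also have "\<dots> \<le> 4 * K1 d * prob {\<omega>\<in>space M. \<exists>k. v / 2 \<le> \<bar>SS (coords I X) I \<omega> k\<bar>}"
      proof (rule nonsym_inf[OF CC CI vc _ rv fin' v(1)])
        show "indep_vars (\<lambda>_. RN) (coords I X) J" if "J \<subseteq> I" for J by (rule ind'[OF that])
        show "prob {\<omega>\<in>space M. \<exists>k. K1 d * v \<le> \<bar>SS (coords I X) C \<omega> k\<bar>} \<le> 1 / 2" if "C \<in> CC" for C
          using True that by blast
      qed
      also have "\<dots> \<le> 4 * K1 d * sum_tail M X I (u / K)"
        using sum_tail_ge[OF X order_refl, where w' = "u / K" and w = "v / 2"] v(3) K1 by (intro mult_left_mono) auto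
      also have "\<dots> \<le> K * sum_tail M X I (u / K)"
        using st01 K1 by (intro mult_right_mono) (auto simp: K_def)
      also have "\<dots> \<le> K * (SUP C\<in>CC \<union> {I}. sum_tail M X C (u / K))"
        using up[of I] K1 by (intro mult_left_mono) (auto simp: K_def)
      finally show ?thesis .
    next
      case False
      then obtain C where C: "C \<in> CC" "1 / 2 < prob {\<omega>\<in>space M. \<exists>k. K1 d * v \<le> \<bar>SS (coords I X) C \<omega> k\<bar>}"
        by (auto simp: not_le)
      have "u / K \<le> K1 d * v" unfolding v(2) K_def using u K1 by (intro divide_left_mono) auto
      then have "1 / 2 < sum_tail M X C (u / K)"
        using C(2) sum_tail_ge[OF X CI[OF C(1)], where w' = "u / K" and w = "K1 d * v"] by linarith
      then have "1 / 2 \<le> (SUP C\<in>CC \<union> {I}. sum_tail M X C (u / K))" using up[of C] C(1) by simp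
      then have "K * (1 / 2) \<le> K * (SUP C\<in>CC \<union> {I}. sum_tail M X C (u / K))"
        using K1 by (intro mult_left_mono) (auto simp: K_def)
      moreover have "sup_tail M X CC u \<le> 1" by (simp add: sup_tail_def)
      moreover have "1 \<le> K * (1 / 2)" using K1 by (simp add: K_def)
      ultimately show ?thesis by linarith
    qed
  qed
  show "sup_tail M X CC u \<le> K * sum_tail M X I (u / K)"
    if sym: "\<forall>i\<in>I. symmetric_rv M (X i)" and u: "0 < u" for u
  proof -
    define v where "v = u / (2 * K1 d)"
    have v: "0 < v" "K1 d * v = u / 2" using u K1 by (simp_all add: v_def)
    have "sup_tail M X CC u \<le> prob {\<omega>\<in>space M. \<exists>C\<in>CC. \<exists>k. K1 d * v \<le> \<bar>SS (coords I X) C \<omega> k\<bar>}"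
      unfolding v(2) by (rule sup_tail_le[OF X CC CI u])
    also have "\<dots> \<le> K1 d * prob {\<omega>\<in>space M. \<exists>k. v \<le> \<bar>SS (coords I X) I \<omega> k\<bar>}"
    proof (rule sym_inf[OF CC CI vc _ rv _ fin' v(1)])
      show "indep_vars (\<lambda>_. RN) (coords I X) J" if "J \<subseteq> I" for J by (rule ind'[OF that])
      fix i assume i: "i \<in> I"
      let ?c = "\<lambda>(x :: nat \<Rightarrow>\<^sub>C real) k. apply_bcontfun x k"
      have s: "distr M borel (X i) = distr M borel (\<lambda>\<omega>. - X i \<omega>)" using sym i by (simp add: symmetric_rv_def)
      have mneg: "(\<lambda>\<omega>. - X i \<omega>) \<in> borel_measurable M"
        by (rule measurable_compose[OF bspec[OF X i]]) (intro borel_measurable_continuous_onI continuous_intros)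
      have "distr M RN (coords I X i) = distr (distr M borel (X i)) RN ?c"
        using distr_distr[OF measurable_bcontfun_RN bspec[OF X i]] by (simp add: coords_in[OF i] comp_def)
      also have "\<dots> = distr M RN (\<lambda>\<omega> k. - coords I X i \<omega> k)"
        unfolding s using distr_distr[OF measurable_bcontfun_RN mneg] by (simp add: coords_in[OF i] comp_def)
      finally show "distr M RN (coords I X i) = distr M RN (\<lambda>\<omega> k. - coords I X i \<omega> k)" .
    qed
    also have "\<dots> \<le> K1 d * sum_tail M X I (u / K)"
    proof (rule mult_left_mono[OF sum_tail_ge[OF X order_refl]])
      show "u / K \<le> v" unfolding v_def K_def using u K1 by (intro divide_left_mono) auto
    qed (use K1 in auto)
    also have "\<dots> \<le> K * sum_tail M X I (u / K)"
      using st01 K1 by (intro mult_right_mono) (auto simp: K_def)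
    finally show ?thesis .
  qed
qed

end

section \<open>Transfer to Banach spaces\<close>

text \<open>The predicate under the choice operator of \<open>VC_const\<close>: one admissible value
  therefore makes the chosen constant admissible.\<close>

definition VC_prop :: "nat \<Rightarrow> real \<Rightarrow> bool" where
  "VC_prop d K \<longleftrightarrow> K > 0 \<and>
     (\<forall>(F :: (nat \<Rightarrow>\<^sub>C real) set) (I :: nat set) (M :: (nat \<Rightarrow> (nat \<Rightarrow>\<^sub>C real)) measure) X \<C>.
        subspace F \<and> closed F \<and> (\<exists>D. countable D \<and> F \<subseteq> closure D) \<and>
        prob_space M \<and> prob_space.indep_vars M (\<lambda>_. borel) X I \<and>
        (\<forall>i\<in>I. \<forall>\<omega>\<in>space M. X i \<omega> \<in> F) \<and>
        (AE \<omega> in M. finite {i \<in> I. X i \<omega> \<noteq> 0}) \<and>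
        countable \<C> \<and> VC_class I \<C> d \<longrightarrow>
        (\<forall>u>0. sup_tail M X \<C> u \<le> K * (SUP C\<in>\<C> \<union> {I}. sum_tail M X C (u / K))) \<and>
        ((\<forall>i\<in>I. symmetric_rv M (X i)) \<longrightarrow>
           (\<forall>u>0. sup_tail M X \<C> u \<le> K * sum_tail M X I (u / K))))"

lemma VC_prop_VC_const: "VC_prop d (VC_const d)"
proof -
  have "VC_prop d (8 * K1 d)"
    unfolding VC_prop_def
  proof (intro conjI allI impI; (elim conjE)?)
    show "0 < 8 * K1 d" using K1_ge[of d] by simp
    fix M :: "(nat \<Rightarrow> (nat \<Rightarrow>\<^sub>C real)) measure" and I and X :: "nat \<Rightarrow> (nat \<Rightarrow> (nat \<Rightarrow>\<^sub>C real)) \<Rightarrow> (nat \<Rightarrow>\<^sub>C real)" and \<C> and u :: real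
    assume a: "prob_space M" "prob_space.indep_vars M (\<lambda>_. borel) X I"
      "AE \<omega> in M. finite {i \<in> I. X i \<omega> \<noteq> 0}" "countable \<C>" "VC_class I \<C> d" "0 < u"
    show "sup_tail M X \<C> u \<le> 8 * K1 d * (SUP C\<in>\<C> \<union> {I}. sum_tail M X C (u / (8 * K1 d)))"
      by (rule prob_space.universal_case(1)[OF a])
    show "sup_tail M X \<C> u \<le> 8 * K1 d * sum_tail M X I (u / (8 * K1 d))"
      if "\<forall>i\<in>I. symmetric_rv M (X i)"
      by (rule prob_space.universal_case(2)[OF a(1-5) that a(6)])
  qed
  then have "VC_prop d (SOME K. VC_prop d K)" by (rule someI)
  then show ?thesis unfolding VC_prop_def VC_const_def .
qed

text \<open>Traces on a subset of the image are images of traces on its preimage in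
  \<open>I\<close>, which has the same size by injectivity.\<close>

lemma VC_class_image:
  assumes VC: "VC_class I \<C> d" and g: "inj_on g I"
  shows "VC_class (g ` I) ((\<lambda>C. g ` C) ` \<C>) d"
  unfolding VC_class_def
proof (intro conjI allI impI)
  have sub: "C \<subseteq> I" if "C \<in> \<C>" for C using VC that by (auto simp: VC_class_def)
  show "(\<lambda>C. g ` C) ` \<C> \<subseteq> Pow (g ` I)" using sub by blast
  fix A assume A: "A \<subseteq> g ` I \<and> card A = d + 1"
  define B where "B = {i\<in>I. g i \<in> A}"
  have gB: "g ` B = A" using A by (auto simp: B_def)
  have BI: "B \<subseteq> I" by (auto simp: B_def)
  have cB: "card B = d + 1" using card_image[OF inj_on_subset[OF g BI]] gB A by simp
  then have fB: "finite B" using card_ge_0_finite[of B] by simp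
  have "{C' \<inter> A | C'. C' \<in> (\<lambda>C. g ` C) ` \<C>} = (\<lambda>S. g ` S) ` {C \<inter> B | C. C \<in> \<C>}"
  proof -
    have eq: "g ` C \<inter> A = g ` (C \<inter> B)" if "C \<in> \<C>" for C
      unfolding gB[symmetric] by (rule inj_on_image_Int[OF g sub[OF that] BI, symmetric])
    have "{C' \<inter> A | C'. C' \<in> (\<lambda>C. g ` C) ` \<C>} = (\<lambda>C. g ` C \<inter> A) ` \<C>" by blast
    also have "\<dots> = (\<lambda>C. g ` (C \<inter> B)) ` \<C>" by (intro image_cong refl eq)
    also have "\<dots> = (\<lambda>S. g ` S) ` (\<lambda>C. C \<inter> B) ` \<C>" by (rule image_image[symmetric])
    also have "(\<lambda>C. C \<inter> B) ` \<C> = {C \<inter> B | C. C \<in> \<C>}" by blast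
    finally show ?thesis .
  qed
  moreover have "finite {C \<inter> B | C. C \<in> \<C>}" by (rule finite_subset[of _ "Pow B"]) (use fB in auto)
  ultimately have "card {C' \<inter> A | C'. C' \<in> (\<lambda>C. g ` C) ` \<C>} \<le> card {C \<inter> B | C. C \<in> \<C>}"
    by (simp add: card_image_le)
  also have "\<dots> < 2 ^ (d + 1)" using VC BI cB unfolding VC_class_def by blast
  finally show "card {C' \<inter> A | C'. C' \<in> (\<lambda>C. g ` C) ` \<C>} < 2 ^ (d + 1)" .
qed

text \<open>The image of \<open>M\<close> under \<open>T\<close>, on the largest \<open>\<sigma>\<close>-algebra that makes \<open>T\<close> measurable: every
  event, measurable or not, then has the same measure as its preimage.\<close>

definition final_distr :: "'a measure \<Rightarrow> ('a \<Rightarrow> 'c) \<Rightarrow> 'c measure" where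
  "final_distr M T = distr M (sigma UNIV {A. T -` A \<inter> space M \<in> sets M}) T"

lemma measurable_final: "T \<in> M \<rightarrow>\<^sub>M sigma UNIV {A. T -` A \<inter> space M \<in> sets M}"
  by (rule measurable_measure_of) auto

lemma space_final_distr [simp]: "space (final_distr M T) = UNIV"
  by (simp add: final_distr_def)

lemma sets_final_distr: "A \<in> sets (final_distr M T) \<longleftrightarrow> T -` A \<inter> space M \<in> sets M"
proof
  assume "A \<in> sets (final_distr M T)"
  then show "T -` A \<inter> space M \<in> sets M"
    unfolding final_distr_def sets_distr by (rule measurable_sets[OF measurable_final])
qed (simp add: final_distr_def)

lemma measure_final_distr: "measure (final_distr M T) A = measure M (T -` A \<inter> space M)"
proof (cases "A \<in> sets (final_distr M T)")
  case True
  then show ?thesis unfolding final_distr_def by (intro measure_distr[OF measurable_final]) simp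
next
  case False
  then show ?thesis by (simp add: measure_notin_sets sets_final_distr)
qed

lemma measurable_final_distr:
  assumes "(\<lambda>\<omega>. f (T \<omega>)) \<in> borel_measurable M"
  shows "f \<in> borel_measurable (final_distr M T)"
proof (rule measurableI)
  fix A :: "'b set" assume A: "A \<in> sets borel"
  have "T -` (f -` A \<inter> space (final_distr M T)) \<inter> space M = (\<lambda>\<omega>. f (T \<omega>)) -` A \<inter> space M" by auto
  then show "f -` A \<inter> space (final_distr M T) \<in> sets (final_distr M T)"
    unfolding sets_final_distr using measurable_sets[OF assms A] by simp
qed simp

lemma distr_final_distr:
  assumes "(\<lambda>\<omega>. f (T \<omega>)) \<in> borel_measurable M"
  shows "distr (final_distr M T) borel f = distr M borel (\<lambda>\<omega>. f (T \<omega>))"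
proof -
  have fm: "f \<in> borel_measurable (sigma UNIV {A. T -` A \<inter> space M \<in> sets M})"
    using measurable_final_distr[where f = f and T = T, OF assms] by (simp add: final_distr_def)
  then show ?thesis
    unfolding final_distr_def distr_distr[OF fm measurable_final] by (simp add: comp_def)
qed

text \<open>The family is read as one random sequence \<open>T\<close> that has the embedded
  variables at the codes of their indices, and \<open>Y\<close> is the coordinate process on the
  space of sequences. On the final \<sigma>-algebra the tails agree exactly, even where the
  measurability of an event is not known.\<close>

lemma transfer_embedding:
  fixes X :: "'i \<Rightarrow> 'a \<Rightarrow> 'b::{banach, second_countable_topology}"
  assumes I: "countable I" and M: "prob_space M" and ind: "prob_space.indep_vars M (\<lambda>_. borel) X I"
    and fin: "AE \<omega> in M. finite {i \<in> I. X i \<omega> \<noteq> 0}" and CI: "\<forall>C\<in>\<C>. C \<subseteq> I"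
  obtains F :: "(nat \<Rightarrow>\<^sub>C real) set" and g :: "'i \<Rightarrow> nat" and N :: "(nat \<Rightarrow> (nat \<Rightarrow>\<^sub>C real)) measure" and Y
  where "subspace F" "closed F" "\<exists>D. countable D \<and> F \<subseteq> closure D" "inj_on g I"
    "prob_space N" "prob_space.indep_vars N (\<lambda>_. borel) Y (g ` I)"
    "\<forall>n\<in>g ` I. \<forall>\<omega>\<in>space N. Y n \<omega> \<in> F" "AE \<omega> in N. finite {n \<in> g ` I. Y n \<omega> \<noteq> 0}"
    "\<forall>u. sup_tail N Y ((\<lambda>C. g ` C) ` \<C>) u = sup_tail M X \<C> u"
    "\<forall>C\<subseteq>I. \<forall>u. sum_tail N Y (g ` C) u = sum_tail M X C u"
    "\<forall>i\<in>I. symmetric_rv M (X i) \<longrightarrow> symmetric_rv N (Y (g i))"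
proof -
  interpret prob_space M by (rule M)
  obtain \<Phi> :: "'b \<Rightarrow> (nat \<Rightarrow>\<^sub>C real)" where bl: "bounded_linear \<Phi>" and iso: "\<And>x. norm (\<Phi> x) = norm x"
    using isometric_embedding by blast
  interpret \<Phi>: bounded_linear \<Phi> by (rule bl)
  have \<Phi>0: "\<Phi> x = 0 \<longleftrightarrow> x = 0" for x using iso[of x] by (metis norm_eq_zero)
  define F where "F = range \<Phi>"
  define g where "g = to_nat_on I"
  have g: "inj_on g I" unfolding g_def by (rule inj_on_to_nat_on[OF I])
  define h where "h = the_inv_into I g"
  have hg: "h (g i) = i" if "i \<in> I" for i unfolding h_def by (rule the_inv_into_f_f[OF g that])
  define T where "T \<omega> n = (if n \<in> g ` I then \<Phi> (X (h n) \<omega>) else 0)" for \<omega> n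
  define N where "N = final_distr M T"
  \<comment> \<open>Membership in \<open>F\<close> is required at every sequence, including those
    that \<open>T\<close> never produces; values outside \<open>F\<close> are therefore reset to 0,
    which changes nothing along \<open>T\<close> at the codes.\<close>
  define Y where "Y n \<omega> = (if \<omega> n \<in> F then \<omega> n else 0)" for n :: nat and \<omega>
  have YT: "Y (g i) (T \<omega>) = \<Phi> (X i \<omega>)" if "i \<in> I" for i \<omega>
    using that hg by (simp add: Y_def T_def F_def)
  have F0: "0 \<in> F" unfolding F_def using \<Phi>0[of 0] by (metis rangeI)
  have X: "X i \<in> borel_measurable M" if "i \<in> I" for i using ind that by (simp add: indep_vars_def2)
  have \<Phi>m: "\<Phi> \<in> borel_measurable borel"
    by (intro borel_measurable_continuous_onI linear_continuous_on bl)
  have \<Phi>X: "(\<lambda>\<omega>. \<Phi> (X i \<omega>)) \<in> borel_measurable M" if "i \<in> I" for i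
    by (rule measurable_compose[OF X[OF that] \<Phi>m])
  have YTm: "(\<lambda>\<omega>. Y (g i) (T \<omega>)) \<in> borel_measurable M" if "i \<in> I" for i using \<Phi>X[OF that] by (simp add: YT[OF that])
  have meas: "measure N A = prob (T -` A \<inter> space M)" for A unfolding N_def by (rule measure_final_distr)
  have sp: "space N = UNIV" by (simp add: N_def)
  have ps: "prob_space N"
    unfolding N_def final_distr_def by (rule prob_space_distr[OF measurable_final])
  interpret N: prob_space N by (rule ps)
  have ps_eq: "partial_sum Y (g ` C) (T \<omega>) = \<Phi> (partial_sum X C \<omega>)" if C: "C \<subseteq> I" for C \<omega>
  proof -
    have "{n \<in> g ` C. Y n (T \<omega>) \<noteq> 0} = g ` {i \<in> C. X i \<omega> \<noteq> 0}" using C YT \<Phi>0 by auto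
    moreover have "inj_on g {i \<in> C. X i \<omega> \<noteq> 0}" by (rule inj_on_subset[OF g]) (use C in auto)
    ultimately have "partial_sum Y (g ` C) (T \<omega>) = (\<Sum>i\<in>{i \<in> C. X i \<omega> \<noteq> 0}. Y (g i) (T \<omega>))"
      by (simp add: partial_sum_def sum.reindex)
    also have "\<dots> = (\<Sum>i\<in>{i \<in> C. X i \<omega> \<noteq> 0}. \<Phi> (X i \<omega>))" using C by (intro sum.cong refl YT) auto
    finally show ?thesis by (simp add: partial_sum_def \<Phi>.sum)
  qed
  have indX: "indep_vars (\<lambda>_. borel) (\<lambda>i \<omega>. \<Phi> (X i \<omega>)) I"
    by (rule indep_vars_compose2[OF ind, where Y = "\<lambda>_. \<Phi>"]) (rule \<Phi>m)
  show ?thesis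
  proof (rule that[of F g N Y])
    show "subspace F" unfolding F_def by (rule linear_subspace_image[OF \<Phi>.linear subspace_UNIV])
    show "closed F"
    proof -
      show ?thesis unfolding F_def
        by (rule complete_imp_closed, rule complete_isometric_image[where e = 1])
          (use bl iso complete_UNIV in simp_all)
    qed
    show "\<exists>D. countable D \<and> F \<subseteq> closure D"
    proof -
      obtain D :: "'b set" where D: "countable D" "\<And>U. open U \<Longrightarrow> U \<noteq> {} \<Longrightarrow> \<exists>d\<in>D. d \<in> U"
        using countable_dense_exists by blast
      have "F \<subseteq> closure (\<Phi> ` D)"
      proof
        fix z assume "z \<in> F"
        then obtain x where x: "z = \<Phi> x" by (auto simp: F_def)
        show "z \<in> closure (\<Phi> ` D)"
          unfolding closure_approachable
        proof (intro allI impI)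
          fix e :: real assume e: "0 < e"
          obtain y where y: "y \<in> D" "y \<in> ball x e" using D(2)[of "ball x e"] e by auto
          have "dist (\<Phi> y) z = dist y x" unfolding x dist_norm \<Phi>.diff[symmetric] by (rule iso)
          then have "dist (\<Phi> y) z < e" using y(2) by (simp add: dist_commute)
          then show "\<exists>y\<in>\<Phi> ` D. dist y z < e" using y(1) by (intro bexI[of _ "\<Phi> y"] imageI)
        qed
      qed
      then show ?thesis using D(1) by blast
    qed
    show "inj_on g I" by (rule g)
    show "prob_space N" by (rule ps)
    show "\<forall>n\<in>g ` I. \<forall>\<omega>\<in>space N. Y n \<omega> \<in> F" using F0 by (simp add: Y_def)
    show "prob_space.indep_vars N (\<lambda>_. borel) Y (g ` I)"
      unfolding N.indep_vars_def2 N.indep_sets_def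
    proof (intro conjI ballI allI impI)
      show Ym: "Y n \<in> borel_measurable N" if nI: "n \<in> g ` I" for n
        proof -
        obtain i where i: "i \<in> I" "n = g i" using nI by blast
        show ?thesis unfolding N_def i(2) by (rule measurable_final_distr) (rule YTm[OF i(1)])
      qed
      show "{Y n -` A \<inter> space N |A. A \<in> sets borel} \<subseteq> N.events" if "n \<in> g ` I" for n
        using measurable_sets[OF Ym[OF that]] by auto
      fix J A assume J: "J \<subseteq> g ` I" "J \<noteq> {}" "finite J" and A: "A \<in> (\<Pi> n\<in>J. {Y n -` A \<inter> space N |A. A \<in> sets borel})"
      have "\<forall>n\<in>J. \<exists>B. B \<in> sets borel \<and> A n = Y n -` B \<inter> space N" using A by (auto simp: Pi_iff)
      then obtain B where B: "\<And>n. n \<in> J \<Longrightarrow> B n \<in> sets borel" "\<And>n. n \<in> J \<Longrightarrow> A n = Y n -` B n \<inter> space N"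
        by (auto dest!: bchoice)
      define J0 where "J0 = {i\<in>I. g i \<in> J}"
      have J0: "J0 \<subseteq> I" "g ` J0 = J" using J(1) by (auto simp: J0_def)
      have gJ: "inj_on g J0" by (rule inj_on_subset[OF g J0(1)])
      have fJ0: "finite J0" "J0 \<noteq> {}" using finite_imageD[of g J0] gJ J0 J by auto
      have pre: "T -` A (g i) \<inter> space M = (\<lambda>\<omega>. \<Phi> (X i \<omega>)) -` B (g i) \<inter> space M" if i: "i \<in> J0" for i
      proof -
        have "g i \<in> J" "i \<in> I" using i by (auto simp: J0_def)
        then show ?thesis using B(2)[of "g i"] YT[of i] by (auto simp: sp)
      qed
      have "N.prob (\<Inter>n\<in>J. A n) = prob (\<Inter>i\<in>J0. T -` A (g i) \<inter> space M)"
        unfolding meas by (rule arg_cong[where f = prob]) (use J0(2) fJ0(2) in auto)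
      also have "\<dots> = prob (\<Inter>i\<in>J0. (\<lambda>\<omega>. \<Phi> (X i \<omega>)) -` B (g i) \<inter> space M)" using pre by simp
      also have "\<dots> = (\<Prod>i\<in>J0. prob ((\<lambda>\<omega>. \<Phi> (X i \<omega>)) -` B (g i) \<inter> space M))"
        by (rule indep_varsD[OF indX fJ0(2,1) J0(1)]) (use B(1) in \<open>auto simp: J0_def\<close>)
      also have "\<dots> = (\<Prod>i\<in>J0. N.prob (A (g i)))" unfolding meas using pre by simp
      also have "\<dots> = (\<Prod>n\<in>J. N.prob (A n))" unfolding J0(2)[symmetric] by (simp add: prod.reindex[OF gJ])
      finally show "N.prob (\<Inter>n\<in>J. A n) = (\<Prod>n\<in>J. N.prob (A n))" .
    qed
    show "AE \<omega> in N. finite {n \<in> g ` I. Y n \<omega> \<noteq> 0}"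
    proof -
      have eq: "{n \<in> g ` I. Y n (T \<omega>) \<noteq> 0} = g ` {i \<in> I. X i \<omega> \<noteq> 0}" for \<omega> using YT \<Phi>0 by auto
      have iff: "finite {n \<in> g ` I. Y n (T \<omega>) \<noteq> 0} \<longleftrightarrow> finite {i \<in> I. X i \<omega> \<noteq> 0}" for \<omega>
        unfolding eq by (rule finite_image_iff) (rule inj_on_subset[OF g], auto)
      have ev: "{\<omega>\<in>space M. finite {n \<in> g ` I. Y n (T \<omega>) \<noteq> 0}} \<in> events"
      proof -
        have "{\<omega>\<in>space M. n \<in> {n \<in> g ` I. Y n (T \<omega>) \<noteq> 0}} \<in> events" for n
        proof (cases "n \<in> g ` I")
          case True
          then obtain i where i: "i \<in> I" "n = g i" by blast
          have "{\<omega>\<in>space M. Y (g i) (T \<omega>) \<noteq> 0} = (\<lambda>\<omega>. Y (g i) (T \<omega>)) -` (- {0}) \<inter> space M" by auto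
          also have "\<dots> \<in> events" by (rule measurable_sets[OF YTm[OF i(1)]]) simp
          finally show ?thesis using True i by simp
        qed simp
        then have "Measurable.pred M (\<lambda>\<omega>. finite {n \<in> g ` I. Y n (T \<omega>) \<noteq> 0})" by (rule measurable_finite)
        then show ?thesis by (simp add: pred_def)
      qed
      have vi: "T -` {\<omega>. finite {n \<in> g ` I. Y n \<omega> \<noteq> 0}} \<inter> space M = {\<omega>\<in>space M. finite {n \<in> g ` I. Y n (T \<omega>) \<noteq> 0}}"
        by auto
      have evN: "{\<omega>. finite {n \<in> g ` I. Y n \<omega> \<noteq> 0}} \<in> N.events"
        unfolding N_def sets_final_distr vi by (rule ev)
      have "prob {\<omega>\<in>space M. finite {n \<in> g ` I. Y n (T \<omega>) \<noteq> 0}} = 1"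
        by (subst prob_eq_1[OF ev]) (use fin in \<open>auto simp: iff\<close>)
      then have "N.prob {\<omega>. finite {n \<in> g ` I. Y n \<omega> \<noteq> 0}} = 1" unfolding meas vi .
      then show ?thesis using N.prob_eq_1[OF evN] by simp
    qed
    show "\<forall>u. sup_tail N Y ((\<lambda>C. g ` C) ` \<C>) u = sup_tail M X \<C> u"
    proof
      fix u
      have "(SUP C'\<in>(\<lambda>C. g ` C) ` \<C>. ennreal (norm (partial_sum Y C' (T \<omega>))))
          = (SUP C\<in>\<C>. ennreal (norm (partial_sum X C \<omega>)))" for \<omega>
        unfolding image_image by (rule SUP_cong[OF refl]) (simp add: ps_eq[OF bspec[OF CI]] iso)
      then show "sup_tail N Y ((\<lambda>C. g ` C) ` \<C>) u = sup_tail M X \<C> u"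
        unfolding sup_tail_def meas by (intro arg_cong[where f = prob]) (auto simp: sp)
    qed
    show "\<forall>C\<subseteq>I. \<forall>u. sum_tail N Y (g ` C) u = sum_tail M X C u"
    proof (intro allI impI)
      fix C u assume C: "C \<subseteq> I"
      show "sum_tail N Y (g ` C) u = sum_tail M X C u"
        unfolding sum_tail_def meas by (intro arg_cong[where f = prob]) (auto simp: sp ps_eq[OF C] iso)
    qed
    show "\<forall>i\<in>I. symmetric_rv M (X i) \<longrightarrow> symmetric_rv N (Y (g i))"
    proof (intro ballI impI)
      fix i assume i: "i \<in> I" and s: "symmetric_rv M (X i)"
      have Ym: "Y (g i) \<in> borel_measurable N" unfolding N_def by (rule measurable_final_distr) (rule YTm[OF i])
      have eq: "(\<lambda>\<omega>. Y (g i) (T \<omega>)) = (\<lambda>\<omega>. \<Phi> (X i \<omega>))" by (simp add: YT[OF i])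
      have eq': "(\<lambda>\<omega>. - Y (g i) (T \<omega>)) = (\<lambda>\<omega>. \<Phi> (- X i \<omega>))" by (simp add: YT[OF i] \<Phi>.neg)
      have Xm: "(\<lambda>\<omega>. - X i \<omega>) \<in> borel_measurable M" using X[OF i] by simp
      have m': "(\<lambda>\<omega>. - Y (g i) (T \<omega>)) \<in> borel_measurable M"
        unfolding eq' by (rule measurable_compose[OF Xm \<Phi>m])
      have "distr N borel (Y (g i)) = distr M borel (\<lambda>\<omega>. \<Phi> (X i \<omega>))"
        unfolding N_def distr_final_distr[where f = "Y (g i)" and T = T, OF YTm[OF i]] eq ..
      also have "\<dots> = distr (distr M borel (X i)) borel \<Phi>"
        using distr_distr[OF \<Phi>m X[OF i]] by (simp add: comp_def)
      also have "\<dots> = distr (distr M borel (\<lambda>\<omega>. - X i \<omega>)) borel \<Phi>" using s by (simp add: symmetric_rv_def)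
      also have "\<dots> = distr M borel (\<lambda>\<omega>. \<Phi> (- X i \<omega>))"
        using distr_distr[OF \<Phi>m Xm] by (simp add: comp_def)
      also have "\<dots> = distr N borel (\<lambda>\<omega>. - Y (g i) \<omega>)"
        unfolding N_def using distr_final_distr[where f = "\<lambda>\<omega>. - Y (g i) \<omega>" and T = T, OF m'] eq' by simp
      finally show "symmetric_rv N (Y (g i))" using Ym by (simp add: symmetric_rv_def)
    qed
  qed
qed

theorem theorem8p2:
  fixes d :: nat
    and I :: "'i set"
    and M :: "'a measure"
    and X :: "'i \<Rightarrow> 'a \<Rightarrow> 'b::{banach, second_countable_topology}"
    and \<C> :: "'i set set"
  assumes "countable I"
    and "prob_space M"
    and "prob_space.indep_vars M (\<lambda>_. borel) X I"
    and "AE \<omega> in M. finite {i \<in> I. X i \<omega> \<noteq> 0}"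
    and "countable \<C>"
    and "VC_class I \<C> d"
  shows "VC_const d > 0 \<and>
    (\<forall>u>0. sup_tail M X \<C> u
       \<le> VC_const d * (SUP C\<in>\<C> \<union> {I}. sum_tail M X C (u / VC_const d))) \<and>
    ((\<forall>i\<in>I. symmetric_rv M (X i)) \<longrightarrow>
       (\<forall>u>0. sup_tail M X \<C> u \<le> VC_const d * sum_tail M X I (u / VC_const d)))"
proof -
  have CI: "\<forall>C\<in>\<C>. C \<subseteq> I" using assms(6) by (auto simp: VC_class_def)
  obtain F :: "(nat \<Rightarrow>\<^sub>C real) set" and g :: "'i \<Rightarrow> nat" and N :: "(nat \<Rightarrow> (nat \<Rightarrow>\<^sub>C real)) measure" and Y
    where F: "subspace F" "closed F" "\<exists>D. countable D \<and> F \<subseteq> closure D" and g: "inj_on g I"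
    and N: "prob_space N" "prob_space.indep_vars N (\<lambda>_. borel) Y (g ` I)"
      "\<forall>n\<in>g ` I. \<forall>\<omega>\<in>space N. Y n \<omega> \<in> F" "AE \<omega> in N. finite {n \<in> g ` I. Y n \<omega> \<noteq> 0}"
    and sup: "\<forall>u. sup_tail N Y ((\<lambda>C. g ` C) ` \<C>) u = sup_tail M X \<C> u"
    and sum: "\<forall>C\<subseteq>I. \<forall>u. sum_tail N Y (g ` C) u = sum_tail M X C u"
    and sym: "\<forall>i\<in>I. symmetric_rv M (X i) \<longrightarrow> symmetric_rv N (Y (g i))"
    by (rule transfer_embedding[OF assms(1-4) CI])
  let ?K = "VC_const d" and ?D = "(\<lambda>C. g ` C) ` \<C>"
  have VCK: "VC_prop d ?K" by (rule VC_prop_VC_const)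
  have D: "countable ?D" "VC_class (g ` I) ?D d" using assms(5) VC_class_image[OF assms(6) g] by auto
  \<comment> \<open>\<open>VC_prop\<close> is the only fact used about the constant. Its instance
    lives on types that do not depend on the given index set, probability space or Banach
    space.\<close>
  have conc: "(\<forall>u>0. sup_tail N Y ?D u \<le> ?K * (SUP C\<in>?D \<union> {g ` I}. sum_tail N Y C (u / ?K))) \<and>
      ((\<forall>n\<in>g ` I. symmetric_rv N (Y n)) \<longrightarrow>
         (\<forall>u>0. sup_tail N Y ?D u \<le> ?K * sum_tail N Y (g ` I) (u / ?K)))"
    by (rule VCK[unfolded VC_prop_def, THEN conjunct2, THEN spec, of F, THEN spec, of "g ` I", THEN spec, of N,
          THEN spec, of Y, THEN spec, of ?D, THEN mp]) (intro conjI F N D)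
  have SUP: "(\<lambda>C. sum_tail N Y C w) ` (?D \<union> {g ` I}) = (\<lambda>C. sum_tail M X C w) ` (\<C> \<union> {I})" for w
  proof -
    have "?D \<union> {g ` I} = (\<lambda>C. g ` C) ` (\<C> \<union> {I})" by simp
    then have "(\<lambda>C. sum_tail N Y C w) ` (?D \<union> {g ` I}) = (\<lambda>C. sum_tail N Y (g ` C) w) ` (\<C> \<union> {I})"
      by (simp only: image_image)
    also have "\<dots> = (\<lambda>C. sum_tail M X C w) ` (\<C> \<union> {I})"
    proof (rule image_cong[OF refl])
      fix C assume "C \<in> \<C> \<union> {I}"
      then have "C \<subseteq> I" using CI by blast
      then show "sum_tail N Y (g ` C) w = sum_tail M X C w" using sum by blast
    qed
    finally show ?thesis .
  qed
  have sumI: "sum_tail N Y (g ` I) w = sum_tail M X I w" for w using sum by blast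
  show ?thesis
  proof (intro conjI impI)
    show "0 < ?K" using VCK by (simp add: VC_prop_def)
    show "\<forall>u>0. sup_tail M X \<C> u \<le> ?K * (SUP C\<in>\<C> \<union> {I}. sum_tail M X C (u / ?K))"
      using conc[THEN conjunct1] unfolding SUP sup[rule_format] .
    assume s: "\<forall>i\<in>I. symmetric_rv M (X i)"
    have "\<forall>n\<in>g ` I. symmetric_rv N (Y n)" using s sym by blast
    then show "\<forall>u>0. sup_tail M X \<C> u \<le> ?K * sum_tail M X I (u / ?K)"
      using conc[THEN conjunct2, THEN mp] unfolding sumI sup[rule_format] by blast
  qed
qed

end
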